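(* Suppose $\lambda>r-g+\alpha/\kappa$. Fix $a>0$ and assume that the government acts according to the policy $\xi^a$ reflecting the debt ratio upwards at $a$. Let $\theta_2$ be the negative root of $\frac12\sigma^2\theta(\theta-1)+(r-g)\theta-\lambda=0$, let $\Phi$ be the standard normal distribution function, and for $x,t>0$ set $$d_1(x,t):=\frac{\log(x/m)+(r-g+\frac12\sigma^2)t}{\sigma\sqrt t},\qquad d_2(x,t):=d_1(x,t)-\sigma\sqrt t,$$ $$\overline D_2(a):=-\frac{\alpha}{\theta_2}a^{1-\theta_2}\int_0^\infty e^{-(\lambda-(r-g))t}\Phi(d_1(a,t))\,dt,$$ $$H(x):=\alpha\int_0^\infty\Big(xe^{-(\lambda-(r-g))t}\Phi(d_1(x,t))-me^{-\lambda t}\Phi(d_2(x,t))\Big)dt.$$ Then the value function $$V_2(x;a):=\inf_{\eta\in\mathcal A_{\xi^a}}\mathsf E_x\Big[\int_0^\infty e^{-\lambda t}\alpha(X_t^{\xi^a,\eta}-m)^+dt+\kappa\int_0^\infty e^{-\lambda t}X_t^{\xi^a,\eta}\circ_d d\eta_t\Big],\quad x>0,$$ is given by $$V_2(x;a)=\begin{cases}V_2(a;a),&0<x\le a,\\ \overline D_2(a)x^{\theta_2}+H(x),&x>a,\end{cases}$$ (with $V_2(a;a)$ the value of the second expression at $x=a$). The optimal policy for the legislative body is not to act on the debt ratio, i.e. $\overline\eta\equiv0$.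
   Context: Model. $(\Omega,\mathcal F,\mathsf P)$ is a complete probability space carrying a standard one-dimensional Brownian motion $W$, with $\mathbb F$ the $\mathsf P$-augmented filtration of $W$. Parameters: $r,g\in\mathbb R$, $\sigma,\rho,\lambda,c_1,c_2,\alpha,\kappa,m>0$, with standing assumptions $c_1>c_2$, $\rho>(2(r-g)+\sigma^2)^+$, $\lambda>r-g$. Controls. $\mathcal U$ is the set of $\mathbb F$-adapted, nondecreasing, càdlàg processes $\upsilon\ge0$ with $\upsilon_{0-}=0$. For $(\xi,\eta)\in\mathcal U\times\mathcal U$ and $x>0$: $X^{\xi,\eta}_{0-}=x$, $X_t^{\xi,\eta}=x\exp\big((r-g-\frac12\sigma^2)t+\sigma W_t+\xi_t-\eta_t\big)$, $t\ge0$; $\mathsf E_x,\mathsf P_x$ indicate the starting value $x$. With $\xi^c,\eta^c$ the continuous parts and $\Delta$ denoting jumps, $$X_t^{\xi,\eta}\circ_u d\xi_t=X_t^{\xi,\eta}d\xi^c_t+X_{t-}^{\xi,\eta}(e^{\Delta\xi_t}-1),\qquad X_t^{\xi,\eta}\circ_d d\eta_t=X_t^{\xi,\eta}d\eta^c_t+X_{t-}^{\xi,\eta}(1-e^{-\Delta\eta_t}),$$ where integrals include sums over all jump times, including a jump at time $0$. Admissibility. $\mathcal A$ is the set of $(\xi,\eta)\in\mathcal U\times\mathcal U$ such that $\mathsf E_x[\int_0^\infty e^{-\rho t}\frac12(X^{\xi,\eta}_t)^2dt+c_1\int_0^\infty e^{-\rho t}X^{\xi,\eta}_t\circ_d d\eta_t+c_2\int_0^\infty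 e^{-\rho t}X^{\xi,\eta}_t\circ_u d\xi_t]<\infty$, $\mathsf E_x[\int_0^\infty e^{-\lambda t}\alpha(X^{\xi,\eta}_t-m)^+dt+\kappa\int_0^\infty e^{-\lambda t}X^{\xi,\eta}_t\circ_d d\eta_t]<\infty$, and $\mathsf P_x(\Delta\xi_t\cdot\Delta\eta_t>0)=0$ for all $t\ge0$, $x>0$. $\mathcal A_\eta=\{\xi\in\mathcal U:(\xi,\eta)\in\mathcal A\}$ and $\mathcal A_\xi=\{\eta\in\mathcal U:(\xi,\eta)\in\mathcal A\}$. Reflection policy. Given $\eta$, $\xi^a_t=(\ln(a/x))^++\xi_t(a)$, $t\ge0$ ($\xi^a_{0-}=0$), where $\xi(a)$ is the unique $\xi\in\mathcal A_\eta$ such that, for $X^{\xi,\eta}$ started at $x\vee a$, a.s. $X^{\xi,\eta}_t\ge a$ for $t>0$ and $\int_0^T\mathbf 1_{\{X^{\xi,\eta}_t>a\}}d\xi_t=0$ for all $T>0$. Thus $\xi^a$ is built from the $\eta$ under consideration, and $\mathcal A_{\xi^a}$ consists of those $\eta$ with $(\xi^a,\eta)\in\mathcal A$. *)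

theory Defs
  imports "HOL-Probability.Probability"
begin

section \<open>Paths\<close>

text \<open>
  A process is a function of time and sample point; only its values at times \<open>t \<ge> 0\<close> matter.
  The path of a control is prolonged by \<open>0\<close> to negative times, which encodes the convention
  \<open>\<upsilon>\<^sub>0\<^sub>- = 0\<close>: the left limit at \<open>0\<close> of the prolonged path is \<open>0\<close>, its jump at \<open>0\<close> is \<open>\<upsilon>\<^sub>0\<close>, and
  the Stieltjes measure \<^const>\<open>interval_measure\<close> of the prolonged path charges \<open>{0}\<close> with \<open>\<upsilon>\<^sub>0\<close>.
\<close>

definition path :: "(real \<Rightarrow> 'w \<Rightarrow> real) \<Rightarrow> 'w \<Rightarrow> real \<Rightarrow> real" where
  "path v \<omega> t = (if t < 0 then 0 else v t \<omega>)"

definition left_lim :: "(real \<Rightarrow> real) \<Rightarrow> real \<Rightarrow> real" where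
  "left_lim f t = Lim (at_left t) f"

definition jump :: "(real \<Rightarrow> real) \<Rightarrow> real \<Rightarrow> real" where
  "jump f t = f t - left_lim f t"

definition cont_part :: "(real \<Rightarrow> real) \<Rightarrow> real \<Rightarrow> real" where
  "cont_part f t = f t - (\<Sum>\<^sub>\<infinity>s\<in>{0..t}. jump f s)"

definition cadlag :: "(real \<Rightarrow> real) \<Rightarrow> bool" where
  "cadlag f \<longleftrightarrow> (\<forall>t\<ge>0. continuous (at_right t) f) \<and> (\<forall>t>0. \<exists>l. (f \<longlongrightarrow> l) (at_left t))"


section \<open>The model\<close>

locale brownian_motion = prob_space M + complete_measure M for M :: "'w measure" +
  fixes W :: "real \<Rightarrow> 'w \<Rightarrow> real"
  assumes W_measurable: "\<And>t. 0 \<le> t \<Longrightarrow> W t \<in> borel_measurable M"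
    and W_zero: "AE \<omega> in M. W 0 \<omega> = 0"
    and W_continuous: "AE \<omega> in M. continuous_on {0..} (\<lambda>t. W t \<omega>)"
    and W_normal: "\<And>s t. 0 \<le> s \<Longrightarrow> s < t \<Longrightarrow>
      distributed M lborel (\<lambda>\<omega>. W t \<omega> - W s \<omega>) (normal_density 0 (sqrt (t - s)))"
    and W_indep: "\<And>s t. 0 \<le> s \<Longrightarrow> s < t \<Longrightarrow>
      indep_set
        (sigma_sets (space M) {W u -` B \<inter> space M |u B. 0 \<le> u \<and> u \<le> s \<and> B \<in> sets borel})
        {(\<lambda>\<omega>. W t \<omega> - W s \<omega>) -` B \<inter> space M |B. B \<in> sets borel}"
begin

definition augmented_filtration :: "real \<Rightarrow> 'w measure" where
  "augmented_filtration t = sigma (space M)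
     ({W u -` B \<inter> space M |u B. 0 \<le> u \<and> u \<le> t \<and> B \<in> sets borel} \<union> null_sets M)"

definition controls :: "(real \<Rightarrow> 'w \<Rightarrow> real) set" where
  "controls = {v.
     (\<forall>t\<ge>0. v t \<in> borel_measurable (augmented_filtration t)) \<and>
     (\<forall>\<omega>\<in>space M. mono_on {0..} (\<lambda>t. v t \<omega>) \<and> cadlag (\<lambda>t. v t \<omega>) \<and> (\<forall>t\<ge>0. 0 \<le> v t \<omega>))}"

end

locale debt_model = brownian_motion M W
  for M :: "'w measure" and W :: "real \<Rightarrow> 'w \<Rightarrow> real" +
  fixes r g \<sigma> \<rho> lam c1 c2 \<alpha> \<kappa> m :: real
  assumes pos: "\<sigma> > 0" "\<rho> > 0" "lam > 0" "c1 > 0" "c2 > 0" "\<alpha> > 0" "\<kappa> > 0" "m > 0"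
    and c1_gt_c2: "c1 > c2"
    and \<rho>_gt: "\<rho> > max 0 (2 * (r - g) + \<sigma>\<^sup>2)"
    and lam_gt: "lam > r - g"
begin

subsection \<open>State and costs\<close>

text \<open>The value at negative times encodes \<open>X\<^sub>0\<^sub>- = x\<close>.\<close>

definition X :: "real \<Rightarrow> (real \<Rightarrow> 'w \<Rightarrow> real) \<Rightarrow> (real \<Rightarrow> 'w \<Rightarrow> real) \<Rightarrow> 'w \<Rightarrow> real \<Rightarrow> real" where
  "X x \<xi> \<eta> \<omega> t = (if t < 0 then x
     else x * exp ((r - g - \<sigma>\<^sup>2 / 2) * t + \<sigma> * W t \<omega> + \<xi> t \<omega> - \<eta> t \<omega>))"

text \<open>
  The discounted control costs, the integrals of \<open>e\<^sup>-\<^sup>q\<^sup>t\<close> over \<open>[0,\<infinity>)\<close> against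
  \<open>X\<^sub>t \<circ>\<^sub>u d\<xi>\<^sub>t\<close> and \<open>X\<^sub>t \<circ>\<^sub>d d\<eta>\<^sub>t\<close>. All integrands are nonnegative, so that the integral
  over the counting measure is the sum over all jump times.
\<close>

definition up_cost ::
  "real \<Rightarrow> real \<Rightarrow> (real \<Rightarrow> 'w \<Rightarrow> real) \<Rightarrow> (real \<Rightarrow> 'w \<Rightarrow> real) \<Rightarrow> 'w \<Rightarrow> ennreal" where
  "up_cost q x \<xi> \<eta> \<omega> =
     (\<integral>\<^sup>+t\<in>{0..}. ennreal (exp (- q * t) * X x \<xi> \<eta> \<omega> t) \<partial>interval_measure (cont_part (path \<xi> \<omega>))) +
     (\<integral>\<^sup>+t. ennreal (exp (- q * t) * (left_lim (X x \<xi> \<eta> \<omega>) t * (exp (jump (path \<xi> \<omega>) t) - 1)))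
        \<partial>count_space {0..})"

definition down_cost ::
  "real \<Rightarrow> real \<Rightarrow> (real \<Rightarrow> 'w \<Rightarrow> real) \<Rightarrow> (real \<Rightarrow> 'w \<Rightarrow> real) \<Rightarrow> 'w \<Rightarrow> ennreal" where
  "down_cost q x \<xi> \<eta> \<omega> =
     (\<integral>\<^sup>+t\<in>{0..}. ennreal (exp (- q * t) * X x \<xi> \<eta> \<omega> t) \<partial>interval_measure (cont_part (path \<eta> \<omega>))) +
     (\<integral>\<^sup>+t. ennreal (exp (- q * t) * (left_lim (X x \<xi> \<eta> \<omega>) t * (1 - exp (- jump (path \<eta> \<omega>) t))))
        \<partial>count_space {0..})"

definition J1 :: "real \<Rightarrow> (real \<Rightarrow> 'w \<Rightarrow> real) \<Rightarrow> (real \<Rightarrow> 'w \<Rightarrow> real) \<Rightarrow> ennreal" where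
  "J1 x \<xi> \<eta> = (\<integral>\<^sup>+\<omega>.
     ((\<integral>\<^sup>+t\<in>{0..}. ennreal (exp (- \<rho> * t) * ((X x \<xi> \<eta> \<omega> t)\<^sup>2 / 2)) \<partial>lborel)
      + ennreal c1 * down_cost \<rho> x \<xi> \<eta> \<omega> + ennreal c2 * up_cost \<rho> x \<xi> \<eta> \<omega>) \<partial>M)"

definition J2 :: "real \<Rightarrow> (real \<Rightarrow> 'w \<Rightarrow> real) \<Rightarrow> (real \<Rightarrow> 'w \<Rightarrow> real) \<Rightarrow> ennreal" where
  "J2 x \<xi> \<eta> = (\<integral>\<^sup>+\<omega>.
     ((\<integral>\<^sup>+t\<in>{0..}. ennreal (exp (- lam * t) * (\<alpha> * max 0 (X x \<xi> \<eta> \<omega> t - m))) \<partial>lborel)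
      + ennreal \<kappa> * down_cost lam x \<xi> \<eta> \<omega>) \<partial>M)"


subsection \<open>Admissible policies\<close>

definition admissible :: "((real \<Rightarrow> 'w \<Rightarrow> real) \<times> (real \<Rightarrow> 'w \<Rightarrow> real)) set" where
  "admissible = {(\<xi>, \<eta>) \<in> controls \<times> controls.
     (\<forall>x>0. J1 x \<xi> \<eta> < \<infinity> \<and> J2 x \<xi> \<eta> < \<infinity>) \<and>
     (\<forall>t\<ge>0. AE \<omega> in M. \<not> jump (path \<xi> \<omega>) t * jump (path \<eta> \<omega>) t > 0)}"

definition admissible_up :: "(real \<Rightarrow> 'w \<Rightarrow> real) \<Rightarrow> (real \<Rightarrow> 'w \<Rightarrow> real) set" where
  "admissible_up \<eta> = {\<xi> \<in> controls. (\<xi>, \<eta>) \<in> admissible}"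

definition admissible_down :: "(real \<Rightarrow> 'w \<Rightarrow> real) \<Rightarrow> (real \<Rightarrow> 'w \<Rightarrow> real) set" where
  "admissible_down \<xi> = {\<eta> \<in> controls. (\<xi>, \<eta>) \<in> admissible}"


subsection \<open>The reflection policy\<close>

definition reflects ::
  "real \<Rightarrow> real \<Rightarrow> (real \<Rightarrow> 'w \<Rightarrow> real) \<Rightarrow> (real \<Rightarrow> 'w \<Rightarrow> real) \<Rightarrow> bool" where
  "reflects a y \<eta> \<xi> \<longleftrightarrow> \<xi> \<in> admissible_up \<eta> \<and>
     (AE \<omega> in M. \<forall>t>0. a \<le> X y \<xi> \<eta> \<omega> t) \<and>
     (AE \<omega> in M. \<forall>T>0.
        (\<integral>\<^sup>+t\<in>{0..T}. indicator {t. X y \<xi> \<eta> \<omega> t > a} t \<partial>interval_measure (path \<xi> \<omega>)) = 0)"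

text \<open>Processes are identified up to indistinguishability; uniqueness is meant in this sense.\<close>

definition unique_reflects ::
  "real \<Rightarrow> real \<Rightarrow> (real \<Rightarrow> 'w \<Rightarrow> real) \<Rightarrow> (real \<Rightarrow> 'w \<Rightarrow> real) \<Rightarrow> bool" where
  "unique_reflects a y \<eta> \<xi> \<longleftrightarrow> reflects a y \<eta> \<xi> \<and>
     (\<forall>\<xi>'. reflects a y \<eta> \<xi>' \<longrightarrow> (AE \<omega> in M. \<forall>t\<ge>0. \<xi>' t \<omega> = \<xi> t \<omega>))"

text \<open>
  The policy depends on the initial value \<open>x\<close> and on the control \<open>\<eta>\<close> it reacts to. The choice
  operator only selects a version of the unique reflecting control. When there is none, the value
  is meaningless, and \<open>\<eta>\<close> is excluded from the set of admissible responses.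
\<close>

definition reflection_policy ::
  "real \<Rightarrow> real \<Rightarrow> (real \<Rightarrow> 'w \<Rightarrow> real) \<Rightarrow> real \<Rightarrow> 'w \<Rightarrow> real" where
  "reflection_policy a x \<eta> t \<omega> =
     max 0 (ln (a / x)) + (SOME \<xi>. unique_reflects a (max x a) \<eta> \<xi>) t \<omega>"

definition admissible_responses :: "real \<Rightarrow> real \<Rightarrow> (real \<Rightarrow> 'w \<Rightarrow> real) set" where
  "admissible_responses a x = {\<eta>. (\<exists>\<xi>. unique_reflects a (max x a) \<eta> \<xi>) \<and>
     \<eta> \<in> admissible_down (reflection_policy a x \<eta>)}"

definition V2 :: "real \<Rightarrow> real \<Rightarrow> ereal" where
  "V2 x a = (INF \<eta>\<in>admissible_responses a x. enn2ereal (J2 x (reflection_policy a x \<eta>) \<eta>))"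

definition optimal_response :: "real \<Rightarrow> real \<Rightarrow> (real \<Rightarrow> 'w \<Rightarrow> real) \<Rightarrow> bool" where
  "optimal_response a x \<eta> \<longleftrightarrow> \<eta> \<in> admissible_responses a x \<and>
     enn2ereal (J2 x (reflection_policy a x \<eta>) \<eta>) = V2 x a"

end


section \<open>The explicit value function\<close>

definition Phi :: "real \<Rightarrow> real" where
  "Phi = cdf std_normal_distribution"

context
  fixes r g \<sigma> lam \<alpha> m :: real
begin

definition d1 :: "real \<Rightarrow> real \<Rightarrow> real" where
  "d1 x t = (ln (x / m) + (r - g + \<sigma>\<^sup>2 / 2) * t) / (\<sigma> * sqrt t)"

definition d2 :: "real \<Rightarrow> real \<Rightarrow> real" where
  "d2 x t = d1 x t - \<sigma> * sqrt t"

definition D2 :: "real \<Rightarrow> real \<Rightarrow> real" where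
  "D2 \<theta> a = - \<alpha> / \<theta> * a powr (1 - \<theta>) *
     (LBINT t:{0<..}. exp (- (lam - (r - g)) * t) * Phi (d1 a t))"

definition H :: "real \<Rightarrow> real" where
  "H x = \<alpha> * (LBINT t:{0<..}.
     x * exp (- (lam - (r - g)) * t) * Phi (d1 x t) - m * exp (- lam * t) * Phi (d2 x t))"

end

end

theory Submission
  imports Defs
begin

text \<open>
  On \<open>t \<ge> 0\<close> the state is \<open>X = exp B * Z\<close>, where \<open>exp B\<close> is the uncontrolled debt ratio. Without
  intervention of the legislative body, \<open>Z\<close> is the running maximum \<open>Z0\<close> of \<open>y = max x a\<close> and
  \<open>a * exp (- B)\<close>. For any other response, \<open>Z\<close> stays above \<open>a * exp (- B)\<close>, and the running maximum
  of the shortfall \<open>Z0 - Z\<close> increases by at most the increase of the integral of \<open>Z\<close> against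
  the downward control. As \<open>exp (B t - (r - g) * t)\<close> is a martingale, one unit of \<open>Z\<close> removed at
  time \<open>s\<close> lowers the expected running cost by at most \<open>\<alpha> / (lam - (r - g))\<close> times the discounted
  value of \<open>exp (B s)\<close>, whereas removing it costs \<open>\<kappa>\<close> times that value, which is more.

  The cost of not acting is computed without stochastic calculus. The function
  \<open>V x = D2 * x powr \<theta>2 + H x\<close> is convex, \<open>H\<close> is the discounted cost of the uncontrolled
  process, and \<open>exp (- lam * t + \<theta>2 * B t)\<close> is a martingale. On a time grid, moving \<open>B\<close> therefore
  changes the expectation of the discounted \<open>V\<close> by exactly the running cost, while \<open>Z0\<close> moves
  only when the state is near the barrier, where the slope of \<open>V\<close> vanishes by the choice of \<open>D2\<close>;
  this contribution disappears as the mesh tends to 0.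
\<close>

section \<open>Running maxima and jumps of paths\<close>

text \<open>The policy that reacts to a general response has no closed form. What is exploited is
  pathwise: it keeps the state above \<open>a\<close> and never lowers \<open>Z\<close>. It may
  however push \<open>Z\<close> up again, so the shortfall \<open>Z0 - Z\<close> need not be
  monotone. Its running maximum is increasing and dominates it; hence it can be integrated by parts
  against the discount factor, and the martingale moves each weight to a time at which the increment
  is already known. The condition on \<open>lam\<close> enters as \<alpha> \<le> \<kappa>
  \<open>* (lam - (r - g))\<close>. For the zero response, membership in
  \<open>admissible_responses\<close> demands existence, uniqueness and admissibility of the
  reflecting control. Admissibility rests on moments: the first two moments of the uncontrolled
  ratio grow at rates \<open>r - g\<close> and \<open>2 * (r - g) +\<close> \<sigma> squared, and
  the standing assumptions put the discount rates \<open>lam\<close> and \<rho> above their positive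
  parts. Everything is proved on a bounded horizon \<open>[0, T]\<close>. The accrued cost converges
  monotonically as \<open>T\<close> grows, and the terminal value vanishes because the first moment
  of the reflected state grows more slowly than \<open>exp (lam * T)\<close>.\<close>

definition runmax :: "(real \<Rightarrow> real) \<Rightarrow> real \<Rightarrow> real" where
  "runmax f t = (SUP s\<in>{0..t}. f s)"

lemma runmax_upper: "bdd_above (f ` {0..t}) \<Longrightarrow> 0 \<le> s \<Longrightarrow> s \<le> t \<Longrightarrow> f s \<le> runmax f t"
  unfolding runmax_def by (rule cSUP_upper) auto

lemma runmax_least: "0 \<le> t \<Longrightarrow> (\<And>s. 0 \<le> s \<Longrightarrow> s \<le> t \<Longrightarrow> f s \<le> c) \<Longrightarrow> runmax f t \<le> c"
  unfolding runmax_def by (rule cSUP_least) auto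

lemma runmax_mono:
  "bdd_above (f ` {0..t}) \<Longrightarrow> 0 \<le> s \<Longrightarrow> s \<le> t \<Longrightarrow> runmax f s \<le> runmax f t"
  by (rule runmax_least) (auto intro: runmax_upper)

lemma bdd_above_continuous_image:
  fixes f :: "real \<Rightarrow> real"
  shows "continuous_on {0..} f \<Longrightarrow> bdd_above (f ` {0..t})"
  by (intro bounded_imp_bdd_above compact_imp_bounded compact_continuous_image)
     (auto intro: continuous_on_subset)

lemma runmax_attained:
  assumes "continuous_on {0..} f" "0 \<le> t"
  obtains s where "0 \<le> s" "s \<le> t" "runmax f t = f s"
proof -
  have "\<exists>x\<in>{0..t}. \<forall>y\<in>{0..t}. f y \<le> f x"
    using assms by (intro continuous_attains_sup) (auto intro: continuous_on_subset)
  then obtain x where x: "x \<in> {0..t}" "\<And>y. y \<in> {0..t} \<Longrightarrow> f y \<le> f x" by auto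
  then have "runmax f t = f x"
    by (intro antisym runmax_least runmax_upper bdd_above_continuous_image assms) auto
  with x that show ?thesis by auto
qed

lemma runmax_right_continuous:
  assumes bdd: "\<And>T. bdd_above (f ` {0..T})" and t: "0 \<le> t"
    and f: "continuous (at_right t) f"
  shows "continuous (at_right t) (runmax f)"
  unfolding continuous_within
proof (rule order_tendstoI)
  fix c assume c: "c < runmax f t"
  show "\<forall>\<^sub>F v in at_right t. c < runmax f v"
    using eventually_at_right_less[of t]
  proof eventually_elim
    case (elim v)
    then show ?case using c runmax_mono[OF bdd t, of v] by simp
  qed
next
  fix c assume c: "runmax f t < c"
  \<comment> \<open>The midpoint leaves room: values below \<open>e\<close> only give a supremum at
    most \<open>e\<close>, which still has to be strictly below \<open>c\<close>.\<close>
  define e where "e = (c + runmax f t) / 2"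
  have e: "runmax f t < e" "e < c" using c by (auto simp: e_def)
  have "f t < e" using runmax_upper[OF bdd t order_refl] e(1) by (rule le_less_trans)
  then have "\<forall>\<^sub>F v in at_right t. f v < e"
    using f unfolding continuous_within by (intro order_tendstoD)
  then obtain b where b: "t < b" "\<And>v. t < v \<Longrightarrow> v < b \<Longrightarrow> f v < e"
    by (auto simp: eventually_at_right[OF less_add_one])
  show "\<forall>\<^sub>F v in at_right t. runmax f v < c"
    unfolding eventually_at_right[OF less_add_one]
  proof (intro exI[of _ b] conjI allI impI b)
    fix v assume v: "t < v" "v < b"
    have "runmax f v \<le> e"
    proof (rule runmax_least)
      fix s assume s: "0 \<le> s" "s \<le> v"
      show "f s \<le> e"
      proof (cases "s \<le> t")
        case True then show ?thesis using runmax_upper[OF bdd s(1)] e by (meson less_imp_le order_trans)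
      next
        case False then show ?thesis using b(2)[of s] s v by (auto intro: less_imp_le)
      qed
    qed (use v t in auto)
    with e show "runmax f v < c" by simp
  qed
qed

lemma runmax_continuous_on:
  assumes f: "continuous_on {0..} f"
  shows "continuous_on {0..} (runmax f)"
  unfolding continuous_on_iff
proof (intro ballI allI impI)
  fix x e :: real assume x: "x \<in> {0..}" and e: "0 < e"
  note bdd = bdd_above_continuous_image[OF f]
  have "uniformly_continuous_on {0..x+1} f"
    by (intro compact_uniformly_continuous continuous_on_subset[OF f]) auto
  then obtain d where d: "d > 0"
    "\<And>s t. s \<in> {0..x+1} \<Longrightarrow> t \<in> {0..x+1} \<Longrightarrow> dist s t < d \<Longrightarrow> dist (f s) (f t) < e/2"
    unfolding uniformly_continuous_on_def using e by (metis half_gt_zero)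
  have key: "runmax f v \<le> runmax f u + e/2" if uv: "0 \<le> u" "u \<le> v" "v \<le> x + 1" "v - u < d" for u v
  proof (rule runmax_least)
    fix s assume s: "0 \<le> s" "s \<le> v"
    \<comment> \<open>The point \<open>s\<close> is compared with its projection
      \<open>min s u\<close> onto the shorter interval, which is at distance at most
      \<open>v - u\<close>.\<close>
    have "dist (f s) (f (min s u)) < e/2"
      by (rule d) (use s uv d(1) in \<open>auto simp: dist_real_def min_def\<close>)
    moreover have "f (min s u) \<le> runmax f u"
      by (rule runmax_upper[OF bdd]) (use s uv in auto)
    ultimately show "f s \<le> runmax f u + e/2" unfolding dist_real_def by linarith
  qed (use uv in auto)
  show "\<exists>d>0. \<forall>x'\<in>{0..}. dist x' x < d \<longrightarrow> dist (runmax f x') (runmax f x) < e"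
  proof (intro exI[of _ "min d 1"] conjI ballI impI)
    fix v assume v: "v \<in> {0..}" "dist v x < min d 1"
    show "dist (runmax f v) (runmax f x) < e"
    proof (cases "v \<le> x")
      case True
      then show ?thesis using key[of v x] runmax_mono[OF bdd, of v x] v x e
        by (auto simp: dist_real_def)
    next
      case False
      then show ?thesis using key[of x v] runmax_mono[OF bdd, of x v] v x e
        by (auto simp: dist_real_def)
    qed
  qed (use d in auto)
qed

text \<open>Right continuity pushes any value to a rational point on its right. The endpoint
  \<open>t\<close> has no such point inside the interval and is added by hand. The countable
  supremum gives measurability.\<close>

lemma runmax_eq_SUP_rat:
  assumes bdd: "bdd_above (f ` {0..t})" and t: "0 \<le> t"
    and f: "\<And>s. 0 \<le> s \<Longrightarrow> continuous (at_right s) f"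
  shows "runmax f t = (SUP s\<in>insert t ({0..t} \<inter> \<rat>). f s)"
proof (rule antisym)
  have bdd': "bdd_above (f ` insert t ({0..t} \<inter> \<rat>))"
    by (rule bdd_above_mono[OF bdd]) (use t in auto)
  show "runmax f t \<le> (SUP s\<in>insert t ({0..t} \<inter> \<rat>). f s)"
  proof (rule runmax_least[OF t])
    fix s assume s: "0 \<le> s" "s \<le> t"
    show "f s \<le> (SUP s\<in>insert t ({0..t} \<inter> \<rat>). f s)" (is "_ \<le> ?S")
    proof (cases "s = t")
      case True then show ?thesis by (intro cSUP_upper bdd') auto
    next
      case False
      show ?thesis
      proof (rule ccontr)
        assume "\<not> f s \<le> ?S"
        then have "?S < f s" by simp
        then have "\<forall>\<^sub>F v in at_right s. ?S < f v"
          using f[OF s(1)] unfolding continuous_within by (intro order_tendstoD)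
        then obtain b where b: "s < b" "\<And>v. s < v \<Longrightarrow> v < b \<Longrightarrow> ?S < f v"
          by (auto simp: eventually_at_right[OF less_add_one])
        obtain q where q: "q \<in> \<rat>" "s < q" "q < min b t"
          using Rats_dense_in_real[of s "min b t"] b s False by auto
        have "f q \<le> ?S" by (intro cSUP_upper bdd') (use q s in auto)
        with b(2)[of q] q show False by auto
      qed
    qed
  qed
  show "(SUP s\<in>insert t ({0..t} \<inter> \<rat>). f s) \<le> runmax f t"
    by (intro cSUP_least) (use t in \<open>auto intro!: runmax_upper bdd\<close>)
qed

lemma runmax_measurable:
  assumes bdd: "\<And>\<omega>. \<omega> \<in> space N \<Longrightarrow> bdd_above ((\<lambda>s. f s \<omega>) ` {0..t})" and t: "0 \<le> t"
    and f: "\<And>s \<omega>. \<omega> \<in> space N \<Longrightarrow> 0 \<le> s \<Longrightarrow> continuous (at_right s) (\<lambda>s. f s \<omega>)"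
    and meas: "\<And>s. 0 \<le> s \<Longrightarrow> s \<le> t \<Longrightarrow> f s \<in> borel_measurable N"
  shows "(\<lambda>\<omega>. runmax (\<lambda>s. f s \<omega>) t) \<in> borel_measurable N"
proof -
  have "(\<lambda>\<omega>. SUP s\<in>insert t ({0..t} \<inter> \<rat>). f s \<omega>) \<in> borel_measurable N"
  proof (rule borel_measurable_cSUP)
    show "countable (insert t ({0..t} \<inter> \<rat>))" by (auto simp: countable_rat)
    show "f s \<in> borel_measurable N" if "s \<in> insert t ({0..t} \<inter> \<rat>)" for s
      using that t by (auto intro: meas)
    show "bdd_above ((\<lambda>i. f i \<omega>) ` insert t ({0..t} \<inter> \<rat>))" if "\<omega> \<in> space N" for \<omega>
      by (rule bdd_above_mono[OF bdd[OF that]]) (use t in auto)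
  qed
  then show ?thesis
    by (rule measurable_cong[THEN iffD1, rotated]) (simp add: runmax_eq_SUP_rat bdd t f)
qed

text \<open>Joint measurability, needed for Tonelli, comes from approximating each time by grid
  points from the right. Regularity is assumed at nonnegative times, so \<open>max 0\<close> freezes
  the process before 0.\<close>

lemma right_continuous_pair_measurable:
  fixes f :: "real \<Rightarrow> 'w \<Rightarrow> real"
  assumes f: "\<And>s \<omega>. \<omega> \<in> space N \<Longrightarrow> 0 \<le> s \<Longrightarrow> continuous (at_right s) (\<lambda>s. f s \<omega>)"
    and meas: "\<And>s. 0 \<le> s \<Longrightarrow> f s \<in> borel_measurable N"
  shows "(\<lambda>p :: real \<times> 'w. f (max 0 (fst p)) (snd p)) \<in> borel_measurable (borel \<Otimes>\<^sub>M N)"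
proof (rule borel_measurable_LIMSEQ_real)
  \<comment> \<open>The numerator is \<open>k + 1\<close>: with \<open>k\<close> the integer part of
    \<open>t * (n + 1)\<close> the grid point lies strictly to the right of \<open>t\<close>, as
    convergence along \<open>at_right t\<close> requires.\<close>
  define tn :: "nat \<Rightarrow> nat \<Rightarrow> real" where "tn n k = (real k + 1) / real (Suc n)" for n k
  define k where "k n t = nat \<lfloor>max 0 t * real (Suc n)\<rfloor>" for n and t :: real
  show "(\<lambda>p :: real \<times> 'w. f (tn n (k n (fst p))) (snd p)) \<in> borel_measurable (borel \<Otimes>\<^sub>M N)" for n
  proof (rule measurable_compose_countable[where f = "\<lambda>i (p :: real \<times> 'w). f (tn n i) (snd p)"])
    show "(\<lambda>p :: real \<times> 'w. f (tn n i) (snd p)) \<in> borel_measurable (borel \<Otimes>\<^sub>M N)" for i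
    proof -
      have [measurable]: "f (tn n i) \<in> borel_measurable N" by (rule meas) (auto simp: tn_def)
      show ?thesis by measurable
    qed
    show "(\<lambda>x. k n (fst x)) \<in> borel \<Otimes>\<^sub>M N \<rightarrow>\<^sub>M count_space UNIV"
      unfolding k_def by measurable
  qed
  fix p :: "real \<times> 'w" assume p: "p \<in> space (borel \<Otimes>\<^sub>M N)"
  define t where "t = max 0 (fst p)"
  have up: "tn n (k n (fst p)) \<le> t + 1 / real (Suc n)" and lo: "t < tn n (k n (fst p))" for n
  proof -
    have *: "real (k n (fst p)) = real_of_int \<lfloor>t * real (Suc n)\<rfloor>"
      unfolding k_def t_def by simp
    have "real (k n (fst p)) \<le> t * real (Suc n)" unfolding * by simp
    then have "(real (k n (fst p)) + 1) / real (Suc n) \<le> (t * real (Suc n) + 1) / real (Suc n)"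
      by (intro divide_right_mono) auto
    then show "tn n (k n (fst p)) \<le> t + 1 / real (Suc n)"
      unfolding tn_def by (simp add: add_divide_distrib)
    have "t * real (Suc n) < real (k n (fst p)) + 1" unfolding * by linarith
    then show "t < tn n (k n (fst p))"
      unfolding tn_def by (subst pos_less_divide_eq) auto
  qed
  have lim: "(\<lambda>n. tn n (k n (fst p))) \<longlonglongrightarrow> t"
  proof (rule real_tendsto_sandwich[where f = "\<lambda>_. t" and h = "\<lambda>n. t + 1 / real (Suc n)"])
    show "(\<lambda>n. t + 1 / real (Suc n)) \<longlonglongrightarrow> t"
      using tendsto_add[OF tendsto_const LIMSEQ_inverse_real_of_nat, of t] by (simp add: inverse_eq_divide)
  qed (use up lo in \<open>auto intro!: always_eventually less_imp_le\<close>)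
  have "filterlim (\<lambda>n. tn n (k n (fst p))) (at_right t) sequentially"
    unfolding filterlim_at
    by (intro conjI always_eventually allI lim) (use lo in \<open>auto simp: less_imp_neq[THEN not_sym]\<close>)
  moreover have "((\<lambda>s. f s (snd p)) \<longlongrightarrow> f t (snd p)) (at_right t)"
    using f[of "snd p" t] p by (auto simp: t_def continuous_within space_pair_measure)
  ultimately show "(\<lambda>n. f (tn n (k n (fst p))) (snd p)) \<longlonglongrightarrow> f (max 0 (fst p)) (snd p)"
    unfolding t_def[symmetric] by (rule filterlim_compose[rotated])
qed

text \<open>The joint statement is applied over a one-point sample space.\<close>

lemma right_continuous_measurable:
  fixes f :: "real \<Rightarrow> real"
  assumes "\<And>s. 0 \<le> s \<Longrightarrow> continuous (at_right s) f"
  shows "(\<lambda>t. f (max 0 t)) \<in> borel_measurable borel"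
proof -
  have "(\<lambda>p :: real \<times> unit. f (max 0 (fst p))) \<in> borel_measurable (borel \<Otimes>\<^sub>M count_space UNIV)"
    by (rule right_continuous_pair_measurable[where f = "\<lambda>t _. f t"]) (use assms in auto)
  from measurable_compose[OF measurable_Pair this, of "\<lambda>t. t" borel "\<lambda>_. ()"]
  show ?thesis by simp
qed

section \<open>Left limits and jumps of increasing paths\<close>

lemma mono_left_lim:
  fixes f :: "real \<Rightarrow> real"
  assumes "mono f"
  shows "(f \<longlongrightarrow> left_lim f t) (at_left t)"
proof -
  have bdd: "bdd_above (f ` {..<t})"
    by (intro bdd_aboveI[of _ "f t"]) (auto intro: monoD[OF assms])
  have "(f \<longlongrightarrow> (SUP s\<in>{..<t}. f s)) (at_left t)"
  proof (rule increasing_tendsto)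
    show "\<forall>\<^sub>F n in at_left t. f n \<le> (SUP s\<in>{..<t}. f s)"
      by (auto simp: eventually_at_filter intro!: always_eventually cSUP_upper bdd)
    fix x assume "x < (SUP s\<in>{..<t}. f s)"
    then obtain s where s: "s < t" "x < f s"
      using less_cSUP_iff[OF _ bdd, of x] by (auto simp: lt_ex)
    then show "\<forall>\<^sub>F n in at_left t. x < f n"
      unfolding eventually_at_left[OF s(1)]
      by (intro exI[of _ s]) (meson assms less_imp_le less_le_trans monoD)
  qed
  then show ?thesis unfolding left_lim_def by (simp add: tendsto_Lim)
qed

lemma left_lim_eqI: "(f \<longlongrightarrow> l) (at_left (t::real)) \<Longrightarrow> left_lim f t = l"
  unfolding left_lim_def by (rule tendsto_Lim) auto

lemma left_lim_at_0: "(\<And>t. t < 0 \<Longrightarrow> f t = c) \<Longrightarrow> left_lim f 0 = c"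
  by (rule left_lim_eqI, rule tendsto_eventually) (auto simp: eventually_at_filter intro!: always_eventually)

lemma left_lim_le: assumes "mono f" shows "left_lim f t \<le> f t"
proof (rule tendsto_upperbound[OF mono_left_lim[OF assms]])
  show "\<forall>\<^sub>F i in at_left t. f i \<le> f t"
    unfolding eventually_at_filter by (intro always_eventually allI impI monoD[OF assms]) simp
qed simp

lemma le_left_lim: assumes "mono f" "s < t" shows "f s \<le> left_lim f t"
proof (rule tendsto_lowerbound[OF mono_left_lim[OF assms(1)]])
  show "\<forall>\<^sub>F i in at_left t. f s \<le> f i"
    unfolding eventually_at_left[OF assms(2)]
    by (intro exI[of _ s]) (use assms(2) in \<open>auto intro: monoD[OF assms(1)]\<close>)
qed simp

lemma jump_nonneg: "mono f \<Longrightarrow> 0 \<le> jump f t"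
  by (simp add: jump_def left_lim_le)

text \<open>Induction on the largest jump time \<open>b\<close>: the earlier jumps happen up to some
  \<open>b'\<close> before \<open>b\<close>, so they use up at most
  \<open>left_lim f b - f u\<close>, and the jump at \<open>b\<close> supplies the rest.\<close>

lemma sum_jump_le:
  assumes "mono f" "finite F"
  shows "F \<subseteq> {u<..v} \<Longrightarrow> u \<le> v \<Longrightarrow> (\<Sum>s\<in>F. jump f s) \<le> f v - f u"
  using assms(2)
proof (induction F arbitrary: v rule: finite_linorder_max_induct)
  case empty then show ?case using monoD[OF assms(1)] by auto
next
  case (insert b F)
  define b' where "b' = Max (insert u F)"
  have b': "F \<subseteq> {u<..b'}" "u \<le> b'" "b' < b"
    using insert by (auto simp: b'_def)
  have "sum (jump f) F \<le> f b' - f u" by (rule insert.IH) (use b' in auto)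
  also have "f b' \<le> left_lim f b" by (rule le_left_lim) (use b' assms in auto)
  finally have "sum (jump f) F + jump f b \<le> f b - f u" by (simp add: jump_def)
  also have "f b \<le> f v" using insert monoD[OF assms(1)] by auto
  finally show ?case using insert by auto
qed

lemma jump_summable: assumes "mono f" shows "jump f summable_on {u<..v}"
proof (rule nonneg_bdd_above_summable_on)
  show "bdd_above (sum (jump f) ` {F. F \<subseteq> {u<..v} \<and> finite F})"
  proof (rule bdd_aboveI2)
    fix F assume "F \<in> {F. F \<subseteq> {u<..v} \<and> finite F}"
    then show "sum (jump f) F \<le> max 0 (f v - f u)"
      using sum_jump_le[OF assms, of F u v] by (cases "u \<le> v") auto
  qed
qed (auto intro: jump_nonneg assms)

lemma infsum_jump_le: assumes "mono f" "u \<le> v" shows "infsum (jump f) {u<..v} \<le> f v - f u"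
  by (rule infsum_le_finite_sums[OF jump_summable]) (auto intro: sum_jump_le assms)

text \<open>The properties of a control path after its prolongation by 0. The value at 0 thereby
  becomes an ordinary jump and needs no separate treatment.\<close>

locale control_path =
  fixes f :: "real \<Rightarrow> real"
  assumes mono: "mono f" and rc: "\<And>t. continuous (at_right t) f" and neg: "\<And>t. t < 0 \<Longrightarrow> f t = 0"
begin

lemma jump_neg: "t < 0 \<Longrightarrow> jump f t = 0"
proof -
  assume t: "t < 0"
  have "(f \<longlongrightarrow> 0) (at_left t)"
    by (rule tendsto_eventually) (use t neg in \<open>auto simp: eventually_at_filter intro!: always_eventually\<close>)
  then show ?thesis using neg[OF t] by (simp add: jump_def left_lim_eqI)
qed

lemma infsum_jump_0: "infsum (jump f) {-1<..t} = infsum (jump f) {0..t}"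
  by (rule infsum_cong_neutral) (auto simp: jump_neg)

text \<open>A half-open interval that begins before 0 contains the jump at 0, so the estimates for
  \<open>{u<..v}\<close> apply to the whole jump sum.\<close>

lemma cont_part_alt: "cont_part f t = f t - infsum (jump f) {-1<..t}"
  by (simp add: cont_part_def infsum_jump_0)

lemma cont_part_diff:
  assumes "0 \<le> u" "u \<le> v"
  shows "cont_part f v - cont_part f u = f v - f u - infsum (jump f) {u<..v}"
proof -
  have "infsum (jump f) ({-1<..u} \<union> {u<..v}) = infsum (jump f) {-1<..u} + infsum (jump f) {u<..v}"
    by (rule infsum_Un_disjoint) (auto intro: jump_summable mono)
  moreover have "{-1<..u} \<union> {u<..v} = {-1<..v}" using assms by auto
  ultimately show ?thesis by (simp add: cont_part_alt)
qed

lemma cont_part_neg: "t < 0 \<Longrightarrow> cont_part f t = 0"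
  by (simp add: cont_part_def neg)

lemma cont_part_mono: "mono (cont_part f)"
proof (rule monoI)
  fix u v :: real assume uv: "u \<le> v"
  consider "0 \<le> u" | "u < 0" "0 \<le> v" | "v < 0" by linarith
  then show "cont_part f u \<le> cont_part f v"
  proof cases
    case 1 then show ?thesis using cont_part_diff[of u v] infsum_jump_le[OF mono uv] uv by auto
  next
    case 2
    then have "0 \<le> cont_part f v"
      using infsum_jump_le[OF mono, of "-1" v] by (simp add: cont_part_alt neg)
    then show ?thesis using 2 by (simp add: cont_part_neg)
  next
    case 3 then show ?thesis using uv by (simp add: cont_part_neg)
  qed
qed

lemma infsum_jump_nonneg: "0 \<le> infsum (jump f) A"
  by (rule infsum_nonneg) (auto intro: jump_nonneg mono)

text \<open>To the right of \<open>t\<close>, the increments of the continuous part lie between 0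
  and those of \<open>f\<close>. This regularity lets \<open>interval_measure\<close> assign them as
  masses.\<close>

lemma cont_part_rc: "continuous (at_right t) (cont_part f)"
proof (cases "t < 0")
  case True
  then have "\<forall>\<^sub>F v in at_right t. cont_part f v = 0"
    unfolding eventually_at_right[OF True] by (auto simp: cont_part_neg)
  then show ?thesis using True unfolding continuous_within
    by (simp add: cont_part_neg tendsto_eventually)
next
  case False
  have "((\<lambda>v. cont_part f v - cont_part f t) \<longlongrightarrow> 0) (at_right t)"
  proof (rule tendsto_sandwich[where f = "\<lambda>_. 0" and h = "\<lambda>v. f v - f t"])
    show "\<forall>\<^sub>F v in at_right t. 0 \<le> cont_part f v - cont_part f t"
      using monoD[OF cont_part_mono] by (auto simp: eventually_at_filter)
    show "\<forall>\<^sub>F v in at_right t. cont_part f v - cont_part f t \<le> f v - f t"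
      using cont_part_diff[of t] False infsum_jump_nonneg by (auto simp: eventually_at_filter)
    show "((\<lambda>v. f v - f t) \<longlongrightarrow> 0) (at_right t)"
      using rc[of t] unfolding continuous_within by (simp add: LIM_zero)
  qed auto
  then show ?thesis unfolding continuous_within by (simp add: LIM_zero_iff)
qed

lemma emeasure_cont_part:
  "u \<le> v \<Longrightarrow> emeasure (interval_measure (cont_part f)) {u<..v} = ennreal (cont_part f v - cont_part f u)"
  by (rule emeasure_interval_measure_Ioc) (auto intro: cont_part_rc monoD[OF cont_part_mono])

end

section \<open>Losses of a controlled path\<close>

text \<open>Truncation at 0 is subadditive, so sums can be split without knowing signs.\<close>

lemma ennreal_add_le: "ennreal (a + b) \<le> ennreal a + ennreal b"
proof -
  have "ennreal (a + b) \<le> ennreal (max 0 a + max 0 b)" by (rule ennreal_leI) simp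
  also have "\<dots> = ennreal a + ennreal b" by (subst ennreal_plus) (auto simp: max_def ennreal_neg)
  finally show ?thesis .
qed

lemma nn_integral_count_space_infsum:
  fixes g :: "'a \<Rightarrow> real"
  assumes "\<And>x. x \<in> A \<Longrightarrow> 0 \<le> g x" "g summable_on A"
  shows "(\<integral>\<^sup>+x. ennreal (g x) \<partial>count_space A) = ennreal (infsum g A)"
proof -
  have "(\<lambda>x. norm (g x)) summable_on A"
    using assms(2) by (rule summable_on_iff_abs_summable_on_real[THEN iffD1])
  then have "Infinite_Set_Sum.abs_summable_on g A"
    by (rule abs_summable_equivalent[THEN iffD1])
  then show ?thesis
    by (simp only: nn_integral_conv_infsetsum assms(1) infsetsum_infsum)
qed

text \<open>Its superadditivity compares one large loss with the sum of its parts.\<close>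

definition exp_gap :: "real \<Rightarrow> real" where "exp_gap j = j - (1 - exp (- j))"

lemma exp_gap_nonneg: "0 \<le> exp_gap j"
  using exp_ge_add_one_self[of "- j"] by (simp add: exp_gap_def)

text \<open>The difference of the two sides is exactly
  \<open>(1 - exp (- a)) * (1 - exp (- b))\<close>.\<close>

lemma exp_gap_add: "0 \<le> a \<Longrightarrow> 0 \<le> b \<Longrightarrow> exp_gap a + exp_gap b \<le> exp_gap (a + b)"
proof -
  assume "0 \<le> a" "0 \<le> b"
  then have "0 \<le> (1 - exp (- a)) * (1 - exp (- b))" by simp
  moreover have "exp (- (a + b)) = exp (- a) * exp (- b)" by (simp flip: exp_add)
  ultimately show ?thesis by (simp add: exp_gap_def algebra_simps)
qed

lemma exp_gap_mono: "0 \<le> a \<Longrightarrow> a \<le> b \<Longrightarrow> exp_gap a \<le> exp_gap b"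
  using exp_gap_add[of a "b - a"] exp_gap_nonneg[of "b - a"] by simp

lemma exp_gap_sum:
  "finite F \<Longrightarrow> (\<And>x. x \<in> F \<Longrightarrow> 0 \<le> j x) \<Longrightarrow> (\<Sum>x\<in>F. exp_gap (j x)) \<le> exp_gap (\<Sum>x\<in>F. j x)"
proof (induction F rule: finite_induct)
  case empty then show ?case by (simp add: exp_gap_def)
next
  case (insert x F)
  then have "(\<Sum>x\<in>F. exp_gap (j x)) \<le> exp_gap (\<Sum>x\<in>F. j x)" by auto
  moreover have "exp_gap (j x) + exp_gap (\<Sum>x\<in>F. j x) \<le> exp_gap (j x + (\<Sum>x\<in>F. j x))"
    by (rule exp_gap_add) (use insert in \<open>auto intro: sum_nonneg\<close>)
  ultimately show ?case using insert by simp
qed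

text \<open>Here \<open>f\<close> is the downward control and \<open>Z\<close> the factor of the
  state that remains after \<open>exp B\<close> is split off. The upward control is hidden in the
  inequality \<open>Z_dec\<close>: it can only raise \<open>Z\<close>, so \<open>Z\<close> falls at
  most by what \<open>f\<close> removes.\<close>

locale net_path = control_path f for f :: "real \<Rightarrow> real" +
  fixes Z :: "real \<Rightarrow> real"
  assumes Z_pos: "\<And>t. 0 < Z t"
    and Z_rc: "\<And>t. 0 \<le> t \<Longrightarrow> continuous (at_right t) Z"
    and Z_left: "\<And>t. 0 < t \<Longrightarrow> (Z \<longlongrightarrow> left_lim Z t) (at_left t)"
    and Z_dec: "\<And>u v. 0 \<le> u \<Longrightarrow> u \<le> v \<Longrightarrow> Z u * exp (- (f v - f u)) \<le> Z v"
begin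

abbreviation "cmeas \<equiv> interval_measure (cont_part f)"

definition jump_loss :: "real \<Rightarrow> real" where
  "jump_loss w = left_lim Z w * (1 - exp (- jump f w))"

text \<open>The integral of \<open>l\<close> over \<open>A\<close> against \<open>Z\<close> \<circ>
  \<open>d f\<close> in the sense of the downward control cost. With \<open>l\<close> the discounted
  \<open>exp B\<close> and \<open>A = {0..}\<close> it is \<open>down_cost\<close>; with
  \<open>l = 1\<close> it is the amount of \<open>Z\<close> removed, as in
  \<open>mu\<close>.\<close>

definition nu :: "(real \<Rightarrow> real) \<Rightarrow> real set \<Rightarrow> ennreal" where
  "nu l A = (\<integral>\<^sup>+w\<in>A. ennreal (l w * Z w) \<partial>cmeas) + (\<integral>\<^sup>+w\<in>A. ennreal (l w * jump_loss w) \<partial>count_space {0..})"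

abbreviation mu :: "real \<Rightarrow> real \<Rightarrow> ennreal" where
  "mu u v \<equiv> nu (\<lambda>_. 1) {u<..v}"

lemma left_lim_Z_ge:
  assumes "0 \<le> u" "u < t" "\<And>w. u < w \<Longrightarrow> w < t \<Longrightarrow> c \<le> Z w"
  shows "c \<le> left_lim Z t"
  by (rule tendsto_lowerbound[OF Z_left])
     (use assms in \<open>auto simp: eventually_at_left[of u t]\<close>)

lemma left_lim_Z_nonneg: "0 < t \<Longrightarrow> 0 \<le> left_lim Z t"
  by (rule left_lim_Z_ge[of 0]) (auto intro: less_imp_le Z_pos)

lemma Z_jump: assumes "0 < t" shows "left_lim Z t * exp (- jump f t) \<le> Z t"
proof (rule tendsto_upperbound)
  show "((\<lambda>u. Z u * exp (- (f t - f u))) \<longlongrightarrow> left_lim Z t * exp (- jump f t)) (at_left t)"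
    unfolding jump_def using assms by (intro tendsto_intros Z_left mono_left_lim mono)
  show "\<forall>\<^sub>F u in at_left t. Z u * exp (- (f t - f u)) \<le> Z t"
    unfolding eventually_at_left[OF assms]
    by (intro exI[of _ 0]) (use assms Z_dec[of _ t] in auto)
qed simp

lemma nu_mono_set: "A \<subseteq> B \<Longrightarrow> nu l A \<le> nu l B"
  unfolding nu_def by (intro add_mono nn_integral_mono) (auto split: split_indicator)

text \<open>The continuous part needs a measurable integrand, and measurability of \<open>l\<close>
  and \<open>Z\<close> is available on nonnegative times; this is why \<open>A\<close> and
  \<open>B\<close> are kept inside \<open>{0..}\<close>.\<close>

lemma nu_Un:
  assumes [measurable]: "A \<in> sets borel" "B \<in> sets borel" and AB: "A \<inter> B = {}" "A \<subseteq> {0..}" "B \<subseteq> {0..}"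
    and l[measurable]: "(\<lambda>t. l (max 0 t)) \<in> borel_measurable borel"
  shows "nu l (A \<union> B) = nu l A + nu l B"
proof -
  have [measurable]: "(\<lambda>t. Z (max 0 t)) \<in> borel_measurable borel"
    by (rule right_continuous_measurable[OF Z_rc])
  have m: "(\<lambda>w. ennreal (l w * Z w) * indicator C w) \<in> borel_measurable cmeas"
    if [measurable]: "C \<in> sets borel" and C: "C \<subseteq> {0..}" for C
  proof -
    have "(\<lambda>w. ennreal (l (max 0 w) * Z (max 0 w)) * indicator C w) \<in> borel_measurable cmeas"
      by measurable
    also have "(\<lambda>w. ennreal (l (max 0 w) * Z (max 0 w)) * indicator C w) = (\<lambda>w. ennreal (l w * Z w) * indicator C w)"
      using C by (auto simp: fun_eq_iff max_def indicator_def)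
    finally show ?thesis .
  qed
  have "(\<integral>\<^sup>+w\<in>A \<union> B. ennreal (l w * Z w) \<partial>cmeas)
      = (\<integral>\<^sup>+w. ennreal (l w * Z w) * indicator A w + ennreal (l w * Z w) * indicator B w \<partial>cmeas)"
    using AB by (intro nn_integral_cong) (auto split: split_indicator)
  also have "\<dots> = (\<integral>\<^sup>+w\<in>A. ennreal (l w * Z w) \<partial>cmeas) + (\<integral>\<^sup>+w\<in>B. ennreal (l w * Z w) \<partial>cmeas)"
    by (intro nn_integral_add m) (use AB in auto)
  finally have 1: "(\<integral>\<^sup>+w\<in>A \<union> B. ennreal (l w * Z w) \<partial>cmeas)
      = (\<integral>\<^sup>+w\<in>A. ennreal (l w * Z w) \<partial>cmeas) + (\<integral>\<^sup>+w\<in>B. ennreal (l w * Z w) \<partial>cmeas)" .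
  have "(\<integral>\<^sup>+w\<in>A \<union> B. ennreal (l w * jump_loss w) \<partial>count_space {0..})
      = (\<integral>\<^sup>+w. ennreal (l w * jump_loss w) * indicator A w + ennreal (l w * jump_loss w) * indicator B w \<partial>count_space {0..})"
    using AB by (intro nn_integral_cong) (auto split: split_indicator)
  also have "\<dots> = (\<integral>\<^sup>+w\<in>A. ennreal (l w * jump_loss w) \<partial>count_space {0..})
      + (\<integral>\<^sup>+w\<in>B. ennreal (l w * jump_loss w) \<partial>count_space {0..})"
    by (intro nn_integral_add) auto
  finally show ?thesis unfolding nu_def 1 by (simp add: algebra_simps)
qed

lemma mu_Un: "0 \<le> u \<Longrightarrow> u \<le> v \<Longrightarrow> v \<le> w \<Longrightarrow> mu u v + mu v w = mu u w"
  by (subst nu_Un[symmetric]) (auto simp: ivl_disj_un)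

lemma jump_loss_nonneg: "0 < w \<Longrightarrow> 0 \<le> jump_loss w"
  unfolding jump_loss_def using left_lim_Z_nonneg[of w] jump_nonneg[OF mono, of w] by simp

lemma nu_ge:
  assumes "0 \<le> u" "0 \<le> k" "\<And>w. u < w \<Longrightarrow> w \<le> v \<Longrightarrow> k \<le> l w"
  shows "ennreal k * mu u v \<le> nu l {u<..v}"
proof -
  have [measurable]: "(\<lambda>t. Z (max 0 t)) \<in> borel_measurable borel"
    by (rule right_continuous_measurable[OF Z_rc])
  have eq: "ennreal (1 * Z w) * indicator {u<..v} w = ennreal (Z (max 0 w)) * indicator {u<..v} w" for w
    using assms by (auto split: split_indicator simp: max_def)
  have "ennreal k * mu u v = (\<integral>\<^sup>+w\<in>{u<..v}. ennreal k * ennreal (1 * Z w) \<partial>cmeas)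
     + (\<integral>\<^sup>+w\<in>{u<..v}. ennreal k * ennreal (1 * jump_loss w) \<partial>count_space {0..})"
    unfolding nu_def distrib_left mult.assoc eq
    by (intro arg_cong2[where f="(+)"] nn_integral_cmult[symmetric]) auto
  also have "\<dots> \<le> nu l {u<..v}"
    unfolding nu_def using assms jump_loss_nonneg Z_pos
    by (intro add_mono nn_integral_mono)
       (auto split: split_indicator simp: ennreal_mult[symmetric] less_imp_le intro!: ennreal_leI mult_right_mono)
  finally show ?thesis .
qed

text \<open>With \<open>T = f v - f u\<close>, the relative loss is
  \<open>1 - exp (- T) = T - exp_gap T\<close>. Superadditivity of \<open>exp_gap\<close> bounds
  \<open>exp_gap T\<close> below by the sum over the jumps, which leaves the continuous increase
  plus the relative losses of the single jumps.\<close>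

lemma one_minus_exp_le:
  assumes "u \<le> v"
  shows "(\<lambda>w. 1 - exp (- jump f w)) summable_on {u<..v}"
    and "1 - exp (- (f v - f u)) \<le> f v - f u - infsum (jump f) {u<..v} + (\<Sum>\<^sub>\<infinity>w\<in>{u<..v}. 1 - exp (- jump f w))"
proof -
  note J = jump_summable[OF mono, of u v] and j0 = jump_nonneg[OF mono]
  show S: "(\<lambda>w. 1 - exp (- jump f w)) summable_on {u<..v}"
    by (rule summable_on_comparison_test[OF J])
       (use j0 exp_gap_nonneg in \<open>auto simp: exp_gap_def\<close>)
  have G: "(\<lambda>w. exp_gap (jump f w)) summable_on {u<..v}"
    by (rule summable_on_comparison_test[OF J])
       (use j0 exp_gap_nonneg in \<open>auto simp: exp_gap_def\<close>)
  have "(\<Sum>\<^sub>\<infinity>w\<in>{u<..v}. exp_gap (jump f w)) + (\<Sum>\<^sub>\<infinity>w\<in>{u<..v}. 1 - exp (- jump f w)) = infsum (jump f) {u<..v}"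
    unfolding infsum_add[OF G S, symmetric] by (simp add: exp_gap_def)
  moreover have "(\<Sum>\<^sub>\<infinity>w\<in>{u<..v}. exp_gap (jump f w)) \<le> exp_gap (f v - f u)"
  proof (rule infsum_le_finite_sums[OF G])
    fix F assume F: "finite F" "F \<subseteq> {u<..v}"
    have "(\<Sum>w\<in>F. exp_gap (jump f w)) \<le> exp_gap (\<Sum>w\<in>F. jump f w)"
      by (rule exp_gap_sum) (use F j0 in auto)
    also have "\<dots> \<le> exp_gap (f v - f u)"
      by (intro exp_gap_mono sum_nonneg sum_jump_le) (use F j0 mono assms in auto)
    finally show "(\<Sum>w\<in>F. exp_gap (jump f w)) \<le> exp_gap (f v - f u)" .
  qed
  ultimately show "1 - exp (- (f v - f u)) \<le> f v - f u - infsum (jump f) {u<..v} + (\<Sum>\<^sub>\<infinity>w\<in>{u<..v}. 1 - exp (- jump f w))"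
    by (simp add: exp_gap_def)
qed

text \<open>
  Continuous induction: over a short interval to the right of a point, \<open>Z\<close> is nearly constant and
  the loss is at most the continuous increase plus the losses at the jumps; left limits are
  passed through \<open>Z_jump\<close>. Common jumps of the upward control only increase \<open>Z\<close>.
\<close>

lemma loss_local:
  assumes u: "0 \<le> u" and e: "0 < e"
  shows "\<forall>\<^sub>F v in at_right u. ennreal (Z u - Z v) \<le> mu u v + ennreal (e * (f v - f u))"
proof -
  \<comment> \<open>A lower bound for \<open>Z\<close> just to the right of \<open>u\<close>; the
    truncation keeps it nonnegative, so that it can serve as a density.\<close>
  define k where "k = max 0 (Z u - e)"
  have "\<forall>\<^sub>F v in at_right u. Z u - e < Z v"
    using Z_rc[OF u] e unfolding continuous_within by (intro order_tendstoD) auto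
  then obtain b where b: "u < b" "\<And>v. u < v \<Longrightarrow> v < b \<Longrightarrow> Z u - e < Z v"
    by (auto simp: eventually_at_right[OF less_add_one])
  have Zk: "k \<le> Z w" if "u < w" "w < b" for w
    using b(2)[OF that] Z_pos[of w] by (auto simp: k_def)
  show ?thesis
    unfolding eventually_at_right[OF less_add_one]
  proof (intro exI[of _ b] conjI allI impI b)
    fix v assume v: "u < v" "v < b"
    define T where "T = f v - f u"
    define P where "P = (\<Sum>\<^sub>\<infinity>w\<in>{u<..v}. 1 - exp (- jump f w))"
    have T0: "0 \<le> T" using monoD[OF mono, of u v] v by (simp add: T_def)
    have k0: "0 \<le> k" by (simp add: k_def)
    have P0: "0 \<le> P" unfolding P_def
      by (rule infsum_nonneg) (use jump_nonneg[OF mono] in auto)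
    have c0: "0 \<le> cont_part f v - cont_part f u"
      using monoD[OF cont_part_mono, of u v] v by simp
    have one: "1 - exp (- T) \<le> cont_part f v - cont_part f u + P"
      using one_minus_exp_le(2)[of u v] cont_part_diff[of u v] u v by (simp add: T_def P_def)
    have "Z u - Z v \<le> Z u * (1 - exp (- T))"
      using Z_dec[of u v] u v by (simp add: T_def algebra_simps)
    \<comment> \<open>As \<open>Z u\<close> is at most \<open>k + e\<close>, the loss splits: the
      part with \<open>k\<close> is covered by \<open>mu\<close>, the part with \<open>e\<close>
      goes into the error term.\<close>
    also have "\<dots> \<le> (k + e) * (1 - exp (- T))"
      by (intro mult_right_mono) (use T0 in \<open>auto simp: k_def\<close>)
    also have "\<dots> \<le> k * (cont_part f v - cont_part f u + P) + e * T"
      unfolding distrib_right using one k0 e exp_gap_nonneg[of T]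
      by (intro add_mono mult_left_mono) (auto simp: exp_gap_def)
    also have "\<dots> = k * (cont_part f v - cont_part f u) + k * P + e * T"
      by (simp add: algebra_simps)
    finally have "ennreal (Z u - Z v) \<le> ennreal (k * (cont_part f v - cont_part f u) + k * P + e * T)"
      by (rule ennreal_leI)
    also have "\<dots> = ennreal (k * (cont_part f v - cont_part f u)) + ennreal (k * P) + ennreal (e * T)"
      using k0 c0 P0 T0 e by (subst ennreal_plus | simp)+
    also have "ennreal (k * (cont_part f v - cont_part f u)) = (\<integral>\<^sup>+w\<in>{u<..v}. ennreal k \<partial>cmeas)"
      using v k0 c0 by (simp add: nn_integral_cmult_indicator emeasure_cont_part ennreal_mult)
    also have "ennreal (k * P) = (\<integral>\<^sup>+w. ennreal (k * (1 - exp (- jump f w))) \<partial>count_space {u<..v})"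
      unfolding P_def infsum_cmult_right'[symmetric]
      by (rule nn_integral_count_space_infsum[symmetric])
         (use k0 jump_nonneg[OF mono] one_minus_exp_le(1)[of u v] v in \<open>auto intro!: summable_on_cmult_right\<close>)
    also have "\<dots> = (\<integral>\<^sup>+w\<in>{u<..v}. ennreal (k * (1 - exp (- jump f w))) \<partial>count_space {0..})"
    proof -
      have "{u<..v} \<inter> {0..} = {u<..v}" "{u<..v} \<subseteq> {0..}" using u by auto
      then show ?thesis
        using nn_integral_restrict_space[of "{u<..v}" "count_space {0..}" "\<lambda>w. ennreal (k * (1 - exp (- jump f w)))"]
        by (simp only: restrict_count_space space_count_space sets_count_space Pow_iff Int_lower2)
    qed
    also have "(\<integral>\<^sup>+w\<in>{u<..v}. ennreal k \<partial>cmeas)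
        + (\<integral>\<^sup>+w\<in>{u<..v}. ennreal (k * (1 - exp (- jump f w))) \<partial>count_space {0..}) + ennreal (e * T)
      \<le> mu u v + ennreal (e * T)"
      unfolding nu_def
    proof (intro add_mono nn_integral_mono order_refl)
      fix w
      show "ennreal k * indicator {u<..v} w \<le> ennreal (1 * Z w) * indicator {u<..v} w"
        using Zk v by (auto split: split_indicator intro!: ennreal_leI)
      have "k \<le> left_lim Z w" if "u < w" "w \<le> v"
        by (rule left_lim_Z_ge[of u]) (use that u v Zk in auto)
      then show "ennreal (k * (1 - exp (- jump f w))) * indicator {u<..v} w
          \<le> ennreal (1 * jump_loss w) * indicator {u<..v} w"
        unfolding jump_loss_def
        using jump_nonneg[OF mono, of w]
        by (auto split: split_indicator intro!: ennreal_leI mult_right_mono)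
    qed
    finally show "ennreal (Z u - Z v) \<le> mu u v + ennreal (e * (f v - f u))" by (simp add: T_def)
  qed
qed

lemma mu_jump: assumes "0 < c" shows "ennreal (jump_loss c) \<le> nu (\<lambda>_. 1) {c}"
proof -
  have "ennreal (jump_loss c) \<le> (\<integral>\<^sup>+w\<in>{c}. ennreal (1 * jump_loss w) \<partial>count_space {0..})"
    using assms by (intro order_trans[OF _ nn_integral_ge_point[of c]]) auto
  then show ?thesis by (simp add: nu_def add_increasing)
qed

text \<open>The error is proportional to the increment of \<open>f\<close>, hence additive over
  adjacent intervals: it does not accumulate however many local steps the continuous induction
  takes.\<close>

lemma loss_le_mu_eps:
  assumes s: "0 \<le> s" "s \<le> t" and e: "0 < e"
  shows "ennreal (Z s - Z t) \<le> mu s t + ennreal (e * (f t - f s))"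
proof -
  define P where "P v \<longleftrightarrow> ennreal (Z s - Z v) \<le> mu s v + ennreal (e * (f v - f s))" for v
  define A where "A = {v\<in>{s..t}. P v}"
  define c where "c = Sup A"
  have sA: "s \<in> A" using s by (simp add: A_def P_def)
  have bdd: "bdd_above A" by (auto simp: A_def intro: bdd_aboveI)
  have sc: "s \<le> c" unfolding c_def by (rule cSup_upper[OF sA bdd])
  have ct: "c \<le> t" unfolding c_def by (rule cSup_least) (use sA in \<open>auto simp: A_def\<close>)
  have fle: "x \<le> y \<Longrightarrow> f x \<le> f y" for x y by (rule monoD[OF mono])
  have "P c"
  proof (cases "c \<in> A")
    case True then show ?thesis by (simp add: A_def)
  next
    case False
    then have sc': "s < c" using sA sc by (metis le_less)
    then have c0: "0 < c" using s by simp
    define R where "R = mu s c + ennreal (e * (f c - f s))"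
    show ?thesis
    proof (cases "R = top")
      case True then show ?thesis by (simp add: P_def R_def)
    next
      case False
      then obtain r where r: "0 \<le> r" "R = ennreal r" by (cases R) auto
      \<comment> \<open>The atom of the loss at \<open>c\<close> is reserved in advance:
        \<open>{s<..v}\<close> and \<open>{c}\<close> are disjoint subsets of
        \<open>{s<..c}\<close>.\<close>
      have step: "Z s - Z v + jump_loss c \<le> r" if v: "v \<in> A" "v < c" for v
      proof -
        have v': "s \<le> v" "v \<le> t" "P v" using v by (auto simp: A_def)
        have "ennreal (Z s - Z v + jump_loss c) \<le> ennreal (Z s - Z v) + ennreal (jump_loss c)"
          by (rule ennreal_add_le)
        also have "\<dots> \<le> (mu s v + ennreal (e * (f v - f s))) + nu (\<lambda>_. 1) {c}"
          using v'(3) mu_jump[OF c0] unfolding P_def by (rule add_mono)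
        also have "\<dots> = nu (\<lambda>_. 1) ({s<..v} \<union> {c}) + ennreal (e * (f v - f s))"
          by (subst nu_Un) (use s v v' c0 in \<open>auto simp: algebra_simps\<close>)
        also have "\<dots> \<le> R"
          unfolding R_def using v v' sc' e fle[of v c]
          by (intro add_mono nu_mono_set ennreal_leI mult_left_mono) auto
        finally show ?thesis using r by simp
      qed
      have "Z s - left_lim Z c + jump_loss c \<le> r"
      proof (rule ccontr)
        assume "\<not> ?thesis"
        \<comment> \<open>Points of \<open>A\<close> lie arbitrarily close to \<open>c\<close> from
          the left, since \<open>c\<close> is the supremum and not in \<open>A\<close>; at such a
          point this contradicts \<open>step\<close>.\<close>
        then have "\<forall>\<^sub>F v in at_left c. Z v < Z s + jump_loss c - r"
          by (intro order_tendstoD(2)[OF Z_left[OF c0]]) auto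
        then obtain b where b: "b < c" "\<And>v. b < v \<Longrightarrow> v < c \<Longrightarrow> Z v < Z s + jump_loss c - r"
          by (auto simp: eventually_at_left[OF c0])
        obtain v where v: "v \<in> A" "b < v"
          using b(1) less_cSup_iff[of A b] sA bdd unfolding c_def by auto
        moreover have "v \<le> c" unfolding c_def by (rule cSup_upper[OF v(1) bdd])
        moreover have "v \<noteq> c" using v \<open>c \<notin> A\<close> by auto
        ultimately have "v < c" by simp
        then show False using b(2)[OF v(2)] step[OF v(1)] by simp
      qed
      \<comment> \<open>Subtracting the jump loss from the left limit leaves
        \<open>left_lim Z c * exp (- jump f c)\<close>, which by \<open>Z_jump\<close> is at most
        \<open>Z c\<close>.\<close>
      then have "Z s - Z c \<le> r"
        using Z_jump[OF c0] by (simp add: jump_loss_def algebra_simps)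
      then show ?thesis using r by (simp add: P_def R_def[symmetric])
    qed
  qed
  have "c = t"
  proof (rule ccontr)
    assume "c \<noteq> t"
    then have ct': "c < t" using ct by simp
    have "\<forall>\<^sub>F v in at_right c. ennreal (Z c - Z v) \<le> mu c v + ennreal (e * (f v - f c)) \<and> v < t"
      using loss_local[of c e] e s sc ct' eventually_at_rightI[of c t "\<lambda>v. v < t"]
      by (intro eventually_conj) auto
    then obtain b where b: "c < b"
      "\<And>v. c < v \<Longrightarrow> v < b \<Longrightarrow> ennreal (Z c - Z v) \<le> mu c v + ennreal (e * (f v - f c)) \<and> v < t"
      by (auto simp: eventually_at_right[OF less_add_one])
    obtain v where v: "c < v" "v < b" using dense[OF b(1)] by auto
    have "ennreal (Z s - Z v) \<le> ennreal (Z s - Z c) + ennreal (Z c - Z v)"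
      using ennreal_add_le[of "Z s - Z c" "Z c - Z v"] by simp
    also have "\<dots> \<le> (mu s c + ennreal (e * (f c - f s))) + (mu c v + ennreal (e * (f v - f c)))"
      using \<open>P c\<close> b(2)[OF v] unfolding P_def by (intro add_mono) auto
    also have "\<dots> = (mu s c + mu c v) + (ennreal (e * (f c - f s)) + ennreal (e * (f v - f c)))"
      by (simp add: algebra_simps)
    also have "mu s c + mu c v = mu s v" by (rule mu_Un) (use s sc v in auto)
    also have "ennreal (e * (f c - f s)) + ennreal (e * (f v - f c)) = ennreal (e * (f v - f s))"
      using e fle[of s c] fle[of c v] sc v by (subst ennreal_plus[symmetric]) (auto simp: algebra_simps)
    finally have "v \<in> A" using v sc s b(2)[OF v] by (auto simp: A_def P_def)
    then have "v \<le> c" unfolding c_def by (rule cSup_upper[OF _ bdd])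
    then show False using v by simp
  qed
  with \<open>P c\<close> show ?thesis by (simp add: P_def)
qed

lemma loss_le_mu:
  assumes s: "0 \<le> s" "s \<le> t"
  shows "ennreal (Z s - Z t) \<le> mu s t"
proof (rule ennreal_le_epsilon)
  fix e :: real assume e: "0 < e"
  \<comment> \<open>The summand 1 guards against a constant \<open>f\<close>.\<close>
  define e' where "e' = e / (f t - f s + 1)"
  have T: "0 \<le> f t - f s" using monoD[OF mono s(2)] by simp
  have e': "0 < e'" using e T by (simp add: e'_def)
  have "ennreal (Z s - Z t) \<le> mu s t + ennreal (e' * (f t - f s))"
    by (rule loss_le_mu_eps[OF s e'])
  also have "e' * (f t - f s) \<le> e" using T e by (simp add: e'_def field_simps)
  finally show "ennreal (Z s - Z t) \<le> mu s t + ennreal e" by (simp add: ennreal_leI add_left_mono order_trans)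
qed

text \<open>
  Whenever \<open>Z0\<close> increases it equals the barrier, which \<open>Z\<close> dominates; hence only losses of \<open>Z\<close>
  can enlarge the running maximum of the shortfall.
\<close>

lemma shortfall_increment:
  fixes Z0 :: "real \<Rightarrow> real"
  defines "D \<equiv> runmax (\<lambda>s. max 0 (Z0 s - Z s))"
  assumes bdd: "\<And>T. bdd_above ((\<lambda>s. max 0 (Z0 s - Z s)) ` {0..T})"
    and step: "\<And>s u. 0 \<le> s \<Longrightarrow> s \<le> u \<Longrightarrow> Z0 u = Z0 s \<or> (\<exists>v. s < v \<and> v \<le> u \<and> Z0 u \<le> Z v)"
    and s: "0 \<le> s" "s \<le> t"
  shows "ennreal (D t - D s) \<le> mu s t"
proof (cases "mu s t = top")
  case False
  then obtain q where q: "0 \<le> q" "mu s t = ennreal q" by (cases "mu s t") auto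
  have D0: "0 \<le> D s" unfolding D_def
    by (rule order_trans[OF _ runmax_upper[OF bdd, of 0 s]]) (use s in auto)
  have loss: "Z x - Z u \<le> q" if "s \<le> x" "x \<le> u" "u \<le> t" for x u
  proof -
    have "ennreal (Z x - Z u) \<le> mu x u" by (rule loss_le_mu) (use that s in auto)
    also have "\<dots> \<le> mu s t" by (rule nu_mono_set) (use that in auto)
    finally show ?thesis using q by simp
  qed
  have "D t \<le> D s + q"
    unfolding D_def
  proof (rule runmax_least, goal_cases)
    case (2 u)
    show ?case
    proof (cases "u \<le> s")
      case True
      then show ?thesis using runmax_upper[OF bdd, of u s] 2 q by simp
    next
      case False
      have "Z0 u - Z u \<le> D s + q"
        using step[of s u]
      proof
        assume eq: "Z0 u = Z0 s"
        have "Z0 s - Z s \<le> D s" unfolding D_def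
          by (rule order_trans[OF _ runmax_upper[OF bdd, of s s]]) (use s in auto)
        then show ?thesis using loss[of s u] False 2 eq by simp
      next
        assume "\<exists>v>s. v \<le> u \<and> Z0 u \<le> Z v"
        then obtain v where "s < v" "v \<le> u" "Z0 u \<le> Z v" by auto
        then show ?thesis using loss[of v u] 2 D0 by simp
      qed (use s False in auto)
      then show ?thesis using D0 q unfolding D_def by simp
    qed
  qed (use s in auto)
  then show ?thesis using q by (simp add: ennreal_leI)
qed simp

text \<open>Bounds the weighted loss from below by a Riemann-Stieltjes sum in \<open>D\<close>. On
  each cell the weight exceeds \<open>l\<close> by at most \<open>e\<close>, and the increment of
  \<open>D\<close> is at most the loss; the errors telescope to \<open>e * D (t n)\<close>. The
  initial value of \<open>D\<close> is paid by the atom of the loss at time 0.\<close>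

lemma riemann_le_nu:
  assumes l[measurable]: "(\<lambda>t. l (max 0 t)) \<in> borel_measurable borel"
    and l0: "\<And>t. 0 \<le> t \<Longrightarrow> 0 \<le> l t"
    and D: "\<And>s t. 0 \<le> s \<Longrightarrow> s \<le> t \<Longrightarrow> ennreal (D t - D s) \<le> mu s t"
    and D_mono: "\<And>s t. 0 \<le> s \<Longrightarrow> s \<le> t \<Longrightarrow> D s \<le> D t"
    and D0: "D 0 \<le> jump_loss 0" "0 \<le> D 0"
    and t: "t 0 = 0" "incseq t"
    and w: "\<And>k. k < n \<Longrightarrow> 0 \<le> w k"
    and w_l: "\<And>k s. k < n \<Longrightarrow> t k < s \<Longrightarrow> s \<le> t (Suc k) \<Longrightarrow> w k \<le> l s + e"
    and e: "0 \<le> e"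
  shows "ennreal (l 0 * D 0 + (\<Sum>k<n. w k * (D (t (Suc k)) - D (t k)))) \<le> nu l {0..t n} + ennreal (e * D (t n))"
  using w w_l
proof (induction n)
  case 0
  have "ennreal (l 0 * D 0) \<le> ennreal (l 0 * jump_loss 0)"
    using D0 l0[of 0] by (intro ennreal_leI mult_left_mono) auto
  also have "\<dots> \<le> (\<integral>\<^sup>+w\<in>{0}. ennreal (l w * jump_loss w) \<partial>count_space {0..})"
    by (intro order_trans[OF _ nn_integral_ge_point[of 0]]) auto
  also have "\<dots> \<le> nu l {0..t 0}" using t by (simp add: nu_def add_increasing)
  finally show ?case using t by (simp add: add_increasing2)
next
  case (Suc n)
  have tn: "0 \<le> t n" "t n \<le> t (Suc n)" using t by (metis incseqD le0) (simp add: t incseqD)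
  define d where "d = D (t (Suc n)) - D (t n)"
  have d: "0 \<le> d" using D_mono[OF tn] by (simp add: d_def)
  have Dn: "0 \<le> D (t n)" using D_mono[of 0 "t n"] tn D0 by simp
  \<comment> \<open>A constant lower bound for \<open>l\<close> on the last cell, nonnegative as
    \<open>nu_ge\<close> requires.\<close>
  define k where "k = max 0 (w n - e)"
  have k0: "0 \<le> k" by (simp add: k_def)
  have "w n * d \<le> (k + e) * d" using d by (intro mult_right_mono) (auto simp: k_def)
  then have "ennreal (w n * d) \<le> ennreal (k * d + e * d)" by (intro ennreal_leI) (simp add: algebra_simps)
  also have "\<dots> = ennreal k * ennreal d + ennreal (e * d)"
    using d e k0 by (simp add: ennreal_mult)
  also have "ennreal k * ennreal d \<le> ennreal k * mu (t n) (t (Suc n))"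
    unfolding d_def by (intro mult_left_mono D tn) auto
  also have "\<dots> \<le> nu l {t n<..t (Suc n)}"
  proof (rule nu_ge)
    fix s assume "t n < s" "s \<le> t (Suc n)"
    then show "k \<le> l s" using Suc.prems(2)[of n s] l0[of s] tn by (auto simp: k_def)
  qed (use tn in \<open>auto simp: k_def\<close>)
  finally have step: "ennreal (w n * d) \<le> nu l {t n<..t (Suc n)} + ennreal (e * d)"
    by (simp add: add_right_mono)
  have "ennreal (l 0 * D 0 + (\<Sum>k<Suc n. w k * (D (t (Suc k)) - D (t k))))
    \<le> ennreal (l 0 * D 0 + (\<Sum>k<n. w k * (D (t (Suc k)) - D (t k)))) + ennreal (w n * d)"
    using ennreal_add_le[of "l 0 * D 0 + (\<Sum>k<n. w k * (D (t (Suc k)) - D (t k)))" "w n * d"]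
    by (simp add: d_def algebra_simps)
  also have "\<dots> \<le> (nu l {0..t n} + ennreal (e * D (t n))) + (nu l {t n<..t (Suc n)} + ennreal (e * d))"
    using Suc by (intro add_mono step Suc.IH) auto
  also have "\<dots> = nu l ({0..t n} \<union> {t n<..t (Suc n)}) + (ennreal (e * D (t n)) + ennreal (e * d))"
    by (subst nu_Un) (use tn in \<open>auto simp: algebra_simps\<close>)
  also have "{0..t n} \<union> {t n<..t (Suc n)} = {0..t (Suc n)}" using tn by auto
  also have "ennreal (e * D (t n)) + ennreal (e * d) = ennreal (e * D (t (Suc n)))"
    using e d Dn by (subst ennreal_plus[symmetric]) (auto simp: d_def algebra_simps intro: mult_left_mono)
  finally show ?case .
qed

end

section \<open>Brownian motion\<close>

definition gauss :: "real \<Rightarrow> real measure" where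
  "gauss v = density lborel (\<lambda>z. ennreal (normal_density 0 (sqrt v) z))"

lemma sets_gauss[measurable_cong, simp]: "sets (gauss v) = sets borel"
  by (simp add: gauss_def)

lemma space_gauss[simp]: "space (gauss v) = UNIV"
  by (simp add: gauss_def)

lemma nn_integral_gauss:
  "h \<in> borel_measurable borel \<Longrightarrow> (\<integral>\<^sup>+z. h z \<partial>gauss v) = (\<integral>\<^sup>+z. ennreal (normal_density 0 (sqrt v) z) * h z \<partial>lborel)"
  unfolding gauss_def by (subst nn_integral_density) auto

lemma prob_space_gauss: "0 < v \<Longrightarrow> prob_space (gauss v)"
  unfolding gauss_def using prob_space_normal_density[of "sqrt v" 0] by simp

text \<open>Completing the square: an exponential weight shifts the mean. This yields the
  exponential moments and, integrated over a half-line, the formula for the cost of the uncontrolled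
  process.\<close>

lemma normal_density_tilt:
  assumes "0 < v"
  shows "exp (\<theta> * z) * normal_density 0 (sqrt v) z = exp (\<theta>\<^sup>2 * v / 2) * normal_density (\<theta> * v) (sqrt v) z"
proof -
  have e: "\<theta> * z + - z\<^sup>2 / (2 * v) = \<theta>\<^sup>2 * v / 2 + - (z - \<theta> * v)\<^sup>2 / (2 * v)"
    using assms by (simp add: field_simps power2_eq_square)
  have "exp (\<theta> * z) * exp (- z\<^sup>2 / (2 * v)) = exp (\<theta>\<^sup>2 * v / 2) * exp (- (z - \<theta> * v)\<^sup>2 / (2 * v))"
    unfolding exp_add[symmetric] e ..
  then show ?thesis using assms by (simp add: normal_density_def)
qed

lemma nn_integral_exp_gauss:
  assumes "0 < v"
  shows "(\<integral>\<^sup>+z. ennreal (exp (\<theta> * z)) \<partial>gauss v) = ennreal (exp (\<theta>\<^sup>2 * v / 2))"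
proof -
  have "(\<integral>\<^sup>+z. ennreal (exp (\<theta> * z)) \<partial>gauss v)
    = (\<integral>\<^sup>+z. ennreal (exp (\<theta>\<^sup>2 * v / 2)) * ennreal (normal_density (\<theta> * v) (sqrt v) z) \<partial>lborel)"
    by (subst nn_integral_gauss)
       (auto simp: ennreal_mult[symmetric] normal_density_tilt[OF assms, symmetric] mult.commute[of "normal_density _ _ _"] intro!: nn_integral_cong)
  also have "\<dots> = ennreal (exp (\<theta>\<^sup>2 * v / 2)) * 1"
    using assms by (subst nn_integral_cmult) (auto simp: nn_integral_eq_integral)
  finally show ?thesis by simp
qed

text \<open>
  Doob's inequality follows from its pathwise form
  \<open>M\<^sub>n\<^sup>2 - 2 Y\<^sub>n M\<^sub>n + 2 \<Sum>k<n. M\<^sub>k (Y\<^sub>k\<^sub>+\<^sub>1 - Y\<^sub>k) \<le> 0\<close>, so that \<open>sub\<close> is all that is needed of the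
  submartingale property.
\<close>

lemma doob_L2:
  fixes Y :: "nat \<Rightarrow> 'w \<Rightarrow> real"
  defines "Mx \<equiv> \<lambda>k \<omega>. Max ((\<lambda>i. Y i \<omega>) ` {..k})"
  assumes Y[measurable]: "\<And>k. Y k \<in> borel_measurable N"
    and Y0: "\<And>k \<omega>. 0 \<le> Y k \<omega>"
    and fin: "\<And>k. (\<integral>\<^sup>+\<omega>. ennreal ((Y k \<omega>)\<^sup>2) \<partial>N) < \<infinity>"
    and sub: "\<And>k. (\<integral>\<^sup>+\<omega>. ennreal (Mx k \<omega> * Y k \<omega>) \<partial>N) \<le> (\<integral>\<^sup>+\<omega>. ennreal (Mx k \<omega> * Y (Suc k) \<omega>) \<partial>N)"
  shows "(\<integral>\<^sup>+\<omega>. ennreal ((Mx n \<omega>)\<^sup>2) \<partial>N) \<le> 4 * (\<integral>\<^sup>+\<omega>. ennreal ((Y n \<omega>)\<^sup>2) \<partial>N)"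
proof -
  have MSuc: "Mx (Suc k) \<omega> = max (Y (Suc k) \<omega>) (Mx k \<omega>)" for k \<omega>
    unfolding Mx_def by (simp add: atMost_Suc)
  have M0: "Mx 0 = Y 0" by (simp add: Mx_def fun_eq_iff)
  have [measurable]: "Mx k \<in> borel_measurable N" for k
  proof (induction k)
    case (Suc k)
    then have "(\<lambda>\<omega>. max (Y (Suc k) \<omega>) (Mx k \<omega>)) \<in> borel_measurable N" by measurable
    then show ?case by (simp add: MSuc[abs_def])
  qed (simp add: M0)
  have Mx0: "0 \<le> Mx k \<omega>" for k \<omega>
    by (induction k) (auto simp: M0 MSuc Y0 max_def)
  have path: "(Mx n \<omega>)\<^sup>2 + 2 * (\<Sum>k<n. Mx k \<omega> * Y (Suc k) \<omega>) \<le> 2 * (Y n \<omega> * Mx n \<omega>) + 2 * (\<Sum>k<n. Mx k \<omega> * Y k \<omega>)" for n \<omega>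
  proof (induction n)
    case 0 then show ?case by (simp add: M0 power2_eq_square Y0)
  next
    case (Suc n)
    have "(Mx (Suc n) \<omega>)\<^sup>2 - (Mx n \<omega>)\<^sup>2 - 2 * Y (Suc n) \<omega> * Mx (Suc n) \<omega> + 2 * Y n \<omega> * Mx n \<omega>
        + 2 * Mx n \<omega> * (Y (Suc n) \<omega> - Y n \<omega>) \<le> 0"
    proof (cases "Y (Suc n) \<omega> \<le> Mx n \<omega>")
      case True then show ?thesis by (simp add: MSuc max_def algebra_simps)
    next
      case False
      have "0 \<le> (Mx n \<omega> - Y (Suc n) \<omega>)\<^sup>2" by simp
      then show ?thesis using False by (simp add: MSuc max_def algebra_simps power2_eq_square)
    qed
    with Suc show ?case by (simp add: algebra_simps)
  qed
  \<comment> \<open>Finiteness is needed before anything can be cancelled or absorbed in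
    \<open>ennreal\<close>.\<close>
  have Msq: "(\<integral>\<^sup>+\<omega>. ennreal ((Mx k \<omega>)\<^sup>2) \<partial>N) < \<infinity>" for k
  proof (induction k)
    case (Suc k)
    have "(\<integral>\<^sup>+\<omega>. ennreal ((Mx (Suc k) \<omega>)\<^sup>2) \<partial>N)
        \<le> (\<integral>\<^sup>+\<omega>. ennreal ((Y (Suc k) \<omega>)\<^sup>2) + ennreal ((Mx k \<omega>)\<^sup>2) \<partial>N)"
      by (intro nn_integral_mono) (auto simp: MSuc max_def)
    also have "\<dots> < \<infinity>" using Suc fin[of "Suc k"] by (subst nn_integral_add) auto
    finally show ?case .
  qed (use fin[of 0] in \<open>simp add: M0\<close>)
  have MY: "(\<integral>\<^sup>+\<omega>. ennreal (Mx k \<omega> * Y j \<omega>) \<partial>N) < \<infinity>" for k j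
  proof -
    have "(\<integral>\<^sup>+\<omega>. ennreal (Mx k \<omega> * Y j \<omega>) \<partial>N)
        \<le> (\<integral>\<^sup>+\<omega>. ennreal ((Mx k \<omega>)\<^sup>2) + ennreal ((Y j \<omega>)\<^sup>2) \<partial>N)"
    proof (intro nn_integral_mono)
      fix \<omega>
      have "0 \<le> (Mx k \<omega> - Y j \<omega>)\<^sup>2" "0 \<le> Mx k \<omega> * Y j \<omega>" using Mx0 Y0 by auto
      then have "Mx k \<omega> * Y j \<omega> \<le> (Mx k \<omega>)\<^sup>2 + (Y j \<omega>)\<^sup>2"
        by (simp add: power2_eq_square algebra_simps)
      then show "ennreal (Mx k \<omega> * Y j \<omega>) \<le> ennreal ((Mx k \<omega>)\<^sup>2) + ennreal ((Y j \<omega>)\<^sup>2)"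
        by (simp add: ennreal_leI del: ennreal_plus flip: ennreal_plus)
    qed
    also have "\<dots> < \<infinity>" using Msq[of k] fin[of j] by (subst nn_integral_add) auto
    finally show ?thesis .
  qed
  define A B C where "A = (\<integral>\<^sup>+\<omega>. ennreal ((Mx n \<omega>)\<^sup>2) \<partial>N)"
    and "B = (\<Sum>k<n. \<integral>\<^sup>+\<omega>. ennreal (Mx k \<omega> * Y (Suc k) \<omega>) \<partial>N)"
    and "C = (\<integral>\<^sup>+\<omega>. ennreal ((Y n \<omega>)\<^sup>2) \<partial>N)"
  have Bfin: "B < \<infinity>" unfolding B_def using MY by simp
  have sumI: "ennreal (2 * (\<Sum>k<n. Mx k \<omega> * Y (j k) \<omega>)) = 2 * (\<Sum>k<n. ennreal (Mx k \<omega> * Y (j k) \<omega>))" for \<omega> j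
  proof -
    have "(\<Sum>k<n. ennreal (Mx k \<omega> * Y (j k) \<omega>)) = ennreal (\<Sum>k<n. Mx k \<omega> * Y (j k) \<omega>)"
      using Mx0 Y0 by (intro sum_ennreal) auto
    then show ?thesis using Mx0 Y0 by (simp add: ennreal_mult'' sum_nonneg)
  qed
  have nnI: "(\<integral>\<^sup>+\<omega>. ennreal (2 * (\<Sum>k<n. Mx k \<omega> * Y (j k) \<omega>)) \<partial>N) = 2 * (\<Sum>k<n. \<integral>\<^sup>+\<omega>. ennreal (Mx k \<omega> * Y (j k) \<omega>) \<partial>N)" for j
    unfolding sumI by (subst nn_integral_cmult; (subst nn_integral_sum)?; simp)
  have "A + 2 * B = (\<integral>\<^sup>+\<omega>. ennreal ((Mx n \<omega>)\<^sup>2 + 2 * (\<Sum>k<n. Mx k \<omega> * Y (Suc k) \<omega>)) \<partial>N)"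
    unfolding A_def B_def using Mx0 Y0
    by (subst ennreal_plus) (auto simp del: sum_ennreal simp: nn_integral_add nnI intro!: sum_nonneg)
  also have "\<dots> \<le> (\<integral>\<^sup>+\<omega>. ennreal (2 * (Y n \<omega> * Mx n \<omega>) + 2 * (\<Sum>k<n. Mx k \<omega> * Y k \<omega>)) \<partial>N)"
    by (intro nn_integral_mono ennreal_leI path)
  also have "\<dots> = (\<integral>\<^sup>+\<omega>. ennreal (2 * (Y n \<omega> * Mx n \<omega>)) \<partial>N) + 2 * (\<Sum>k<n. \<integral>\<^sup>+\<omega>. ennreal (Mx k \<omega> * Y k \<omega>) \<partial>N)"
    using Mx0 Y0
    by (subst ennreal_plus) (auto simp del: sum_ennreal simp: nn_integral_add nnI intro!: sum_nonneg)
  also have "\<dots> \<le> (\<integral>\<^sup>+\<omega>. ennreal (2 * (Y n \<omega> * Mx n \<omega>)) \<partial>N) + 2 * B"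
    unfolding B_def by (intro add_left_mono mult_left_mono sum_mono sub) auto
  finally have "A \<le> (\<integral>\<^sup>+\<omega>. ennreal (2 * (Y n \<omega> * Mx n \<omega>)) \<partial>N)"
    using Bfin by (metis add.commute ennreal_add_left_cancel_le ennreal_mult_less_top ennreal_numeral
        ennreal_less_top infinity_ennreal_def less_irrefl)
  \<comment> \<open>The weights 1/2 and 2 in Young's inequality let half of \<open>A\<close> be
    absorbed on the left; doubling the remaining \<open>2 * C\<close> produces the constant
    4.\<close>
  also have "\<dots> \<le> (\<integral>\<^sup>+\<omega>. ennreal (1/2) * ennreal ((Mx n \<omega>)\<^sup>2) + 2 * ennreal ((Y n \<omega>)\<^sup>2) \<partial>N)"
  proof (intro nn_integral_mono)
    fix \<omega>
    have "0 \<le> (Mx n \<omega> - 2 * Y n \<omega>)\<^sup>2" by simp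
    then have "2 * (Y n \<omega> * Mx n \<omega>) \<le> (1/2) * (Mx n \<omega>)\<^sup>2 + 2 * (Y n \<omega>)\<^sup>2"
      by (simp add: power2_eq_square algebra_simps)
    then have "ennreal (2 * (Y n \<omega> * Mx n \<omega>)) \<le> ennreal ((1/2) * (Mx n \<omega>)\<^sup>2 + 2 * (Y n \<omega>)\<^sup>2)"
      by (rule ennreal_leI)
    also have "\<dots> = ennreal ((1/2) * (Mx n \<omega>)\<^sup>2) + ennreal (2 * (Y n \<omega>)\<^sup>2)" by (rule ennreal_plus) auto
    also have "ennreal ((1/2) * (Mx n \<omega>)\<^sup>2) = ennreal (1/2) * ennreal ((Mx n \<omega>)\<^sup>2)" by (rule ennreal_mult) auto
    also have "ennreal (2 * (Y n \<omega>)\<^sup>2) = 2 * ennreal ((Y n \<omega>)\<^sup>2)" by (simp add: ennreal_mult)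
    finally show "ennreal (2 * (Y n \<omega> * Mx n \<omega>)) \<le> ennreal (1/2) * ennreal ((Mx n \<omega>)\<^sup>2) + 2 * ennreal ((Y n \<omega>)\<^sup>2)" .
  qed
  also have "\<dots> = ennreal (1/2) * A + 2 * C"
    unfolding A_def C_def by (subst nn_integral_add) (auto simp: nn_integral_cmult)
  finally have le: "A \<le> ennreal (1/2) * A + 2 * C" .
  obtain a c where ac: "0 \<le> a" "0 \<le> c" "A = ennreal a" "C = ennreal c"
    using Msq[of n] fin[of n] unfolding A_def[symmetric] C_def[symmetric]
    by (cases A; cases C) auto
  have "ennreal a \<le> ennreal (1/2 * a + 2 * c)"
  proof -
    have "ennreal (1/2 * a + 2 * c) = ennreal (1/2 * a) + ennreal (2 * c)" using ac by (intro ennreal_plus) auto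
    also have "ennreal (1/2 * a) = ennreal (1/2) * ennreal a" using ac by (intro ennreal_mult) auto
    also have "ennreal (2 * c) = 2 * ennreal c" using ac by (simp add: ennreal_mult)
    finally show ?thesis using le unfolding ac by simp
  qed
  then have "a \<le> 1/2 * a + 2 * c" using ac by (subst (asm) ennreal_le_iff) auto
  then have "ennreal a \<le> ennreal (4 * c)" by (intro ennreal_leI) simp
  then show ?thesis unfolding A_def[symmetric] C_def[symmetric] using ac by (simp add: ennreal_mult)
qed

section \<open>Increments of Brownian motion and the augmented filtration\<close>

context brownian_motion
begin

definition good :: "'w set" where
  "good = {\<omega>\<in>space M. W 0 \<omega> = 0 \<and> continuous_on {0..} (\<lambda>t. W t \<omega>)}"

text \<open>
  Continuity of \<open>W\<close> holds only almost surely. Since the filtration contains all null sets,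
  \<open>Wc\<close> is an adapted version all of whose paths are continuous.
\<close>

definition Wc :: "real \<Rightarrow> 'w \<Rightarrow> real" where
  "Wc t \<omega> = (if \<omega> \<in> good then W t \<omega> else 0)"

lemma AE_good: "AE \<omega> in M. \<omega> \<in> good"
  using W_zero W_continuous AE_space by eventually_elim (simp add: good_def)

text \<open>Continuity involves uncountably many times, so measurability of \<open>good\<close> is
  not evident; completeness of \<open>M\<close> supplies it.\<close>

lemma bad_null: "space M - good \<in> null_sets M"
proof -
  obtain N where N: "{\<omega>\<in>space M. \<not> \<omega> \<in> good} \<subseteq> N" "emeasure M N = 0" "N \<in> sets M"
    using AE_good by (rule AE_E)
  then have "N \<in> null_sets M" by auto
  from complete2[OF _ this] N(1) show ?thesis by (simp add: set_diff_eq)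
qed

lemma Wc_cont: "continuous_on {0..} (\<lambda>t. Wc t \<omega>)"
  by (cases "\<omega> \<in> good") (simp_all add: Wc_def, simp add: good_def)

lemma Wc_0[simp]: "Wc 0 \<omega> = 0"
  by (auto simp: Wc_def good_def)

lemma AE_Wc: "AE \<omega> in M. \<forall>t. W t \<omega> = Wc t \<omega>"
  using AE_good by eventually_elim (simp add: Wc_def)

abbreviation "F \<equiv> augmented_filtration"

lemma space_F[simp]: "space (F t) = space M"
  unfolding augmented_filtration_def
  by (rule space_measure_of) (auto dest: sets.sets_into_space)

lemma sets_F: "sets (F t) = sigma_sets (space M)
  ({W u -` B \<inter> space M |u B. 0 \<le> u \<and> u \<le> t \<and> B \<in> sets borel} \<union> null_sets M)"
  unfolding augmented_filtration_def
  by (rule sets_measure_of) (auto dest: sets.sets_into_space)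

lemma sets_F_subset: "sets (F t) \<subseteq> sets M"
  unfolding sets_F
  by (rule sets.sigma_sets_subset) (auto intro: measurable_sets[OF W_measurable])

lemma F_mono: "s \<le> t \<Longrightarrow> sets (F s) \<subseteq> sets (F t)"
  unfolding sets_F
  by (intro sigma_sets_mono' Un_mono order_refl Collect_mono) (blast intro: order_trans)

lemma measurable_F_mono:
  assumes "h \<in> measurable (F s) N" "s \<le> t" shows "h \<in> measurable (F t) N"
  using assms F_mono[OF assms(2)] by (auto simp: measurable_def)

lemma measurable_F_M:
  assumes "h \<in> measurable (F s) N" shows "h \<in> measurable M N"
  using assms sets_F_subset[of s] by (auto simp: measurable_def)

lemma good_F: "good \<in> sets (F t)"
proof -
  have "space M - good \<in> sets (F t)"
    unfolding sets_F using bad_null by (intro sigma_sets.Basic) auto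
  from sets.compl_sets[OF this] show ?thesis
    by (simp add: good_def double_diff)
qed

lemma W_F: assumes "0 \<le> u" "u \<le> t" shows "W u \<in> borel_measurable (F t)"
proof (rule measurableI)
  fix B :: "real set" assume "B \<in> sets borel"
  then show "W u -` B \<inter> space (F t) \<in> sets (F t)"
    unfolding sets_F space_F using assms by (intro sigma_sets.Basic) auto
qed simp

lemma Wc_F: assumes "0 \<le> u" "u \<le> t" shows "Wc u \<in> borel_measurable (F t)"
proof -
  note [measurable] = W_F[OF assms] good_F
  show ?thesis unfolding Wc_def[abs_def] by measurable
qed

lemma Wc_M[measurable]: "0 \<le> u \<Longrightarrow> Wc u \<in> borel_measurable M"
  using Wc_F[of u u] measurable_F_M by auto

text \<open>Agreement up to a null set with an event of the raw filtration passes through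
  complements and countable unions. It transfers the independence assumption \<open>W_indep\<close>
  to the augmented filtration.\<close>

lemma augmented_approx:
  assumes "A \<in> sets (F s)"
  shows "\<exists>A'\<in>sigma_sets (space M) {W u -` B \<inter> space M |u B. 0 \<le> u \<and> u \<le> s \<and> B \<in> sets borel}.
    (A - A') \<union> (A' - A) \<in> null_sets M"
  using assms unfolding sets_F
proof (induction rule: sigma_sets.induct)
  case (Basic a)
  then show ?case
  proof
    assume "a \<in> null_sets M" then show ?thesis by (intro bexI[of _ "{}"]) (auto intro: sigma_sets.Empty)
  qed (intro bexI[of _ a], auto)
next
  case Empty then show ?case by (intro bexI[of _ "{}"]) (auto intro: sigma_sets.Empty)
next
  case (Compl a)
  then obtain A' where A': "A' \<in> sigma_sets (space M) {W u -` B \<inter> space M |u B. 0 \<le> u \<and> u \<le> s \<and> B \<in> sets borel}"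
    "(a - A') \<union> (A' - a) \<in> null_sets M" by auto
  have "(space M - a - (space M - A')) \<union> ((space M - A') - (space M - a)) \<in> null_sets M"
    by (rule complete2[OF _ A'(2)]) auto
  with sigma_sets.Compl[OF A'(1)] show ?case by blast
next
  case (Union a)
  define G where "G = sigma_sets (space M) {W u -` B \<inter> space M |u B. 0 \<le> u \<and> u \<le> s \<and> B \<in> sets borel}"
  from Union have "\<forall>i. \<exists>A'. A' \<in> G \<and> (a i - A') \<union> (A' - a i) \<in> null_sets M"
    unfolding G_def by blast
  then obtain A' where A': "\<And>i. A' i \<in> G" "\<And>i. (a i - A' i) \<union> (A' i - a i) \<in> null_sets M"
    by (auto dest!: choice)
  have "(\<Union>i. (a i - A' i) \<union> (A' i - a i)) \<in> null_sets M" by (intro null_sets_UN A')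
  then have "((\<Union>i. a i) - (\<Union>i. A' i)) \<union> ((\<Union>i. A' i) - (\<Union>i. a i)) \<in> null_sets M"
    by (rule complete2[rotated]) auto
  moreover have "(\<Union>i. A' i) \<in> G"
    using A'(1) unfolding G_def by (rule sigma_sets.Union)
  ultimately show ?case unfolding G_def by blast
qed

lemma increment_indep:
  assumes st: "0 \<le> s" "s < t" and A: "A \<in> sets (F s)" and B: "B \<in> sets borel"
  shows "prob (A \<inter> ((\<lambda>\<omega>. W t \<omega> - W s \<omega>) -` B \<inter> space M)) = prob A * prob ((\<lambda>\<omega>. W t \<omega> - W s \<omega>) -` B \<inter> space M)"
proof -
  define C where "C = (\<lambda>\<omega>. W t \<omega> - W s \<omega>) -` B \<inter> space M"
  obtain A' where A': "A' \<in> sigma_sets (space M) {W u -` B \<inter> space M |u B. 0 \<le> u \<and> u \<le> s \<and> B \<in> sets borel}"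
    and N: "(A - A') \<union> (A' - A) \<in> null_sets M"
    using augmented_approx[OF A] by auto
  have [measurable]: "A \<in> sets M" using A sets_F_subset by auto
  have [measurable]: "A' \<in> sets M"
    by (rule subsetD[OF sets.sigma_sets_subset A']) (auto intro: measurable_sets[OF W_measurable])
  have [measurable]: "W t \<in> borel_measurable M" "W s \<in> borel_measurable M" using st by (auto intro: W_measurable)
  have [measurable]: "C \<in> sets M" unfolding C_def using B by measurable
  have ae: "AE \<omega> in M. \<omega> \<in> A \<longleftrightarrow> \<omega> \<in> A'"
    using AE_not_in[OF N] by eventually_elim auto
  have "prob (A \<inter> C) = prob (A' \<inter> C)" "prob A = prob A'"
    using ae by (auto intro!: finite_measure_eq_AE elim: eventually_mono)
  moreover have "prob (A' \<inter> C) = prob A' * prob C"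
    by (rule indep_setD[OF W_indep[OF st] A']) (use B in \<open>auto simp: C_def\<close>)
  ultimately show ?thesis by (simp add: C_def)
qed

text \<open>The past may be frozen while the increment is integrated out: by
  \<open>increment_indep\<close> the joint law of \<open>Y\<close> and the increment agrees with the
  product law on rectangles, hence everywhere, and Tonelli applies.\<close>

lemma nn_integral_increment_W:
  assumes st: "0 \<le> s" "s < t" and Y: "Y \<in> measurable (F s) N"
    and h[measurable]: "h \<in> borel_measurable (N \<Otimes>\<^sub>M borel)"
  shows "(\<integral>\<^sup>+\<omega>. h (Y \<omega>, W t \<omega> - W s \<omega>) \<partial>M) = (\<integral>\<^sup>+\<omega>. (\<integral>\<^sup>+z. h (Y \<omega>, z) \<partial>gauss (t - s)) \<partial>M)"
proof -
  define dW where "dW \<omega> = W t \<omega> - W s \<omega>" for \<omega>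
  note [measurable] = measurable_F_M[OF Y]
  have [measurable]: "W t \<in> borel_measurable M" "W s \<in> borel_measurable M" using st by (auto intro: W_measurable)
  have [measurable]: "dW \<in> borel_measurable M" unfolding dW_def by measurable
  have "distr M lborel dW = density lborel (\<lambda>z. ennreal (normal_density 0 (sqrt (t - s)) z))"
    using W_normal[OF st] by (simp add: distributed_def dW_def[abs_def])
  also have "distr M lborel dW = distr M borel dW" by (rule distr_cong) auto
  finally have dg: "distr M borel dW = gauss (t - s)" by (simp add: gauss_def)
  interpret g: prob_space "gauss (t - s)" using st by (intro prob_space_gauss) simp
  interpret Y: prob_space "distr M N Y" by (rule prob_space_distr) simp
  have eq: "distr M N Y \<Otimes>\<^sub>M gauss (t - s) = distr M (N \<Otimes>\<^sub>M borel) (\<lambda>\<omega>. (Y \<omega>, dW \<omega>))"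
  proof (rule pair_measure_eqI)
    show "sigma_finite_measure (distr M N Y)" "sigma_finite_measure (gauss (t - s))" by unfold_locales
    show "sets (distr M N Y \<Otimes>\<^sub>M gauss (t - s)) = sets (distr M (N \<Otimes>\<^sub>M borel) (\<lambda>\<omega>. (Y \<omega>, dW \<omega>)))"
      by (simp cong: sets_pair_measure_cong)
    fix A B assume A: "A \<in> sets (distr M N Y)" and B: "B \<in> sets (gauss (t - s))"
    have AF: "Y -` A \<inter> space M \<in> sets (F s)" using measurable_sets[OF Y, of A] A by simp
    have "emeasure (distr M N Y) A * emeasure (gauss (t - s)) B
        = ennreal (prob (Y -` A \<inter> space M) * prob (dW -` B \<inter> space M))"
      unfolding dg[symmetric] using A B by (simp add: emeasure_distr emeasure_eq_measure ennreal_mult)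
    also have "\<dots> = ennreal (prob ((Y -` A \<inter> space M) \<inter> (dW -` B \<inter> space M)))"
      using increment_indep[OF st AF, of B] B by (simp add: dW_def[abs_def])
    also have "(Y -` A \<inter> space M) \<inter> (dW -` B \<inter> space M) = (\<lambda>\<omega>. (Y \<omega>, dW \<omega>)) -` (A \<times> B) \<inter> space M" by auto
    finally show "emeasure (distr M N Y) A * emeasure (gauss (t - s)) B = emeasure (distr M (N \<Otimes>\<^sub>M borel) (\<lambda>\<omega>. (Y \<omega>, dW \<omega>))) (A \<times> B)"
      using A B by (simp add: emeasure_distr emeasure_eq_measure)
  qed
  have "(\<integral>\<^sup>+\<omega>. h (Y \<omega>, dW \<omega>) \<partial>M) = (\<integral>\<^sup>+p. h p \<partial>distr M (N \<Otimes>\<^sub>M borel) (\<lambda>\<omega>. (Y \<omega>, dW \<omega>)))"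
    by (subst nn_integral_distr) auto
  also have "\<dots> = (\<integral>\<^sup>+y. (\<integral>\<^sup>+z. h (y, z) \<partial>gauss (t - s)) \<partial>distr M N Y)"
    unfolding eq[symmetric]
    by (rule g.nn_integral_fst[symmetric]) (simp cong: measurable_cong_sets sets_pair_measure_cong)
  also have "\<dots> = (\<integral>\<^sup>+\<omega>. (\<integral>\<^sup>+z. h (Y \<omega>, z) \<partial>gauss (t - s)) \<partial>M)"
    by (rule nn_integral_distr) auto
  finally show ?thesis by (simp add: dW_def)
qed

lemma nn_integral_increment:
  assumes st: "0 \<le> s" "s < t" and Y: "Y \<in> measurable (F s) N"
    and h: "h \<in> borel_measurable (N \<Otimes>\<^sub>M borel)"
  shows "(\<integral>\<^sup>+\<omega>. h (Y \<omega>, Wc t \<omega> - Wc s \<omega>) \<partial>M) = (\<integral>\<^sup>+\<omega>. (\<integral>\<^sup>+z. h (Y \<omega>, z) \<partial>gauss (t - s)) \<partial>M)"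
  unfolding nn_integral_increment_W[OF assms, symmetric]
  by (rule nn_integral_cong_AE) (use AE_Wc in \<open>eventually_elim, simp\<close>)

text \<open>The exponential martingale, tested against nonnegative variables known at time
  \<open>s\<close>; conditional expectations are thereby avoided.\<close>

lemma nn_integral_exp_increment:
  assumes st: "0 \<le> s" "s \<le> t" and Y[measurable]: "Y \<in> borel_measurable (F s)"
  shows "(\<integral>\<^sup>+\<omega>. Y \<omega> * ennreal (exp (\<theta> * (Wc t \<omega> - Wc s \<omega>))) \<partial>M) = ennreal (exp (\<theta>\<^sup>2 * (t - s) / 2)) * (\<integral>\<^sup>+\<omega>. Y \<omega> \<partial>M)"
proof (cases "s = t")
  case False
  have "(\<integral>\<^sup>+\<omega>. Y \<omega> * ennreal (exp (\<theta> * (Wc t \<omega> - Wc s \<omega>))) \<partial>M)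
    = (\<integral>\<^sup>+\<omega>. (\<integral>\<^sup>+z. Y \<omega> * ennreal (exp (\<theta> * z)) \<partial>gauss (t - s)) \<partial>M)"
    using nn_integral_increment[of s t Y borel "\<lambda>p. fst p * ennreal (exp (\<theta> * snd p))"] st Y False by simp
  also have "\<dots> = (\<integral>\<^sup>+\<omega>. ennreal (exp (\<theta>\<^sup>2 * (t - s) / 2)) * Y \<omega> \<partial>M)"
    using st False
    by (subst nn_integral_cmult) (auto simp: nn_integral_exp_gauss mult.commute[of "Y _"])
  also have "\<dots> = ennreal (exp (\<theta>\<^sup>2 * (t - s) / 2)) * (\<integral>\<^sup>+\<omega>. Y \<omega> \<partial>M)"
    by (rule nn_integral_cmult) (rule measurable_F_M[OF Y])
  finally show ?thesis .
qed simp

lemma nn_integral_exp_increment':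
  assumes "0 \<le> s" "s \<le> t"
  shows "(\<integral>\<^sup>+\<omega>. ennreal (exp (\<theta> * (Wc t \<omega> - Wc s \<omega>))) \<partial>M) = ennreal (exp (\<theta>\<^sup>2 * (t - s) / 2))"
  using nn_integral_exp_increment[OF assms, of "\<lambda>_. 1" \<theta>] by (simp add: emeasure_space_1)

text \<open>Doob's inequality for the submartingale of exponentials at the grid points. The exponent
  on the right comes from the second moment of the last of them, that is from doubling
  \<theta>.\<close>

lemma doob_grid:
  assumes s: "0 \<le> s" and h: "0 \<le> h"
  shows "(\<integral>\<^sup>+\<omega>. ennreal ((Max ((\<lambda>i. exp (\<theta> * (Wc (s + real i * h) \<omega> - Wc s \<omega>))) ` {..n}))\<^sup>2) \<partial>M)
    \<le> 4 * ennreal (exp (2 * \<theta>\<^sup>2 * (real n * h)))"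
proof -
  define Y where "Y i \<omega> = exp (\<theta> * (Wc (s + real i * h) \<omega> - Wc s \<omega>))" for i :: nat and \<omega>
  have YF: "Y i \<in> borel_measurable (F (s + real k * h))" if "i \<le> k" for i k
  proof -
    have [measurable]: "Wc (s + real i * h) \<in> borel_measurable (F (s + real k * h))"
      "Wc s \<in> borel_measurable (F (s + real k * h))"
      using that s h by (auto intro!: Wc_F mult_right_mono)
    show ?thesis unfolding Y_def[abs_def] by measurable
  qed
  have sq: "(\<integral>\<^sup>+\<omega>. ennreal ((Y k \<omega>)\<^sup>2) \<partial>M) = ennreal (exp (2 * \<theta>\<^sup>2 * (real k * h)))" for k
  proof -
    have "(Y k \<omega>)\<^sup>2 = exp ((2 * \<theta>) * (Wc (s + real k * h) \<omega> - Wc s \<omega>))" for \<omega>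
      by (simp add: Y_def power2_eq_square flip: exp_add)
    then show ?thesis using nn_integral_exp_increment'[of s "s + real k * h" "2 * \<theta>"] s h
      by (simp add: power_mult_distrib mult.assoc)
  qed
  have "(\<integral>\<^sup>+\<omega>. ennreal ((Max ((\<lambda>i. Y i \<omega>) ` {..n}))\<^sup>2) \<partial>M) \<le> 4 * (\<integral>\<^sup>+\<omega>. ennreal ((Y n \<omega>)\<^sup>2) \<partial>M)"
  proof (rule doob_L2)
    show "Y k \<in> borel_measurable M" for k by (rule measurable_F_M[OF YF[OF order_refl]])
    show "0 \<le> Y k \<omega>" for k \<omega> by (simp add: Y_def)
    show "(\<integral>\<^sup>+\<omega>. ennreal ((Y k \<omega>)\<^sup>2) \<partial>M) < \<infinity>" for k by (simp add: sq)
    fix k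
    define V where "V \<omega> = Max ((\<lambda>i. Y i \<omega>) ` {..k}) * Y k \<omega>" for \<omega>
    have V0: "0 \<le> V \<omega>" for \<omega>
    proof -
      have Y0: "0 \<le> Y k \<omega>" by (simp add: Y_def)
      also have "Y k \<omega> \<le> Max ((\<lambda>i. Y i \<omega>) ` {..k})" by (rule Max_ge) auto
      finally show ?thesis unfolding V_def using Y0 by simp
    qed
    have [measurable]: "V \<in> borel_measurable (F (s + real k * h))"
    proof -
      have [measurable]: "Y k \<in> borel_measurable (F (s + real k * h))" by (rule YF) simp
      have "(\<lambda>\<omega>. Max ((\<lambda>i. Y i \<omega>) ` {..k})) \<in> borel_measurable (F (s + real k * h))"
        by (rule borel_measurable_Max) (auto intro: YF)
      then show ?thesis unfolding V_def[abs_def] by measurable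
    qed
    have "(\<integral>\<^sup>+\<omega>. ennreal (V \<omega>) \<partial>M) = 1 * (\<integral>\<^sup>+\<omega>. ennreal (V \<omega>) \<partial>M)" by simp
    \<comment> \<open>The mean of an exponential increment is at least 1; this is the submartingale
      property required as \<open>sub\<close>.\<close>
    also have "\<dots> \<le> ennreal (exp (\<theta>\<^sup>2 * (s + real (Suc k) * h - (s + real k * h)) / 2)) * (\<integral>\<^sup>+\<omega>. ennreal (V \<omega>) \<partial>M)"
      using h by (intro mult_right_mono) (auto simp: one_le_exp_iff algebra_simps)
    also have "\<dots> = (\<integral>\<^sup>+\<omega>. ennreal (V \<omega>) * ennreal (exp (\<theta> * (Wc (s + real (Suc k) * h) \<omega> - Wc (s + real k * h) \<omega>))) \<partial>M)"
    proof (rule nn_integral_exp_increment[symmetric])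
      show "s + real k * h \<le> s + real (Suc k) * h" using h by (simp add: algebra_simps)
      show "(\<lambda>\<omega>. ennreal (V \<omega>)) \<in> borel_measurable (F (s + real k * h))" by measurable
    qed (use s h in simp)
    also have "\<dots> = (\<integral>\<^sup>+\<omega>. ennreal (Max ((\<lambda>i. Y i \<omega>) ` {..k}) * Y (Suc k) \<omega>) \<partial>M)"
    proof (intro nn_integral_cong)
      fix \<omega>
      have "Y k \<omega> * exp (\<theta> * (Wc (s + real (Suc k) * h) \<omega> - Wc (s + real k * h) \<omega>)) = Y (Suc k) \<omega>"
        unfolding Y_def exp_add[symmetric] by (simp add: algebra_simps)
      then have "V \<omega> * exp (\<theta> * (Wc (s + real (Suc k) * h) \<omega> - Wc (s + real k * h) \<omega>)) = Max ((\<lambda>i. Y i \<omega>) ` {..k}) * Y (Suc k) \<omega>"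
        by (simp add: V_def mult.assoc)
      then show "ennreal (V \<omega>) * ennreal (exp (\<theta> * (Wc (s + real (Suc k) * h) \<omega> - Wc (s + real k * h) \<omega>)))
         = ennreal (Max ((\<lambda>i. Y i \<omega>) ` {..k}) * Y (Suc k) \<omega>)"
        using V0[of \<omega>] by (simp add: ennreal_mult[symmetric])
    qed
    finally show "(\<integral>\<^sup>+\<omega>. ennreal (Max ((\<lambda>i. Y i \<omega>) ` {..k}) * Y k \<omega>) \<partial>M)
      \<le> (\<integral>\<^sup>+\<omega>. ennreal (Max ((\<lambda>i. Y i \<omega>) ` {..k}) * Y (Suc k) \<omega>) \<partial>M)"
      by (simp add: V_def)
  qed
  then show ?thesis unfolding sq by (simp add: Y_def)
qed

definition Wsup :: "real \<Rightarrow> real \<Rightarrow> 'w \<Rightarrow> real" where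
  "Wsup s T \<omega> = runmax (\<lambda>u. \<bar>Wc (s + u) \<omega> - Wc s \<omega>\<bar>) T"

lemma Wc_shift_cont: "0 \<le> s \<Longrightarrow> continuous_on {0..} (\<lambda>u. Wc (s + u) \<omega>)"
  by (rule continuous_on_compose2[OF Wc_cont]) (auto intro!: continuous_intros)

lemma Wsup_F:
  assumes "0 \<le> s" "0 \<le> T"
  shows "Wsup s T \<in> borel_measurable (F (s + T))"
  unfolding Wsup_def[abs_def]
proof (rule runmax_measurable)
  have c: "continuous_on {0..} (\<lambda>u. \<bar>Wc (s + u) \<omega> - Wc s \<omega>\<bar>)" for \<omega>
    by (intro continuous_intros Wc_shift_cont assms)
  then show "bdd_above ((\<lambda>u. \<bar>Wc (s + u) \<omega> - Wc s \<omega>\<bar>) ` {0..T})" for \<omega>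
    by (rule bdd_above_continuous_image)
  show "continuous (at_right u) (\<lambda>u. \<bar>Wc (s + u) \<omega> - Wc s \<omega>\<bar>)" if "0 \<le> u" for u \<omega>
    using c[of \<omega>] that unfolding continuous_on_eq_continuous_within
    by (auto intro: continuous_within_subset)
  show "(\<lambda>\<omega>. \<bar>Wc (s + u) \<omega> - Wc s \<omega>\<bar>) \<in> borel_measurable (F (s + T))" if "0 \<le> u" "u \<le> T" for u
  proof -
    have [measurable]: "Wc (s + u) \<in> borel_measurable (F (s + T))" "Wc s \<in> borel_measurable (F (s + T))"
      using that assms by (auto intro!: Wc_F)
    show ?thesis by measurable
  qed
qed (use assms in auto)

lemma Wsup_M: "0 \<le> s \<Longrightarrow> 0 \<le> T \<Longrightarrow> Wsup s T \<in> borel_measurable M"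
  using Wsup_F measurable_F_M by blast

lemma Wsup_upper: "0 \<le> s \<Longrightarrow> 0 \<le> u \<Longrightarrow> u \<le> T \<Longrightarrow> \<bar>Wc (s + u) \<omega> - Wc s \<omega>\<bar> \<le> Wsup s T \<omega>"
  unfolding Wsup_def
  by (rule runmax_upper[of "\<lambda>u. \<bar>Wc (s + u) \<omega> - Wc s \<omega>\<bar>"])
     (auto intro!: bdd_above_continuous_image continuous_intros Wc_shift_cont)

lemma floor_grid_tendsto:
  fixes u T :: real
  assumes "0 \<le> u" "u \<le> T" "0 < T"
  shows "(\<lambda>n. real (nat \<lfloor>u / T * real n\<rfloor>) * (T / real n)) \<longlonglongrightarrow> u"
    and "nat \<lfloor>u / T * real n\<rfloor> \<le> n"
proof -
  have r: "real (nat \<lfloor>u / T * real n\<rfloor>) = real_of_int \<lfloor>u / T * real n\<rfloor>" for n :: nat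
    using assms by simp
  show "(\<lambda>n. real (nat \<lfloor>u / T * real n\<rfloor>) * (T / real n)) \<longlonglongrightarrow> u"
  proof (rule real_tendsto_sandwich[where f = "\<lambda>n. u - T / real n" and h = "\<lambda>_. u"])
    show "\<forall>\<^sub>F n in sequentially. u - T / real n \<le> real (nat \<lfloor>u / T * real n\<rfloor>) * (T / real n)"
      using eventually_gt_at_top[of 0]
    proof eventually_elim
      case (elim n)
      have "(u / T * real n - 1) * (T / real n) \<le> real (nat \<lfloor>u / T * real n\<rfloor>) * (T / real n)"
        unfolding r
      proof (rule mult_right_mono)
        show "u / T * real n - 1 \<le> real_of_int \<lfloor>u / T * real n\<rfloor>" by linarith
        show "0 \<le> T / real n" using assms by simp
      qed
      moreover have "(u / T * real n - 1) * (T / real n) = u - T / real n"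
        using elim assms by (simp add: field_simps)
      ultimately show ?case by simp
    qed
    show "\<forall>\<^sub>F n in sequentially. real (nat \<lfloor>u / T * real n\<rfloor>) * (T / real n) \<le> u"
      using eventually_gt_at_top[of 0]
    proof eventually_elim
      case (elim n)
      have "real (nat \<lfloor>u / T * real n\<rfloor>) * (T / real n) \<le> (u / T * real n) * (T / real n)"
        unfolding r
      proof (rule mult_right_mono)
        show "real_of_int \<lfloor>u / T * real n\<rfloor> \<le> u / T * real n" by simp
        show "0 \<le> T / real n" using assms by simp
      qed
      then show ?case using elim assms by simp
    qed
    show "(\<lambda>n. u - T / real n) \<longlonglongrightarrow> u"
      using tendsto_diff[OF tendsto_const lim_const_over_n[of T], of u] by simp
  qed simp
  have "u / T * real n \<le> 1 * real n" using assms by (intro mult_right_mono) auto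
  then show "nat \<lfloor>u / T * real n\<rfloor> \<le> n" by (simp add: nat_le_iff floor_le_iff)
qed

text \<open>The maximum over \<open>[0, T]\<close> is attained at some \<open>u\<close>, which is a
  limit of grid points; so the squared maximum is at most the lower limit of the squared grid
  maxima, and Fatou's lemma carries the uniform bound over.\<close>

lemma doob_continuous:
  assumes s: "0 \<le> s" and T: "0 < T"
  shows "(\<integral>\<^sup>+\<omega>. ennreal ((runmax (\<lambda>u. exp (\<theta> * (Wc (s + u) \<omega> - Wc s \<omega>))) T)\<^sup>2) \<partial>M)
    \<le> 4 * ennreal (exp (2 * \<theta>\<^sup>2 * T))"
proof -
  define f where "f = (\<lambda>\<omega> u. exp (\<theta> * (Wc (s + u) \<omega> - Wc s \<omega>)))"
  define Mn where "Mn n \<omega> = Max ((\<lambda>i. f \<omega> (real i * (T / real n))) ` {..n})" for n :: nat and \<omega>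
  have fc: "continuous_on {0..} (f \<omega>)" for \<omega>
    unfolding f_def by (intro continuous_intros Wc_shift_cont s)
  have fm[measurable]: "(\<lambda>\<omega>. f \<omega> u) \<in> borel_measurable M" if "0 \<le> u" for u
  proof -
    have [measurable]: "Wc (s + u) \<in> borel_measurable M" "Wc s \<in> borel_measurable M" using that s by auto
    show ?thesis unfolding f_def by measurable
  qed
  have Mn_m[measurable]: "Mn n \<in> borel_measurable M" for n
    unfolding Mn_def by (rule borel_measurable_Max) (use T in \<open>auto intro!: fm\<close>)
  have "(\<integral>\<^sup>+\<omega>. ennreal ((runmax (f \<omega>) T)\<^sup>2) \<partial>M) \<le> (\<integral>\<^sup>+\<omega>. liminf (\<lambda>n. ennreal ((Mn n \<omega>)\<^sup>2)) \<partial>M)"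
  proof (intro nn_integral_mono)
    fix \<omega>
    obtain u where u: "0 \<le> u" "u \<le> T" "runmax (f \<omega>) T = f \<omega> u"
      using runmax_attained[OF fc, of T \<omega>] T by auto
    define v where "v n = real (nat \<lfloor>u / T * real n\<rfloor>) * (T / real n)" for n :: nat
    have v: "v \<longlonglongrightarrow> u" unfolding v_def by (rule floor_grid_tendsto(1)[OF u(1,2) T])
    have v0: "0 \<le> v n" for n unfolding v_def using T by simp
    have "(\<lambda>n. f \<omega> (v n)) \<longlonglongrightarrow> f \<omega> u"
      by (rule continuous_on_tendsto_compose[OF fc v]) (use u v0 in auto)
    then have "(\<lambda>n. ennreal ((f \<omega> (v n))\<^sup>2)) \<longlonglongrightarrow> ennreal ((f \<omega> u)\<^sup>2)"
      by (intro tendsto_intros)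
    then have "ennreal ((f \<omega> u)\<^sup>2) = liminf (\<lambda>n. ennreal ((f \<omega> (v n))\<^sup>2))"
      by (rule lim_imp_Liminf[symmetric, rotated]) simp
    also have "\<dots> \<le> liminf (\<lambda>n. ennreal ((Mn n \<omega>)\<^sup>2))"
    proof (intro Liminf_mono always_eventually allI ennreal_leI power_mono)
      fix n show "f \<omega> (v n) \<le> Mn n \<omega>"
        unfolding Mn_def v_def using floor_grid_tendsto(2)[OF u(1,2) T, of n] by (intro Max_ge) auto
      show "0 \<le> f \<omega> (v n)" by (simp add: f_def)
    qed
    finally show "ennreal ((runmax (f \<omega>) T)\<^sup>2) \<le> liminf (\<lambda>n. ennreal ((Mn n \<omega>)\<^sup>2))" by (simp add: u)
  qed
  also have "\<dots> \<le> liminf (\<lambda>n. \<integral>\<^sup>+\<omega>. ennreal ((Mn n \<omega>)\<^sup>2) \<partial>M)"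
    by (rule nn_integral_liminf) measurable
  also have "\<dots> \<le> liminf (\<lambda>n::nat. 4 * ennreal (exp (2 * \<theta>\<^sup>2 * T)))"
  proof (rule Liminf_mono)
    show "\<forall>\<^sub>F n in sequentially. (\<integral>\<^sup>+\<omega>. ennreal ((Mn n \<omega>)\<^sup>2) \<partial>M) \<le> 4 * ennreal (exp (2 * \<theta>\<^sup>2 * T))"
      using eventually_gt_at_top[of 0]
    proof eventually_elim
      case (elim n)
      show ?case using doob_grid[OF s, of "T / real n" \<theta> n] T elim by (simp add: Mn_def f_def)
    qed
  qed
  also have "\<dots> = 4 * ennreal (exp (2 * \<theta>\<^sup>2 * T))" by (simp add: Liminf_const)
  finally show ?thesis by (simp add: f_def)
qed

text \<open>The absolute value is handled by the two signs: \<open>exp (c * Wsup)\<close> is at most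
  the sum of the squared maxima for the parameters \<open>c / 2\<close> and \<open>- c / 2\<close>.
  Each contributes the factor 4 of Doob's inequality, together 8.\<close>

lemma exp_Wsup:
  assumes s: "0 \<le> s" and T: "0 < T" and c: "0 \<le> c"
  shows "(\<integral>\<^sup>+\<omega>. ennreal (exp (c * Wsup s T \<omega>)) \<partial>M) \<le> ennreal (8 * exp (c\<^sup>2 * T / 2))"
proof -
  define R where "R \<theta> \<omega> = runmax (\<lambda>u. exp (\<theta> * (Wc (s + u) \<omega> - Wc s \<omega>))) T" for \<theta> \<omega>
  have fc: "continuous_on {0..} (\<lambda>u. exp (\<theta> * (Wc (s + u) \<omega> - Wc s \<omega>)))" for \<omega> \<theta>
    by (intro continuous_intros Wc_shift_cont s)
  have Rm[measurable]: "R \<theta> \<in> borel_measurable M" for \<theta>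
    unfolding R_def[abs_def]
  proof (rule runmax_measurable)
    show "continuous (at_right u) (\<lambda>u. exp (\<theta> * (Wc (s + u) \<omega> - Wc s \<omega>)))" if "0 \<le> u" for u \<omega>
      using fc[of \<theta> \<omega>] that unfolding continuous_on_eq_continuous_within
      by (auto intro: continuous_within_subset)
    show "(\<lambda>\<omega>. exp (\<theta> * (Wc (s + u) \<omega> - Wc s \<omega>))) \<in> borel_measurable M" if "0 \<le> u" for u
    proof -
      have [measurable]: "Wc (s + u) \<in> borel_measurable M" "Wc s \<in> borel_measurable M" using that s by auto
      show ?thesis by measurable
    qed
  qed (use T fc in \<open>auto intro!: bdd_above_continuous_image\<close>)
  have "(\<integral>\<^sup>+\<omega>. ennreal (exp (c * Wsup s T \<omega>)) \<partial>M) \<le> (\<integral>\<^sup>+\<omega>. ennreal ((R (c / 2) \<omega>)\<^sup>2) + ennreal ((R (- c / 2) \<omega>)\<^sup>2) \<partial>M)"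
  proof (intro nn_integral_mono)
    fix \<omega>
    obtain u where u: "0 \<le> u" "u \<le> T" "Wsup s T \<omega> = \<bar>Wc (s + u) \<omega> - Wc s \<omega>\<bar>"
      unfolding Wsup_def
      by (rule runmax_attained[of "\<lambda>u. \<bar>Wc (s + u) \<omega> - Wc s \<omega>\<bar>" T])
         (use T s in \<open>auto intro!: continuous_intros Wc_shift_cont\<close>)
    have R: "exp (\<theta> * (Wc (s + u) \<omega> - Wc s \<omega>)) \<le> R \<theta> \<omega>" for \<theta>
      unfolding R_def
      by (rule runmax_upper[of "\<lambda>u. exp (\<theta> * (Wc (s + u) \<omega> - Wc s \<omega>))"])
         (use u fc in \<open>auto intro!: bdd_above_continuous_image\<close>)
    have R2: "exp (2 * \<theta> * (Wc (s + u) \<omega> - Wc s \<omega>)) \<le> (R \<theta> \<omega>)\<^sup>2" for \<theta>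
    proof -
      have "exp (2 * \<theta> * (Wc (s + u) \<omega> - Wc s \<omega>)) = (exp (\<theta> * (Wc (s + u) \<omega> - Wc s \<omega>)))\<^sup>2"
        by (simp add: power2_eq_square flip: exp_add)
      also have "\<dots> \<le> (R \<theta> \<omega>)\<^sup>2" by (intro power_mono R) simp
      finally show ?thesis .
    qed
    have "exp (c * Wsup s T \<omega>) \<le> (R (c / 2) \<omega>)\<^sup>2 + (R (- c / 2) \<omega>)\<^sup>2"
    proof (cases "0 \<le> Wc (s + u) \<omega> - Wc s \<omega>")
      case True
      then show ?thesis using R2[of "c / 2"] u by (simp add: add_increasing2)
    next
      case False
      then have "Wsup s T \<omega> = - (Wc (s + u) \<omega> - Wc s \<omega>)" using u by simp
      then have "c * Wsup s T \<omega> = c * - (Wc (s + u) \<omega> - Wc s \<omega>)" by (simp only:)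
      also have "\<dots> = 2 * (- c / 2) * (Wc (s + u) \<omega> - Wc s \<omega>)" by (simp add: algebra_simps)
      finally have "c * Wsup s T \<omega> = 2 * (- c / 2) * (Wc (s + u) \<omega> - Wc s \<omega>)" .
      then have "exp (c * Wsup s T \<omega>) \<le> (R (- c / 2) \<omega>)\<^sup>2" using R2[of "- c / 2"] by (simp only:)
      then show ?thesis by (rule add_increasing[rotated]) simp
    qed
    then show "ennreal (exp (c * Wsup s T \<omega>)) \<le> ennreal ((R (c / 2) \<omega>)\<^sup>2) + ennreal ((R (- c / 2) \<omega>)\<^sup>2)"
      by (rule order_trans[OF ennreal_leI ennreal_add_le])
  qed
  also have "\<dots> = (\<integral>\<^sup>+\<omega>. ennreal ((R (c / 2) \<omega>)\<^sup>2) \<partial>M) + (\<integral>\<^sup>+\<omega>. ennreal ((R (- c / 2) \<omega>)\<^sup>2) \<partial>M)"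
    by (rule nn_integral_add) measurable
  also have "\<dots> \<le> 4 * ennreal (exp (2 * (c / 2)\<^sup>2 * T)) + 4 * ennreal (exp (2 * (- c / 2)\<^sup>2 * T))"
    unfolding R_def by (intro add_mono doob_continuous s T)
  also have "\<dots> = ennreal (8 * exp (c\<^sup>2 * T / 2))"
  proof -
    have "2 * (c / 2)\<^sup>2 * T = c\<^sup>2 * T / 2" "2 * (- c / 2)\<^sup>2 * T = c\<^sup>2 * T / 2" by (auto simp: power2_eq_square)
    then have "4 * ennreal (exp (2 * (c / 2)\<^sup>2 * T)) + 4 * ennreal (exp (2 * (- c / 2)\<^sup>2 * T)) = (4 + 4) * ennreal (exp (c\<^sup>2 * T / 2))"
      by (simp only: distrib_right)
    then show ?thesis by (simp add: ennreal_mult)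
  qed
  finally show ?thesis .
qed

lemma exp_Wsup':
  assumes s: "0 \<le> s" and T: "0 \<le> T" and c: "0 \<le> c"
  shows "(\<integral>\<^sup>+\<omega>. ennreal (exp (c * Wsup s T \<omega>)) \<partial>M) \<le> ennreal (8 * exp (c\<^sup>2 * T / 2))"
proof (cases "T = 0")
  case True
  then show ?thesis by (simp add: Wsup_def runmax_def emeasure_space_1)
next
  case False
  then show ?thesis using exp_Wsup[OF s _ c] T by simp
qed

lemma controls_path:
  assumes v: "v \<in> controls" and \<omega>: "\<omega> \<in> space M"
  shows "control_path (path v \<omega>)"
proof
  have m: "mono_on {0..} (\<lambda>t. v t \<omega>)" and c: "cadlag (\<lambda>t. v t \<omega>)" and nn: "\<And>t. 0 \<le> t \<Longrightarrow> 0 \<le> v t \<omega>"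
    using v \<omega> by (auto simp: controls_def)
  show "mono (path v \<omega>)"
    by (rule monoI) (use mono_onD[OF m] nn in \<open>auto simp: path_def\<close>)
  show "path v \<omega> t = 0" if "t < 0" for t using that by (simp add: path_def)
  show "continuous (at_right t) (path v \<omega>)" for t
  proof (cases "t < 0")
    case True
    then have "\<forall>\<^sub>F s in at_right t. path v \<omega> s = 0"
      unfolding eventually_at_right[OF True] by (auto simp: path_def)
    then show ?thesis using True unfolding continuous_within by (simp add: path_def tendsto_eventually)
  next
    case False
    then have "((\<lambda>s. v s \<omega>) \<longlongrightarrow> v t \<omega>) (at_right t)"
      using c by (auto simp: cadlag_def continuous_within)
    moreover have "\<forall>\<^sub>F s in at_right t. v s \<omega> = path v \<omega> s"
      using False unfolding eventually_at_filter by (intro always_eventually) (auto simp: path_def)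
    ultimately show ?thesis
      using False unfolding continuous_within by (auto simp: path_def intro: Lim_transform_eventually)
  qed
qed

end

section \<open>The reflected process\<close>

lemma continuous_on_right:
  fixes f :: "real \<Rightarrow> real"
  shows "continuous_on {0..} f \<Longrightarrow> 0 \<le> t \<Longrightarrow> continuous (at_right t) f"
  unfolding continuous_on_eq_continuous_within by (auto intro: continuous_within_subset)

lemma continuous_on_left:
  fixes f :: "real \<Rightarrow> real"
  assumes "continuous_on {0..} f" "0 < t"
  shows "(f \<longlongrightarrow> f t) (at_left t)"
proof -
  have "isCont f t" using assms by (intro continuous_on_interior[of "{0..}"]) auto
  then show ?thesis by (simp add: isCont_def filterlim_at_split)
qed

text \<open>The parameter \<open>y\<close> is the state just after the initial jump of the policy;
  it is later taken to be \<open>max x a\<close>.\<close>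

locale reflected = debt_model +
  fixes a y :: real
  assumes a_pos: "0 < a" and a_le_y: "a \<le> y"
begin

lemma y_pos: "0 < y" using a_pos a_le_y by simp

text \<open>
  In logarithmic coordinates the barrier is hit when \<open>gap\<close> becomes positive, and Skorokhod's
  reflection is the running maximum \<open>xi0\<close>. The state factors as \<open>X0 = exp B * Z0\<close>; \<open>K\<close> bounds
  \<open>B\<close> and \<open>xi0\<close> on \<open>[0, T]\<close> and has exponential moments of all orders.
\<close>

definition B :: "real \<Rightarrow> 'a \<Rightarrow> real" where
  "B t \<omega> = (r - g - \<sigma>\<^sup>2 / 2) * t + \<sigma> * Wc t \<omega>"

definition gap :: "'a \<Rightarrow> real \<Rightarrow> real" where
  "gap \<omega> s = max 0 (ln (a / y) - B s \<omega>)"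

definition xi0 :: "real \<Rightarrow> 'a \<Rightarrow> real" where
  "xi0 t \<omega> = runmax (gap \<omega>) t"

definition Z0 :: "real \<Rightarrow> 'a \<Rightarrow> real" where
  "Z0 t \<omega> = y * exp (xi0 t \<omega>)"

definition X0 :: "real \<Rightarrow> 'a \<Rightarrow> real" where
  "X0 t \<omega> = exp (B t \<omega>) * Z0 t \<omega>"

definition K :: "real \<Rightarrow> 'a \<Rightarrow> real" where
  "K T \<omega> = \<bar>r - g - \<sigma>\<^sup>2 / 2\<bar> * T + \<sigma> * Wsup 0 T \<omega>"

lemma B_cont: "continuous_on {0..} (\<lambda>t. B t \<omega>)"
  unfolding B_def by (intro continuous_intros Wc_cont)

lemma B_0[simp]: "B 0 \<omega> = 0" by (simp add: B_def)

lemma B_F: "0 \<le> u \<Longrightarrow> u \<le> t \<Longrightarrow> B u \<in> borel_measurable (F t)"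
proof -
  assume "0 \<le> u" "u \<le> t"
  note [measurable] = Wc_F[OF this]
  show ?thesis unfolding B_def[abs_def] by measurable
qed

lemma gap_cont: "continuous_on {0..} (gap \<omega>)"
  unfolding gap_def by (intro continuous_intros B_cont)

lemma ln_le: "ln (a / y) \<le> 0"
  using a_pos a_le_y y_pos by simp

lemma gap_0: "gap \<omega> 0 = 0" using ln_le by (simp add: gap_def)

lemma xi0_cont: "continuous_on {0..} (\<lambda>t. xi0 t \<omega>)"
  unfolding xi0_def by (rule runmax_continuous_on[OF gap_cont])

lemma xi0_0[simp]: "xi0 0 \<omega> = 0"
  by (simp add: xi0_def runmax_def gap_0)

lemma xi0_mono: "0 \<le> s \<Longrightarrow> s \<le> t \<Longrightarrow> xi0 s \<omega> \<le> xi0 t \<omega>"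
  unfolding xi0_def by (rule runmax_mono[OF bdd_above_continuous_image[OF gap_cont]])

lemma xi0_nonneg: "0 \<le> t \<Longrightarrow> 0 \<le> xi0 t \<omega>"
  using xi0_mono[of 0 t \<omega>] by simp

lemma gap_le_xi0: "0 \<le> s \<Longrightarrow> s \<le> t \<Longrightarrow> gap \<omega> s \<le> xi0 t \<omega>"
  unfolding xi0_def by (rule runmax_upper[OF bdd_above_continuous_image[OF gap_cont]])

lemma xi0_F: assumes "0 \<le> t" shows "xi0 t \<in> borel_measurable (F t)"
  unfolding xi0_def[abs_def]
proof (rule runmax_measurable[OF _ assms])
  show "bdd_above (gap \<omega> ` {0..t})" for \<omega> by (rule bdd_above_continuous_image[OF gap_cont])
  show "continuous (at_right s) (gap \<omega>)" if "0 \<le> s" for s \<omega> by (rule continuous_on_right[OF gap_cont that])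
  show "(\<lambda>\<omega>. gap \<omega> s) \<in> borel_measurable (F t)" if "0 \<le> s" "s \<le> t" for s
  proof -
    note [measurable] = B_F[OF that]
    show ?thesis unfolding gap_def by measurable
  qed
qed

lemma xi0_controls: "xi0 \<in> controls"
  unfolding controls_def mem_Collect_eq
proof (intro conjI allI impI ballI)
  fix \<omega> show "mono_on {0..} (\<lambda>t. xi0 t \<omega>)" by (auto intro!: mono_onI xi0_mono)
  show "cadlag (\<lambda>t. xi0 t \<omega>)"
    unfolding cadlag_def using continuous_on_right[OF xi0_cont] continuous_on_left[OF xi0_cont] by blast
qed (auto intro: xi0_F xi0_nonneg)

lemma Z0_pos: "0 < Z0 t \<omega>" by (simp add: Z0_def y_pos)

lemma X0_pos: "0 < X0 t \<omega>" by (simp add: X0_def Z0_pos)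

lemma Z0_mono: "0 \<le> s \<Longrightarrow> s \<le> t \<Longrightarrow> Z0 s \<omega> \<le> Z0 t \<omega>"
  unfolding Z0_def using y_pos by (auto intro: xi0_mono)

lemma Z0_cont: "continuous_on {0..} (\<lambda>t. Z0 t \<omega>)"
  unfolding Z0_def by (intro continuous_intros xi0_cont)

lemma X0_cont: "continuous_on {0..} (\<lambda>t. X0 t \<omega>)"
  unfolding X0_def by (intro continuous_intros Z0_cont B_cont)

lemma Z0_F: "0 \<le> t \<Longrightarrow> Z0 t \<in> borel_measurable (F t)"
  using xi0_F[of t] unfolding Z0_def[abs_def] by measurable

lemma X0_F: "0 \<le> t \<Longrightarrow> X0 t \<in> borel_measurable (F t)"
  using Z0_F[of t] B_F[of t t] unfolding X0_def[abs_def] by measurable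

lemma y_exp_gap: "y * exp (ln (a / y) - b) = a * exp (- b)"
  using a_pos y_pos by (simp add: exp_diff exp_minus field_simps)

lemma barrier_le_Z0: assumes "0 \<le> s" "s \<le> t" shows "a * exp (- B s \<omega>) \<le> Z0 t \<omega>"
proof -
  have "ln (a / y) - B s \<omega> \<le> xi0 t \<omega>" using gap_le_xi0[OF assms, of \<omega>] by (simp add: gap_def)
  then have "y * exp (ln (a / y) - B s \<omega>) \<le> Z0 t \<omega>" using y_pos by (simp add: Z0_def)
  then show ?thesis by (simp only: y_exp_gap)
qed

lemma X0_ge: "0 \<le> t \<Longrightarrow> a \<le> X0 t \<omega>"
  using barrier_le_Z0[of t t \<omega>] by (simp add: X0_def exp_minus field_simps)

text \<open>The maximum over \<open>[0, u]\<close> is attained, and not before \<open>s\<close> if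
  it has grown since then. The time \<open>v\<close> obtained is one at which the reflected state
  sits on the barrier.\<close>

lemma xi0_step:
  assumes "0 \<le> s" "s \<le> u" "xi0 u \<omega> \<noteq> xi0 s \<omega>"
  obtains v where "s < v" "v \<le> u" "xi0 u \<omega> = ln (a / y) - B v \<omega>" "xi0 v \<omega> = xi0 u \<omega>"
proof -
  obtain v where v: "0 \<le> v" "v \<le> u" "xi0 u \<omega> = gap \<omega> v"
    using runmax_attained[OF gap_cont, of u \<omega>] assms unfolding xi0_def by auto
  have less: "xi0 s \<omega> < xi0 u \<omega>" using assms xi0_mono[OF assms(1,2), of \<omega>] by simp
  have "s < v"
  proof (rule ccontr)
    assume "\<not> s < v"
    then have "gap \<omega> v \<le> xi0 s \<omega>" using v by (intro gap_le_xi0) auto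
    then show False using less v by simp
  qed
  moreover have "0 < xi0 u \<omega>" using less xi0_nonneg[OF assms(1), of \<omega>] by simp
  then have "xi0 u \<omega> = ln (a / y) - B v \<omega>" using v by (auto simp: gap_def max_def split: if_splits)
  moreover have "xi0 v \<omega> = xi0 u \<omega>"
    using gap_le_xi0[of v v \<omega>] xi0_mono[of v u \<omega>] v by simp
  ultimately show ?thesis using that v by auto
qed

lemma Z0_step:
  assumes "0 \<le> s" "s \<le> u" "Z0 u \<omega> \<noteq> Z0 s \<omega>"
  obtains v where "s < v" "v \<le> u" "Z0 u \<omega> = a * exp (- B v \<omega>)"
proof -
  have "xi0 u \<omega> \<noteq> xi0 s \<omega>" using assms by (auto simp: Z0_def)
  from xi0_step[OF assms(1,2) this] obtain v where "s < v" "v \<le> u" "xi0 u \<omega> = ln (a / y) - B v \<omega>" by auto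
  then show ?thesis using that by (simp add: Z0_def y_exp_gap)
qed

lemma abs_B_le: assumes "0 \<le> t" "t \<le> T" shows "\<bar>B t \<omega>\<bar> \<le> K T \<omega>"
proof -
  have "\<bar>B t \<omega>\<bar> \<le> \<bar>r - g - \<sigma>\<^sup>2 / 2\<bar> * t + \<sigma> * \<bar>Wc t \<omega>\<bar>"
    unfolding B_def using assms pos by (intro order_trans[OF abs_triangle_ineq]) (simp add: abs_mult)
  also have "\<dots> \<le> K T \<omega>"
    unfolding K_def using Wsup_upper[of 0 t T \<omega>] assms pos by (intro add_mono mult_left_mono) auto
  finally show ?thesis .
qed

lemma K_nonneg: "0 \<le> T \<Longrightarrow> 0 \<le> K T \<omega>"
  using abs_B_le[of 0 T \<omega>] by simp

lemma xi0_le: assumes "0 \<le> t" "t \<le> T" shows "xi0 t \<omega> \<le> K T \<omega>"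
  unfolding xi0_def
proof (rule runmax_least)
  fix s assume "0 \<le> s" "s \<le> t"
  then show "gap \<omega> s \<le> K T \<omega>"
    using abs_B_le[of s T \<omega>] assms ln_le K_nonneg[of T \<omega>] by (simp add: gap_def)
qed (use assms in simp)

lemma Z0_le: "0 \<le> t \<Longrightarrow> t \<le> T \<Longrightarrow> Z0 t \<omega> \<le> y * exp (K T \<omega>)"
  unfolding Z0_def using xi0_le[of t T \<omega>] y_pos by simp

lemma expB_le: "0 \<le> t \<Longrightarrow> t \<le> T \<Longrightarrow> exp (B t \<omega>) \<le> exp (K T \<omega>)"
  using abs_B_le[of t T \<omega>] by simp

lemma K_F: "0 \<le> T \<Longrightarrow> K T \<in> borel_measurable (F T)"
  using Wsup_F[of 0 T] unfolding K_def[abs_def] by simp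

lemma K_M: "0 \<le> T \<Longrightarrow> K T \<in> borel_measurable M"
  using K_F measurable_F_M by blast

lemma exp_K_finite:
  assumes "0 \<le> T" "0 \<le> c"
  shows "(\<integral>\<^sup>+\<omega>. ennreal (exp (c * K T \<omega>)) \<partial>M) < \<infinity>"
proof -
  have "(\<integral>\<^sup>+\<omega>. ennreal (exp (c * K T \<omega>)) \<partial>M)
    = (\<integral>\<^sup>+\<omega>. ennreal (exp (c * \<bar>r - g - \<sigma>\<^sup>2 / 2\<bar> * T)) * ennreal (exp (c * \<sigma> * Wsup 0 T \<omega>)) \<partial>M)"
    by (intro nn_integral_cong) (simp add: K_def algebra_simps exp_add ennreal_mult[symmetric])
  also have "\<dots> = ennreal (exp (c * \<bar>r - g - \<sigma>\<^sup>2 / 2\<bar> * T)) * (\<integral>\<^sup>+\<omega>. ennreal (exp (c * \<sigma> * Wsup 0 T \<omega>)) \<partial>M)"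
    using Wsup_M[of 0 T] assms by (intro nn_integral_cmult) simp
  also have "\<dots> < \<infinity>"
    using exp_Wsup'[of 0 T "c * \<sigma>"] assms pos
    by (auto simp: ennreal_mult_less_top intro: le_less_trans)
  finally show ?thesis .
qed

text \<open>The quantifiers stand inside: one exceptional null set, that of the passage from
  \<open>W\<close> to \<open>Wc\<close>, serves all initial values and controls.\<close>

lemma AE_X: "AE \<omega> in M. \<omega> \<in> space M \<and> (\<forall>x \<xi> \<eta> t. 0 \<le> t \<longrightarrow> X x \<xi> \<eta> \<omega> t = x * exp (B t \<omega> + \<xi> t \<omega> - \<eta> t \<omega>))"
  using AE_Wc AE_space by eventually_elim (simp add: X_def B_def algebra_simps)

lemma X0_eq: "y * exp (B t \<omega> + xi0 t \<omega> - 0) = X0 t \<omega>"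
  by (simp add: X0_def Z0_def exp_add)

lemma path_xi0: "\<omega> \<in> space M \<Longrightarrow> control_path (path xi0 \<omega>)"
  by (rule controls_path[OF xi0_controls])

lemma emeasure_xi0:
  assumes "\<omega> \<in> space M" "s \<le> t"
  shows "emeasure (interval_measure (path xi0 \<omega>)) {s<..t} = ennreal (path xi0 \<omega> t - path xi0 \<omega> s)"
proof -
  interpret control_path "path xi0 \<omega>" by (rule path_xi0[OF assms(1)])
  show ?thesis by (rule emeasure_interval_measure_Ioc) (use assms in \<open>auto intro: rc monoD[OF mono]\<close>)
qed

text \<open>The times with the state above \<open>a\<close> form a relatively open set, covered by
  countably many rational intervals on which the state stays above \<open>a\<close>. By
  \<open>xi0_step\<close> the control is constant on each of them.\<close>

lemma xi0_charges_barrier: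
  assumes \<omega>: "\<omega> \<in> space M"
  shows "{t. 0 \<le> t \<and> X0 t \<omega> > a} \<in> null_sets (interval_measure (path xi0 \<omega>))"
proof -
  let ?m = "interval_measure (path xi0 \<omega>)"
  interpret control_path "path xi0 \<omega>" by (rule path_xi0[OF \<omega>])
  define Q where "Q = {(p, q) \<in> \<rat> \<times> \<rat>. p < q \<and> (\<forall>t\<in>{p<..q}. 0 \<le> t \<longrightarrow> X0 t \<omega> > a)}"
  have null: "{p<..q} \<in> null_sets ?m" if "(p, q) \<in> Q" for p q
  proof -
    have pq: "p < q" "\<And>t. p < t \<Longrightarrow> t \<le> q \<Longrightarrow> 0 \<le> t \<Longrightarrow> X0 t \<omega> > a" using that by (auto simp: Q_def)
    have "path xi0 \<omega> q = path xi0 \<omega> p"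
    proof (cases "0 \<le> q")
      case True
      have "xi0 q \<omega> = xi0 (max 0 p) \<omega>"
      proof (rule ccontr)
        assume "xi0 q \<omega> \<noteq> xi0 (max 0 p) \<omega>"
        then obtain v where v: "max 0 p < v" "v \<le> q" "xi0 q \<omega> = ln (a / y) - B v \<omega>" "xi0 v \<omega> = xi0 q \<omega>"
          using xi0_step[of "max 0 p" q \<omega>] True pq by auto
        have "Z0 v \<omega> = a * exp (- B v \<omega>)" unfolding Z0_def v(4) v(3) by (rule y_exp_gap)
        then have "X0 v \<omega> = a" by (simp add: X0_def exp_minus)
        then show False using pq(2)[of v] v by auto
      qed
      then show ?thesis using True by (auto simp: path_def max_def split: if_splits)
    qed (use pq in \<open>simp add: path_def\<close>)
    then show ?thesis using emeasure_xi0[OF \<omega>, of p q] pq by (intro null_setsI) auto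
  qed
  have "countable Q" unfolding Q_def
    by (rule countable_subset[of _ "\<rat> \<times> \<rat>"]) (auto intro!: countable_SIGMA countable_rat)
  then have N: "(\<Union>(p, q)\<in>Q. {p<..q}) \<in> null_sets ?m"
    by (intro null_sets_UN') (use null in auto)
  have cont: "continuous_on UNIV (\<lambda>t. X0 (max 0 t) \<omega>)"
    by (rule continuous_on_compose2[OF X0_cont]) (auto intro!: continuous_intros)
  have "{t. 0 \<le> t \<and> X0 t \<omega> > a} = {0..} \<inter> {t. X0 (max 0 t) \<omega> > a}" by auto
  moreover have "open {t. X0 (max 0 t) \<omega> > a}"
    using cont by (intro open_Collect_less) (auto intro: continuous_intros)
  ultimately have meas: "{t. 0 \<le> t \<and> X0 t \<omega> > a} \<in> sets ?m" by auto
  have "{t. 0 \<le> t \<and> X0 t \<omega> > a} \<subseteq> (\<Union>(p, q)\<in>Q. {p<..q})"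
  proof
    fix t assume t: "t \<in> {t. 0 \<le> t \<and> X0 t \<omega> > a}"
    then have "t \<in> {t. X0 (max 0 t) \<omega> > a}" by simp
    with \<open>open {t. X0 (max 0 t) \<omega> > a}\<close> obtain e where e: "0 < e" "ball t e \<subseteq> {t. X0 (max 0 t) \<omega> > a}"
      by (meson open_contains_ball)
    obtain p where p: "p \<in> \<rat>" "t - e < p" "p < t" using Rats_dense_in_real[of "t - e" t] e by auto
    obtain q where q: "q \<in> \<rat>" "t < q" "q < t + e" using Rats_dense_in_real[of t "t + e"] e by auto
    have "X0 s \<omega> > a" if s: "s \<in> {p<..q}" "0 \<le> s" for s
    proof -
      have "s \<in> ball t e" using s p q by (auto simp: dist_real_def)
      then show ?thesis using e(2) s by (auto simp: max_def split: if_splits)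
    qed
    then have "(p, q) \<in> Q" using p q by (auto simp: Q_def)
    then show "t \<in> (\<Union>(p, q)\<in>Q. {p<..q})" by (rule UN_I) (use p q in simp)
  qed
  then show ?thesis by (rule null_sets_subset[OF N meas])
qed

text \<open>Skorokhod's uniqueness. Being increasing and at least \<open>gap\<close>, any such
  \<open>z\<close> dominates the running maximum. If it exceeded it strictly at \<open>T\<close>,
  the state would lie strictly above \<open>a\<close> while \<open>z\<close> passes from
  \<open>xi0 T\<close> to \<open>z T\<close>, so this increase would have to carry no mass.\<close>

lemma reflecting_unique_path:
  fixes z :: "real \<Rightarrow> real"
  assumes \<omega>: "\<omega> \<in> space M" and z: "control_path z"
    and ge: "\<And>t. 0 < t \<Longrightarrow> a \<le> y * exp (B t \<omega> + z t)"
    and charge: "\<And>T. 0 < T \<Longrightarrow> (\<integral>\<^sup>+t\<in>{0..T}. indicator {t. y * exp (B t \<omega> + z t) > a} t \<partial>interval_measure z) = 0"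
    and t: "0 \<le> t"
  shows "z t = xi0 t \<omega>"
proof -
  interpret z: control_path z by (rule z)
  have z0: "0 \<le> z s" for s using monoD[OF z.mono, of "min s (-1)" s] z.neg[of "min s (-1)"] by simp
  have lower: "gap \<omega> s \<le> z s" if "0 < s" for s
  proof -
    have "y * exp (ln (a / y)) \<le> y * exp (B s \<omega> + z s)"
      using ge[OF that] a_pos y_pos by simp
    then have "ln (a / y) \<le> B s \<omega> + z s" using y_pos by simp
    then show ?thesis using z0 by (simp add: gap_def)
  qed
  have le: "xi0 t \<omega> \<le> z t" if "0 \<le> t" for t
    unfolding xi0_def
  proof (rule runmax_least[OF that])
    fix s assume s: "0 \<le> s" "s \<le> t"
    show "gap \<omega> s \<le> z t"
    proof (cases "s = 0")
      case True then show ?thesis using z0 by (simp add: gap_0)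
    next
      case False then show ?thesis using lower[of s] monoD[OF z.mono s(2)] s by simp
    qed
  qed
  have ge': "z T \<le> xi0 T \<omega>" if T: "0 < T" for T
  proof (rule ccontr)
    assume "\<not> z T \<le> xi0 T \<omega>"
    then have gt: "xi0 T \<omega> < z T" by simp
    \<comment> \<open>The comparison level is the constant \<open>xi0 T\<close>, so monotonicity of
      \<open>z\<close> makes \<open>A\<close> an interval that ends at \<open>T\<close>; since
      \<open>xi0\<close> is at most this level there, the state is above \<open>a\<close> on all of
      \<open>A\<close>.\<close>
    define A where "A = {s\<in>{0..T}. xi0 T \<omega> < z s}"
    have [measurable]: "z \<in> borel_measurable borel" by (rule borel_measurable_mono[OF z.mono])
    have [measurable]: "A \<in> sets borel" unfolding A_def by measurable
    have A_a: "y * exp (B s \<omega> + z s) > a" if "s \<in> A" for s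
    proof -
      have s: "0 \<le> s" "s \<le> T" "xi0 T \<omega> < z s" using that by (auto simp: A_def)
      have "a \<le> y * exp (B s \<omega> + xi0 s \<omega> - 0)" using X0_ge[OF s(1), of \<omega>] by (simp only: X0_eq)
      also have "\<dots> < y * exp (B s \<omega> + z s)" using y_pos xi0_mono[OF s(1,2), of \<omega>] s by simp
      finally show ?thesis .
    qed
    have "emeasure (interval_measure z) A = (\<integral>\<^sup>+t. indicator A t \<partial>interval_measure z)" by simp
    also have "\<dots> \<le> (\<integral>\<^sup>+t\<in>{0..T}. indicator {t. y * exp (B t \<omega> + z t) > a} t \<partial>interval_measure z)"
      by (intro nn_integral_mono) (auto simp: A_a split: split_indicator, auto simp: A_def)
    also have "\<dots> = 0" by (rule charge[OF T])
    finally have A0: "emeasure (interval_measure z) A = 0" by simp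
    define u where "u = Inf A"
    have TA: "T \<in> A" using gt T by (simp add: A_def)
    have bdd: "bdd_below A" by (auto simp: A_def intro: bdd_belowI)
    have u: "0 \<le> u" "u \<le> T" unfolding u_def
      using TA cInf_lower[OF TA bdd] by (auto simp: A_def intro!: cInf_greatest)
    have up: "s \<in> A" if us: "u < s" "s \<le> T" for s
    proof -
      have "A \<noteq> {}" using TA by blast
      then obtain v where "v \<in> A" "v < s" using cInf_less_iff[of A s] bdd us(1) unfolding u_def by blast
      then show ?thesis using monoD[OF z.mono, of v s] us u by (auto simp: A_def)
    qed
    show False
    proof (cases "u \<in> A")
      case False
      then have "z u \<le> xi0 T \<omega>" using u by (auto simp: A_def)
      then have "0 < ennreal (z T - z u)" using gt by simp
      also have "\<dots> = emeasure (interval_measure z) {u<..T}"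
        by (rule emeasure_interval_measure_Ioc[symmetric]) (use u in \<open>auto intro: z.rc monoD[OF z.mono]\<close>)
      also have "\<dots> \<le> emeasure (interval_measure z) A"
        by (rule emeasure_mono) (use up in auto)
      finally show False using A0 by simp
    next
      case True
      \<comment> \<open>Here \<open>z\<close> passes the level by a jump at \<open>u\<close> itself,
        so the mass of the closed interval \<open>{u..T}\<close> is needed; it is the limit of the
        masses of half-open intervals that start slightly earlier, where \<open>z\<close> is still
        below the level.\<close>
      define e where "e = z T - xi0 T \<omega>"
      have "ennreal e \<le> emeasure (interval_measure z) {u..T}"
      proof -
        have L1: "ennreal e \<le> emeasure (interval_measure z) {u - 1 / Suc n<..T}" for n :: nat
        proof -
          define w where "w = u - 1 / real (Suc n)"
          have w: "w < u" by (simp add: w_def)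
          have "z w \<le> xi0 T \<omega>"
          proof (cases "0 \<le> w")
            case True
            have "w \<notin> A" using cInf_lower[OF _ bdd, of w] w unfolding u_def[symmetric] by auto
            then show ?thesis using True u w by (auto simp: A_def)
          next
            case False
            then show ?thesis using z.neg[of w] xi0_nonneg[of T \<omega>] T by simp
          qed
          then have "ennreal e \<le> ennreal (z T - z w)" by (intro ennreal_leI) (simp add: e_def)
          also have "\<dots> = emeasure (interval_measure z) {w<..T}"
            by (rule emeasure_interval_measure_Ioc[symmetric]) (use u w in \<open>auto intro: z.rc monoD[OF z.mono]\<close>)
          finally show ?thesis by (simp add: w_def)
        qed
        have L2: "(\<lambda>n. emeasure (interval_measure z) {u - 1 / Suc n<..T}) \<longlonglongrightarrow> emeasure (interval_measure z) (\<Inter>n. {u - 1 / Suc n<..T})"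
        proof (rule Lim_emeasure_decseq)
          show "decseq (\<lambda>n. {u - 1 / Suc n<..T})"
          proof (rule antimonoI)
            fix i j :: nat assume "i \<le> j"
            then have "1 / real (Suc j) \<le> 1 / real (Suc i)" by (intro frac_le) auto
            then show "{u - 1 / Suc j<..T} \<subseteq> {u - 1 / Suc i<..T}" by auto
          qed
          show "emeasure (interval_measure z) {u - 1 / Suc n<..T} \<noteq> \<infinity>" for n
            by (subst emeasure_interval_measure_Ioc_eq) (auto intro: z.rc monoD[OF z.mono])
        qed auto
        have L3: "(\<Inter>n. {u - 1 / Suc n<..T}) = {u..T}"
        proof safe
          fix s assume s: "s \<in> (\<Inter>n. {u - 1 / Suc n<..T})"
          have "u \<le> s"
          proof (rule LIMSEQ_le_const2)
            show "(\<lambda>n. u - 1 / Suc n) \<longlonglongrightarrow> u"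
              using tendsto_diff[OF tendsto_const LIMSEQ_inverse_real_of_nat, of u] by (simp add: inverse_eq_divide)
            show "\<exists>N. \<forall>n\<ge>N. u - 1 / Suc n \<le> s" using s by (auto intro: less_imp_le)
          qed
          then show "s \<in> {u..T}" using s by auto
        next
          fix s n assume s: "s \<in> {u..T}"
          have "0 < 1 / real (Suc n)" by simp
          moreover have "u \<le> s" using s by simp
          ultimately have "u - 1 / real (Suc n) < s" by linarith
          then show "s \<in> {u - 1 / Suc n<..T}" using s by simp
        qed
        show ?thesis by (rule LIMSEQ_le_const[OF L2[unfolded L3]]) (use L1 in auto)
      qed
      also have "\<dots> \<le> emeasure (interval_measure z) A"
      proof (rule emeasure_mono)
        show "{u..T} \<subseteq> A" using up True by (metis atLeastAtMost_iff le_less subsetI)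
      qed simp
      finally show False using A0 gt by (simp add: e_def)
    qed
  qed
  show ?thesis
  proof (cases "t = 0")
    case False then show ?thesis using le[OF t] ge'[of t] t by simp
  next
    case True
    \<comment> \<open>The barrier condition speaks of positive times; the value at 0 follows by
      right continuity, which excludes a jump of \<open>z\<close> at 0.\<close>
    have "(z \<longlongrightarrow> z 0) (at_right 0)" using z.rc[of 0] by (simp add: continuous_within)
    moreover have "\<forall>\<^sub>F s in at_right 0. z s = xi0 s \<omega>"
      unfolding eventually_at_filter by (intro always_eventually) (use le ge' in \<open>auto intro: antisym\<close>)
    ultimately have "((\<lambda>s. xi0 s \<omega>) \<longlongrightarrow> z 0) (at_right 0)" by (rule Lim_transform_eventually)
    moreover have "((\<lambda>s. xi0 s \<omega>) \<longlongrightarrow> xi0 0 \<omega>) (at_right 0)"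
      using continuous_on_right[OF xi0_cont, of 0 \<omega>] by (simp add: continuous_within)
    ultimately show ?thesis using True tendsto_unique[of "at_right (0::real)"] by auto
  qed
qed

end

section \<open>Moments of the reflected process\<close>

lemma nn_integral_exp_decay:
  assumes "0 < c"
  shows "(\<integral>\<^sup>+t\<in>{0..}. ennreal (exp (- c * t)) \<partial>lborel) = ennreal (1 / c)"
proof -
  have "(\<integral>\<^sup>+t\<in>{0..}. ennreal (exp (- c * t)) \<partial>lborel) = ennreal (0 - (- exp (- c * 0) / c))"
  proof (rule nn_integral_FTC_atLeast)
    show "((\<lambda>t. - exp (- c * t) / c) has_real_derivative exp (- c * t)) (at t)" for t
      using assms by (auto intro!: derivative_eq_intros)
    have "((\<lambda>t. exp (- c * t)) \<longlongrightarrow> 0) at_top"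
      by (rule filterlim_compose[OF exp_at_bot filterlim_tendsto_neg_mult_at_bot[OF tendsto_const _ filterlim_ident]])
         (use assms in simp)
    then show "((\<lambda>t. - exp (- c * t) / c) \<longlongrightarrow> 0) at_top"
      using tendsto_divide[OF tendsto_minus tendsto_const, of "\<lambda>t. exp (- c * t)" 0 at_top c] assms by simp
  qed auto
  then show ?thesis by simp
qed

context brownian_motion
begin

text \<open>Tonelli in the form in which the costs are written, for processes whose joint
  measurability is stated through \<open>max 0\<close>.\<close>

lemma nn_integral_swap:
  fixes f :: "real \<Rightarrow> 'w \<Rightarrow> ennreal"
  assumes "(\<lambda>p. f (max 0 (fst p)) (snd p)) \<in> borel_measurable (borel \<Otimes>\<^sub>M M)"
  shows "(\<integral>\<^sup>+\<omega>. (\<integral>\<^sup>+t\<in>{0..}. f t \<omega> \<partial>lborel) \<partial>M) = (\<integral>\<^sup>+t\<in>{0..}. (\<integral>\<^sup>+\<omega>. f t \<omega> \<partial>M) \<partial>lborel)"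
    and "(\<lambda>\<omega>. \<integral>\<^sup>+t\<in>{0..}. f t \<omega> \<partial>lborel) \<in> borel_measurable M"
proof -
  interpret pair_sigma_finite lborel M
    by (intro pair_sigma_finite.intro sigma_finite_lborel) unfold_locales
  define h where "h t \<omega> = f (max 0 t) \<omega> * indicator {0..} t" for t :: real and \<omega>
  have eq: "f t \<omega> * indicator {0..} t = h t \<omega>" for t \<omega>
    by (auto simp: h_def split: split_indicator)
  have [measurable]: "(\<lambda>p. h (fst p) (snd p)) \<in> borel_measurable (lborel \<Otimes>\<^sub>M M)"
    unfolding h_def using assms by (simp cong: measurable_cong_sets)
  then have m: "case_prod h \<in> borel_measurable (lborel \<Otimes>\<^sub>M M)"
    by (simp add: case_prod_beta)
  have "(\<integral>\<^sup>+\<omega>. (\<integral>\<^sup>+t. h t \<omega> \<partial>lborel) \<partial>M) = (\<integral>\<^sup>+t. (\<integral>\<^sup>+\<omega>. h t \<omega> \<partial>M) \<partial>lborel)"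
    by (rule Fubini'[OF m])
  also have "\<dots> = (\<integral>\<^sup>+t\<in>{0..}. (\<integral>\<^sup>+\<omega>. f t \<omega> \<partial>M) \<partial>lborel)"
    by (intro nn_integral_cong) (auto simp: h_def split: split_indicator)
  finally show "(\<integral>\<^sup>+\<omega>. (\<integral>\<^sup>+t\<in>{0..}. f t \<omega> \<partial>lborel) \<partial>M) = (\<integral>\<^sup>+t\<in>{0..}. (\<integral>\<^sup>+\<omega>. f t \<omega> \<partial>M) \<partial>lborel)"
    by (simp only: eq)
  have "(\<lambda>p. h (snd p) (fst p)) \<in> borel_measurable (M \<Otimes>\<^sub>M lborel)"
    using measurable_compose[OF measurable_pair_swap' m] by (simp add: case_prod_beta)
  then show "(\<lambda>\<omega>. \<integral>\<^sup>+t\<in>{0..}. f t \<omega> \<partial>lborel) \<in> borel_measurable M"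
    unfolding eq by (intro lborel.borel_measurable_nn_integral) (simp add: case_prod_beta)
qed

lemma zero_control: "(\<lambda>t \<omega>. 0) \<in> controls"
  by (auto simp: controls_def cadlag_def intro!: mono_onI)

end

lemma zero_path: "path (\<lambda>t \<omega>. 0) \<omega> = (\<lambda>_. 0)"
  by (simp add: path_def fun_eq_iff)

lemma jump_const: "jump (\<lambda>_. c) t = 0"
  by (simp add: jump_def left_lim_eqI[OF tendsto_const])

lemma nn_integral_interval_measure_const: "(\<integral>\<^sup>+t. f t \<partial>interval_measure (\<lambda>_. 0)) = 0"
proof -
  have "emeasure (interval_measure (\<lambda>_. 0)) (\<Union>n::nat. {- real n<..real n}) = 0"
    by (rule emeasure_UN_eq_0) (auto simp: emeasure_interval_measure_Ioc_eq)
  moreover have "(\<Union>n::nat. {- real n<..real n}) = UNIV"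
  proof (intro set_eqI iffI UNIV_I)
    fix x :: real
    obtain n where "\<bar>x\<bar> < real n" using reals_Archimedean2 by blast
    then show "x \<in> (\<Union>n::nat. {- real n<..real n})" by (intro UN_I[of n]) auto
  qed
  ultimately have "UNIV \<in> null_sets (interval_measure (\<lambda>_. 0))" by (intro null_setsI) auto
  then have "AE t in interval_measure (\<lambda>_. 0). f t = 0"
    by (rule AE_I') simp
  then have "(\<integral>\<^sup>+t. f t \<partial>interval_measure (\<lambda>_. 0)) = (\<integral>\<^sup>+t. 0 \<partial>interval_measure (\<lambda>_. 0))"
    by (rule nn_integral_cong_AE)
  then show ?thesis by simp
qed

lemma cont_part_zero: "cont_part (\<lambda>_. 0) = (\<lambda>_. 0)"
  by (simp add: cont_part_def jump_const fun_eq_iff)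

lemma (in debt_model) down_cost_zero: "down_cost q x \<xi> (\<lambda>t \<omega>. 0) \<omega> = 0"
  by (simp add: down_cost_def zero_path cont_part_zero jump_const nn_integral_interval_measure_const)

context reflected
begin

text \<open>The exponential growth rate of the mean of \<open>exp (p * B t)\<close>. The standing
  assumptions say that \<open>lam\<close> exceeds \<open>growth 1\<close> and \<rho> exceeds
  \<open>growth 2\<close>; the equation for the root \<theta> says that its growth rate equals
  \<open>lam\<close>.\<close>

definition growth :: "real \<Rightarrow> real" where
  "growth p = p * (r - g - \<sigma>\<^sup>2 / 2) + p\<^sup>2 * \<sigma>\<^sup>2 / 2"

lemma growth_1: "growth 1 = r - g" by (simp add: growth_def)

lemma growth_2: "growth 2 = 2 * (r - g) + \<sigma>\<^sup>2" by (simp add: growth_def field_simps)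

lemma B_diff: "B t \<omega> - B s \<omega> = (r - g - \<sigma>\<^sup>2 / 2) * (t - s) + \<sigma> * (Wc t \<omega> - Wc s \<omega>)"
  by (simp add: B_def right_diff_distrib)

lemma nn_integral_expB:
  assumes st: "0 \<le> s" "s \<le> t" and Y: "Y \<in> borel_measurable (F s)"
  shows "(\<integral>\<^sup>+\<omega>. Y \<omega> * ennreal (exp (p * (B t \<omega> - B s \<omega>))) \<partial>M) = ennreal (exp (growth p * (t - s))) * (\<integral>\<^sup>+\<omega>. Y \<omega> \<partial>M)"
proof -
  have e: "exp (p * (B t \<omega> - B s \<omega>)) = exp (p * (r - g - \<sigma>\<^sup>2 / 2) * (t - s)) * exp (p * \<sigma> * (Wc t \<omega> - Wc s \<omega>))" for \<omega>
    unfolding B_diff distrib_left exp_add by (simp add: mult.assoc)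
  have YM[measurable]: "Y \<in> borel_measurable M" by (rule measurable_F_M[OF Y])
  have [measurable]: "Wc s \<in> borel_measurable M" "Wc t \<in> borel_measurable M" using st by auto
  have "(\<integral>\<^sup>+\<omega>. Y \<omega> * ennreal (exp (p * (B t \<omega> - B s \<omega>))) \<partial>M)
    = (\<integral>\<^sup>+\<omega>. ennreal (exp (p * (r - g - \<sigma>\<^sup>2 / 2) * (t - s))) * (Y \<omega> * ennreal (exp (p * \<sigma> * (Wc t \<omega> - Wc s \<omega>)))) \<partial>M)"
    unfolding e by (intro nn_integral_cong) (simp add: ennreal_mult ac_simps)
  also have "\<dots> = ennreal (exp (p * (r - g - \<sigma>\<^sup>2 / 2) * (t - s))) * (\<integral>\<^sup>+\<omega>. Y \<omega> * ennreal (exp (p * \<sigma> * (Wc t \<omega> - Wc s \<omega>))) \<partial>M)"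
    by (rule nn_integral_cmult) measurable
  also have "\<dots> = ennreal (exp (p * (r - g - \<sigma>\<^sup>2 / 2) * (t - s)) * exp ((p * \<sigma>)\<^sup>2 * (t - s) / 2)) * (\<integral>\<^sup>+\<omega>. Y \<omega> \<partial>M)"
    by (subst nn_integral_exp_increment[OF st Y]) (simp add: ennreal_mult mult.assoc)
  also have "exp (p * (r - g - \<sigma>\<^sup>2 / 2) * (t - s)) * exp ((p * \<sigma>)\<^sup>2 * (t - s) / 2) = exp (growth p * (t - s))"
    by (simp add: growth_def power_mult_distrib distrib_right flip: exp_add)
  finally show ?thesis .
qed

lemma nn_integral_expB_0:
  "0 \<le> t \<Longrightarrow> (\<integral>\<^sup>+\<omega>. ennreal (exp (p * B t \<omega>)) \<partial>M) = ennreal (exp (growth p * t))"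
  using nn_integral_expB[of 0 t "\<lambda>_. 1" p] by (simp add: emeasure_space_1)

text \<open>
  The supremum of \<open>exp (B t - B s)\<close> over \<open>s \<le> t\<close> is bounded by the sum of the suprema over unit
  intervals. A maximal inequality over \<open>[0, t]\<close> would give a growth rate that is too large
  when \<open>r < g\<close>.
\<close>

lemma X0_power_bound:
  fixes p :: nat and t :: real
  assumes t: "0 \<le> t"
  defines "T \<equiv> \<lambda>k::nat. min (real k + 1) t"
  shows "X0 t \<omega> ^ p \<le> y ^ p * exp (real p * B t \<omega>) +
    (\<Sum>k\<le>nat \<lfloor>t\<rfloor>. a ^ p * exp (real p * \<bar>r - g - \<sigma>\<^sup>2 / 2\<bar>) * exp (2 * real p * \<sigma> * Wsup (real k) (T k - real k) \<omega>)
        * exp (real p * (B t \<omega> - B (T k) \<omega>)))" (is "_ \<le> ?A + sum ?G _")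
proof -
  have G0: "0 \<le> ?G k" for k using a_pos by simp
  have A0: "0 \<le> ?A" using y_pos by simp
  have pw: "(c * exp b) ^ p = c ^ p * exp (real p * b)" for b c :: real
    by (simp add: power_mult_distrib exp_of_nat_mult)
  show ?thesis
  proof (cases "Z0 t \<omega> = Z0 0 \<omega>")
    case True
    then have "X0 t \<omega> = y * exp (B t \<omega>)" by (simp add: X0_def Z0_def)
    then show ?thesis using G0 by (simp add: pw sum_nonneg)
  next
    case False
    then obtain v where v: "0 < v" "v \<le> t" "Z0 t \<omega> = a * exp (- B v \<omega>)"
      using Z0_step[of 0 t \<omega>] t by auto
    \<comment> \<open>The last barrier time \<open>v\<close> that matters lies in the unit interval
      starting at \<open>k\<close>, whose end is capped at \<open>t\<close> by \<open>T k\<close>.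
      The increment of \<open>B\<close> from \<open>v\<close> to \<open>t\<close> then splits into
      an oscillation known at \<open>T k\<close> and an increment after \<open>T k\<close>.\<close>
    define k where "k = nat \<lfloor>v\<rfloor>"
    have k: "real k \<le> v" "v < real k + 1" using v unfolding k_def by (auto simp: of_nat_nat)
    then have vT: "v \<le> T k" "real k \<le> T k" "T k \<le> t" "T k \<le> real k + 1" using v by (auto simp: T_def)
    have kt: "k \<in> {..nat \<lfloor>t\<rfloor>}" unfolding k_def using v by (auto intro: nat_mono floor_mono)
    have W1: "\<bar>Wc v \<omega> - Wc (real k) \<omega>\<bar> \<le> Wsup (real k) (T k - real k) \<omega>"
      using Wsup_upper[of "real k" "v - real k" "T k - real k" \<omega>] k vT by simp
    have W2: "\<bar>Wc (T k) \<omega> - Wc (real k) \<omega>\<bar> \<le> Wsup (real k) (T k - real k) \<omega>"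
      using Wsup_upper[of "real k" "T k - real k" "T k - real k" \<omega>] k vT by simp
    have "B (T k) \<omega> - B v \<omega> = (r - g - \<sigma>\<^sup>2 / 2) * (T k - v) + \<sigma> * (Wc (T k) \<omega> - Wc v \<omega>)"
      by (rule B_diff)
    also have "\<dots> \<le> \<bar>r - g - \<sigma>\<^sup>2 / 2\<bar> * 1 + \<sigma> * (2 * Wsup (real k) (T k - real k) \<omega>)"
    proof (intro add_mono mult_left_mono)
      have "(r - g - \<sigma>\<^sup>2 / 2) * (T k - v) \<le> \<bar>r - g - \<sigma>\<^sup>2 / 2\<bar> * (T k - v)"
        using vT by (intro mult_right_mono) auto
      also have "\<dots> \<le> \<bar>r - g - \<sigma>\<^sup>2 / 2\<bar> * 1" using vT k by (intro mult_left_mono) auto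
      finally show "(r - g - \<sigma>\<^sup>2 / 2) * (T k - v) \<le> \<bar>r - g - \<sigma>\<^sup>2 / 2\<bar> * 1" .
    qed (use W1 W2 pos in auto)
    finally have Bv: "B t \<omega> - B v \<omega> \<le> \<bar>r - g - \<sigma>\<^sup>2 / 2\<bar> + 2 * \<sigma> * Wsup (real k) (T k - real k) \<omega> + (B t \<omega> - B (T k) \<omega>)"
      by simp
    have "X0 t \<omega> = a * exp (B t \<omega> - B v \<omega>)" using v by (simp add: X0_def exp_diff exp_minus field_simps)
    then have "X0 t \<omega> ^ p = a ^ p * exp (real p * (B t \<omega> - B v \<omega>))" by (simp add: pw)
    also have "\<dots> \<le> a ^ p * exp (real p * (\<bar>r - g - \<sigma>\<^sup>2 / 2\<bar> + 2 * \<sigma> * Wsup (real k) (T k - real k) \<omega> + (B t \<omega> - B (T k) \<omega>)))"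
      using a_pos Bv by (intro mult_left_mono) (auto intro: mult_left_mono)
    also have "\<dots> = ?G k" by (simp add: algebra_simps flip: exp_add)
    also have "\<dots> \<le> sum ?G {..nat \<lfloor>t\<rfloor>}" by (rule member_le_sum[OF kt]) (use G0 in auto)
    finally show ?thesis using A0 by simp
  qed
qed

text \<open>In each summand of \<open>X0_power_bound\<close> the oscillation has a bounded
  exponential moment and the later increment of \<open>B\<close> is independent of it. The linear
  factor counts the unit intervals; the rate is truncated at 0 because a barrier visit shortly
  before \<open>t\<close> leaves no time for decay.\<close>

lemma X0_moment:
  fixes p :: nat
  obtains C where "0 \<le> C"
    "\<And>t. 0 \<le> t \<Longrightarrow> (\<integral>\<^sup>+\<omega>. ennreal (X0 t \<omega> ^ p) \<partial>M) \<le> ennreal (C * (t + 2) * exp (max 0 (growth (real p)) * t))"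
proof -
  define b where "b = max 0 (growth (real p))"
  define C0 where "C0 = a ^ p * exp (real p * \<bar>r - g - \<sigma>\<^sup>2 / 2\<bar>)"
  define c where "c = 2 * real p * \<sigma>"
  define C1 where "C1 = C0 * (8 * exp (c\<^sup>2 / 2))"
  define C where "C = y ^ p + C1"
  have c0: "0 \<le> c" "0 \<le> C0" "0 \<le> C1" using pos a_pos by (auto simp: c_def C0_def C1_def)
  have gb: "exp (growth (real p) * u) \<le> exp (b * t)" if "0 \<le> u" "u \<le> t" for u t
    using that by (auto simp: b_def intro!: mult_mono)
  have "(\<integral>\<^sup>+\<omega>. ennreal (X0 t \<omega> ^ p) \<partial>M) \<le> ennreal (C * (t + 2) * exp (b * t))" if t: "0 \<le> t" for t
  proof -
    define T where "T k = min (real k + 1) t" for k :: nat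
    define N where "N = nat \<lfloor>t\<rfloor>"
    define G where "G k \<omega> = C0 * exp (c * Wsup (real k) (T k - real k) \<omega>)" for k \<omega>
    have Tk: "real k \<le> T k" "T k \<le> t" "T k - real k \<le> 1" if "k \<le> N" for k
    proof -
      have "real k \<le> real N" using that by simp
      also have "\<dots> \<le> t" unfolding N_def using t by (simp add: of_nat_nat)
      finally show "real k \<le> T k" "T k \<le> t" "T k - real k \<le> 1" by (auto simp: T_def)
    qed
    have GF: "(\<lambda>\<omega>. ennreal (G k \<omega>)) \<in> borel_measurable (F (T k))" if "k \<le> N" for k
      using Wsup_F[of "real k" "T k - real k"] Tk[OF that] unfolding G_def by simp
    have BM: "B u \<in> borel_measurable M" if "0 \<le> u" for u using B_F[of u u] that measurable_F_M by auto
    have EG: "(\<integral>\<^sup>+\<omega>. ennreal (G k \<omega> * exp (real p * (B t \<omega> - B (T k) \<omega>))) \<partial>M) \<le> ennreal (C1 * exp (b * t))" if k: "k \<le> N" for k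
    proof -
      have "(\<integral>\<^sup>+\<omega>. ennreal (G k \<omega>) \<partial>M) = ennreal C0 * (\<integral>\<^sup>+\<omega>. ennreal (exp (c * Wsup (real k) (T k - real k) \<omega>)) \<partial>M)"
        unfolding G_def using c0 Wsup_M[of "real k" "T k - real k"] Tk[OF k]
        by (subst nn_integral_cmult[symmetric]) (auto simp: ennreal_mult)
      also have "\<dots> \<le> ennreal C0 * ennreal (8 * exp (c\<^sup>2 * (T k - real k) / 2))"
        using Tk[OF k] c0 by (intro mult_left_mono exp_Wsup') auto
      also have "\<dots> \<le> ennreal C0 * ennreal (8 * exp (c\<^sup>2 / 2))"
        using Tk[OF k] by (intro mult_left_mono ennreal_leI) (auto intro: mult_left_le)
      also have "\<dots> = ennreal C1" using c0 by (simp add: C1_def ennreal_mult)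
      finally have 1: "(\<integral>\<^sup>+\<omega>. ennreal (G k \<omega>) \<partial>M) \<le> ennreal C1" .
      have "(\<integral>\<^sup>+\<omega>. ennreal (G k \<omega> * exp (real p * (B t \<omega> - B (T k) \<omega>))) \<partial>M)
        = (\<integral>\<^sup>+\<omega>. ennreal (G k \<omega>) * ennreal (exp (real p * (B t \<omega> - B (T k) \<omega>))) \<partial>M)"
        using c0 by (intro nn_integral_cong) (auto simp: ennreal_mult G_def)
      also have "\<dots> = ennreal (exp (growth (real p) * (t - T k))) * (\<integral>\<^sup>+\<omega>. ennreal (G k \<omega>) \<partial>M)"
        using Tk[OF k] by (intro nn_integral_expB GF k) auto
      also have "\<dots> \<le> ennreal (exp (b * t)) * ennreal C1"
        using Tk[OF k] by (intro mult_mono 1 ennreal_leI gb) auto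
      finally show ?thesis using c0 by (simp add: ennreal_mult mult.commute)
    qed
    have "(\<integral>\<^sup>+\<omega>. ennreal (X0 t \<omega> ^ p) \<partial>M)
       \<le> (\<integral>\<^sup>+\<omega>. ennreal (y ^ p * exp (real p * B t \<omega>)) + (\<Sum>k\<le>N. ennreal (G k \<omega> * exp (real p * (B t \<omega> - B (T k) \<omega>)))) \<partial>M)"
    proof (intro nn_integral_mono)
      fix \<omega>
      have "X0 t \<omega> ^ p \<le> y ^ p * exp (real p * B t \<omega>) + (\<Sum>k\<le>N. G k \<omega> * exp (real p * (B t \<omega> - B (T k) \<omega>)))"
        using X0_power_bound[OF t, of \<omega> p] by (simp add: G_def C0_def c_def T_def N_def)
      then have "ennreal (X0 t \<omega> ^ p) \<le> ennreal (y ^ p * exp (real p * B t \<omega>)) + ennreal (\<Sum>k\<le>N. G k \<omega> * exp (real p * (B t \<omega> - B (T k) \<omega>)))"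
        by (rule order_trans[OF ennreal_leI ennreal_add_le])
      also have "ennreal (\<Sum>k\<le>N. G k \<omega> * exp (real p * (B t \<omega> - B (T k) \<omega>))) = (\<Sum>k\<le>N. ennreal (G k \<omega> * exp (real p * (B t \<omega> - B (T k) \<omega>))))"
        using c0 by (intro sum_ennreal[symmetric]) (auto simp: G_def)
      finally show "ennreal (X0 t \<omega> ^ p) \<le> ennreal (y ^ p * exp (real p * B t \<omega>)) + (\<Sum>k\<le>N. ennreal (G k \<omega> * exp (real p * (B t \<omega> - B (T k) \<omega>))))" .
    qed
    also have "\<dots> = (\<integral>\<^sup>+\<omega>. ennreal (y ^ p * exp (real p * B t \<omega>)) \<partial>M) + (\<Sum>k\<le>N. \<integral>\<^sup>+\<omega>. ennreal (G k \<omega> * exp (real p * (B t \<omega> - B (T k) \<omega>))) \<partial>M)"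
    proof -
      have [measurable]: "B t \<in> borel_measurable M" using BM t by auto
      have [measurable]: "(\<lambda>\<omega>. G k \<omega> * exp (real p * (B t \<omega> - B (T k) \<omega>))) \<in> borel_measurable M" if "k \<le> N" for k
      proof -
        have [measurable]: "B (T k) \<in> borel_measurable M" "Wsup (real k) (T k - real k) \<in> borel_measurable M"
          using Tk[OF that] by (auto intro!: BM Wsup_M)
        show ?thesis unfolding G_def by measurable
      qed
      show ?thesis
        by (subst nn_integral_add) (auto intro!: nn_integral_sum borel_measurable_sum measurable_compose[OF _ measurable_ennreal])
    qed
    also have "\<dots> \<le> ennreal (y ^ p * exp (b * t)) + (\<Sum>k\<le>N. ennreal (C1 * exp (b * t)))"
    proof (intro add_mono sum_mono)
      have "(\<integral>\<^sup>+\<omega>. ennreal (y ^ p * exp (real p * B t \<omega>)) \<partial>M) = ennreal (y ^ p) * ennreal (exp (growth (real p) * t))"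
        unfolding nn_integral_expB_0[OF t, symmetric] using y_pos BM[OF t]
        by (subst nn_integral_cmult[symmetric]) (auto simp: ennreal_mult)
      also have "\<dots> \<le> ennreal (y ^ p) * ennreal (exp (b * t))"
        by (intro mult_left_mono ennreal_leI gb) (use t in auto)
      finally show "(\<integral>\<^sup>+\<omega>. ennreal (y ^ p * exp (real p * B t \<omega>)) \<partial>M) \<le> ennreal (y ^ p * exp (b * t))"
        using y_pos by (simp add: ennreal_mult)
    qed (use EG in auto)
    also have "(\<Sum>k\<le>N. ennreal (C1 * exp (b * t))) = ennreal (\<Sum>k\<le>N. C1 * exp (b * t))"
      using c0 by (intro sum_ennreal) auto
    also have "ennreal (y ^ p * exp (b * t)) + ennreal (\<Sum>k\<le>N. C1 * exp (b * t)) = ennreal (y ^ p * exp (b * t) + (\<Sum>k\<le>N. C1 * exp (b * t)))"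
      using y_pos c0 by (intro ennreal_plus[symmetric]) auto
    also have "\<dots> \<le> ennreal (C * (t + 2) * exp (b * t))"
    proof (intro ennreal_leI)
      have N: "real N \<le> t" unfolding N_def using t by (simp add: of_nat_nat)
      have "y ^ p + (real N + 1) * C1 \<le> y ^ p * (t + 2) + (t + 2) * C1"
        using N t y_pos c0 by (intro add_mono mult_right_mono) auto
      then have "(y ^ p + (real N + 1) * C1) * exp (b * t) \<le> (C * (t + 2)) * exp (b * t)"
        by (intro mult_right_mono) (auto simp: C_def algebra_simps)
      then show "y ^ p * exp (b * t) + (\<Sum>k\<le>N. C1 * exp (b * t)) \<le> C * (t + 2) * exp (b * t)"
        by (simp add: algebra_simps)
    qed
    finally show ?thesis .
  qed
  then show ?thesis using c0 y_pos by (intro that[of C]) (auto simp: C_def b_def)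
qed

lemma X0_M: "0 \<le> t \<Longrightarrow> X0 t \<in> borel_measurable M"
  using X0_F measurable_F_M by blast

lemma X0_joint[measurable]: "(\<lambda>p. X0 (max 0 (fst p)) (snd p)) \<in> borel_measurable (borel \<Otimes>\<^sub>M M)"
  by (rule right_continuous_pair_measurable) (auto intro: continuous_on_right[OF X0_cont] X0_M)

lemma X0_path_measurable[measurable]: "(\<lambda>t. X0 (max 0 t) \<omega>) \<in> borel_measurable borel"
  by (rule right_continuous_measurable) (rule continuous_on_right[OF X0_cont])

lemma linear_le_exp: "0 < d \<Longrightarrow> 0 \<le> t \<Longrightarrow> t + 2 \<le> (1 / d + 2) * exp (d * (t::real))"
proof -
  assume d: "0 < d" and t: "0 \<le> t"
  have "d * t \<le> exp (d * t)" using exp_ge_add_one_self[of "d * t"] by linarith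
  then have "t \<le> 1 / d * exp (d * t)" using d by (simp add: field_simps)
  moreover have "1 \<le> exp (d * t)" using d t by simp
  moreover have "(1 / d + 2) * exp (d * t) = 1 / d * exp (d * t) + 2 * exp (d * t)" by (rule distrib_right)
  ultimately show ?thesis by linarith
qed

lemma discounted_moment_finite:
  fixes p :: nat
  assumes q: "max 0 (growth (real p)) < q"
  shows "(\<integral>\<^sup>+\<omega>. (\<integral>\<^sup>+t\<in>{0..}. ennreal (exp (- q * t) * X0 t \<omega> ^ p) \<partial>lborel) \<partial>M) < \<infinity>"
proof -
  define b where "b = max 0 (growth (real p))"
  \<comment> \<open>Half of the excess of the discount rate over the growth rate absorbs the linear
    factor, the other half keeps the integral finite.\<close>
  define d where "d = (q - b) / 2"
  have d: "0 < d" using q by (simp add: d_def b_def)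
  obtain C where C: "0 \<le> C" "\<And>t. 0 \<le> t \<Longrightarrow> (\<integral>\<^sup>+\<omega>. ennreal (X0 t \<omega> ^ p) \<partial>M) \<le> ennreal (C * (t + 2) * exp (b * t))"
    unfolding b_def using X0_moment[of p] by blast
  have "(\<integral>\<^sup>+\<omega>. (\<integral>\<^sup>+t\<in>{0..}. ennreal (exp (- q * t) * X0 t \<omega> ^ p) \<partial>lborel) \<partial>M)
    = (\<integral>\<^sup>+t\<in>{0..}. (\<integral>\<^sup>+\<omega>. ennreal (exp (- q * t) * X0 t \<omega> ^ p) \<partial>M) \<partial>lborel)"
    by (rule nn_integral_swap) measurable
  also have "\<dots> \<le> (\<integral>\<^sup>+t\<in>{0..}. ennreal (C * (1 / d + 2)) * ennreal (exp (- d * t)) \<partial>lborel)"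
  proof (intro nn_integral_mono)
    fix t :: real
    show "(\<integral>\<^sup>+\<omega>. ennreal (exp (- q * t) * X0 t \<omega> ^ p) \<partial>M) * indicator {0..} t
      \<le> ennreal (C * (1 / d + 2)) * ennreal (exp (- d * t)) * indicator {0..} t"
    proof (cases "0 \<le> t")
      case True
      have [measurable]: "X0 t \<in> borel_measurable M" by (rule X0_M[OF True])
      have "(\<integral>\<^sup>+\<omega>. ennreal (exp (- q * t) * X0 t \<omega> ^ p) \<partial>M) = ennreal (exp (- q * t)) * (\<integral>\<^sup>+\<omega>. ennreal (X0 t \<omega> ^ p) \<partial>M)"
        using X0_pos by (subst nn_integral_cmult[symmetric]) (auto simp: ennreal_mult less_imp_le)
      also have "\<dots> \<le> ennreal (exp (- q * t)) * ennreal (C * (t + 2) * exp (b * t))"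
        by (intro mult_left_mono C True) simp
      also have "\<dots> = ennreal (exp (- q * t) * (C * (t + 2) * exp (b * t)))"
        using C True by (simp add: ennreal_mult)
      also have "\<dots> \<le> ennreal (C * (1 / d + 2) * exp (- d * t))"
      proof (intro ennreal_leI)
        have "exp (- q * t) * (C * (t + 2) * exp (b * t)) = C * (t + 2) * exp (- (2 * d) * t)"
        proof -
          have "2 * d = q - b" by (simp add: d_def)
          then have "- (2 * d) * t = - q * t + b * t" by (simp only:) (simp add: algebra_simps)
          then have "exp (- (2 * d) * t) = exp (- q * t) * exp (b * t)" by (simp only: exp_add)
          then show ?thesis by (simp only: ac_simps)
        qed
        also have "\<dots> \<le> C * ((1 / d + 2) * exp (d * t)) * exp (- (2 * d) * t)"
          using C by (intro mult_right_mono mult_left_mono linear_le_exp d True) auto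
        also have "\<dots> = C * (1 / d + 2) * exp (- d * t)"
          by (simp add: mult.assoc flip: exp_add)
        finally show "exp (- q * t) * (C * (t + 2) * exp (b * t)) \<le> C * (1 / d + 2) * exp (- d * t)" .
      qed
      finally show ?thesis using True C d by (simp add: ennreal_mult)
    qed simp
  qed
  also have "\<dots> = ennreal (C * (1 / d + 2)) * (\<integral>\<^sup>+t\<in>{0..}. ennreal (exp (- d * t)) \<partial>lborel)"
    by (subst nn_integral_cmult[symmetric]) (auto simp: mult.assoc)
  also have "\<dots> < \<infinity>" by (simp only: nn_integral_exp_decay[OF d]) (simp add: ennreal_mult_less_top)
  finally show ?thesis .
qed

text \<open>Majorant for the cost of reflection. As \<open>xi0\<close> acts when the state equals
  \<open>a\<close>, the cost is the discounted total variation of \<open>xi0\<close> times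
  \<open>a\<close>; on the cell from \<open>k - 1\<close> to \<open>k\<close> the discount is taken
  at the left end and the increment is bounded by \<open>xi0 k\<close>.\<close>

definition up_bound :: "real \<Rightarrow> 'a \<Rightarrow> ennreal" where
  "up_bound q \<omega> = (\<Sum>k. ennreal (a * exp (- q * (real k - 1))) * ennreal (xi0 (real k) \<omega>))"

lemma xi0_M: "0 \<le> t \<Longrightarrow> xi0 t \<in> borel_measurable M"
  using xi0_F measurable_F_M by blast

lemma up_integral_le:
  assumes \<omega>: "\<omega> \<in> space M" and q: "0 < q"
  shows "(\<integral>\<^sup>+t\<in>{0..}. ennreal (exp (- q * t) * X0 t \<omega>) \<partial>interval_measure (path xi0 \<omega>)) \<le> up_bound q \<omega>"
proof -
  let ?m = "interval_measure (path xi0 \<omega>)"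
  have ae: "AE t in ?m. 0 \<le> t \<longrightarrow> X0 t \<omega> = a"
    using AE_not_in[OF xi0_charges_barrier[OF \<omega>]] by eventually_elim (use X0_ge in \<open>auto intro: antisym\<close>)
  have "(\<integral>\<^sup>+t\<in>{0..}. ennreal (exp (- q * t) * X0 t \<omega>) \<partial>?m)
    \<le> (\<integral>\<^sup>+t. (\<Sum>k. ennreal (a * exp (- q * (real k - 1))) * indicator {real k - 1<..real k} t) \<partial>?m)"
  proof (rule nn_integral_mono_AE)
    show "AE t in ?m. ennreal (exp (- q * t) * X0 t \<omega>) * indicator {0..} t
      \<le> (\<Sum>k. ennreal (a * exp (- q * (real k - 1))) * indicator {real k - 1<..real k} t)"
      using ae
    proof eventually_elim
      case (elim t)
      show ?case
      proof (cases "0 \<le> t")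
        case True
        define k where "k = nat \<lceil>t\<rceil>"
        have "real k = of_int \<lceil>t\<rceil>" using True by (simp add: k_def)
        then have k: "real k - 1 < t" "t \<le> real k" by linarith+
        have "ennreal (exp (- q * t) * X0 t \<omega>) \<le> ennreal (a * exp (- q * (real k - 1)))"
          using elim True k q a_pos by (intro ennreal_leI) (auto simp: mult.commute)
        also have "\<dots> = (\<Sum>i\<in>{k}. ennreal (a * exp (- q * (real i - 1))) * indicator {real i - 1<..real i} t)"
          using k by simp
        also have "\<dots> \<le> (\<Sum>k. ennreal (a * exp (- q * (real k - 1))) * indicator {real k - 1<..real k} t)"
          by (rule sum_le_suminf) auto
        finally show ?thesis using True by simp
      qed simp
    qed
  qed
  also have "\<dots> = (\<Sum>k. \<integral>\<^sup>+t. ennreal (a * exp (- q * (real k - 1))) * indicator {real k - 1<..real k} t \<partial>?m)"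
    by (rule nn_integral_suminf) measurable
  also have "\<dots> \<le> up_bound q \<omega>"
    unfolding up_bound_def
  proof (intro suminf_le)
    fix k :: nat
    have "path xi0 \<omega> (real k) - path xi0 \<omega> (real k - 1) \<le> xi0 (real k) \<omega>"
      using xi0_nonneg[of "real k - 1" \<omega>] by (simp add: path_def)
    then show "(\<integral>\<^sup>+t. ennreal (a * exp (- q * (real k - 1))) * indicator {real k - 1<..real k} t \<partial>?m)
        \<le> ennreal (a * exp (- q * (real k - 1))) * ennreal (xi0 (real k) \<omega>)"
      by (subst nn_integral_cmult_indicator) (auto simp: emeasure_xi0[OF \<omega>] intro!: mult_left_mono ennreal_leI)
  qed auto
  finally show ?thesis .
qed

lemma up_bound_M: "up_bound q \<in> borel_measurable M"
proof -
  have [measurable]: "xi0 (real k) \<in> borel_measurable M" for k by (rule xi0_M) simp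
  show ?thesis unfolding up_bound_def[abs_def] by measurable
qed

text \<open>The mean of \<open>xi0 k\<close> is bounded by a multiple of
  \<open>exp (q * k / 2)\<close>, so discounting at rate \<open>q\<close> leaves a geometric series
  with ratio \<open>exp (- q / 2)\<close>.\<close>

lemma up_bound_finite:
  assumes q: "0 < q"
  shows "(\<integral>\<^sup>+\<omega>. up_bound q \<omega> \<partial>M) < \<infinity>"
proof -
  define C0 where "C0 = \<bar>r - g - \<sigma>\<^sup>2 / 2\<bar> * (2 / q) + \<sigma> * (8 / sqrt q)"
  define C where "C = a * exp q * C0"
  have C0: "0 \<le> C0" "0 \<le> C" using q pos a_pos by (auto simp: C0_def C_def)
  have xi: "(\<integral>\<^sup>+\<omega>. ennreal (xi0 (real k) \<omega>) \<partial>M) \<le> ennreal (C0 * exp (q * real k / 2))" for k :: nat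
  proof -
    have "(\<integral>\<^sup>+\<omega>. ennreal (xi0 (real k) \<omega>) \<partial>M)
      \<le> (\<integral>\<^sup>+\<omega>. ennreal (\<bar>r - g - \<sigma>\<^sup>2 / 2\<bar> * real k) + ennreal (\<sigma> / sqrt q) * ennreal (exp (sqrt q * Wsup 0 (real k) \<omega>)) \<partial>M)"
    proof (intro nn_integral_mono)
      fix \<omega>
      \<comment> \<open>The parameter \<open>sqrt q\<close> makes the exponential moment grow at
        rate \<open>q / 2\<close>, half of the discount rate; the 8 in \<open>C0\<close> is that of
        \<open>exp_Wsup'\<close>.\<close>
      have "sqrt q * Wsup 0 (real k) \<omega> \<le> exp (sqrt q * Wsup 0 (real k) \<omega>)"
        using exp_ge_add_one_self[of "sqrt q * Wsup 0 (real k) \<omega>"] by linarith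
      then have "\<sigma> * Wsup 0 (real k) \<omega> \<le> \<sigma> / sqrt q * exp (sqrt q * Wsup 0 (real k) \<omega>)"
        using q pos by (simp add: field_simps)
      then have "xi0 (real k) \<omega> \<le> \<bar>r - g - \<sigma>\<^sup>2 / 2\<bar> * real k + \<sigma> / sqrt q * exp (sqrt q * Wsup 0 (real k) \<omega>)"
        using xi0_le[of "real k" "real k" \<omega>] by (simp add: K_def)
      then have "ennreal (xi0 (real k) \<omega>) \<le> ennreal (\<bar>r - g - \<sigma>\<^sup>2 / 2\<bar> * real k) + ennreal (\<sigma> / sqrt q * exp (sqrt q * Wsup 0 (real k) \<omega>))"
        by (rule order_trans[OF ennreal_leI ennreal_add_le])
      also have "ennreal (\<sigma> / sqrt q * exp (sqrt q * Wsup 0 (real k) \<omega>)) = ennreal (\<sigma> / sqrt q) * ennreal (exp (sqrt q * Wsup 0 (real k) \<omega>))"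
        using q pos by (intro ennreal_mult) auto
      finally show "ennreal (xi0 (real k) \<omega>) \<le> ennreal (\<bar>r - g - \<sigma>\<^sup>2 / 2\<bar> * real k) + ennreal (\<sigma> / sqrt q) * ennreal (exp (sqrt q * Wsup 0 (real k) \<omega>))" .
    qed
    also have "\<dots> = ennreal (\<bar>r - g - \<sigma>\<^sup>2 / 2\<bar> * real k) + ennreal (\<sigma> / sqrt q) * (\<integral>\<^sup>+\<omega>. ennreal (exp (sqrt q * Wsup 0 (real k) \<omega>)) \<partial>M)"
      using Wsup_M[of 0 "real k"] by (simp add: nn_integral_add nn_integral_cmult emeasure_space_1)
    also have "\<dots> \<le> ennreal (\<bar>r - g - \<sigma>\<^sup>2 / 2\<bar> * (2 / q * exp (q * real k / 2))) + ennreal (\<sigma> / sqrt q) * ennreal (8 * exp ((sqrt q)\<^sup>2 * real k / 2))"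
    proof (intro add_mono ennreal_leI mult_left_mono exp_Wsup')
      have "q * real k / 2 \<le> exp (q * real k / 2)" using exp_ge_add_one_self[of "q * real k / 2"] by linarith
      then show "real k \<le> 2 / q * exp (q * real k / 2)" using q by (simp add: field_simps)
    qed (use q in auto)
    also have "\<dots> = ennreal (\<bar>r - g - \<sigma>\<^sup>2 / 2\<bar> * (2 / q * exp (q * real k / 2))) + ennreal (\<sigma> / sqrt q * (8 * exp (q * real k / 2)))"
      using q pos by (subst ennreal_mult[symmetric]) auto
    also have "\<dots> = ennreal (C0 * exp (q * real k / 2))"
      using q pos by (subst ennreal_plus[symmetric]) (auto simp: C0_def algebra_simps)
    finally show ?thesis .
  qed
  have "(\<integral>\<^sup>+\<omega>. up_bound q \<omega> \<partial>M) = (\<Sum>k. \<integral>\<^sup>+\<omega>. ennreal (a * exp (- q * (real k - 1))) * ennreal (xi0 (real k) \<omega>) \<partial>M)"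
    unfolding up_bound_def using xi0_M by (intro nn_integral_suminf) auto
  also have "\<dots> \<le> (\<Sum>k. ennreal (C * exp (- q / 2) ^ k))"
  proof (intro suminf_le)
    fix k :: nat
    have "(\<integral>\<^sup>+\<omega>. ennreal (a * exp (- q * (real k - 1))) * ennreal (xi0 (real k) \<omega>) \<partial>M)
      = ennreal (a * exp (- q * (real k - 1))) * (\<integral>\<^sup>+\<omega>. ennreal (xi0 (real k) \<omega>) \<partial>M)"
      using xi0_M[of "real k"] by (intro nn_integral_cmult) simp
    also have "\<dots> \<le> ennreal (a * exp (- q * (real k - 1))) * ennreal (C0 * exp (q * real k / 2))"
      by (intro mult_left_mono xi) simp
    also have "\<dots> = ennreal (a * exp (- q * (real k - 1)) * (C0 * exp (q * real k / 2)))"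
      using a_pos C0 by (intro ennreal_mult[symmetric]) auto
    also have "a * exp (- q * (real k - 1)) * (C0 * exp (q * real k / 2)) = C * exp (- q / 2) ^ k"
    proof -
      have "exp (- q * (real k - 1)) * exp (q * real k / 2) = exp q * exp (real k * (- q / 2))"
        unfolding exp_add[symmetric] by (simp add: field_simps)
      then show ?thesis by (simp add: C_def exp_of_nat_mult[symmetric])
    qed
    finally show "(\<integral>\<^sup>+\<omega>. ennreal (a * exp (- q * (real k - 1))) * ennreal (xi0 (real k) \<omega>) \<partial>M) \<le> ennreal (C * exp (- q / 2) ^ k)" .
  qed auto
  also have "\<dots> < \<infinity>"
  proof -
    have "summable (\<lambda>k. C * exp (- q / 2) ^ k)" using q by (intro summable_mult summable_geometric) simp
    then show ?thesis using C0 by (simp add: less_top ennreal_suminf_neq_top)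
  qed
  finally show ?thesis .
qed

end

section \<open>Admissibility and uniqueness of the reflection\<close>

lemma jump_path_0: "jump (path v \<omega>) 0 = v 0 \<omega>"
  using left_lim_at_0[of "path v \<omega>" 0] by (simp add: jump_def path_def)

lemma (in brownian_motion) controls_shift:
  assumes "v \<in> controls" "0 \<le> c" shows "(\<lambda>t \<omega>. c + v t \<omega>) \<in> controls"
  unfolding controls_def mem_Collect_eq
proof (intro conjI allI impI ballI)
  fix t :: real assume "0 \<le> t"
  then have [measurable]: "v t \<in> borel_measurable (F t)" using assms by (auto simp: controls_def)
  show "(\<lambda>\<omega>. c + v t \<omega>) \<in> borel_measurable (F t)" by measurable
next
  fix \<omega> assume \<omega>: "\<omega> \<in> space M"
  have m: "mono_on {0..} (\<lambda>t. v t \<omega>)" and cl: "cadlag (\<lambda>t. v t \<omega>)"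
    using assms(1) \<omega> by (auto simp: controls_def)
  show "mono_on {0..} (\<lambda>t. c + v t \<omega>)" by (rule mono_onI) (use mono_onD[OF m] in auto)
  show "cadlag (\<lambda>t. c + v t \<omega>)"
    unfolding cadlag_def
  proof (intro conjI allI impI)
    fix t :: real assume t: "0 < t"
    then obtain l where "((\<lambda>t. v t \<omega>) \<longlongrightarrow> l) (at_left t)" using cl by (auto simp: cadlag_def)
    then have "((\<lambda>t. c + v t \<omega>) \<longlongrightarrow> c + l) (at_left t)" by (intro tendsto_intros)
    then show "\<exists>l. ((\<lambda>t. c + v t \<omega>) \<longlongrightarrow> l) (at_left t)" ..
  qed (use cl in \<open>auto simp: cadlag_def intro!: continuous_intros\<close>)
  show "0 \<le> c + v t \<omega>" if "0 \<le> t" for t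
    using assms \<omega> that by (auto simp: controls_def)
qed

context reflected
begin

definition reflection_cost :: ennreal where
  "reflection_cost = (\<integral>\<^sup>+\<omega>. (\<integral>\<^sup>+t\<in>{0..}. ennreal (exp (- lam * t) * (\<alpha> * max 0 (X0 t \<omega> - m))) \<partial>lborel) \<partial>M)"

text \<open>The policy differs from \<open>xi0\<close> by its initial jump. As \<open>xi0\<close> is
  continuous and starts at 0, that jump is the only one, and removing it returns
  \<open>xi0\<close>.\<close>

lemma shifted_path:
  assumes \<xi>: "\<And>t. 0 \<le> t \<Longrightarrow> \<xi> t \<omega> = c + xi0 t \<omega>"
  shows "0 < t \<Longrightarrow> jump (path \<xi> \<omega>) t = 0" and "jump (path \<xi> \<omega>) 0 = c"
    and "cont_part (path \<xi> \<omega>) = path xi0 \<omega>"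
proof -
  show pos: "jump (path \<xi> \<omega>) t = 0" if "0 < t" for t
  proof -
    have "((\<lambda>s. c + xi0 s \<omega>) \<longlongrightarrow> c + xi0 t \<omega>) (at_left t)"
      by (intro tendsto_intros continuous_on_left[OF xi0_cont that])
    moreover have "\<forall>\<^sub>F s in at_left t. c + xi0 s \<omega> = path \<xi> \<omega> s"
      unfolding eventually_at_left[OF that] by (intro exI[of _ 0]) (use that \<xi> in \<open>auto simp: path_def\<close>)
    ultimately have "(path \<xi> \<omega> \<longlongrightarrow> c + xi0 t \<omega>) (at_left t)"
      by (rule Lim_transform_eventually)
    then show ?thesis using that \<xi> by (simp add: jump_def left_lim_eqI path_def)
  qed
  show zero: "jump (path \<xi> \<omega>) 0 = c" using \<xi>[of 0] by (simp add: jump_path_0)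
  show "cont_part (path \<xi> \<omega>) = path xi0 \<omega>"
  proof
    fix t
    show "cont_part (path \<xi> \<omega>) t = path xi0 \<omega> t"
    proof (cases "0 \<le> t")
      case True
      have "infsum (jump (path \<xi> \<omega>)) {0..t} = infsum (jump (path \<xi> \<omega>)) {0}"
        by (rule infsum_cong_neutral) (use True pos in auto)
      then show ?thesis using True \<xi> zero by (simp add: cont_part_def path_def)
    qed (simp add: cont_part_def path_def)
  qed
qed

lemma X_shifted:
  assumes "\<forall>x \<xi> \<eta> t. 0 \<le> t \<longrightarrow> X x \<xi> \<eta> \<omega> t = x * exp (B t \<omega> + \<xi> t \<omega> - \<eta> t \<omega>)"
    and "\<And>t. 0 \<le> t \<Longrightarrow> \<xi> t \<omega> = c + xi0 t \<omega>" and "0 \<le> t"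
  shows "X x \<xi> (\<lambda>t \<omega>. 0) \<omega> t = x * exp c / y * X0 t \<omega>"
  using assms y_pos by (simp add: X0_def Z0_def exp_add)

lemma left_lim_X_0: "left_lim (X x \<xi> \<eta> \<omega>) 0 = x"
  by (rule left_lim_at_0) (simp add: X_def)

lemma up_cost_shifted_le:
  assumes X: "\<forall>x \<xi> \<eta> t. 0 \<le> t \<longrightarrow> X x \<xi> \<eta> \<omega> t = x * exp (B t \<omega> + \<xi> t \<omega> - \<eta> t \<omega>)"
    and \<xi>: "\<And>t. 0 \<le> t \<Longrightarrow> \<xi> t \<omega> = c + xi0 t \<omega>" and \<omega>: "\<omega> \<in> space M" and x: "0 < x" and q: "0 < q"
  shows "up_cost q x \<xi> (\<lambda>t \<omega>. 0) \<omega> \<le> ennreal (x * exp c / y) * up_bound q \<omega> + ennreal (x * (exp c - 1))"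
proof -
  define k where "k = x * exp c / y"
  have k: "0 \<le> k" using x y_pos by (simp add: k_def)
  let ?X = "X x \<xi> (\<lambda>t \<omega>. 0) \<omega>"
  have XX: "?X t = k * X0 t \<omega>" if "0 \<le> t" for t
    unfolding k_def by (rule X_shifted[OF X]) (use \<xi> that in auto)
  have meas: "(\<lambda>t. ennreal (exp (- q * t) * X0 t \<omega>) * indicator {0..} t) \<in> borel_measurable (interval_measure (path xi0 \<omega>))"
  proof -
    have "(\<lambda>t. ennreal (exp (- q * t) * X0 (max 0 t) \<omega>) * indicator {0..} t) \<in> borel_measurable (interval_measure (path xi0 \<omega>))"
      by measurable
    also have "(\<lambda>t. ennreal (exp (- q * t) * X0 (max 0 t) \<omega>) * indicator {0..} t) = (\<lambda>t. ennreal (exp (- q * t) * X0 t \<omega>) * indicator {0..} t)"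
      by (auto simp: fun_eq_iff split: split_indicator)
    finally show ?thesis .
  qed
  have "(\<integral>\<^sup>+t\<in>{0..}. ennreal (exp (- q * t) * ?X t) \<partial>interval_measure (cont_part (path \<xi> \<omega>)))
    = (\<integral>\<^sup>+t. ennreal k * (ennreal (exp (- q * t) * X0 t \<omega>) * indicator {0..} t) \<partial>interval_measure (path xi0 \<omega>))"
    unfolding shifted_path(3)[of \<xi> \<omega> c, OF \<xi>, simplified]
    by (intro nn_integral_cong)
       (use k in \<open>auto simp: XX ennreal_mult[symmetric] X0_pos less_imp_le ac_simps split: split_indicator\<close>)
  also have "\<dots> = ennreal k * (\<integral>\<^sup>+t\<in>{0..}. ennreal (exp (- q * t) * X0 t \<omega>) \<partial>interval_measure (path xi0 \<omega>))"
    by (rule nn_integral_cmult[OF meas])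
  also have "\<dots> \<le> ennreal k * up_bound q \<omega>"
    by (intro mult_left_mono up_integral_le[OF \<omega> q]) simp
  finally have 1: "(\<integral>\<^sup>+t\<in>{0..}. ennreal (exp (- q * t) * ?X t) \<partial>interval_measure (cont_part (path \<xi> \<omega>))) \<le> ennreal k * up_bound q \<omega>" .
  have "(\<integral>\<^sup>+t. ennreal (exp (- q * t) * (left_lim ?X t * (exp (jump (path \<xi> \<omega>) t) - 1))) \<partial>count_space {0..})
    = (\<integral>\<^sup>+t. ennreal (x * (exp c - 1)) * indicator {0} (t :: real) \<partial>count_space {0..})"
  proof (intro nn_integral_cong)
    fix t :: real assume "t \<in> space (count_space {0..})"
    then consider "t = 0" | "0 < t" by fastforce
    then show "ennreal (exp (- q * t) * (left_lim ?X t * (exp (jump (path \<xi> \<omega>) t) - 1))) = ennreal (x * (exp c - 1)) * indicator {0} t"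
      using shifted_path(1,2)[of \<xi> \<omega> c, OF \<xi>] by cases (auto simp: left_lim_X_0)
  qed
  also have "\<dots> = ennreal (x * (exp c - 1))" by (subst nn_integral_cmult_indicator) auto
  finally show ?thesis unfolding up_cost_def k_def[symmetric] using 1 by (simp add: add_right_mono)
qed

lemma J2_shifted:
  assumes \<xi>: "AE \<omega> in M. \<forall>t\<ge>0. \<xi> t \<omega> = c + xi0 t \<omega>"
  shows "J2 x \<xi> (\<lambda>t \<omega>. 0) = (\<integral>\<^sup>+\<omega>. (\<integral>\<^sup>+t\<in>{0..}. ennreal (exp (- lam * t) * (\<alpha> * max 0 (x * exp c / y * X0 t \<omega> - m))) \<partial>lborel) \<partial>M)"
  unfolding J2_def down_cost_zero
proof (rule nn_integral_cong_AE)
  show "AE \<omega> in M. (\<integral>\<^sup>+t\<in>{0..}. ennreal (exp (- lam * t) * (\<alpha> * max 0 (X x \<xi> (\<lambda>t \<omega>. 0) \<omega> t - m))) \<partial>lborel) + ennreal \<kappa> * 0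
     = (\<integral>\<^sup>+t\<in>{0..}. ennreal (exp (- lam * t) * (\<alpha> * max 0 (x * exp c / y * X0 t \<omega> - m))) \<partial>lborel)"
    using AE_X \<xi>
  proof eventually_elim
    case (elim \<omega>)
    then show ?case using X_shifted[of \<omega> \<xi> c _ x]
      by (auto intro!: nn_integral_cong split: split_indicator)
  qed
qed

text \<open>Admissibility is demanded for every initial value, also where the control does not
  reflect at \<open>a\<close>. By \<open>X_shifted\<close> the state is then a constant multiple of
  \<open>X0\<close>, so the bounds for \<open>X0\<close> scale.\<close>

lemma admissible_shifted:
  assumes c: "\<xi> \<in> controls" and \<xi>: "AE \<omega> in M. \<forall>t\<ge>0. \<xi> t \<omega> = c + xi0 t \<omega>"
  shows "(\<xi>, \<lambda>t \<omega>. 0) \<in> admissible"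
  unfolding admissible_def mem_Collect_eq prod.case mem_Times_iff fst_conv snd_conv
proof (intro conjI allI impI c zero_control)
  fix x :: real assume x: "0 < x"
  define k where "k = x * exp c / y"
  have k: "0 \<le> k" using x y_pos by (simp add: k_def)
  have "J2 x \<xi> (\<lambda>t \<omega>. 0) \<le> (\<integral>\<^sup>+\<omega>. ennreal (\<alpha> * k) * (\<integral>\<^sup>+t\<in>{0..}. ennreal (exp (- lam * t) * X0 t \<omega> ^ 1) \<partial>lborel) \<partial>M)"
    unfolding J2_shifted[OF \<xi>] k_def[symmetric]
  proof (intro nn_integral_mono)
    fix \<omega>
    have "(\<integral>\<^sup>+t\<in>{0..}. ennreal (exp (- lam * t) * (\<alpha> * max 0 (k * X0 t \<omega> - m))) \<partial>lborel)
      \<le> (\<integral>\<^sup>+t. ennreal (\<alpha> * k) * (ennreal (exp (- lam * t) * X0 (max 0 t) \<omega> ^ 1) * indicator {0..} t) \<partial>lborel)"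
    proof (intro nn_integral_mono)
      fix t :: real
      have "exp (- lam * t) * (\<alpha> * max 0 (k * X0 t \<omega> - m)) \<le> \<alpha> * k * (exp (- lam * t) * X0 t \<omega>)" 
      proof -
        have "max 0 (k * X0 t \<omega> - m) \<le> k * X0 t \<omega>" using k X0_pos[of t \<omega>] pos by simp
        then have "exp (- lam * t) * \<alpha> * max 0 (k * X0 t \<omega> - m) \<le> exp (- lam * t) * \<alpha> * (k * X0 t \<omega>)"
          using pos by (intro mult_left_mono) auto
        then show ?thesis by (simp add: ac_simps)
      qed
      then show "ennreal (exp (- lam * t) * (\<alpha> * max 0 (k * X0 t \<omega> - m))) * indicator {0..} t
          \<le> ennreal (\<alpha> * k) * (ennreal (exp (- lam * t) * X0 (max 0 t) \<omega> ^ 1) * indicator {0..} t)"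
        using k pos X0_pos[of t \<omega>] by (auto split: split_indicator simp: ennreal_mult[symmetric] intro!: ennreal_leI)
    qed
    also have "\<dots> = ennreal (\<alpha> * k) * (\<integral>\<^sup>+t\<in>{0..}. ennreal (exp (- lam * t) * X0 (max 0 t) \<omega> ^ 1) \<partial>lborel)"
      by (rule nn_integral_cmult) measurable
    also have "(\<integral>\<^sup>+t\<in>{0..}. ennreal (exp (- lam * t) * X0 (max 0 t) \<omega> ^ 1) \<partial>lborel) = (\<integral>\<^sup>+t\<in>{0..}. ennreal (exp (- lam * t) * X0 t \<omega> ^ 1) \<partial>lborel)"
      by (intro nn_integral_cong) (auto split: split_indicator)
    finally show "(\<integral>\<^sup>+t\<in>{0..}. ennreal (exp (- lam * t) * (\<alpha> * max 0 (k * X0 t \<omega> - m))) \<partial>lborel)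
      \<le> ennreal (\<alpha> * k) * (\<integral>\<^sup>+t\<in>{0..}. ennreal (exp (- lam * t) * X0 t \<omega> ^ 1) \<partial>lborel)" .
  qed
  also have "\<dots> = ennreal (\<alpha> * k) * (\<integral>\<^sup>+\<omega>. (\<integral>\<^sup>+t\<in>{0..}. ennreal (exp (- lam * t) * X0 t \<omega> ^ 1) \<partial>lborel) \<partial>M)"
    by (rule nn_integral_cmult, rule nn_integral_swap(2)) measurable
  also have "\<dots> < \<infinity>"
    using discounted_moment_finite[of 1 lam] lam_gt pos by (simp add: ennreal_mult_less_top growth_1)
  finally show "J2 x \<xi> (\<lambda>t \<omega>. 0) < \<infinity>" .
  define I where "I \<omega> = (\<integral>\<^sup>+t\<in>{0..}. ennreal (exp (- \<rho> * t) * X0 t \<omega> ^ 2) \<partial>lborel)" for \<omega>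
  have I[measurable]: "I \<in> borel_measurable M" unfolding I_def[abs_def] by (rule nn_integral_swap(2)) measurable
  note [measurable] = up_bound_M
  have "J1 x \<xi> (\<lambda>t \<omega>. 0) \<le> (\<integral>\<^sup>+\<omega>. ennreal (k\<^sup>2 / 2) * I \<omega> + ennreal c2 * (ennreal k * up_bound \<rho> \<omega> + ennreal (x * (exp c - 1))) \<partial>M)"
    unfolding J1_def down_cost_zero
  proof (rule nn_integral_mono_AE)
    show "AE \<omega> in M. (\<integral>\<^sup>+t\<in>{0..}. ennreal (exp (- \<rho> * t) * ((X x \<xi> (\<lambda>t \<omega>. 0) \<omega> t)\<^sup>2 / 2)) \<partial>lborel) + ennreal c1 * 0 + ennreal c2 * up_cost \<rho> x \<xi> (\<lambda>t \<omega>. 0) \<omega>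
      \<le> ennreal (k\<^sup>2 / 2) * I \<omega> + ennreal c2 * (ennreal k * up_bound \<rho> \<omega> + ennreal (x * (exp c - 1)))"
      using AE_X \<xi>
    proof eventually_elim
      case (elim \<omega>)
      have "(\<integral>\<^sup>+t\<in>{0..}. ennreal (exp (- \<rho> * t) * ((X x \<xi> (\<lambda>t \<omega>. 0) \<omega> t)\<^sup>2 / 2)) \<partial>lborel)
        = (\<integral>\<^sup>+t. ennreal (k\<^sup>2 / 2) * (ennreal (exp (- \<rho> * t) * X0 (max 0 t) \<omega> ^ 2) * indicator {0..} t) \<partial>lborel)"
        using elim X_shifted[of \<omega> \<xi> c _ x]
        by (intro nn_integral_cong)
           (auto split: split_indicator simp: k_def[symmetric] ennreal_mult[symmetric] power_mult_distrib ac_simps)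
      also have "\<dots> = ennreal (k\<^sup>2 / 2) * (\<integral>\<^sup>+t\<in>{0..}. ennreal (exp (- \<rho> * t) * X0 (max 0 t) \<omega> ^ 2) \<partial>lborel)"
        by (rule nn_integral_cmult) measurable
      also have "(\<integral>\<^sup>+t\<in>{0..}. ennreal (exp (- \<rho> * t) * X0 (max 0 t) \<omega> ^ 2) \<partial>lborel) = I \<omega>"
        unfolding I_def by (intro nn_integral_cong) (auto split: split_indicator)
      finally have "(\<integral>\<^sup>+t\<in>{0..}. ennreal (exp (- \<rho> * t) * ((X x \<xi> (\<lambda>t \<omega>. 0) \<omega> t)\<^sup>2 / 2)) \<partial>lborel) = ennreal (k\<^sup>2 / 2) * I \<omega>" .
      moreover have "up_cost \<rho> x \<xi> (\<lambda>t \<omega>. 0) \<omega> \<le> ennreal k * up_bound \<rho> \<omega> + ennreal (x * (exp c - 1))"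
        unfolding k_def by (rule up_cost_shifted_le) (use elim x pos in auto)
      ultimately show ?case by (auto intro!: add_mono mult_left_mono)
    qed
  qed
  also have "\<dots> = ennreal (k\<^sup>2 / 2) * (\<integral>\<^sup>+\<omega>. I \<omega> \<partial>M) + ennreal c2 * (ennreal k * (\<integral>\<^sup>+\<omega>. up_bound \<rho> \<omega> \<partial>M) + ennreal (x * (exp c - 1)))"
    by (simp add: nn_integral_add nn_integral_cmult emeasure_space_1)
  also have "\<dots> < \<infinity>"
    using discounted_moment_finite[of 2 \<rho>] up_bound_finite[of \<rho>] \<rho>_gt pos
    by (simp add: I_def growth_2 ennreal_mult_less_top)
  finally show "J1 x \<xi> (\<lambda>t \<omega>. 0) < \<infinity>" .
next
  fix t :: real
  show "AE \<omega> in M. \<not> 0 < jump (path \<xi> \<omega>) t * jump (path (\<lambda>t \<omega>. 0) \<omega>) t"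
    by (simp add: zero_path jump_const)
qed

lemma reflects_zero_unique:
  assumes "reflects a y (\<lambda>t \<omega>. 0) \<xi>"
  shows "AE \<omega> in M. \<forall>t\<ge>0. \<xi> t \<omega> = xi0 t \<omega>"
proof -
  have c: "\<xi> \<in> controls" using assms by (auto simp: reflects_def admissible_up_def)
  have "AE \<omega> in M. \<forall>t>0. a \<le> X y \<xi> (\<lambda>t \<omega>. 0) \<omega> t"
    and "AE \<omega> in M. \<forall>T>0. (\<integral>\<^sup>+t\<in>{0..T}. indicator {t. X y \<xi> (\<lambda>t \<omega>. 0) \<omega> t > a} t \<partial>interval_measure (path \<xi> \<omega>)) = 0"
    using assms by (auto simp: reflects_def)
  then show ?thesis using AE_X
  proof eventually_elim
    case (elim \<omega>)
    then have X: "X y \<xi> (\<lambda>t \<omega>. 0) \<omega> t = y * exp (B t \<omega> + path \<xi> \<omega> t)" if "0 \<le> t" for t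
      using that by (simp add: path_def)
    show ?case
    proof (intro allI impI)
      fix t :: real assume t: "0 \<le> t"
      have "path \<xi> \<omega> t = xi0 t \<omega>"
      proof (rule reflecting_unique_path[OF _ controls_path[OF c]])
        show "a \<le> y * exp (B t \<omega> + path \<xi> \<omega> t)" if "0 < t" for t
          using elim(1) X[of t] that by (metis less_imp_le)
        fix T :: real assume "0 < T"
        then have "(\<integral>\<^sup>+t\<in>{0..T}. indicator {t. X y \<xi> (\<lambda>t \<omega>. 0) \<omega> t > a} t \<partial>interval_measure (path \<xi> \<omega>)) = 0"
          using elim(2) by blast
        also have "(\<integral>\<^sup>+t\<in>{0..T}. indicator {t. X y \<xi> (\<lambda>t \<omega>. 0) \<omega> t > a} t \<partial>interval_measure (path \<xi> \<omega>))
          = (\<integral>\<^sup>+t\<in>{0..T}. indicator {t. y * exp (B t \<omega> + path \<xi> \<omega> t) > a} t \<partial>interval_measure (path \<xi> \<omega>))"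
          by (intro nn_integral_cong) (auto split: split_indicator simp: X)
        finally show "(\<integral>\<^sup>+t\<in>{0..T}. indicator {t. y * exp (B t \<omega> + path \<xi> \<omega> t) > a} t \<partial>interval_measure (path \<xi> \<omega>)) = 0" .
      qed (use elim t in auto)
      then show "\<xi> t \<omega> = xi0 t \<omega>" using t by (simp add: path_def)
    qed
  qed
qed

lemma reflects_xi0: "reflects a y (\<lambda>t \<omega>. 0) xi0"
  unfolding reflects_def admissible_up_def mem_Collect_eq
proof (intro conjI xi0_controls)
  show "(xi0, \<lambda>t \<omega>. 0) \<in> admissible"
    by (rule admissible_shifted[OF xi0_controls, of 0]) simp
  have X: "AE \<omega> in M. \<omega> \<in> space M \<and> (\<forall>t\<ge>0. X y xi0 (\<lambda>t \<omega>. 0) \<omega> t = X0 t \<omega>)"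
    using AE_X by eventually_elim (auto simp: X0_def Z0_def exp_add)
  from X show "AE \<omega> in M. \<forall>t>0. a \<le> X y xi0 (\<lambda>t \<omega>. 0) \<omega> t"
    by eventually_elim (auto simp: X0_ge)
  from X show "AE \<omega> in M. \<forall>T>0. (\<integral>\<^sup>+t\<in>{0..T}. indicator {t. X y xi0 (\<lambda>t \<omega>. 0) \<omega> t > a} t \<partial>interval_measure (path xi0 \<omega>)) = 0"
  proof eventually_elim
    case (elim \<omega>)
    show ?case
    proof (intro allI impI)
      fix T :: real
      have "(\<integral>\<^sup>+t\<in>{0..T}. indicator {t. X y xi0 (\<lambda>t \<omega>. 0) \<omega> t > a} t \<partial>interval_measure (path xi0 \<omega>))
        \<le> (\<integral>\<^sup>+t. indicator {t. 0 \<le> t \<and> X0 t \<omega> > a} t \<partial>interval_measure (path xi0 \<omega>))"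
        by (intro nn_integral_mono) (use elim in \<open>auto split: split_indicator\<close>)
      also have "\<dots> = 0"
        using xi0_charges_barrier[of \<omega>] elim by (subst nn_integral_indicator) auto
      finally show "(\<integral>\<^sup>+t\<in>{0..T}. indicator {t. X y xi0 (\<lambda>t \<omega>. 0) \<omega> t > a} t \<partial>interval_measure (path xi0 \<omega>)) = 0" by simp
    qed
  qed
qed

lemma unique_reflects_xi0: "unique_reflects a y (\<lambda>t \<omega>. 0) xi0"
  unfolding unique_reflects_def using reflects_xi0 reflects_zero_unique by auto

context
  fixes x :: real
  assumes x: "0 < x" and y: "y = max x a"
begin

lemma initial_jump: "x * exp (max 0 (ln (a / x))) = y"
proof (cases "x \<le> a")
  case True
  then have "1 \<le> a / x" using x by simp
  then have "0 \<le> ln (a / x)" by simp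
  then show ?thesis using True x a_pos y by (simp add: max_def)
next
  case False
  then have "ln (a / x) \<le> 0" using x a_pos by (simp add: ln_div)
  then show ?thesis using False y by (simp add: max_def)
qed

text \<open>The choice operator may return another version of the reflecting control; uniqueness
  makes it indistinguishable from \<open>xi0\<close>, which is all that the costs can see.\<close>

lemma reflection_policy_zero:
  "AE \<omega> in M. \<forall>t\<ge>0. reflection_policy a x (\<lambda>t \<omega>. 0) t \<omega> = max 0 (ln (a / x)) + xi0 t \<omega>"
  "reflection_policy a x (\<lambda>t \<omega>. 0) \<in> controls"
proof -
  define \<xi> where "\<xi> = (SOME \<xi>. unique_reflects a (max x a) (\<lambda>t \<omega>. 0) \<xi>)"
  have "unique_reflects a (max x a) (\<lambda>t \<omega>. 0) \<xi>"
    unfolding \<xi>_def by (rule someI[of _ xi0]) (use unique_reflects_xi0 y in simp)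
  then have r: "reflects a y (\<lambda>t \<omega>. 0) \<xi>" using y by (simp add: unique_reflects_def)
  have eq: "reflection_policy a x (\<lambda>t \<omega>. 0) = (\<lambda>t \<omega>. max 0 (ln (a / x)) + \<xi> t \<omega>)"
    by (simp add: reflection_policy_def \<xi>_def fun_eq_iff)
  show "AE \<omega> in M. \<forall>t\<ge>0. reflection_policy a x (\<lambda>t \<omega>. 0) t \<omega> = max 0 (ln (a / x)) + xi0 t \<omega>"
    using reflects_zero_unique[OF r] by (simp add: eq)
  have "\<xi> \<in> controls" using r by (auto simp: reflects_def admissible_up_def)
  then show "reflection_policy a x (\<lambda>t \<omega>. 0) \<in> controls" unfolding eq by (rule controls_shift) simp
qed

lemma zero_response: "(\<lambda>t \<omega>. 0) \<in> admissible_responses a x"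
  unfolding admissible_responses_def mem_Collect_eq admissible_down_def
  using unique_reflects_xi0 y zero_control admissible_shifted[OF reflection_policy_zero(2) reflection_policy_zero(1)]
  by auto

lemma J2_zero: "J2 x (reflection_policy a x (\<lambda>t \<omega>. 0)) (\<lambda>t \<omega>. 0) = reflection_cost"
  unfolding J2_shifted[OF reflection_policy_zero(1)] initial_jump reflection_cost_def using y_pos by simp

end

end

section \<open>Lower bound for the cost of a response\<close>

lemma nn_integral_exp_interval:
  fixes c :: real
  assumes "u \<le> v" "0 < c"
  shows "(\<integral>\<^sup>+t\<in>{u<..v}. ennreal (c * exp (- c * t)) \<partial>lborel) \<le> ennreal (exp (- c * u) - exp (- c * v))"
proof -
  have "(\<integral>\<^sup>+t\<in>{u<..v}. ennreal (c * exp (- c * t)) \<partial>lborel) \<le> (\<integral>\<^sup>+t\<in>{u..v}. ennreal (c * exp (- c * t)) \<partial>lborel)"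
    by (intro nn_integral_mono) (auto split: split_indicator)
  also have "\<dots> = ennreal (- exp (- c * v) - (- exp (- c * u)))"
    by (rule nn_integral_FTC_Icc[where F = "\<lambda>t. - exp (- c * t)"])
       (use assms in \<open>auto intro!: derivative_eq_intros\<close>)
  finally show ?thesis by simp
qed

text \<open>Integration by parts for the increasing function \<open>D\<close>. An equality becomes
  an inequality because \<open>D\<close> is bounded on each cell by its right value and the discount
  by its left one. The boundary term is carried along to make the induction close.\<close>

lemma discounted_integral_le_sum:
  fixes D :: "real \<Rightarrow> real"
  assumes c: "0 < c" and D0: "\<And>t. 0 \<le> t \<Longrightarrow> 0 \<le> D t"
    and D: "\<And>s t. 0 \<le> s \<Longrightarrow> s \<le> t \<Longrightarrow> D s \<le> D t"
    and m: "(\<lambda>t. D (max 0 t)) \<in> borel_measurable borel"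
    and t: "t 0 = 0" "incseq t"
  shows "(\<integral>\<^sup>+s\<in>{0..t n}. ennreal (c * exp (- c * s) * D s) \<partial>lborel) + ennreal (exp (- c * t n) * D (t n))
    \<le> ennreal (D 0 + (\<Sum>k<n. exp (- c * t k) * (D (t (Suc k)) - D (t k))))"
proof (induction n)
  case 0
  have "(\<integral>\<^sup>+s\<in>{0..0}. ennreal (c * exp (- c * s) * D s) \<partial>lborel) = 0"
  proof -
    have "(\<integral>\<^sup>+s\<in>{0..0}. ennreal (c * exp (- c * s) * D s) \<partial>lborel) = (\<integral>\<^sup>+s. ennreal (c * D 0) * indicator {0} (s :: real) \<partial>lborel)"
      by (intro nn_integral_cong) (auto split: split_indicator)
    then show ?thesis by (simp add: nn_integral_cmult_indicator)
  qed
  then show ?case using t by simp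
next
  case (Suc n)
  have tn: "0 \<le> t n" "t n \<le> t (Suc n)" using t incseqD[OF t(2), of 0 n] incseqD[OF t(2), of n "Suc n"] by auto
  have eq: "ennreal (c * exp (- c * s) * D s) * indicator {0..T} s = ennreal (c * exp (- c * s) * D (max 0 s)) * indicator {0..T} s" for s T
    by (auto split: split_indicator)
  note [measurable] = m
  have "(\<integral>\<^sup>+s\<in>{0..t (Suc n)}. ennreal (c * exp (- c * s) * D s) \<partial>lborel)
    \<le> (\<integral>\<^sup>+s. ennreal (c * exp (- c * s) * D (max 0 s)) * indicator {0..t n} s + ennreal (c * exp (- c * s) * D (t (Suc n))) * indicator {t n<..t (Suc n)} s \<partial>lborel)"
    by (intro nn_integral_mono)
       (use tn c D in \<open>auto split: split_indicator intro!: ennreal_leI mult_left_mono\<close>)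
  also have "\<dots> = (\<integral>\<^sup>+s\<in>{0..t n}. ennreal (c * exp (- c * s) * D s) \<partial>lborel)
      + (\<integral>\<^sup>+s. ennreal (D (t (Suc n))) * (ennreal (c * exp (- c * s)) * indicator {t n<..t (Suc n)} s) \<partial>lborel)"
  proof -
    have m2: "(\<lambda>s. ennreal (c * exp (- c * s) * D (t (Suc n))) * indicator {t n<..t (Suc n)} s) \<in> borel_measurable lborel"
      by measurable
    have "(\<integral>\<^sup>+s. ennreal (c * exp (- c * s) * D (t (Suc n))) * indicator {t n<..t (Suc n)} s \<partial>lborel)
      = (\<integral>\<^sup>+s. ennreal (D (t (Suc n))) * (ennreal (c * exp (- c * s)) * indicator {t n<..t (Suc n)} s) \<partial>lborel)"
      using c D0[of "t (Suc n)"] tn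
      by (intro nn_integral_cong) (auto simp: ennreal_mult[symmetric] ac_simps split: split_indicator)
    then show ?thesis unfolding eq by (subst nn_integral_add[OF _ m2]) auto
  qed
  also have "(\<integral>\<^sup>+s. ennreal (D (t (Suc n))) * (ennreal (c * exp (- c * s)) * indicator {t n<..t (Suc n)} s) \<partial>lborel)
     = ennreal (D (t (Suc n))) * (\<integral>\<^sup>+s\<in>{t n<..t (Suc n)}. ennreal (c * exp (- c * s)) \<partial>lborel)"
    by (rule nn_integral_cmult) measurable
  also have "\<dots> \<le> ennreal (D (t (Suc n))) * ennreal (exp (- c * t n) - exp (- c * t (Suc n)))"
    by (intro mult_left_mono nn_integral_exp_interval tn c) simp
  also have "\<dots> = ennreal (D (t (Suc n)) * (exp (- c * t n) - exp (- c * t (Suc n))))"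
    using D0[of "t (Suc n)"] tn c by (intro ennreal_mult[symmetric]) auto
  finally have "(\<integral>\<^sup>+s\<in>{0..t (Suc n)}. ennreal (c * exp (- c * s) * D s) \<partial>lborel) + ennreal (exp (- c * t (Suc n)) * D (t (Suc n)))
    \<le> (\<integral>\<^sup>+s\<in>{0..t n}. ennreal (c * exp (- c * s) * D s) \<partial>lborel)
      + ennreal (D (t (Suc n)) * (exp (- c * t n) - exp (- c * t (Suc n)))) + ennreal (exp (- c * t (Suc n)) * D (t (Suc n)))"
    by (intro add_right_mono) (simp add: add_left_mono)
  also have "\<dots> = (\<integral>\<^sup>+s\<in>{0..t n}. ennreal (c * exp (- c * s) * D s) \<partial>lborel) + ennreal (exp (- c * t n) * D (t (Suc n)))"
    unfolding add.assoc using D0[of "t (Suc n)"] tn c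
    by (subst ennreal_plus[symmetric]) (auto simp: algebra_simps intro!: mult_left_mono)
  also have "ennreal (exp (- c * t n) * D (t (Suc n)))
    = ennreal (exp (- c * t n) * D (t n)) + ennreal (exp (- c * t n) * (D (t (Suc n)) - D (t n)))"
    using D0[of "t n"] D[OF tn] tn by (subst ennreal_plus[symmetric]) (auto simp: algebra_simps)
  also have "(\<integral>\<^sup>+s\<in>{0..t n}. ennreal (c * exp (- c * s) * D s) \<partial>lborel)
      + (ennreal (exp (- c * t n) * D (t n)) + ennreal (exp (- c * t n) * (D (t (Suc n)) - D (t n))))
    \<le> ennreal (D 0 + (\<Sum>k<n. exp (- c * t k) * (D (t (Suc k)) - D (t k)))) + ennreal (exp (- c * t n) * (D (t (Suc n)) - D (t n)))"
    unfolding add.assoc[symmetric] by (intro add_right_mono Suc.IH)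
  also have "\<dots> = ennreal (D 0 + (\<Sum>k<Suc n. exp (- c * t k) * (D (t (Suc k)) - D (t k))))"
  proof -
    have "0 \<le> (\<Sum>k<n. exp (- c * t k) * (D (t (Suc k)) - D (t k)))"
    proof (intro sum_nonneg mult_nonneg_nonneg)
      fix k
      have "0 \<le> t k" "t k \<le> t (Suc k)" using t incseqD[OF t(2), of 0 k] incseqD[OF t(2), of k "Suc k"] by auto
      then show "0 \<le> D (t (Suc k)) - D (t k)" using D[of "t k" "t (Suc k)"] by simp
    qed simp
    then show ?thesis using D0[of 0] D[OF tn] by (subst ennreal_plus[symmetric]) (auto simp: add.assoc)
  qed
  finally show ?case .
qed

text \<open>Monotone convergence in the horizon, after exchanging the integrals.\<close>

lemma (in reflected) reflection_cost_leI:
  assumes le: "\<And>T. 0 < T \<Longrightarrow> (\<integral>\<^sup>+\<omega>. (\<integral>\<^sup>+t\<in>{0..}. ennreal (exp (- lam * t) * (\<alpha> * max 0 (X0 t \<omega> - m))) * indicator {..T} t \<partial>lborel) \<partial>M) \<le> C"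
  shows "reflection_cost \<le> C"
proof -
  define f where "f t \<omega> = ennreal (exp (- lam * t) * (\<alpha> * max 0 (X0 t \<omega> - m)))" for t \<omega>
  define G where "G t = (\<integral>\<^sup>+\<omega>. f t \<omega> \<partial>M) * indicator {0..} t" for t
  have sw: "(\<integral>\<^sup>+\<omega>. (\<integral>\<^sup>+t\<in>{0..}. f t \<omega> * indicator A t \<partial>lborel) \<partial>M) = (\<integral>\<^sup>+t. G t * indicator A t \<partial>lborel)"
    if [measurable]: "A \<in> sets borel" for A
  proof -
    have "(\<integral>\<^sup>+\<omega>. (\<integral>\<^sup>+t\<in>{0..}. f t \<omega> * indicator A t \<partial>lborel) \<partial>M) = (\<integral>\<^sup>+t\<in>{0..}. (\<integral>\<^sup>+\<omega>. f t \<omega> * indicator A t \<partial>M) \<partial>lborel)"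
      unfolding f_def by (rule nn_integral_swap(1)) measurable
    also have "\<dots> = (\<integral>\<^sup>+t. G t * indicator A t \<partial>lborel)"
      by (intro nn_integral_cong) (auto simp: G_def split: split_indicator)
    finally show ?thesis .
  qed
  have GM: "G \<in> borel_measurable lborel"
  proof -
    have "(\<lambda>t. (\<integral>\<^sup>+\<omega>. f (max 0 t) \<omega> \<partial>M) * indicator {0..} t) \<in> borel_measurable borel"
      unfolding f_def by (intro borel_measurable_times_ennreal borel_measurable_nn_integral borel_measurable_indicator)
        (simp_all add: case_prod_beta)
    also have "(\<lambda>t. (\<integral>\<^sup>+\<omega>. f (max 0 t) \<omega> \<partial>M) * indicator {0..} t) = G"
      by (auto simp: G_def fun_eq_iff split: split_indicator)
    finally show ?thesis by simp
  qed
  have "reflection_cost = (\<integral>\<^sup>+\<omega>. (\<integral>\<^sup>+t\<in>{0..}. f t \<omega> * indicator UNIV t \<partial>lborel) \<partial>M)"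
    by (simp add: reflection_cost_def f_def)
  also have "\<dots> = (\<integral>\<^sup>+t. G t * indicator UNIV t \<partial>lborel)" by (rule sw) simp
  also have "\<dots> = (\<integral>\<^sup>+t. (SUP n::nat. G t * indicator {..real (Suc n)} t) \<partial>lborel)"
  proof (intro nn_integral_cong antisym)
    fix t :: real
    obtain n where "t < real n" using reals_Archimedean2 by blast
    then show "G t * indicator UNIV t \<le> (SUP n::nat. G t * indicator {..real (Suc n)} t)"
      by (intro SUP_upper2[of n]) auto
    show "(SUP n::nat. G t * indicator {..real (Suc n)} t) \<le> G t * indicator UNIV t"
      by (intro SUP_least) (auto split: split_indicator)
  qed
  also have "\<dots> = (SUP n::nat. \<integral>\<^sup>+t. G t * indicator {..real (Suc n)} t \<partial>lborel)"
    using GM by (intro nn_integral_monotone_convergence_SUP) (auto intro!: incseq_SucI le_funI split: split_indicator)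
  also have "\<dots> \<le> C"
  proof (rule SUP_least)
    fix n :: nat
    show "(\<integral>\<^sup>+t. G t * indicator {..real (Suc n)} t \<partial>lborel) \<le> C"
      using le[of "real (Suc n)"] unfolding sw[OF atMost_borel, symmetric] f_def by simp
  qed
  finally show ?thesis .
qed

lemma (in reflected) B_joint[measurable]: "(\<lambda>p. B (max 0 (fst p)) (snd p)) \<in> borel_measurable (borel \<Otimes>\<^sub>M M)"
  by (rule right_continuous_pair_measurable) (auto intro: continuous_on_right[OF B_cont] measurable_F_M B_F)

lemma uniform_grid:
  fixes T :: real and k n :: nat
  assumes "0 \<le> T" "k < n"
  shows "0 \<le> real k * (T / real n)" "real k * (T / real n) \<le> real (Suc k) * (T / real n)"
    "real (Suc k) * (T / real n) \<le> T" "real (Suc k) * (T / real n) - real k * (T / real n) = T / real n"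
proof -
  show "0 \<le> real k * (T / real n)" using assms by simp
  show "real k * (T / real n) \<le> real (Suc k) * (T / real n)" using assms by (intro mult_right_mono) auto
  have "real (Suc k) * (T / real n) \<le> real n * (T / real n)" using assms by (intro mult_right_mono) auto
  then show "real (Suc k) * (T / real n) \<le> T" using assms by simp
  show "real (Suc k) * (T / real n) - real k * (T / real n) = T / real n"
    by (simp add: distrib_right add_divide_distrib)
qed

text \<open>Here \<xi> is the reflecting control for the start in \<open>y\<close>; the initial jump
  from \<open>x\<close> to \<open>y\<close> is added in \<open>policy\<close>.\<close>

locale response = reflected +
  fixes x :: real and \<eta> \<xi> :: "real \<Rightarrow> 'a \<Rightarrow> real"
  assumes x_pos: "0 < x" and y_eq: "y = max x a"
    and \<xi>: "\<xi> \<in> controls" and \<eta>: "\<eta> \<in> controls"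
    and above: "AE \<omega> in M. \<forall>t>0. a \<le> X y \<xi> \<eta> \<omega> t"
    and no_initial: "x < a \<Longrightarrow> AE \<omega> in M. \<eta> 0 \<omega> = 0"
begin

text \<open>The initial jump of the policy is absorbed into \<open>y\<close>. The value
  \<open>x\<close> before time 0 makes the left limit at 0 the true one, which prices a jump of
  \<eta> at time 0.\<close>

definition Z :: "'a \<Rightarrow> real \<Rightarrow> real" where
  "Z \<omega> t = (if t < 0 then x else y * exp (\<xi> t \<omega> - \<eta> t \<omega>))"

definition short :: "real \<Rightarrow> 'a \<Rightarrow> real" where
  "short t \<omega> = runmax (\<lambda>s. max 0 (Z0 s \<omega> - Z \<omega> s)) t"

definition L :: "real \<Rightarrow> 'a \<Rightarrow> real" where
  "L t \<omega> = exp (B t \<omega> - (r - g) * t)"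

definition c :: real where "c = lam - (r - g)"

lemma c_pos: "0 < c" using lam_gt by (simp add: c_def)

lemma Z_pos: "0 < Z \<omega> t" using x_pos y_pos by (simp add: Z_def)

lemma left_lim_Z_0: "left_lim (Z \<omega>) 0 = x"
  by (rule left_lim_at_0) (simp add: Z_def)

lemma Z_right: assumes "\<omega> \<in> space M" "0 \<le> t" shows "continuous (at_right t) (Z \<omega>)"
proof -
  interpret p: control_path "path \<xi> \<omega>" by (rule controls_path[OF \<xi> assms(1)])
  interpret q: control_path "path \<eta> \<omega>" by (rule controls_path[OF \<eta> assms(1)])
  have "((\<lambda>s. y * exp (path \<xi> \<omega> s - path \<eta> \<omega> s)) \<longlongrightarrow> y * exp (path \<xi> \<omega> t - path \<eta> \<omega> t)) (at_right t)"
    using p.rc[of t] q.rc[of t] unfolding continuous_within by (intro tendsto_intros)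
  moreover have "\<forall>\<^sub>F s in at_right t. y * exp (path \<xi> \<omega> s - path \<eta> \<omega> s) = Z \<omega> s"
    unfolding eventually_at_filter by (intro always_eventually) (use assms in \<open>auto simp: path_def Z_def\<close>)
  ultimately have "(Z \<omega> \<longlongrightarrow> y * exp (path \<xi> \<omega> t - path \<eta> \<omega> t)) (at_right t)" by (rule Lim_transform_eventually)
  then show ?thesis using assms unfolding continuous_within by (simp add: Z_def path_def)
qed

lemma Z_left: assumes "\<omega> \<in> space M" "0 < t" shows "(Z \<omega> \<longlongrightarrow> left_lim (Z \<omega>) t) (at_left t)"
proof -
  interpret p: control_path "path \<xi> \<omega>" by (rule controls_path[OF \<xi> assms(1)])
  interpret q: control_path "path \<eta> \<omega>" by (rule controls_path[OF \<eta> assms(1)])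
  let ?l = "y * exp (left_lim (path \<xi> \<omega>) t - left_lim (path \<eta> \<omega>) t)"
  have "((\<lambda>s. y * exp (path \<xi> \<omega> s - path \<eta> \<omega> s)) \<longlongrightarrow> ?l) (at_left t)"
    by (intro tendsto_intros mono_left_lim p.mono q.mono)
  moreover have "\<forall>\<^sub>F s in at_left t. y * exp (path \<xi> \<omega> s - path \<eta> \<omega> s) = Z \<omega> s"
    unfolding eventually_at_left[OF assms(2)] by (intro exI[of _ 0]) (use assms in \<open>auto simp: path_def Z_def\<close>)
  ultimately have "(Z \<omega> \<longlongrightarrow> ?l) (at_left t)" by (rule Lim_transform_eventually)
  with left_lim_eqI[OF this] show ?thesis by simp
qed

lemma net: assumes "\<omega> \<in> space M" shows "net_path (path \<eta> \<omega>) (Z \<omega>)"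
proof -
  interpret p: control_path "path \<xi> \<omega>" by (rule controls_path[OF \<xi> assms(1)])
  interpret q: control_path "path \<eta> \<omega>" by (rule controls_path[OF \<eta> assms(1)])
  show ?thesis
  proof
    fix u v :: real assume uv: "0 \<le> u" "u \<le> v"
    have "\<xi> u \<omega> \<le> \<xi> v \<omega>" using monoD[OF p.mono uv(2)] uv by (simp add: path_def)
    then have "y * exp (\<xi> u \<omega> - \<eta> u \<omega> + - (\<eta> v \<omega> - \<eta> u \<omega>)) \<le> y * exp (\<xi> v \<omega> - \<eta> v \<omega>)" using y_pos by simp
    then show "Z \<omega> u * exp (- (path \<eta> \<omega> v - path \<eta> \<omega> u)) \<le> Z \<omega> v"
      unfolding exp_add using uv by (simp add: Z_def path_def mult.assoc)
  qed (use Z_pos Z_right Z_left assms in auto)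
qed

lemma gap_bdd: "bdd_above ((\<lambda>s. max 0 (Z0 s \<omega> - Z \<omega> s)) ` {0..T})"
proof (rule bdd_aboveI2)
  fix s assume "s \<in> {0..T}"
  then show "max 0 (Z0 s \<omega> - Z \<omega> s) \<le> Z0 T \<omega>"
    using Z0_mono[of s T \<omega>] Z_pos[of \<omega> s] Z0_pos[of T \<omega>] by auto
qed

lemma short_mono: "0 \<le> s \<Longrightarrow> s \<le> t \<Longrightarrow> short s \<omega> \<le> short t \<omega>"
  unfolding short_def by (rule runmax_mono[OF gap_bdd])

lemma short_upper: "0 \<le> t \<Longrightarrow> max 0 (Z0 t \<omega> - Z \<omega> t) \<le> short t \<omega>"
  unfolding short_def by (rule runmax_upper[OF gap_bdd]) auto

lemma short_nonneg: "0 \<le> t \<Longrightarrow> 0 \<le> short t \<omega>"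
  using short_upper[of t \<omega>] by simp

lemma short_le: assumes "0 \<le> t" shows "short t \<omega> \<le> Z0 t \<omega>"
  unfolding short_def
proof (rule runmax_least[OF assms])
  fix s assume "0 \<le> s" "s \<le> t"
  then show "max 0 (Z0 s \<omega> - Z \<omega> s) \<le> Z0 t \<omega>"
    using Z0_mono[of s t \<omega>] Z_pos[of \<omega> s] Z0_pos[of t \<omega>] by auto
qed

lemma gap_right: assumes "\<omega> \<in> space M" "0 \<le> t"
  shows "continuous (at_right t) (\<lambda>s. max 0 (Z0 s \<omega> - Z \<omega> s))"
  using continuous_on_right[OF Z0_cont assms(2), of \<omega>] Z_right[OF assms]
  unfolding continuous_within by (intro tendsto_intros)

lemma Z_F: assumes "0 \<le> s" "s \<le> t" shows "(\<lambda>\<omega>. Z \<omega> s) \<in> borel_measurable (F t)"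
proof -
  have [measurable]: "\<xi> s \<in> borel_measurable (F t)" "\<eta> s \<in> borel_measurable (F t)"
    using \<xi> \<eta> assms by (auto simp: controls_def intro: measurable_F_mono)
  show ?thesis using assms by (simp add: Z_def)
qed

lemma short_F: assumes "0 \<le> t" shows "short t \<in> borel_measurable (F t)"
  unfolding short_def[abs_def]
proof (rule runmax_measurable[OF gap_bdd assms])
  fix s assume s: "0 \<le> s" "s \<le> t"
  note [measurable] = Z_F[OF s] measurable_F_mono[OF Z0_F[OF s(1)] s(2)]
  show "(\<lambda>\<omega>. max 0 (Z0 s \<omega> - Z \<omega> s)) \<in> borel_measurable (F t)" by measurable
qed (auto intro: gap_right)

lemma short_M: "0 \<le> t \<Longrightarrow> short t \<in> borel_measurable M"
  using short_F measurable_F_M by blast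

lemma short_right: "\<omega> \<in> space M \<Longrightarrow> 0 \<le> t \<Longrightarrow> continuous (at_right t) (\<lambda>s. short s \<omega>)"
  unfolding short_def by (rule runmax_right_continuous[OF gap_bdd _ gap_right])

lemma short_joint[measurable]: "(\<lambda>p. short (max 0 (fst p)) (snd p)) \<in> borel_measurable (borel \<Otimes>\<^sub>M M)"
  by (rule right_continuous_pair_measurable) (auto intro: short_right short_M)

lemma Z_joint[measurable]: "(\<lambda>p. Z (snd p) (max 0 (fst p))) \<in> borel_measurable (borel \<Otimes>\<^sub>M M)"
  by (rule right_continuous_pair_measurable) (auto intro: Z_right measurable_F_M Z_F)

lemma L_0[simp]: "L 0 \<omega> = 1" by (simp add: L_def)

lemma L_pos: "0 < L t \<omega>" by (simp add: L_def)

lemma L_cont: "continuous_on {0..} (\<lambda>t. L t \<omega>)"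
  unfolding L_def by (intro continuous_intros B_cont)

lemma L_M: "0 \<le> t \<Longrightarrow> L t \<in> borel_measurable M"
  using measurable_F_M[OF B_F[of t t]] unfolding L_def[abs_def] by simp

lemma discount_L: "exp (- c * t) * L t \<omega> = exp (- lam * t) * exp (B t \<omega>)"
  unfolding L_def c_def exp_add[symmetric] by (simp add: algebra_simps)

lemma L_martingale:
  assumes st: "0 \<le> s" "s \<le> T" and Y[measurable]: "Y \<in> borel_measurable (F s)"
  shows "(\<integral>\<^sup>+\<omega>. Y \<omega> * ennreal (L T \<omega>) \<partial>M) = (\<integral>\<^sup>+\<omega>. Y \<omega> * ennreal (L s \<omega>) \<partial>M)"
proof -
  have [measurable]: "B s \<in> borel_measurable (F s)" using st by (intro B_F) auto
  have [measurable]: "L s \<in> borel_measurable (F s)" unfolding L_def[abs_def] by measurable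
  have LT: "L T \<omega> = L s \<omega> * (exp (- (r - g) * (T - s)) * exp (1 * (B T \<omega> - B s \<omega>)))" for \<omega>
    unfolding L_def exp_add[symmetric] by (simp add: algebra_simps)
  have [measurable]: "B T \<in> borel_measurable M" "B s \<in> borel_measurable M" "Y \<in> borel_measurable M" "L s \<in> borel_measurable M"
    using st measurable_F_M[OF B_F[of T T]] measurable_F_M[OF B_F[of s s]] measurable_F_M[OF Y] L_M[of s] by auto
  have "(\<integral>\<^sup>+\<omega>. Y \<omega> * ennreal (L T \<omega>) \<partial>M)
    = (\<integral>\<^sup>+\<omega>. ennreal (exp (- (r - g) * (T - s))) * ((Y \<omega> * ennreal (L s \<omega>)) * ennreal (exp (1 * (B T \<omega> - B s \<omega>)))) \<partial>M)"
    unfolding LT using L_pos by (intro nn_integral_cong) (simp add: ennreal_mult less_imp_le ac_simps)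
  also have "\<dots> = ennreal (exp (- (r - g) * (T - s))) * (\<integral>\<^sup>+\<omega>. (Y \<omega> * ennreal (L s \<omega>)) * ennreal (exp (1 * (B T \<omega> - B s \<omega>))) \<partial>M)"
    by (rule nn_integral_cmult) measurable
  also have "\<dots> = ennreal (exp (- (r - g) * (T - s))) * (ennreal (exp (growth 1 * (T - s))) * (\<integral>\<^sup>+\<omega>. Y \<omega> * ennreal (L s \<omega>) \<partial>M))"
    by (subst nn_integral_expB[OF st]) auto
  also have "\<dots> = ennreal (exp (- (r - g) * (T - s)) * exp ((r - g) * (T - s))) * (\<integral>\<^sup>+\<omega>. Y \<omega> * ennreal (L s \<omega>) \<partial>M)"
    by (simp add: growth_1 ennreal_mult mult.assoc)
  also have "exp (- (r - g) * (T - s)) * exp ((r - g) * (T - s)) = 1"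
    by (simp only: mult_minus_left exp_minus) simp
  finally show ?thesis by simp
qed

definition policy :: "real \<Rightarrow> 'a \<Rightarrow> real" where
  "policy t \<omega> = max 0 (ln (a / x)) + \<xi> t \<omega>"

lemma X_policy:
  assumes "\<forall>x \<xi> \<eta> t. 0 \<le> t \<longrightarrow> X x \<xi> \<eta> \<omega> t = x * exp (B t \<omega> + \<xi> t \<omega> - \<eta> t \<omega>)" "0 \<le> t"
  shows "X x policy \<eta> \<omega> t = exp (B t \<omega>) * Z \<omega> t"
proof -
  have "X x policy \<eta> \<omega> t = (x * exp (max 0 (ln (a / x)))) * exp (B t \<omega> + (\<xi> t \<omega> - \<eta> t \<omega>))"
    using assms by (simp add: policy_def exp_add exp_diff)
  also have "x * exp (max 0 (ln (a / x))) = y" by (rule initial_jump[OF x_pos y_eq])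
  finally show ?thesis using assms(2) by (simp add: Z_def exp_add)
qed

lemma down_cost_eq:
  assumes X: "\<forall>x \<xi> \<eta> t. 0 \<le> t \<longrightarrow> X x \<xi> \<eta> \<omega> t = x * exp (B t \<omega> + \<xi> t \<omega> - \<eta> t \<omega>)" and \<omega>: "\<omega> \<in> space M"
  shows "down_cost lam x policy \<eta> \<omega> = net_path.nu (path \<eta> \<omega>) (Z \<omega>) (\<lambda>t. exp (- lam * t) * exp (B t \<omega>)) {0..}"
proof -
  interpret net_path "path \<eta> \<omega>" "Z \<omega>" by (rule net[OF \<omega>])
  have left: "left_lim (X x policy \<eta> \<omega>) t = exp (B t \<omega>) * left_lim (Z \<omega>) t" if "0 \<le> t" for t
  proof (cases "t = 0")
    case True
    then show ?thesis using left_lim_X_0 left_lim_Z_0 by simp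
  next
    case False
    then have t: "0 < t" using that by simp
    have "((\<lambda>s. exp (B s \<omega>) * Z \<omega> s) \<longlongrightarrow> exp (B t \<omega>) * left_lim (Z \<omega>) t) (at_left t)"
      by (intro tendsto_intros continuous_on_left[OF B_cont t] Z_left[OF t])
    moreover have "\<forall>\<^sub>F s in at_left t. exp (B s \<omega>) * Z \<omega> s = X x policy \<eta> \<omega> s"
      unfolding eventually_at_left[OF t] by (intro exI[of _ 0]) (use t X_policy[OF X] in auto)
    ultimately show ?thesis by (intro left_lim_eqI) (rule Lim_transform_eventually)
  qed
  show ?thesis
    unfolding down_cost_def nu_def jump_loss_def
  proof (intro arg_cong2[where f = "(+)"] nn_integral_cong)
    fix t
    show "ennreal (exp (- lam * t) * X x policy \<eta> \<omega> t) * indicator {0..} t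
      = ennreal (exp (- lam * t) * exp (B t \<omega>) * Z \<omega> t) * indicator {0..} t"
      using X_policy[OF X] by (auto simp: mult.assoc split: split_indicator)
  next
    fix t :: real assume "t \<in> space (count_space {0..})"
    then show "ennreal (exp (- lam * t) * (left_lim (X x policy \<eta> \<omega>) t * (1 - exp (- jump (path \<eta> \<omega>) t))))
      = ennreal (exp (- lam * t) * exp (B t \<omega>) * (left_lim (Z \<omega>) t * (1 - exp (- jump (path \<eta> \<omega>) t)))) * indicator {0..} t"
      using left[of t] by (simp add: mult.assoc)
  qed
qed

text \<open>
  The weights mix the left endpoint in the discount factor with the right endpoint in the
  martingale \<open>L\<close>: this makes the mean bound \<open>riemann_mean_ge\<close> free of error terms.
\<close>

definition riemann :: "real \<Rightarrow> nat \<Rightarrow> 'a \<Rightarrow> real" where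
  "riemann T n \<omega> = short 0 \<omega> + (\<Sum>k<n. exp (- c * (real k * (T / real n))) * L (real (Suc k) * (T / real n)) \<omega>
      * (short (real (Suc k) * (T / real n)) \<omega> - short (real k * (T / real n)) \<omega>))"

text \<open>For \<open>x < a\<close> the policy jumps at time 0, which forbids an initial jump of \<open>\<eta>\<close>.\<close>

lemma AE_riemann:
  assumes T: "0 < T"
  shows "AE \<omega> in M. limsup (\<lambda>n. ennreal (riemann T n \<omega>)) \<le> down_cost lam x policy \<eta> \<omega>"
proof -
  have zero: "AE \<omega> in M. x < a \<longrightarrow> \<eta> 0 \<omega> = 0"
    using no_initial by (cases "x < a") auto
  show ?thesis using AE_X above zero
  proof eventually_elim
    case (elim \<omega>)
    then have \<omega>: "\<omega> \<in> space M" and X: "\<forall>x \<xi> \<eta> t. 0 \<le> t \<longrightarrow> X x \<xi> \<eta> \<omega> t = x * exp (B t \<omega> + \<xi> t \<omega> - \<eta> t \<omega>)" by auto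
    interpret net_path "path \<eta> \<omega>" "Z \<omega>" by (rule net[OF \<omega>])
    interpret p: control_path "path \<xi> \<omega>" by (rule controls_path[OF \<xi> \<omega>])
    define l where "l t = exp (- lam * t) * exp (B t \<omega>)" for t
    define D where "D t = short t \<omega>" for t
    have incr: "ennreal (D t - D s) \<le> mu s t" if "0 \<le> s" "s \<le> t" for s t
      unfolding D_def short_def
    proof (rule shortfall_increment[OF gap_bdd _ that])
      fix s u :: real assume su: "0 \<le> s" "s \<le> u"
      show "Z0 u \<omega> = Z0 s \<omega> \<or> (\<exists>v>s. v \<le> u \<and> Z0 u \<omega> \<le> Z \<omega> v)"
      proof (cases "Z0 u \<omega> = Z0 s \<omega>")
        case False
        obtain v where v: "s < v" "v \<le> u" "Z0 u \<omega> = a * exp (- B v \<omega>)" by (rule Z0_step[OF su False])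
        \<comment> \<open>At the time \<open>v\<close> that determines \<open>Z0 u\<close>, the
          policy keeps the controlled state above \<open>a\<close> as well, so \<open>Z\<close>
          dominates the barrier there.\<close>
        have "a \<le> y * exp (B v \<omega> + \<xi> v \<omega> - \<eta> v \<omega>)" using elim(2) X su v by (metis le_less_trans less_imp_le)
        also have "\<dots> = exp (B v \<omega>) * Z \<omega> v" using su v by (simp add: Z_def exp_add exp_diff)
        finally have "a * exp (- B v \<omega>) \<le> Z \<omega> v" by (simp add: exp_minus field_simps)
        then show ?thesis using v by auto
      qed simp
    qed
    have D0: "D 0 \<le> jump_loss 0"
    proof -
      have "0 \<le> \<xi> 0 \<omega>" "0 \<le> \<eta> 0 \<omega>" using \<xi> \<eta> \<omega> by (auto simp: controls_def)
      have D: "D 0 = max 0 (y - y * exp (\<xi> 0 \<omega> - \<eta> 0 \<omega>))"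
        by (simp add: D_def short_def runmax_def Z_def Z0_def)
      have "y * exp (- \<eta> 0 \<omega>) \<le> y * exp (\<xi> 0 \<omega> - \<eta> 0 \<omega>)" using y_pos \<open>0 \<le> \<xi> 0 \<omega>\<close> by simp
      then have "D 0 \<le> y * (1 - exp (- \<eta> 0 \<omega>))" unfolding D using y_pos \<open>0 \<le> \<eta> 0 \<omega>\<close> by (simp add: right_diff_distrib)
      \<comment> \<open>For \<open>x < a\<close> both sides vanish because \<eta> starts at 0;
        otherwise \<open>y = x\<close>.\<close>
      also have "\<dots> = x * (1 - exp (- \<eta> 0 \<omega>))"
        using elim(3) y_eq by (cases "x < a") auto
      finally show ?thesis by (simp add: jump_loss_def left_lim_Z_0 jump_path_0)
    qed
    have l_meas: "(\<lambda>t. l (max 0 t)) \<in> borel_measurable borel"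
      unfolding l_def by (rule right_continuous_measurable) (rule continuous_on_right, auto intro!: continuous_intros B_cont)
    have key: "limsup (\<lambda>n. ennreal (riemann T n \<omega>)) \<le> nu l {0..} + ennreal e" if e: "0 < e" for e
    proof -
      define e' where "e' = e / (D T + 1)"
      have DT: "0 \<le> D T" using short_nonneg[of T \<omega>] T by (simp add: D_def)
      have e': "0 < e'" "e' * D T \<le> e" using DT e by (auto simp: e'_def field_simps)
      \<comment> \<open>Two time variables, since the weight combines the discount at one end of a
        cell with \<open>L\<close> at the other; both are compared with the diagonal point
        \<open>(s, s)\<close>.\<close>
      have "uniformly_continuous_on ({0..T} \<times> {0..T}) (\<lambda>p. exp (- c * fst p) * L (snd p) \<omega>)"
        by (intro compact_uniformly_continuous compact_Times continuous_intros continuous_on_compose2[OF L_cont]) auto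
      then obtain d where d: "d > 0" "\<And>p q. p \<in> {0..T} \<times> {0..T} \<Longrightarrow> q \<in> {0..T} \<times> {0..T} \<Longrightarrow> dist p q < d
          \<Longrightarrow> dist (exp (- c * fst p) * L (snd p) \<omega>) (exp (- c * fst q) * L (snd q) \<omega>) < e'"
        unfolding uniformly_continuous_on_def using e'(1) by metis
      have "\<forall>\<^sub>F n in sequentially. 2 * T / d < real n"
        using filterlim_real_sequentially by (rule filterlim_at_top_dense[THEN iffD1, rule_format])
      then have "\<forall>\<^sub>F n in sequentially. ennreal (riemann T n \<omega>) \<le> nu l {0..} + ennreal e"
      proof eventually_elim
        case (elim n)
        define h where "h = T / real n"
        have n: "0 < real n" using elim T d by (meson divide_pos_pos less_trans mult_pos_pos zero_less_numeral)
        have h: "0 < h" "2 * h < d" "real n * h = T" using elim T d n by (auto simp: h_def field_simps)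
        have grid: "real k * h \<le> T" if "k \<le> n" for k
          using mult_right_mono[of "real k" "real n" h] that h by simp
        have "ennreal (l 0 * D 0 + (\<Sum>k<n. exp (- c * (real k * h)) * L (real (Suc k) * h) \<omega> * (D (real (Suc k) * h) - D (real k * h))))
          \<le> nu l {0..real n * h} + ennreal (e' * D (real n * h))"
        proof (rule riemann_le_nu[OF l_meas _ incr])
          show "incseq (\<lambda>k. real k * h)" using h by (auto intro!: incseq_SucI simp: algebra_simps)
          fix k s assume k: "k < n" and s: "real k * h < s" "s \<le> real (Suc k) * h"
          have s0: "0 \<le> s" using s h by (meson less_imp_le mult_nonneg_nonneg of_nat_0_le_iff order_trans)
          have "dist (real k * h, real (Suc k) * h) (s, s) \<le> dist (real k * h) s + dist (real (Suc k) * h) s"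
            unfolding dist_Pair_Pair by (rule sqrt_sum_squares_le_sum) auto
          also have "\<dots> < d" using s h by (simp add: dist_real_def algebra_simps)
          finally have "dist (exp (- c * (real k * h)) * L (real (Suc k) * h) \<omega>) (exp (- c * s) * L s \<omega>) < e'"
            using d(2)[of "(real k * h, real (Suc k) * h)" "(s, s)"] grid[of k] grid[of "Suc k"] k s s0 h
            by (auto simp del: of_nat_Suc intro: order_trans[OF _ less_imp_le])
          then show "exp (- c * (real k * h)) * L (real (Suc k) * h) \<omega> \<le> l s + e'"
            unfolding discount_L l_def dist_real_def by linarith
        qed (use D0 short_mono short_nonneg e' in \<open>auto simp: D_def l_def L_def\<close>)
        also have "\<dots> \<le> nu l {0..} + ennreal e"
          unfolding h(3) using e' by (intro add_mono nu_mono_set ennreal_leI) auto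
        finally show ?case unfolding riemann_def h_def[symmetric] by (simp add: l_def D_def)
      qed
      then show ?thesis by (rule Limsup_bounded)
    qed
    have "limsup (\<lambda>n. ennreal (riemann T n \<omega>)) \<le> nu l {0..}"
      by (rule ennreal_le_epsilon) (rule key)
    then show ?case unfolding down_cost_eq[OF X \<omega>] l_def .
  qed
qed

text \<open>A majorant independent of the grid and integrable by the exponential moments of
  \<open>K\<close>, for the reverse Fatou lemma.\<close>

lemma riemann_le:
  assumes T: "0 \<le> T"
  shows "riemann T n \<omega> \<le> exp (\<bar>r - g\<bar> * T) * y * exp (2 * K T \<omega>)"
proof (cases "n = 0")
  case True
  have "short 0 \<omega> \<le> y" using short_le[of 0 \<omega>] by (simp add: Z0_def)
  also have "y \<le> y * (exp (\<bar>r - g\<bar> * T) * exp (2 * K T \<omega>))"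
  proof -
    have "1 \<le> exp (\<bar>r - g\<bar> * T) * exp (2 * K T \<omega>)"
      unfolding exp_add[symmetric] using T K_nonneg[OF T, of \<omega>] by simp
    then show ?thesis using mult_left_mono[of 1 _ y] y_pos by simp
  qed
  finally show ?thesis using True by (simp add: riemann_def ac_simps)
next
  case False
  define h where "h = T / real n"
  define E where "E = exp (\<bar>r - g\<bar> * T) * exp (K T \<omega>)"
  have E1: "1 \<le> E" unfolding E_def exp_add[symmetric] using T K_nonneg[OF T, of \<omega>] by simp
  have LE: "L t \<omega> \<le> E" if "0 \<le> t" "t \<le> T" for t
  proof -
    have "- ((r - g) * t) \<le> \<bar>r - g\<bar> * T"
    proof -
      have "- ((r - g) * t) \<le> \<bar>r - g\<bar> * t" using that by (metis abs_ge_minus_self abs_mult abs_of_nonneg)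
      also have "\<dots> \<le> \<bar>r - g\<bar> * T" using that by (intro mult_left_mono) auto
      finally show ?thesis .
    qed
    then show ?thesis unfolding L_def E_def exp_add[symmetric] using abs_B_le[OF that, of \<omega>] by simp
  qed
  have "riemann T n \<omega> \<le> E * short 0 \<omega> + (\<Sum>k<n. E * (short (real (Suc k) * h) \<omega> - short (real k * h) \<omega>))"
    unfolding riemann_def h_def[symmetric]
  proof (intro add_mono sum_mono mult_right_mono)
    show "short 0 \<omega> \<le> E * short 0 \<omega>" using E1 short_nonneg[of 0 \<omega>] mult_right_mono[of 1 E "short 0 \<omega>"] by simp
    fix k assume "k \<in> {..<n}"
    then have k: "0 \<le> real k * h" "real k * h \<le> real (Suc k) * h" "real (Suc k) * h \<le> T"
      using uniform_grid[OF T, of k n] by (auto simp: h_def)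
    show "0 \<le> short (real (Suc k) * h) \<omega> - short (real k * h) \<omega>" using short_mono[OF k(1,2), of \<omega>] by simp
    have "exp (- c * (real k * h)) * L (real (Suc k) * h) \<omega> \<le> 1 * E"
    proof (intro mult_mono)
      show "exp (- c * (real k * h)) \<le> 1" using c_pos k by simp
      show "L (real (Suc k) * h) \<omega> \<le> E" using k by (intro LE) auto
    qed (use L_pos less_imp_le in auto)
    then show "exp (- c * (real k * h)) * L (real (Suc k) * h) \<omega> \<le> E" by simp
  qed
  also have "\<dots> = E * short (real n * h) \<omega>"
    unfolding sum_distrib_left[symmetric] sum_lessThan_telescope[of "\<lambda>k. short (real k * h) \<omega>"] by (simp add: algebra_simps)
  also have "real n * h = T" using False by (simp add: h_def)
  also have "E * short T \<omega> \<le> E * (y * exp (K T \<omega>))"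
    using short_le[OF T, of \<omega>] Z0_le[OF T order_refl, of \<omega>] E1 by (intro mult_left_mono) auto
  also have "\<dots> = exp (\<bar>r - g\<bar> * T) * y * (exp (K T \<omega>) * exp (K T \<omega>))" by (simp add: E_def ac_simps)
  also have "exp (K T \<omega>) * exp (K T \<omega>) = exp (2 * K T \<omega>)" by (simp flip: exp_add)
  finally show ?thesis .
qed

lemma riemann_M: assumes T: "0 \<le> T" shows "riemann T n \<in> borel_measurable M"
  unfolding riemann_def[abs_def]
proof (intro borel_measurable_add borel_measurable_sum borel_measurable_times borel_measurable_diff)
  fix k assume "k \<in> {..<n}"
  then have k: "0 \<le> real k * (T / real n)" "0 \<le> real (Suc k) * (T / real n)" using T by auto
  show "L (real (Suc k) * (T / real n)) \<in> borel_measurable M" "short (real (Suc k) * (T / real n)) \<in> borel_measurable M"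
    "short (real k * (T / real n)) \<in> borel_measurable M"
    using k by (auto intro!: L_M short_M simp del: of_nat_Suc)
qed (auto intro: short_M)

text \<open>The martingale property is used twice. Replacing \<open>L s\<close> by
  \<open>L T\<close> makes the weight independent of time, so that integration by parts can be done
  path by path; then \<open>L T\<close> is brought back to the right end of each cell, the time at
  which the increment of \<open>short\<close> is known.\<close>

lemma riemann_mean_ge:
  assumes T: "0 < T" and n: "0 < n"
  shows "(\<integral>\<^sup>+\<omega>. (\<integral>\<^sup>+t\<in>{0..}. ennreal (c * exp (- lam * t) * exp (B t \<omega>) * short t \<omega>) * indicator {..T} t \<partial>lborel) \<partial>M)
    \<le> (\<integral>\<^sup>+\<omega>. ennreal (riemann T n \<omega>) \<partial>M)"
proof -
  define h where "h = T / real n"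
  define t where "t k = real k * h" for k
  have h: "0 < h" "real n * h = T" using T n by (auto simp: h_def)
  have t0: "t 0 = 0" "incseq t" "t n = T" "\<And>k. 0 \<le> t k"
    using h by (auto simp: t_def intro!: incseq_SucI simp: algebra_simps)
  have tS: "t k \<le> t (Suc k)" for k using incseqD[OF t0(2), of k "Suc k"] by simp
  have tT: "t k \<le> T" if "k \<le> n" for k using incseqD[OF t0(2) that] t0 by simp
  have LTM[measurable]: "L T \<in> borel_measurable M" using T by (intro L_M) simp
  have sM[measurable]: "short (t k) \<in> borel_measurable M" for k by (rule short_M) (rule t0)
  have s0M[measurable]: "short 0 \<in> borel_measurable M" by (rule short_M) simp
  have dF: "(\<lambda>\<omega>. short (t (Suc k)) \<omega> - short (t k) \<omega>) \<in> borel_measurable (F (t (Suc k)))" for k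
    using short_F[OF t0(4), of "Suc k"] measurable_F_mono[OF short_F[OF t0(4), of k] tS] by simp
  have d0: "0 \<le> short (t (Suc k)) \<omega> - short (t k) \<omega>" for k \<omega> using short_mono[OF t0(4) tS, of k \<omega>] by simp
  have LtM[measurable]: "L (t k) \<in> borel_measurable M" for k by (rule L_M) (rule t0)
  have "(\<integral>\<^sup>+\<omega>. (\<integral>\<^sup>+s\<in>{0..}. ennreal (c * exp (- lam * s) * exp (B s \<omega>) * short s \<omega>) * indicator {..T} s \<partial>lborel) \<partial>M)
    = (\<integral>\<^sup>+s\<in>{0..}. (\<integral>\<^sup>+\<omega>. ennreal (c * exp (- lam * s) * exp (B s \<omega>) * short s \<omega>) * indicator {..T} s \<partial>M) \<partial>lborel)"
    by (rule nn_integral_swap) measurable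
  \<comment> \<open>First use of the martingale, separately at each time \<open>s\<close>:
    \<open>short s\<close> is known at \<open>s\<close>.\<close>
  also have "\<dots> = (\<integral>\<^sup>+s\<in>{0..}. (\<integral>\<^sup>+\<omega>. ennreal (c * exp (- c * s) * short s \<omega>) * indicator {..T} s * ennreal (L T \<omega>) \<partial>M) \<partial>lborel)"
  proof (intro nn_integral_cong)
    fix s :: real
    show "(\<integral>\<^sup>+\<omega>. ennreal (c * exp (- lam * s) * exp (B s \<omega>) * short s \<omega>) * indicator {..T} s \<partial>M) * indicator {0..} s
      = (\<integral>\<^sup>+\<omega>. ennreal (c * exp (- c * s) * short s \<omega>) * indicator {..T} s * ennreal (L T \<omega>) \<partial>M) * indicator {0..} s"
    proof (cases "0 \<le> s \<and> s \<le> T")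
      case True
      have [measurable]: "short s \<in> borel_measurable (F s)" using True by (intro short_F) simp
      have "(\<integral>\<^sup>+\<omega>. ennreal (c * exp (- c * s) * short s \<omega>) * ennreal (L T \<omega>) \<partial>M)
        = (\<integral>\<^sup>+\<omega>. ennreal (c * exp (- c * s) * short s \<omega>) * ennreal (L s \<omega>) \<partial>M)"
        using True by (intro L_martingale) auto
      also have "\<dots> = (\<integral>\<^sup>+\<omega>. ennreal (c * exp (- lam * s) * exp (B s \<omega>) * short s \<omega>) \<partial>M)"
      proof (intro nn_integral_cong)
        fix \<omega>
        have "ennreal (c * exp (- c * s) * short s \<omega>) * ennreal (L s \<omega>) = ennreal (c * (exp (- c * s) * L s \<omega>) * short s \<omega>)"
          using short_nonneg[of s \<omega>] True c_pos L_pos[of s \<omega>] by (subst ennreal_mult[symmetric]) (auto simp: ac_simps less_imp_le)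
        then show "ennreal (c * exp (- c * s) * short s \<omega>) * ennreal (L s \<omega>) = ennreal (c * exp (- lam * s) * exp (B s \<omega>) * short s \<omega>)"
          unfolding discount_L by (simp add: ac_simps)
      qed
      finally show ?thesis using True by simp
    qed (auto split: split_indicator)
  qed
  also have "\<dots> = (\<integral>\<^sup>+\<omega>. (\<integral>\<^sup>+s\<in>{0..}. ennreal (c * exp (- c * s) * short s \<omega>) * indicator {..T} s * ennreal (L T \<omega>) \<partial>lborel) \<partial>M)"
    by (rule nn_integral_swap(1)[symmetric]) measurable
  also have "\<dots> \<le> (\<integral>\<^sup>+\<omega>. ennreal (short 0 \<omega>) * ennreal (L T \<omega>) +
      (\<Sum>k<n. ennreal (exp (- c * t k)) * (ennreal (short (t (Suc k)) \<omega> - short (t k) \<omega>) * ennreal (L T \<omega>))) \<partial>M)"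
  proof (rule nn_integral_mono)
    fix \<omega> assume \<omega>: "\<omega> \<in> space M"
    have [measurable]: "(\<lambda>s. short (max 0 s) \<omega>) \<in> borel_measurable borel"
      by (rule right_continuous_measurable) (rule short_right[OF \<omega>])
    define I where "I = (\<integral>\<^sup>+s\<in>{0..T}. ennreal (c * exp (- c * s) * short (max 0 s) \<omega>) \<partial>lborel)"
    have "(\<integral>\<^sup>+s\<in>{0..}. ennreal (c * exp (- c * s) * short s \<omega>) * indicator {..T} s * ennreal (L T \<omega>) \<partial>lborel)
      = (\<integral>\<^sup>+s. ennreal (L T \<omega>) * (ennreal (c * exp (- c * s) * short (max 0 s) \<omega>) * indicator {0..T} s) \<partial>lborel)"
      by (intro nn_integral_cong) (auto split: split_indicator simp: mult.commute)
    then have A: "(\<integral>\<^sup>+s\<in>{0..}. ennreal (c * exp (- c * s) * short s \<omega>) * indicator {..T} s * ennreal (L T \<omega>) \<partial>lborel)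
      = ennreal (L T \<omega>) * I"
      unfolding I_def by (subst nn_integral_cmult[symmetric]) auto
    have "I = (\<integral>\<^sup>+s\<in>{0..t n}. ennreal (c * exp (- c * s) * short s \<omega>) \<partial>lborel)"
      unfolding t0(3) I_def by (intro nn_integral_cong) (auto split: split_indicator)
    also have "\<dots> \<le> (\<integral>\<^sup>+s\<in>{0..t n}. ennreal (c * exp (- c * s) * short s \<omega>) \<partial>lborel) + ennreal (exp (- c * t n) * short (t n) \<omega>)"
      by simp
    also have "\<dots> \<le> ennreal (short 0 \<omega> + (\<Sum>k<n. exp (- c * t k) * (short (t (Suc k)) \<omega> - short (t k) \<omega>)))"
      by (rule discounted_integral_le_sum[where D = "\<lambda>s. short s \<omega>"])
         (use c_pos t0 short_nonneg short_mono in auto)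
    finally have 1: "I \<le> ennreal (short 0 \<omega>) + ennreal (\<Sum>k<n. exp (- c * t k) * (short (t (Suc k)) \<omega> - short (t k) \<omega>))"
      by (rule order_trans[OF _ ennreal_add_le])
    have "ennreal (\<Sum>k<n. exp (- c * t k) * (short (t (Suc k)) \<omega> - short (t k) \<omega>))
      = (\<Sum>k<n. ennreal (exp (- c * t k) * (short (t (Suc k)) \<omega> - short (t k) \<omega>)))"
      by (rule sum_ennreal[symmetric]) (use d0 in \<open>auto intro!: mult_nonneg_nonneg\<close>)
    also have "\<dots> = (\<Sum>k<n. ennreal (exp (- c * t k)) * ennreal (short (t (Suc k)) \<omega> - short (t k) \<omega>))"
      by (intro sum.cong refl ennreal_mult d0) simp
    finally have "I \<le> ennreal (short 0 \<omega>) + (\<Sum>k<n. ennreal (exp (- c * t k)) * ennreal (short (t (Suc k)) \<omega> - short (t k) \<omega>))"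
      using 1 by simp
    then have "ennreal (L T \<omega>) * I \<le> ennreal (L T \<omega>) * (ennreal (short 0 \<omega>) + (\<Sum>k<n. ennreal (exp (- c * t k)) * ennreal (short (t (Suc k)) \<omega> - short (t k) \<omega>)))"
      by (rule mult_left_mono) simp
    also have "\<dots> = ennreal (short 0 \<omega>) * ennreal (L T \<omega>) +
      (\<Sum>k<n. ennreal (exp (- c * t k)) * (ennreal (short (t (Suc k)) \<omega> - short (t k) \<omega>) * ennreal (L T \<omega>)))"
      unfolding distrib_left sum_distrib_left by (simp add: ac_simps)
    finally show "(\<integral>\<^sup>+s\<in>{0..}. ennreal (c * exp (- c * s) * short s \<omega>) * indicator {..T} s * ennreal (L T \<omega>) \<partial>lborel)
      \<le> ennreal (short 0 \<omega>) * ennreal (L T \<omega>) +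
      (\<Sum>k<n. ennreal (exp (- c * t k)) * (ennreal (short (t (Suc k)) \<omega> - short (t k) \<omega>) * ennreal (L T \<omega>)))"
      unfolding A .
  qed
  also have "\<dots> = (\<integral>\<^sup>+\<omega>. ennreal (short 0 \<omega>) * ennreal (L T \<omega>) \<partial>M) +
      (\<Sum>k<n. ennreal (exp (- c * t k)) * (\<integral>\<^sup>+\<omega>. ennreal (short (t (Suc k)) \<omega> - short (t k) \<omega>) * ennreal (L T \<omega>) \<partial>M))"
    by (simp add: nn_integral_add nn_integral_sum nn_integral_cmult)
  \<comment> \<open>Second use: the increment over the cell is measurable at its right end, and for
    no earlier grid time in general.\<close>
  also have "\<dots> = (\<integral>\<^sup>+\<omega>. ennreal (short 0 \<omega>) * ennreal (L 0 \<omega>) \<partial>M) +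
      (\<Sum>k<n. ennreal (exp (- c * t k)) * (\<integral>\<^sup>+\<omega>. ennreal (short (t (Suc k)) \<omega> - short (t k) \<omega>) * ennreal (L (t (Suc k)) \<omega>) \<partial>M))"
    using T short_F[of 0] dF tT t0(4) measurable_compose[OF dF measurable_ennreal]
    by (intro arg_cong2[where f = "(+)"] sum.cong refl arg_cong2[where f = "(*)"] L_martingale) auto
  also have "\<dots> = (\<integral>\<^sup>+\<omega>. ennreal (riemann T n \<omega>) \<partial>M)"
  proof -
    have eq: "ennreal (riemann T n \<omega>) = ennreal (short 0 \<omega>) * ennreal (L 0 \<omega>) +
      (\<Sum>k<n. ennreal (exp (- c * t k)) * (ennreal (short (t (Suc k)) \<omega> - short (t k) \<omega>) * ennreal (L (t (Suc k)) \<omega>)))" for \<omega>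
    proof -
      have e: "(\<Sum>k<n. ennreal (exp (- c * t k)) * (ennreal (short (t (Suc k)) \<omega> - short (t k) \<omega>) * ennreal (L (t (Suc k)) \<omega>)))
        = (\<Sum>k<n. ennreal (exp (- c * t k) * L (t (Suc k)) \<omega> * (short (t (Suc k)) \<omega> - short (t k) \<omega>)))"
        using d0 L_pos[THEN less_imp_le] by (intro sum.cong refl) (simp add: ennreal_mult ac_simps)
      also have "\<dots> = ennreal (\<Sum>k<n. exp (- c * t k) * L (t (Suc k)) \<omega> * (short (t (Suc k)) \<omega> - short (t k) \<omega>))"
        using d0 L_pos[THEN less_imp_le] by (intro sum_ennreal) auto
      finally show ?thesis
        unfolding riemann_def h_def[symmetric] t_def[symmetric] using d0 L_pos[THEN less_imp_le] short_nonneg[of 0 \<omega>]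
        by (subst ennreal_plus) (auto intro!: sum_nonneg mult_nonneg_nonneg)
    qed
    show ?thesis unfolding eq by (simp add: nn_integral_add nn_integral_sum nn_integral_cmult)
  qed
  finally show ?thesis .
qed

lemma X0_le_shortfall:
  assumes "0 \<le> t"
  shows "max 0 (X0 t \<omega> - m) \<le> max 0 (exp (B t \<omega>) * Z \<omega> t - m) + exp (B t \<omega>) * short t \<omega>"
proof -
  have "Z0 t \<omega> \<le> Z \<omega> t + short t \<omega>" using short_upper[OF assms, of \<omega>] by simp
  then have "exp (B t \<omega>) * Z0 t \<omega> \<le> exp (B t \<omega>) * (Z \<omega> t + short t \<omega>)" by (intro mult_left_mono) auto
  then have "X0 t \<omega> \<le> exp (B t \<omega>) * Z \<omega> t + exp (B t \<omega>) * short t \<omega>" by (simp add: X0_def distrib_left)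
  moreover have "0 \<le> exp (B t \<omega>) * short t \<omega>" using short_nonneg[OF assms, of \<omega>] by simp
  ultimately show ?thesis by simp
qed

text \<open>Not acting costs more than the response by at most the running cost of
  \<open>short\<close>. That excess is at most \<kappa> times the integral \<open>I\<close>, whose
  mean is in turn bounded by the mean of the limiting Riemann sums, hence by that of the control
  cost.\<close>

lemma truncated_cost_le:
  assumes T: "0 < T" and \<kappa>: "\<alpha> \<le> \<kappa> * c"
  shows "(\<integral>\<^sup>+\<omega>. (\<integral>\<^sup>+t\<in>{0..}. ennreal (exp (- lam * t) * (\<alpha> * max 0 (X0 t \<omega> - m))) * indicator {..T} t \<partial>lborel) \<partial>M) \<le> J2 x policy \<eta>"
proof -
  define Ai where "Ai \<omega> = (\<integral>\<^sup>+t\<in>{0..}. ennreal (exp (- lam * t) * (\<alpha> * max 0 (exp (B t \<omega>) * Z \<omega> t - m))) \<partial>lborel)" for \<omega>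
  \<comment> \<open>A measurable minorant of the control cost; \<open>Suc n\<close> excludes the
    empty grid, for which \<open>riemann_mean_ge\<close> makes no claim.\<close>
  define Q where "Q \<omega> = limsup (\<lambda>n. ennreal (riemann T (Suc n) \<omega>))" for \<omega>
  define I where "I \<omega> = (\<integral>\<^sup>+t\<in>{0..}. ennreal (c * exp (- lam * t) * exp (B t \<omega>) * short t \<omega>) * indicator {..T} t \<partial>lborel)" for \<omega>
  have AM[measurable]: "Ai \<in> borel_measurable M" unfolding Ai_def[abs_def] by (rule nn_integral_swap(2)) measurable
  have IM[measurable]: "I \<in> borel_measurable M" unfolding I_def[abs_def] by (rule nn_integral_swap(2)) measurable
  have RM[measurable]: "riemann T n \<in> borel_measurable M" for n using T by (intro riemann_M) simp
  have QM[measurable]: "Q \<in> borel_measurable M" unfolding Q_def[abs_def] by measurable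
  have IQ: "(\<integral>\<^sup>+\<omega>. I \<omega> \<partial>M) \<le> (\<integral>\<^sup>+\<omega>. Q \<omega> \<partial>M)"
  proof -
    have KM[measurable]: "K T \<in> borel_measurable M" using T by (intro K_M) simp
    have "(\<integral>\<^sup>+\<omega>. I \<omega> \<partial>M) \<le> limsup (\<lambda>n::nat. \<integral>\<^sup>+\<omega>. ennreal (riemann T (Suc n) \<omega>) \<partial>M)"
      using riemann_mean_ge[OF T] by (intro order_trans[OF _ Liminf_le_Limsup] Liminf_bounded) (auto simp: I_def)
    \<comment> \<open>Reverse Fatou with the majorant from \<open>riemann_le\<close>.\<close>
    also have "\<dots> \<le> (\<integral>\<^sup>+\<omega>. Q \<omega> \<partial>M)"
      unfolding Q_def
    proof (rule nn_integral_limsup[where w = "\<lambda>\<omega>. ennreal (exp (\<bar>r - g\<bar> * T) * y) * ennreal (exp (2 * K T \<omega>))"])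
      show "AE \<omega> in M. ennreal (riemann T (Suc n) \<omega>) \<le> ennreal (exp (\<bar>r - g\<bar> * T) * y) * ennreal (exp (2 * K T \<omega>))" for n
        using riemann_le[of T "Suc n"] T y_pos by (auto simp: ennreal_mult[symmetric] intro!: ennreal_leI)
      show "(\<integral>\<^sup>+\<omega>. ennreal (exp (\<bar>r - g\<bar> * T) * y) * ennreal (exp (2 * K T \<omega>)) \<partial>M) < \<infinity>"
        using exp_K_finite[of T 2] T by (simp add: nn_integral_cmult ennreal_mult_less_top)
    qed measurable
    finally show ?thesis .
  qed
  have "(\<integral>\<^sup>+\<omega>. (\<integral>\<^sup>+t\<in>{0..}. ennreal (exp (- lam * t) * (\<alpha> * max 0 (X0 t \<omega> - m))) * indicator {..T} t \<partial>lborel) \<partial>M)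
    \<le> (\<integral>\<^sup>+\<omega>. Ai \<omega> + ennreal \<kappa> * I \<omega> \<partial>M)"
  proof (rule nn_integral_mono)
    fix \<omega> assume \<omega>: "\<omega> \<in> space M"
    have [measurable]: "(\<lambda>s. short (max 0 s) \<omega>) \<in> borel_measurable borel"
      by (rule right_continuous_measurable) (rule short_right[OF \<omega>])
    have [measurable]: "(\<lambda>s. Z \<omega> (max 0 s)) \<in> borel_measurable borel"
      by (rule right_continuous_measurable) (rule Z_right[OF \<omega>])
    have [measurable]: "(\<lambda>s. B (max 0 s) \<omega>) \<in> borel_measurable borel"
      by (rule right_continuous_measurable) (rule continuous_on_right[OF B_cont])
    have eqA: "ennreal (exp (- lam * t) * (\<alpha> * max 0 (exp (B t \<omega>) * Z \<omega> t - m))) * indicator {0..} t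
      = ennreal (exp (- lam * t) * (\<alpha> * max 0 (exp (B (max 0 t) \<omega>) * Z \<omega> (max 0 t) - m))) * indicator {0..} t" for t
      by (auto split: split_indicator)
    have eqI: "ennreal (c * exp (- lam * t) * exp (B t \<omega>) * short t \<omega>) * indicator {..T} t * indicator {0..} t
      = ennreal (c * exp (- lam * t) * exp (B (max 0 t) \<omega>) * short (max 0 t) \<omega>) * indicator {..T} t * indicator {0..} t" for t
      by (auto split: split_indicator)
    have "(\<integral>\<^sup>+t\<in>{0..}. ennreal (exp (- lam * t) * (\<alpha> * max 0 (X0 t \<omega> - m))) * indicator {..T} t \<partial>lborel)
      \<le> (\<integral>\<^sup>+t. ennreal (exp (- lam * t) * (\<alpha> * max 0 (exp (B t \<omega>) * Z \<omega> t - m))) * indicator {0..} t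
        + ennreal \<kappa> * (ennreal (c * exp (- lam * t) * exp (B t \<omega>) * short t \<omega>) * indicator {..T} t * indicator {0..} t) \<partial>lborel)"
    proof (rule nn_integral_mono)
      fix t :: real
      show "ennreal (exp (- lam * t) * (\<alpha> * max 0 (X0 t \<omega> - m))) * indicator {..T} t * indicator {0..} t
        \<le> ennreal (exp (- lam * t) * (\<alpha> * max 0 (exp (B t \<omega>) * Z \<omega> t - m))) * indicator {0..} t
        + ennreal \<kappa> * (ennreal (c * exp (- lam * t) * exp (B t \<omega>) * short t \<omega>) * indicator {..T} t * indicator {0..} t)"
      proof (cases "0 \<le> t \<and> t \<le> T")
        case True
        define e where "e = exp (- lam * t)"
        have e: "0 < e" by (simp add: e_def)
        have s: "0 \<le> exp (B t \<omega>) * short t \<omega>" using short_nonneg[of t \<omega>] True by simp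
        have "e * (\<alpha> * max 0 (X0 t \<omega> - m)) \<le> e * (\<alpha> * (max 0 (exp (B t \<omega>) * Z \<omega> t - m) + exp (B t \<omega>) * short t \<omega>))"
          using e pos True by (intro mult_left_mono X0_le_shortfall) auto
        also have "\<dots> = e * (\<alpha> * max 0 (exp (B t \<omega>) * Z \<omega> t - m)) + \<alpha> * (e * (exp (B t \<omega>) * short t \<omega>))"
          by (simp add: algebra_simps)
        \<comment> \<open>Here the price comparison enters: removing a unit of \<open>Z\<close>
          costs at least the running cost that it saves.\<close>
        also have "\<alpha> * (e * (exp (B t \<omega>) * short t \<omega>)) \<le> (\<kappa> * c) * (e * (exp (B t \<omega>) * short t \<omega>))"
          using \<kappa> e s by (intro mult_right_mono) auto
        finally have "ennreal (e * (\<alpha> * max 0 (X0 t \<omega> - m))) \<le> ennreal (e * (\<alpha> * max 0 (exp (B t \<omega>) * Z \<omega> t - m))) + ennreal (\<kappa> * (c * e * exp (B t \<omega>) * short t \<omega>))"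
          by (intro order_trans[OF ennreal_leI ennreal_add_le]) (simp add: ac_simps)
        also have "ennreal (\<kappa> * (c * e * exp (B t \<omega>) * short t \<omega>)) = ennreal \<kappa> * ennreal (c * e * exp (B t \<omega>) * short t \<omega>)"
          using pos c_pos e s by (intro ennreal_mult) (auto simp: mult.assoc)
        finally show ?thesis using True by (simp add: e_def)
      qed (auto split: split_indicator)
    qed
    also have "\<dots> = Ai \<omega> + ennreal \<kappa> * I \<omega>"
      unfolding Ai_def I_def eqA eqI by (simp add: nn_integral_add nn_integral_cmult)
    finally show "(\<integral>\<^sup>+t\<in>{0..}. ennreal (exp (- lam * t) * (\<alpha> * max 0 (X0 t \<omega> - m))) * indicator {..T} t \<partial>lborel) \<le> Ai \<omega> + ennreal \<kappa> * I \<omega>" .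
  qed
  also have "\<dots> = (\<integral>\<^sup>+\<omega>. Ai \<omega> \<partial>M) + ennreal \<kappa> * (\<integral>\<^sup>+\<omega>. I \<omega> \<partial>M)"
    by (simp add: nn_integral_add nn_integral_cmult)
  also have "\<dots> \<le> (\<integral>\<^sup>+\<omega>. Ai \<omega> \<partial>M) + ennreal \<kappa> * (\<integral>\<^sup>+\<omega>. Q \<omega> \<partial>M)"
    by (intro add_left_mono mult_left_mono IQ) simp
  also have "\<dots> = (\<integral>\<^sup>+\<omega>. Ai \<omega> + ennreal \<kappa> * Q \<omega> \<partial>M)"
    by (simp add: nn_integral_add nn_integral_cmult)
  also have "\<dots> \<le> J2 x policy \<eta>"
    unfolding J2_def
  proof (rule nn_integral_mono_AE)
    show "AE \<omega> in M. Ai \<omega> + ennreal \<kappa> * Q \<omega> \<le>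
      (\<integral>\<^sup>+t\<in>{0..}. ennreal (exp (- lam * t) * (\<alpha> * max 0 (X x policy \<eta> \<omega> t - m))) \<partial>lborel) + ennreal \<kappa> * down_cost lam x policy \<eta> \<omega>"
      using AE_X AE_riemann[OF T]
    proof eventually_elim
      case (elim \<omega>)
      have "Ai \<omega> = (\<integral>\<^sup>+t\<in>{0..}. ennreal (exp (- lam * t) * (\<alpha> * max 0 (X x policy \<eta> \<omega> t - m))) \<partial>lborel)"
        unfolding Ai_def using X_policy[of \<omega>] elim by (intro nn_integral_cong) (auto split: split_indicator)
      moreover have "Q \<omega> \<le> down_cost lam x policy \<eta> \<omega>"
        using elim(2) limsup_subseq_mono[of Suc "\<lambda>n. ennreal (riemann T n \<omega>)"]
        by (auto simp: Q_def strict_mono_def o_def intro: order_trans)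
      ultimately show ?case by (auto intro!: add_mono mult_left_mono)
    qed
  qed
  finally show ?thesis .
qed

lemma reflection_cost_le: "\<alpha> \<le> \<kappa> * c \<Longrightarrow> reflection_cost \<le> J2 x policy \<eta>"
  by (rule reflection_cost_leI) (rule truncated_cost_le)

end

section \<open>The discounted cost of the uncontrolled process\<close>

interpretation std_normal: real_distribution std_normal_distribution
  by (rule real_dist_normal_dist)

lemma Phi_nonneg: "0 \<le> Phi q" and Phi_le_1: "Phi q \<le> 1"
  by (simp_all add: Phi_def std_normal.cdf_nonneg std_normal.cdf_bounded_prob)

lemma Phi_measurable[measurable]: "Phi \<in> borel_measurable borel"
  unfolding Phi_def by (rule borel_measurable_mono) (auto intro!: monoI std_normal.cdf_nondecreasing)

text \<open>A distribution function is continuous where the measure has no atom, and a density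
  excludes atoms.\<close>

lemma Phi_isCont: "isCont Phi q"
proof -
  have "emeasure std_normal_distribution {q} = (\<integral>\<^sup>+w. ennreal (std_normal_density w) * indicator {q} w \<partial>lborel)"
    by (rule emeasure_density) auto
  also have "\<dots> = 0"
    by (subst nn_integral_0_iff_AE) (use AE_lborel_singleton[of q] in \<open>auto elim!: eventually_mono\<close>)
  finally show ?thesis unfolding Phi_def std_normal.isCont_cdf by (simp add: measure_def)
qed

lemma nn_integral_normal_tail:
  assumes s: "0 < s"
  shows "(\<integral>\<^sup>+z\<in>{b<..}. ennreal (normal_density \<mu> s z) \<partial>lborel) = ennreal (Phi ((\<mu> - b) / s))"
proof -
  define q where "q = (\<mu> - b) / s"
  \<comment> \<open>The substitution \<open>z =\<close> \<mu> \<open>- s * w\<close> normalises and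
    at the same time turns the upper tail into a lower one, as \<open>Phi\<close> requires.\<close>
  have e: "ennreal s * ennreal (normal_density \<mu> s (\<mu> + - s * w)) = ennreal (std_normal_density w)" for w
  proof -
    have "s * normal_density \<mu> s (\<mu> + - s * w) = std_normal_density w"
      using s by (simp add: normal_density_def real_sqrt_mult power_mult_distrib)
    then show ?thesis using s by (simp flip: ennreal_mult)
  qed
  have i: "indicator {b<..} (\<mu> + - s * w) = (indicator {..<q} w :: ennreal)" for w
    using s by (auto simp: q_def field_simps split: split_indicator)
  have "(\<integral>\<^sup>+z\<in>{b<..}. ennreal (normal_density \<mu> s z) \<partial>lborel)
    = ennreal \<bar>- s\<bar> * (\<integral>\<^sup>+w. ennreal (normal_density \<mu> s (\<mu> + - s * w)) * indicator {b<..} (\<mu> + - s * w) \<partial>lborel)"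
    by (rule nn_integral_real_affine) (use s in auto)
  also have "\<dots> = (\<integral>\<^sup>+w. ennreal s * (ennreal (normal_density \<mu> s (\<mu> + - s * w)) * indicator {b<..} (\<mu> + - s * w)) \<partial>lborel)"
    using s by (subst nn_integral_cmult[symmetric]) auto
  also have "\<dots> = (\<integral>\<^sup>+w. ennreal (std_normal_density w) * indicator {..<q} w \<partial>lborel)"
    unfolding mult.assoc[symmetric] e i ..
  also have "\<dots> = (\<integral>\<^sup>+w. ennreal (std_normal_density w) * indicator {..q} w \<partial>lborel)"
    by (rule nn_integral_cong_AE) (use AE_lborel_singleton[of q] in \<open>auto elim!: eventually_mono split: split_indicator\<close>)
  also have "\<dots> = emeasure std_normal_distribution {..q}"
    by (rule emeasure_density[symmetric]) auto
  also have "\<dots> = ennreal (Phi q)" by (simp add: Phi_def cdf_def std_normal.emeasure_eq_measure)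
  finally show ?thesis by (simp add: q_def)
qed

lemma nn_integral_exp_gauss_tail:
  assumes v: "0 < v"
  shows "(\<integral>\<^sup>+z\<in>{b<..}. ennreal (exp (\<theta> * z)) \<partial>gauss v) = ennreal (exp (\<theta>\<^sup>2 * v / 2) * Phi ((\<theta> * v - b) / sqrt v))"
proof -
  have "(\<integral>\<^sup>+z\<in>{b<..}. ennreal (exp (\<theta> * z)) \<partial>gauss v)
    = (\<integral>\<^sup>+z. ennreal (exp (\<theta>\<^sup>2 * v / 2)) * (ennreal (normal_density (\<theta> * v) (sqrt v) z) * indicator {b<..} z) \<partial>lborel)"
  proof (subst nn_integral_gauss)
    have "ennreal (normal_density 0 (sqrt v) z) * ennreal (exp (\<theta> * z)) = ennreal (exp (\<theta>\<^sup>2 * v / 2)) * ennreal (normal_density (\<theta> * v) (sqrt v) z)" for z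
      using normal_density_tilt[OF v, of \<theta> z] by (simp add: mult.commute flip: ennreal_mult)
    then show "(\<integral>\<^sup>+z. ennreal (normal_density 0 (sqrt v) z) * (ennreal (exp (\<theta> * z)) * indicator {b<..} z) \<partial>lborel)
      = (\<integral>\<^sup>+z. ennreal (exp (\<theta>\<^sup>2 * v / 2)) * (ennreal (normal_density (\<theta> * v) (sqrt v) z) * indicator {b<..} z) \<partial>lborel)"
      by (simp add: mult.assoc[symmetric])
  qed measurable
  also have "\<dots> = ennreal (exp (\<theta>\<^sup>2 * v / 2)) * ennreal (Phi ((\<theta> * v - b) / sqrt v))"
    using v by (subst nn_integral_cmult) (auto simp: nn_integral_normal_tail)
  finally show ?thesis by (simp add: ennreal_mult Phi_nonneg)
qed

context reflected
begin

abbreviation drift :: real where "drift \<equiv> r - g - \<sigma>\<^sup>2 / 2"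

definition disc :: real where "disc = lam - (r - g)"

lemma disc_pos: "0 < disc" using lam_gt by (simp add: disc_def)

text \<open>In the terminology of option pricing, \<open>call\<close> is the Black-Scholes price and \<open>delta\<close> its slope.\<close>

definition delta :: "real \<Rightarrow> real \<Rightarrow> real" where
  "delta x t = exp ((r - g) * t) * Phi (d1 r g \<sigma> m x t)"

definition call :: "real \<Rightarrow> real \<Rightarrow> real" where
  "call x t = x * delta x t - m * Phi (d2 r g \<sigma> m x t)"

lemma delta_nonneg: "0 \<le> delta x t" by (simp add: delta_def Phi_nonneg)

lemma delta_le: "delta x t \<le> exp ((r - g) * t)"
  unfolding delta_def using Phi_le_1 by (simp add: mult_left_le)

lemma delta_measurable[measurable]: "(\<lambda>p. delta (fst p) (snd p)) \<in> borel_measurable (borel \<Otimes>\<^sub>M borel)"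
  unfolding delta_def d1_def by measurable

lemma call_measurable[measurable]: "(\<lambda>p. call (fst p) (snd p)) \<in> borel_measurable (borel \<Otimes>\<^sub>M borel)"
  unfolding call_def d2_def d1_def by measurable

lemma in_the_money:
  assumes "0 < x"
  shows "m < x * exp (drift * t + \<sigma> * z) \<longleftrightarrow> - (ln (x / m) + drift * t) / \<sigma> < z"
proof -
  have "m < x * exp (drift * t + \<sigma> * z) \<longleftrightarrow> ln m < ln (x * exp (drift * t + \<sigma> * z))"
    using assms pos by (intro ln_less_cancel_iff[symmetric]) auto
  also have "\<dots> \<longleftrightarrow> - (ln (x / m) + drift * t) < \<sigma> * z"
    using assms pos by (auto simp: ln_mult ln_div)
  also have "\<dots> \<longleftrightarrow> - (ln (x / m) + drift * t) / \<sigma> < z"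
    using pos by (simp add: pos_divide_less_eq mult.commute)
  finally show ?thesis .
qed

lemma tail_arguments:
  assumes t: "0 < t"
  shows "(0 * t - - (ln (x / m) + drift * t) / \<sigma>) / sqrt t = d2 r g \<sigma> m x t"
    and "(\<sigma> * t - - (ln (x / m) + drift * t) / \<sigma>) / sqrt t = d1 r g \<sigma> m x t"
proof -
  have s: "sqrt t * sqrt t = t" using t by simp
  have "d1 r g \<sigma> m x t = ((ln (x / m) + drift * t) + \<sigma>\<^sup>2 * t) / (\<sigma> * sqrt t)"
    unfolding d1_def by (simp add: algebra_simps)
  also have "\<dots> = (ln (x / m) + drift * t) / (\<sigma> * sqrt t) + \<sigma>\<^sup>2 * (sqrt t * sqrt t) / (\<sigma> * sqrt t)"
    by (simp only: s add_divide_distrib)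
  also have "\<sigma>\<^sup>2 * (sqrt t * sqrt t) / (\<sigma> * sqrt t) = \<sigma> * sqrt t"
  proof -
    have "\<sigma>\<^sup>2 * (sqrt t * sqrt t) = (\<sigma> * sqrt t) * (\<sigma> * sqrt t)" by (simp only: power2_eq_square ac_simps)
    moreover have "\<sigma> * sqrt t \<noteq> 0" using pos t by simp
    ultimately show ?thesis by (simp only: nonzero_mult_div_cancel_left[OF \<open>\<sigma> * sqrt t \<noteq> 0\<close>])
  qed
  finally have d1: "d1 r g \<sigma> m x t = (ln (x / m) + drift * t) / (\<sigma> * sqrt t) + \<sigma> * sqrt t" .
  define l where "l = ln (x / m) + drift * t"
  note d1 = d1[folded l_def]
  show "(0 * t - - (ln (x / m) + drift * t) / \<sigma>) / sqrt t = d2 r g \<sigma> m x t"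
    unfolding d2_def d1 l_def[symmetric] by simp
  have "t / sqrt t = sqrt t" using t by (intro real_div_sqrt) simp
  then have "\<sigma> * t / sqrt t = \<sigma> * sqrt t" by (metis times_divide_eq_right)
  then show "(\<sigma> * t - - (ln (x / m) + drift * t) / \<sigma>) / sqrt t = d1 r g \<sigma> m x t"
    unfolding d1 l_def[symmetric] by (simp add: add_divide_distrib)
qed

lemma nn_integral_delta:
  assumes "0 < x" "0 < t"
  shows "(\<integral>\<^sup>+z. ennreal (exp (drift * t + \<sigma> * z)) * indicator {z. m < x * exp (drift * t + \<sigma> * z)} z \<partial>gauss t) = ennreal (delta x t)"
proof -
  define b where "b = - (ln (x / m) + drift * t) / \<sigma>"
  have A: "{z. m < x * exp (drift * t + \<sigma> * z)} = {b<..}" using in_the_money[OF assms(1)] by (auto simp: b_def)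
  have "(\<integral>\<^sup>+z. ennreal (exp (drift * t + \<sigma> * z)) * indicator {b<..} z \<partial>gauss t)
    = (\<integral>\<^sup>+z. ennreal (exp (drift * t)) * (ennreal (exp (\<sigma> * z)) * indicator {b<..} z) \<partial>gauss t)"
    by (simp add: exp_add ennreal_mult mult.assoc)
  also have "\<dots> = ennreal (exp (drift * t)) * ennreal (exp (\<sigma>\<^sup>2 * t / 2) * Phi ((\<sigma> * t - b) / sqrt t))"
    by (subst nn_integral_cmult) (auto simp: nn_integral_exp_gauss_tail[OF assms(2)])
  also have "\<dots> = ennreal ((exp (drift * t) * exp (\<sigma>\<^sup>2 * t / 2)) * Phi (d1 r g \<sigma> m x t))"
    unfolding b_def tail_arguments(2)[OF assms(2)] by (simp add: ennreal_mult Phi_nonneg mult.assoc)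
  also have "exp (drift * t) * exp (\<sigma>\<^sup>2 * t / 2) = exp ((r - g) * t)"
    by (simp add: algebra_simps flip: exp_add)
  finally show ?thesis by (simp add: A delta_def)
qed

lemma nn_integral_call:
  assumes x: "0 < x" and t: "0 < t"
  shows "(\<integral>\<^sup>+z. ennreal (max 0 (x * exp (drift * t + \<sigma> * z) - m)) \<partial>gauss t) = ennreal (call x t)"
    and call_nonneg: "0 \<le> call x t"
proof -
  define b where "b = - (ln (x / m) + drift * t) / \<sigma>"
  define I where "I = (\<integral>\<^sup>+z. ennreal (max 0 (x * exp (drift * t + \<sigma> * z) - m)) \<partial>gauss t)"
  have A: "{z. m < x * exp (drift * t + \<sigma> * z)} = {b<..}" using in_the_money[OF x] by (auto simp: b_def)
  have "(\<integral>\<^sup>+z\<in>{b<..}. ennreal (exp (0 * z)) \<partial>gauss t) = ennreal (Phi (d2 r g \<sigma> m x t))"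
    unfolding nn_integral_exp_gauss_tail[OF t] b_def tail_arguments(1)[OF t] by simp
  then have P: "(\<integral>\<^sup>+z. ennreal m * indicator {b<..} z \<partial>gauss t) = ennreal (m * Phi (d2 r g \<sigma> m x t))"
    using pos by (subst nn_integral_cmult) (auto simp: ennreal_mult Phi_nonneg)
  have "I + ennreal (m * Phi (d2 r g \<sigma> m x t)) = (\<integral>\<^sup>+z. ennreal (max 0 (x * exp (drift * t + \<sigma> * z) - m)) + ennreal m * indicator {b<..} z \<partial>gauss t)"
    unfolding I_def P[symmetric] by (rule nn_integral_add[symmetric]) auto
  also have "\<dots> = (\<integral>\<^sup>+z. ennreal x * (ennreal (exp (drift * t + \<sigma> * z)) * indicator {z. m < x * exp (drift * t + \<sigma> * z)} z) \<partial>gauss t)"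
  proof (intro nn_integral_cong)
    fix z
    have "z \<in> {b<..} \<longleftrightarrow> m < x * exp (drift * t + \<sigma> * z)" using in_the_money[OF x] by (auto simp: b_def)
    then show "ennreal (max 0 (x * exp (drift * t + \<sigma> * z) - m)) + ennreal m * indicator {b<..} z
      = ennreal x * (ennreal (exp (drift * t + \<sigma> * z)) * indicator {z. m < x * exp (drift * t + \<sigma> * z)} z)"
      using x pos by (auto simp: ennreal_mult[symmetric] simp: ennreal_neg simp flip: ennreal_plus split: split_indicator)
  qed
  also have "\<dots> = ennreal x * ennreal (delta x t)"
    using nn_integral_delta[OF x t] by (subst nn_integral_cmult) (auto simp: A)
  also have "\<dots> = ennreal (x * delta x t)" using x by (simp add: ennreal_mult delta_nonneg)
  finally have eq: "I + ennreal (m * Phi (d2 r g \<sigma> m x t)) = ennreal (x * delta x t)" .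
  then obtain i where i: "0 \<le> i" "I = ennreal i" by (cases I) auto
  have "ennreal (i + m * Phi (d2 r g \<sigma> m x t)) = ennreal (x * delta x t)"
    using eq i pos by (simp add: Phi_nonneg)
  then have "i + m * Phi (d2 r g \<sigma> m x t) = x * delta x t"
    using i x pos Phi_nonneg delta_nonneg by (subst (asm) ennreal_inj) auto
  then have "i = call x t" by (simp add: call_def)
  with i show "(\<integral>\<^sup>+z. ennreal (max 0 (x * exp (drift * t + \<sigma> * z) - m)) \<partial>gauss t) = ennreal (call x t)" "0 \<le> call x t"
    by (auto simp: I_def)
qed

text \<open>Convexity of the payoff replaces the differentiation of \<open>call\<close>.\<close>

lemma call_slope:
  assumes w: "0 < w" "w \<le> x" and t: "0 < t"
  shows "(x - w) * delta w t \<le> call x t - call w t" and "call x t - call w t \<le> (x - w) * delta x t"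
proof -
  have x: "0 < x" using w by simp
  note c = nn_integral_call[OF w(1) t] nn_integral_call[OF x t]
  have we: "w * exp (drift * t + \<sigma> * z) \<le> x * exp (drift * t + \<sigma> * z)" for z
    using w by (intro mult_right_mono) auto
  have D: "(\<integral>\<^sup>+z. ennreal (max 0 (w * exp (drift * t + \<sigma> * z) - m)) + ennreal (x - w) * (ennreal (exp (drift * t + \<sigma> * z)) * indicator {z. m < v * exp (drift * t + \<sigma> * z)} z) \<partial>gauss t)
    = ennreal (call w t + (x - w) * delta v t)" if v: "0 < v" for v
  proof -
    have [measurable]: "{z. m < v * exp (drift * t + \<sigma> * z)} \<in> sets borel" by measurable
    have "(\<integral>\<^sup>+z. ennreal (max 0 (w * exp (drift * t + \<sigma> * z) - m)) + ennreal (x - w) * (ennreal (exp (drift * t + \<sigma> * z)) * indicator {z. m < v * exp (drift * t + \<sigma> * z)} z) \<partial>gauss t)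
      = ennreal (call w t) + ennreal (x - w) * ennreal (delta v t)"
      using nn_integral_delta[OF v t] c by (subst nn_integral_add) (auto simp: nn_integral_cmult)
    also have "\<dots> = ennreal (call w t + (x - w) * delta v t)"
      using w delta_nonneg[of v t] c by (simp add: ennreal_mult)
    finally show ?thesis .
  qed
  have "ennreal (call w t + (x - w) * delta w t) \<le> ennreal (call x t)"
    unfolding D[OF w(1), symmetric] c(3)[symmetric]
  proof (intro nn_integral_mono)
    fix z
    show "ennreal (max 0 (w * exp (drift * t + \<sigma> * z) - m)) + ennreal (x - w) * (ennreal (exp (drift * t + \<sigma> * z)) * indicator {z. m < w * exp (drift * t + \<sigma> * z)} z)
      \<le> ennreal (max 0 (x * exp (drift * t + \<sigma> * z) - m))"
    proof (cases "m < w * exp (drift * t + \<sigma> * z)")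
      case True
      then have "max 0 (w * exp (drift * t + \<sigma> * z) - m) + (x - w) * exp (drift * t + \<sigma> * z) \<le> max 0 (x * exp (drift * t + \<sigma> * z) - m)"
        by (simp add: left_diff_distrib)
      from ennreal_leI[OF this] show ?thesis using True w by (simp add: ennreal_mult)
    next
      case False
      then have "max 0 (w * exp (drift * t + \<sigma> * z) - m) = 0" by simp
      then show ?thesis using False by simp
    qed
  qed
  then show "(x - w) * delta w t \<le> call x t - call w t"
    using c(4) by (subst (asm) ennreal_le_iff) auto
  have "ennreal (call x t) \<le> ennreal (call w t + (x - w) * delta x t)"
    unfolding D[OF x, symmetric] c(3)[symmetric]
  proof (intro nn_integral_mono)
    fix z
    show "ennreal (max 0 (x * exp (drift * t + \<sigma> * z) - m)) \<le> ennreal (max 0 (w * exp (drift * t + \<sigma> * z) - m)) + ennreal (x - w) * (ennreal (exp (drift * t + \<sigma> * z)) * indicator {z. m < x * exp (drift * t + \<sigma> * z)} z)"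
    proof (cases "m < x * exp (drift * t + \<sigma> * z)")
      case True
      then have "max 0 (x * exp (drift * t + \<sigma> * z) - m) \<le> max 0 (w * exp (drift * t + \<sigma> * z) - m) + (x - w) * exp (drift * t + \<sigma> * z)"
        using we[of z] by (simp add: left_diff_distrib)
      from order_trans[OF ennreal_leI[OF this] ennreal_add_le] show ?thesis using True w by (simp add: ennreal_mult)
    next
      case False
      then have "max 0 (x * exp (drift * t + \<sigma> * z) - m) = 0" by simp
      then show ?thesis by simp
    qed
  qed
  then show "call x t - call w t \<le> (x - w) * delta x t"
    using w delta_nonneg[of x t] c(2) by (subst (asm) ennreal_le_iff) auto
qed

lemma exp_disc: "exp (- lam * t) * exp ((r - g) * t) = exp (- disc * t)"
  by (simp add: disc_def algebra_simps flip: exp_add)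

lemma discounted_delta_le: "exp (- lam * t) * delta x t \<le> exp (- disc * t)"
  unfolding exp_disc[symmetric] by (intro mult_left_mono delta_le) simp

lemma call_le: "0 < x \<Longrightarrow> call x t \<le> x * exp ((r - g) * t)"
  unfolding call_def using mult_left_mono[OF delta_le[of x t], of x] pos Phi_nonneg[of "d2 r g \<sigma> m x t"]
  by (smt (verit) mult_nonneg_nonneg)

lemma discounted_call_le: assumes "0 < x" shows "exp (- lam * t) * call x t \<le> x * exp (- disc * t)"
proof -
  have "exp (- lam * t) * call x t \<le> exp (- lam * t) * (x * exp ((r - g) * t))"
    by (intro mult_left_mono call_le assms) simp
  also have "\<dots> = x * exp (- disc * t)" unfolding exp_disc[symmetric] by simp
  finally show ?thesis .
qed

lemma integrable_exp_disc: "set_integrable lborel {0<..} (\<lambda>t. exp (- disc * t))"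
  unfolding set_integrable_def
proof (rule integrableI_bounded)
  have "(\<integral>\<^sup>+t. ennreal (norm (indicat_real {0<..} t *\<^sub>R exp (- disc * t))) \<partial>lborel) \<le> (\<integral>\<^sup>+t\<in>{0..}. ennreal (exp (- disc * t)) \<partial>lborel)"
    by (intro nn_integral_mono) (auto split: split_indicator)
  also have "\<dots> < \<infinity>" by (simp only: nn_integral_exp_decay[OF disc_pos]) simp
  finally show "(\<integral>\<^sup>+t. ennreal (norm (indicat_real {0<..} t *\<^sub>R exp (- disc * t))) \<partial>lborel) < \<infinity>" .
qed measurable

lemma LBINT_exp_disc: "(LBINT t:{0<..}. exp (- disc * t)) \<le> 1 / disc"
proof -
  have "ennreal (LBINT t:{0<..}. exp (- disc * t)) = (\<integral>\<^sup>+t. ennreal (indicat_real {0<..} t *\<^sub>R exp (- disc * t)) \<partial>lborel)"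
    unfolding set_lebesgue_integral_def
    by (rule nn_integral_eq_integral[symmetric]) (use integrable_exp_disc in \<open>auto simp: set_integrable_def\<close>)
  also have "\<dots> \<le> (\<integral>\<^sup>+t\<in>{0..}. ennreal (exp (- disc * t)) \<partial>lborel)"
    by (intro nn_integral_mono) (auto split: split_indicator)
  also have "\<dots> = ennreal (1 / disc)" by (rule nn_integral_exp_decay[OF disc_pos])
  finally show ?thesis using disc_pos by (subst (asm) ennreal_le_iff) auto
qed

lemma delta_integrable: "set_integrable lborel {0<..} (\<lambda>t. exp (- lam * t) * delta x t)"
proof (rule set_integrable_bound[OF integrable_exp_disc])
  show "set_borel_measurable lborel {0<..} (\<lambda>t. exp (- lam * t) * delta x t)"
    unfolding set_borel_measurable_def delta_def d1_def by measurable
  show "AE t in lborel. t \<in> {0<..} \<longrightarrow> norm (exp (- lam * t) * delta x t) \<le> norm (exp (- disc * t))"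
    using delta_nonneg discounted_delta_le by (simp add: abs_mult)
qed

lemma call_integrable:
  assumes x: "0 < x"
  shows "set_integrable lborel {0<..} (\<lambda>t. exp (- lam * t) * call x t)"
proof (rule set_integrable_bound)
  show "set_integrable lborel {0<..} (\<lambda>t. x * exp (- disc * t))" by (intro set_integrable_mult_right integrable_exp_disc)
  show "set_borel_measurable lborel {0<..} (\<lambda>t. exp (- lam * t) * call x t)"
    unfolding set_borel_measurable_def call_def delta_def d2_def d1_def by measurable
  show "AE t in lborel. t \<in> {0<..} \<longrightarrow> norm (exp (- lam * t) * call x t) \<le> norm (x * exp (- disc * t))"
    using discounted_call_le[OF x] call_nonneg[OF x] x by (simp add: abs_mult)
qed

abbreviation Hc :: "real \<Rightarrow> real" where "Hc \<equiv> H r g \<sigma> lam \<alpha> m"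

text \<open>Takes the role of the derivative of \<open>Hc\<close>; this is expressed by the chord
  inequalities in \<open>H_slope\<close>.\<close>

definition G :: "real \<Rightarrow> real" where
  "G x = \<alpha> * (LBINT t:{0<..}. exp (- lam * t) * delta x t)"

lemma H_eq: "Hc x = \<alpha> * (LBINT t:{0<..}. exp (- lam * t) * call x t)"
proof -
  have "x * exp (- (lam - (r - g)) * t) * Phi (d1 r g \<sigma> m x t) - m * exp (- lam * t) * Phi (d2 r g \<sigma> m x t) = exp (- lam * t) * call x t" for t
    unfolding call_def delta_def disc_def[symmetric] exp_disc[symmetric] by (simp add: algebra_simps)
  then show ?thesis by (simp add: H_def)
qed

lemma D2_eq: "D2 r g \<sigma> lam \<alpha> m \<theta> a = - (1 / \<theta>) * a powr (1 - \<theta>) * G a"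
  unfolding D2_def G_def delta_def mult.assoc[symmetric] exp_disc by (simp add: disc_def)

lemma H_slope:
  assumes w: "0 < w" "w \<le> x"
  shows "(x - w) * G w \<le> Hc x - Hc w" and "Hc x - Hc w \<le> (x - w) * G x"
proof -
  have x: "0 < x" using w by simp
  have d: "(LBINT t:{0<..}. exp (- lam * t) * call x t) - (LBINT t:{0<..}. exp (- lam * t) * call w t)
    = (LBINT t:{0<..}. exp (- lam * t) * call x t - exp (- lam * t) * call w t)"
    by (intro set_integral_diff(2)[symmetric] call_integrable x w)
  have di: "set_integrable lborel {0<..} (\<lambda>t. exp (- lam * t) * call x t - exp (- lam * t) * call w t)"
    by (intro set_integral_diff(1) call_integrable x w)
  have m: "(x - w) * (LBINT t:{0<..}. exp (- lam * t) * delta v t) = (LBINT t:{0<..}. (x - w) * (exp (- lam * t) * delta v t))" for v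
    by (rule set_integral_mult_right[symmetric])
  have mi: "set_integrable lborel {0<..} (\<lambda>t. (x - w) * (exp (- lam * t) * delta v t))" for v
    by (rule set_integrable_mult_right[OF delta_integrable])
  have lo: "(x - w) * (exp (- lam * t) * delta w t) \<le> exp (- lam * t) * call x t - exp (- lam * t) * call w t"
    and hi: "exp (- lam * t) * call x t - exp (- lam * t) * call w t \<le> (x - w) * (exp (- lam * t) * delta x t)"
    if "t \<in> {0<..}" for t
    using mult_left_mono[OF call_slope(1)[OF w, of t], of "exp (- lam * t)"]
      mult_left_mono[OF call_slope(2)[OF w, of t], of "exp (- lam * t)"] that
    by (auto simp: right_diff_distrib ac_simps)
  have "(x - w) * (LBINT t:{0<..}. exp (- lam * t) * delta w t) \<le> (LBINT t:{0<..}. exp (- lam * t) * call x t) - (LBINT t:{0<..}. exp (- lam * t) * call w t)"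
    unfolding d m by (rule set_integral_mono[OF mi di lo])
  from mult_left_mono[OF this, of \<alpha>] show "(x - w) * G w \<le> Hc x - Hc w"
    using pos by (simp add: H_eq G_def right_diff_distrib ac_simps)
  have "(LBINT t:{0<..}. exp (- lam * t) * call x t) - (LBINT t:{0<..}. exp (- lam * t) * call w t) \<le> (x - w) * (LBINT t:{0<..}. exp (- lam * t) * delta x t)"
    unfolding d m by (rule set_integral_mono[OF di mi hi])
  from mult_left_mono[OF this, of \<alpha>] show "Hc x - Hc w \<le> (x - w) * G x"
    using pos by (simp add: H_eq G_def right_diff_distrib ac_simps)
qed

lemma G_nonneg: "0 \<le> G x"
  unfolding G_def set_lebesgue_integral_def using pos delta_nonneg
  by (intro mult_nonneg_nonneg integral_nonneg_AE) (auto split: split_indicator)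

lemma G_le: "G x \<le> \<alpha> / disc"
proof -
  have "(LBINT t:{0<..}. exp (- lam * t) * delta x t) \<le> (LBINT t:{0<..}. exp (- disc * t))"
    by (rule set_integral_mono[OF delta_integrable integrable_exp_disc])
       (rule discounted_delta_le)
  also have "\<dots> \<le> 1 / disc" by (rule LBINT_exp_disc)
  finally show ?thesis using mult_left_mono[of _ _ \<alpha>] pos by (fastforce simp: G_def)
qed

text \<open>Dominated convergence: the integrand is continuous in \<open>x\<close> for each positive
  time by continuity of \<open>Phi\<close>, with the majorant
  \<open>exp (- disc * t)\<close>.\<close>

lemma G_isCont: assumes "0 < x" shows "isCont G x"
  unfolding continuous_at_sequentially
proof (intro allI impI)
  fix X :: "nat \<Rightarrow> real" assume X: "X \<longlonglongrightarrow> x"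
  have "(\<lambda>n. LBINT t:{0<..}. exp (- lam * t) * delta (X n) t) \<longlonglongrightarrow> (LBINT t:{0<..}. exp (- lam * t) * delta x t)"
    unfolding set_lebesgue_integral_def
  proof (rule integral_dominated_convergence[where w = "\<lambda>t. indicat_real {0<..} t *\<^sub>R exp (- disc * t)"])
    show "integrable lborel (\<lambda>t. indicat_real {0<..} t *\<^sub>R exp (- disc * t))"
      using integrable_exp_disc by (simp add: set_integrable_def)
    show "AE t in lborel. (\<lambda>n. indicat_real {0<..} t *\<^sub>R (exp (- lam * t) * delta (X n) t)) \<longlonglongrightarrow> indicat_real {0<..} t *\<^sub>R (exp (- lam * t) * delta x t)"
    proof (rule AE_I2)
      fix t :: real
      show "(\<lambda>n. indicat_real {0<..} t *\<^sub>R (exp (- lam * t) * delta (X n) t)) \<longlonglongrightarrow> indicat_real {0<..} t *\<^sub>R (exp (- lam * t) * delta x t)"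
      proof (cases "0 < t")
        case True
        have "(\<lambda>n. d1 r g \<sigma> m (X n) t) \<longlonglongrightarrow> d1 r g \<sigma> m x t"
          unfolding d1_def using True assms pos by (intro tendsto_intros X) auto
        then have "(\<lambda>n. Phi (d1 r g \<sigma> m (X n) t)) \<longlonglongrightarrow> Phi (d1 r g \<sigma> m x t)"
          by (rule isCont_tendsto_compose[OF Phi_isCont])
        then show ?thesis unfolding delta_def by (intro tendsto_intros)
      qed simp
    qed
    show "AE t in lborel. norm (indicat_real {0<..} t *\<^sub>R (exp (- lam * t) * delta (X n) t)) \<le> indicat_real {0<..} t *\<^sub>R exp (- disc * t)" for n
      using delta_nonneg discounted_delta_le by (auto simp: abs_mult split: split_indicator)
  qed (auto simp: delta_def d1_def)
  then show "(G \<circ> X) \<longlonglongrightarrow> G x" unfolding G_def comp_def by (intro tendsto_intros)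
qed

lemma ennreal_H:
  assumes x: "0 < x"
  shows "ennreal (Hc x) = (\<integral>\<^sup>+t\<in>{0<..}. ennreal (\<alpha> * exp (- lam * t) * call x t) \<partial>lborel)" and H_nonneg: "0 \<le> Hc x"
proof -
  have nn: "0 \<le> indicat_real {0<..} t *\<^sub>R (exp (- lam * t) * call x t)" for t
    using call_nonneg[OF x, of t] by (auto split: split_indicator)
  have i: "integrable lborel (\<lambda>t. indicat_real {0<..} t *\<^sub>R (exp (- lam * t) * call x t))"
    using call_integrable[OF x] by (simp add: set_integrable_def)
  show H0: "0 \<le> Hc x"
    unfolding H_eq set_lebesgue_integral_def using pos nn by (intro mult_nonneg_nonneg integral_nonneg_AE) auto
  have "ennreal (Hc x) = ennreal \<alpha> * ennreal (LBINT t:{0<..}. exp (- lam * t) * call x t)"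
    unfolding H_eq using pos nn by (intro ennreal_mult) (auto simp: set_lebesgue_integral_def intro!: integral_nonneg_AE)
  also have "\<dots> = ennreal \<alpha> * (\<integral>\<^sup>+t. ennreal (indicat_real {0<..} t *\<^sub>R (exp (- lam * t) * call x t)) \<partial>lborel)"
    unfolding set_lebesgue_integral_def by (subst nn_integral_eq_integral[OF i]) (use nn in auto)
  also have "\<dots> = (\<integral>\<^sup>+t. ennreal \<alpha> * ennreal (indicat_real {0<..} t *\<^sub>R (exp (- lam * t) * call x t)) \<partial>lborel)"
    by (rule nn_integral_cmult[symmetric]) (use i in measurable)
  also have "\<dots> = (\<integral>\<^sup>+t\<in>{0<..}. ennreal (\<alpha> * exp (- lam * t) * call x t) \<partial>lborel)"
    using pos call_nonneg[OF x] by (intro nn_integral_cong) (auto split: split_indicator simp: ennreal_mult mult.assoc)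
  finally show "ennreal (Hc x) = (\<integral>\<^sup>+t\<in>{0<..}. ennreal (\<alpha> * exp (- lam * t) * call x t) \<partial>lborel)" .
qed

lemma H_le: assumes x: "0 < x" shows "Hc x \<le> \<alpha> / disc * x"
proof -
  have "(LBINT t:{0<..}. exp (- lam * t) * call x t) \<le> (LBINT t:{0<..}. x * exp (- disc * t))"
    by (rule set_integral_mono[OF call_integrable[OF x] set_integrable_mult_right[OF integrable_exp_disc]])
       (rule discounted_call_le[OF x])
  also have "\<dots> = x * (LBINT t:{0<..}. exp (- disc * t))" by (rule set_integral_mult_right)
  also have "\<dots> \<le> x * (1 / disc)" using x LBINT_exp_disc by (intro mult_left_mono) auto
  finally have "Hc x \<le> \<alpha> * (x * (1 / disc))" unfolding H_eq using pos by (intro mult_left_mono) auto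
  then show ?thesis by simp
qed

end

section \<open>The value function\<close>

context reflected
begin

lemma call_comp_measurable[measurable (raw)]:
  "f \<in> borel_measurable N \<Longrightarrow> h \<in> borel_measurable N \<Longrightarrow> (\<lambda>p. call (f p) (h p)) \<in> borel_measurable N"
  using measurable_compose[OF measurable_Pair call_measurable, of f N h] by simp

lemma H_comp_measurable:
  assumes [measurable]: "Y \<in> borel_measurable N" and Y: "\<And>\<omega>. 0 < Y \<omega>"
  shows "(\<lambda>\<omega>. Hc (Y \<omega>)) \<in> borel_measurable N"
proof -
  have "(\<lambda>x. \<integral>\<^sup>+t\<in>{0<..}. ennreal (\<alpha> * exp (- lam * t) * call x t) \<partial>lborel) \<in> borel_measurable borel"
    by measurable
  from measurable_compose[OF assms(1) this]
  have "(\<lambda>\<omega>. enn2real (\<integral>\<^sup>+t\<in>{0<..}. ennreal (\<alpha> * exp (- lam * t) * call (Y \<omega>) t) \<partial>lborel)) \<in> borel_measurable N"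
    by measurable
  then show ?thesis unfolding ennreal_H(1)[OF Y, symmetric] using H_nonneg[OF Y] by simp
qed

text \<open>Mean discounted running cost at time \<open>u\<close> of the state whose factor next to
  \<open>exp B\<close> is frozen at \<zeta>.\<close>

definition payoff :: "('a \<Rightarrow> real) \<Rightarrow> real \<Rightarrow> ennreal" where
  "payoff \<zeta> u = (\<integral>\<^sup>+\<omega>. ennreal (\<alpha> * exp (- lam * u) * max 0 (\<zeta> \<omega> * exp (B u \<omega>) - m)) \<partial>M)"

lemma payoff_measurable:
  assumes [measurable]: "\<zeta> \<in> borel_measurable M"
  shows "(\<lambda>u. payoff \<zeta> (max 0 u)) \<in> borel_measurable borel"
  unfolding payoff_def by (rule borel_measurable_nn_integral) (simp add: case_prod_beta)

text \<open>Integrating out the increment of \<open>B\<close> after \<open>s\<close>, which is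
  independent of \<open>Y\<close>, turns the payoff into \<open>call\<close>; so \<open>Hc\<close>
  of the present state is the mean cost from now on without any control.\<close>

lemma nn_integral_H:
  assumes s: "0 \<le> s" and YF: "Y \<in> borel_measurable (F s)" and Y: "\<And>\<omega>. 0 < Y \<omega>"
  shows "(\<integral>\<^sup>+\<omega>. ennreal (Hc (Y \<omega>)) \<partial>M)
    = (\<integral>\<^sup>+u\<in>{0<..}. (\<integral>\<^sup>+\<omega>. ennreal (\<alpha> * exp (- lam * u) * max 0 (Y \<omega> * exp (B (s + u) \<omega> - B s \<omega>) - m)) \<partial>M) \<partial>lborel)"
proof -
  note [measurable] = measurable_F_M[OF YF]
  have "(\<integral>\<^sup>+\<omega>. ennreal (Hc (Y \<omega>)) \<partial>M) = (\<integral>\<^sup>+\<omega>. (\<integral>\<^sup>+u\<in>{0..}. ennreal (\<alpha> * exp (- lam * u) * call (Y \<omega>) u) * indicator {0<..} u \<partial>lborel) \<partial>M)"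
    unfolding ennreal_H(1)[OF Y] by (intro nn_integral_cong) (auto split: split_indicator)
  also have "\<dots> = (\<integral>\<^sup>+u\<in>{0..}. (\<integral>\<^sup>+\<omega>. ennreal (\<alpha> * exp (- lam * u) * call (Y \<omega>) u) * indicator {0<..} u \<partial>M) \<partial>lborel)"
    by (rule nn_integral_swap(1)) measurable
  also have "\<dots> = (\<integral>\<^sup>+u\<in>{0<..}. (\<integral>\<^sup>+\<omega>. ennreal (\<alpha> * exp (- lam * u) * max 0 (Y \<omega> * exp (B (s + u) \<omega> - B s \<omega>) - m)) \<partial>M) \<partial>lborel)"
  proof (intro nn_integral_cong)
    fix u :: real
    show "(\<integral>\<^sup>+\<omega>. ennreal (\<alpha> * exp (- lam * u) * call (Y \<omega>) u) * indicator {0<..} u \<partial>M) * indicator {0..} u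
      = (\<integral>\<^sup>+\<omega>. ennreal (\<alpha> * exp (- lam * u) * max 0 (Y \<omega> * exp (B (s + u) \<omega> - B s \<omega>) - m)) \<partial>M) * indicator {0<..} u"
    proof (cases "0 < u")
      case True
      define h where "h p = ennreal (\<alpha> * exp (- lam * u)) * ennreal (max 0 (fst p * exp (drift * u + \<sigma> * snd p) - m))" for p :: "real \<times> real"
      have hM: "h \<in> borel_measurable (borel \<Otimes>\<^sub>M borel)" unfolding h_def[abs_def] by measurable
      have split: "ennreal (\<alpha> * exp (- lam * u) * v) = ennreal (\<alpha> * exp (- lam * u)) * ennreal v" if "0 \<le> v" for v
        using pos that by (intro ennreal_mult) auto
      have "(\<integral>\<^sup>+\<omega>. ennreal (\<alpha> * exp (- lam * u) * call (Y \<omega>) u) \<partial>M) = (\<integral>\<^sup>+\<omega>. (\<integral>\<^sup>+z. h (Y \<omega>, z) \<partial>gauss (s + u - s)) \<partial>M)"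
      proof (intro nn_integral_cong)
        fix \<omega>
        have "(\<integral>\<^sup>+z. h (Y \<omega>, z) \<partial>gauss (s + u - s)) = ennreal (\<alpha> * exp (- lam * u)) * ennreal (call (Y \<omega>) u)"
          unfolding h_def fst_conv snd_conv add_diff_cancel_left' using nn_integral_call(1)[OF Y True, of \<omega>]
          by (subst nn_integral_cmult) auto
        then show "ennreal (\<alpha> * exp (- lam * u) * call (Y \<omega>) u) = (\<integral>\<^sup>+z. h (Y \<omega>, z) \<partial>gauss (s + u - s))"
          using split[OF call_nonneg[OF Y True]] by simp
      qed
      also have "\<dots> = (\<integral>\<^sup>+\<omega>. h (Y \<omega>, Wc (s + u) \<omega> - Wc s \<omega>) \<partial>M)"
        by (rule nn_integral_increment[OF s _ YF hM, symmetric]) (use True in simp)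
      also have "\<dots> = (\<integral>\<^sup>+\<omega>. ennreal (\<alpha> * exp (- lam * u) * max 0 (Y \<omega> * exp (B (s + u) \<omega> - B s \<omega>) - m)) \<partial>M)"
        unfolding h_def fst_conv snd_conv B_diff add_diff_cancel_left'
        by (intro nn_integral_cong split[symmetric]) simp
      finally show ?thesis using True by simp
    qed (auto split: split_indicator)
  qed
  finally show ?thesis .
qed

text \<open>The Markov property in discounted form: seen from time 0, the value \<open>Hc\<close> at
  time \<open>s\<close> is what the process with frozen factor still has to pay after
  \<open>s\<close>.\<close>

lemma discounted_H:
  assumes s: "0 \<le> s" and \<zeta>F: "\<zeta> \<in> borel_measurable (F s)" and \<zeta>: "\<And>\<omega>. 0 < \<zeta> \<omega>"
  shows "ennreal (exp (- lam * s)) * (\<integral>\<^sup>+\<omega>. ennreal (Hc (\<zeta> \<omega> * exp (B s \<omega>))) \<partial>M) = (\<integral>\<^sup>+u\<in>{s<..}. payoff \<zeta> u \<partial>lborel)"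
proof -
  let ?g = "\<lambda>u \<omega>. ennreal (\<alpha> * exp (- lam * u) * max 0 (\<zeta> \<omega> * exp (B s \<omega>) * exp (B (s + u) \<omega> - B s \<omega>) - m))"
  note [measurable] = measurable_F_M[OF \<zeta>F] payoff_measurable[OF measurable_F_M[OF \<zeta>F]]
  have [measurable]: "B u \<in> borel_measurable M" if "0 \<le> u" for u using measurable_F_M[OF B_F[of u u]] that by simp
  have YF: "(\<lambda>\<omega>. \<zeta> \<omega> * exp (B s \<omega>)) \<in> borel_measurable (F s)"
    using \<zeta>F B_F[OF s order_refl] by measurable
  have eq: "payoff \<zeta> u * indicator {s<..} u = payoff \<zeta> (max 0 u) * indicator {s<..} u" for u
    using s by (auto split: split_indicator simp: max_def)
  have "(\<integral>\<^sup>+u\<in>{s<..}. payoff \<zeta> u \<partial>lborel) = ennreal \<bar>1\<bar> * (\<integral>\<^sup>+u. payoff \<zeta> (max 0 (s + 1 * u)) * indicator {s<..} (s + 1 * u) \<partial>lborel)"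
    unfolding eq by (rule nn_integral_real_affine) auto
  also have "\<dots> = (\<integral>\<^sup>+u. payoff \<zeta> (s + u) * indicator {0<..} u \<partial>lborel)"
    using s by (simp, intro nn_integral_cong) (auto split: split_indicator)
  also have "\<dots> = (\<integral>\<^sup>+u. ennreal (exp (- lam * s)) * ((\<integral>\<^sup>+\<omega>. ?g u \<omega> \<partial>M) * indicator {0<..} u) \<partial>lborel)"
  proof (intro nn_integral_cong)
    fix u :: real
    show "payoff \<zeta> (s + u) * indicator {0<..} u
      = ennreal (exp (- lam * s)) * ((\<integral>\<^sup>+\<omega>. ?g u \<omega> \<partial>M) * indicator {0<..} u)"
    proof (cases "0 < u")
      case True
      have [measurable]: "B (s + u) \<in> borel_measurable M" "B s \<in> borel_measurable M" using True s by auto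
      have "payoff \<zeta> (s + u) = (\<integral>\<^sup>+\<omega>. ennreal (exp (- lam * s)) * ?g u \<omega> \<partial>M)"
        unfolding payoff_def
      proof (intro nn_integral_cong)
        fix \<omega>
        have "exp (- lam * (s + u)) = exp (- lam * s) * exp (- lam * u)" by (simp add: distrib_left flip: exp_add)
        moreover have "exp (B s \<omega>) * exp (B (s + u) \<omega> - B s \<omega>) = exp (B (s + u) \<omega>)" by (simp flip: exp_add)
        ultimately show "ennreal (\<alpha> * exp (- lam * (s + u)) * max 0 (\<zeta> \<omega> * exp (B (s + u) \<omega>) - m))
          = ennreal (exp (- lam * s)) * ?g u \<omega>"
          using pos by (subst ennreal_mult[symmetric]) (auto simp: mult.assoc mult.left_commute)
      qed
      also have "\<dots> = ennreal (exp (- lam * s)) * (\<integral>\<^sup>+\<omega>. ?g u \<omega> \<partial>M)"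
        by (rule nn_integral_cmult) measurable
      finally show ?thesis using True by simp
    qed simp
  qed
  also have "\<dots> = ennreal (exp (- lam * s)) * (\<integral>\<^sup>+u\<in>{0<..}. (\<integral>\<^sup>+\<omega>. ?g u \<omega> \<partial>M) \<partial>lborel)"
  proof (rule nn_integral_cmult)
    have "(\<lambda>p. B (max 0 (s + max 0 (fst p))) (snd p)) \<in> borel_measurable (borel \<Otimes>\<^sub>M M)"
      using measurable_compose[OF _ B_joint, of "\<lambda>p. (s + max 0 (fst p), snd p)" "borel \<Otimes>\<^sub>M M"] by simp
    also have "(\<lambda>p. B (max 0 (s + max 0 (fst p))) (snd p)) = (\<lambda>p. B (s + max 0 (fst p)) (snd p))" using s by simp
    finally have [measurable]: "(\<lambda>p. B (s + max 0 (fst p)) (snd p)) \<in> borel_measurable (borel \<Otimes>\<^sub>M M)" .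
    have [measurable]: "B s \<in> borel_measurable M" using s by simp
    have "(\<lambda>u. (\<integral>\<^sup>+\<omega>. ennreal (\<alpha> * exp (- lam * u) * max 0 (\<zeta> \<omega> * exp (B s \<omega>) * exp (B (s + max 0 u) \<omega> - B s \<omega>) - m)) \<partial>M) * indicator {0<..} u) \<in> borel_measurable borel"
      by (intro borel_measurable_times_ennreal borel_measurable_nn_integral borel_measurable_indicator) (simp_all add: case_prod_beta)
    also have "(\<lambda>u. (\<integral>\<^sup>+\<omega>. ennreal (\<alpha> * exp (- lam * u) * max 0 (\<zeta> \<omega> * exp (B s \<omega>) * exp (B (s + max 0 u) \<omega> - B s \<omega>) - m)) \<partial>M) * indicator {0<..} u)
      = (\<lambda>u. (\<integral>\<^sup>+\<omega>. ?g u \<omega> \<partial>M) * indicator {0<..} u)"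
      by (auto simp: fun_eq_iff split: split_indicator)
    finally show "(\<lambda>u. (\<integral>\<^sup>+\<omega>. ?g u \<omega> \<partial>M) * indicator {0<..} u) \<in> borel_measurable lborel"
      by simp
  qed
  also have "\<dots> = ennreal (exp (- lam * s)) * (\<integral>\<^sup>+\<omega>. ennreal (Hc (\<zeta> \<omega> * exp (B s \<omega>))) \<partial>M)"
    using nn_integral_H[OF s YF] \<zeta> by simp
  finally show ?thesis by simp
qed

end

locale valued = reflected +
  fixes \<theta> :: real
  assumes \<theta>_neg: "\<theta> < 0" and \<theta>_root: "1 / 2 * \<sigma>\<^sup>2 * \<theta> * (\<theta> - 1) + (r - g) * \<theta> - lam = 0"
begin

abbreviation Dc :: real where "Dc \<equiv> D2 r g \<sigma> lam \<alpha> m \<theta> a"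

definition V :: "real \<Rightarrow> real" where "V x = Dc * x powr \<theta> + Hc x"

definition V' :: "real \<Rightarrow> real" where "V' x = \<theta> * Dc * x powr (\<theta> - 1) + G x"

text \<open>In this form the quadratic equation says that discounting turns the power of the
  uncontrolled process with exponent \<theta> into a martingale.\<close>

lemma growth_\<theta>: "growth \<theta> = lam"
  using \<theta>_root by (simp add: growth_def power2_eq_square field_simps)

lemma Dc_nonneg: "0 \<le> Dc"
  unfolding D2_eq using \<theta>_neg G_nonneg[of a] by (intro mult_nonneg_nonneg) auto

text \<open>Smooth fit with the constant branch below \<open>a\<close>; this is the equation that
  determines \<open>D2\<close>.\<close>

lemma V'_a: "V' a = 0"
proof -
  have "a powr (1 - \<theta>) * a powr (\<theta> - 1) = 1" using a_pos by (simp flip: powr_add)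
  then show ?thesis using \<theta>_neg by (simp add: V'_def D2_eq mult.assoc mult.left_commute)
qed

lemma V'_isCont: "isCont V' a"
  unfolding V'_def[abs_def] using a_pos by (intro continuous_intros G_isCont) auto

lemma V_nonneg: "0 < x \<Longrightarrow> 0 \<le> V x"
  unfolding V_def using Dc_nonneg H_nonneg by simp

text \<open>Convexity of the power function by the mean value theorem, in the chord form that
  \<open>H_slope\<close> has.\<close>

lemma powr_slope:
  assumes w: "0 < w" "w \<le> x"
  shows "(x - w) * (\<theta> * w powr (\<theta> - 1)) \<le> x powr \<theta> - w powr \<theta>" and "x powr \<theta> - w powr \<theta> \<le> (x - w) * (\<theta> * x powr (\<theta> - 1))"
proof -
  have *: "(x - w) * (\<theta> * w powr (\<theta> - 1)) \<le> x powr \<theta> - w powr \<theta> \<and> x powr \<theta> - w powr \<theta> \<le> (x - w) * (\<theta> * x powr (\<theta> - 1))"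
  proof (cases "w = x")
    case False
    then have wx: "w < x" using w by simp
    have "((\<lambda>x. x powr \<theta>) has_real_derivative \<theta> * z powr (\<theta> - 1)) (at z)" if "w \<le> z" "z \<le> x" for z
      using that w by (auto intro!: derivative_eq_intros simp: powr_diff)
    from MVT2[OF wx this] obtain z where z: "w < z" "z < x" "x powr \<theta> - w powr \<theta> = (x - w) * (\<theta> * z powr (\<theta> - 1))" by auto
    have "z powr (\<theta> - 1) \<le> w powr (\<theta> - 1)" "x powr (\<theta> - 1) \<le> z powr (\<theta> - 1)"
      using z w \<theta>_neg by (auto intro!: powr_mono2')
    then show ?thesis unfolding z(3) using wx \<theta>_neg by (auto intro!: mult_left_mono mult_left_mono_neg)
  qed simp
  show "(x - w) * (\<theta> * w powr (\<theta> - 1)) \<le> x powr \<theta> - w powr \<theta>" "x powr \<theta> - w powr \<theta> \<le> (x - w) * (\<theta> * x powr (\<theta> - 1))"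
    using * by auto
qed

lemma V_slope:
  assumes w: "0 < w" "w \<le> x"
  shows "(x - w) * V' w \<le> V x - V w" and "V x - V w \<le> (x - w) * V' x"
proof -
  have e: "V x - V w = Dc * (x powr \<theta> - w powr \<theta>) + (Hc x - Hc w)" by (simp add: V_def algebra_simps)
  have v: "(x - w) * V' z = Dc * ((x - w) * (\<theta> * z powr (\<theta> - 1))) + (x - w) * G z" for z by (simp add: V'_def algebra_simps)
  show "(x - w) * V' w \<le> V x - V w" "V x - V w \<le> (x - w) * V' x"
    unfolding e v by (intro add_mono mult_left_mono powr_slope H_slope w Dc_nonneg)+
qed

lemma V_comp_measurable:
  assumes [measurable]: "Y \<in> borel_measurable N" and Y: "\<And>\<omega>. 0 < Y \<omega>"
  shows "(\<lambda>\<omega>. V (Y \<omega>)) \<in> borel_measurable N"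
proof -
  have [measurable]: "(\<lambda>\<omega>. Hc (Y \<omega>)) \<in> borel_measurable N" by (rule H_comp_measurable) (use Y in auto)
  show ?thesis unfolding V_def by measurable
qed

text \<open>Exact while the factor is frozen: the discounted power term has constant mean by
  \<open>growth_\<close>\<theta>, and for \<open>Hc\<close> the remaining cost after
  \<open>s\<close> is split at \<open>t\<close>. It takes the place of Ito's formula.\<close>

lemma V_step:
  assumes s: "0 \<le> s" "s \<le> t" and \<zeta>F: "\<zeta> \<in> borel_measurable (F s)" and \<zeta>: "\<And>\<omega>. 0 < \<zeta> \<omega>"
  shows "ennreal (exp (- lam * s)) * (\<integral>\<^sup>+\<omega>. ennreal (V (\<zeta> \<omega> * exp (B s \<omega>))) \<partial>M)
    = ennreal (exp (- lam * t)) * (\<integral>\<^sup>+\<omega>. ennreal (V (\<zeta> \<omega> * exp (B t \<omega>))) \<partial>M) + (\<integral>\<^sup>+u\<in>{s<..t}. payoff \<zeta> u \<partial>lborel)"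
proof -
  have \<zeta>M[measurable]: "\<zeta> \<in> borel_measurable M" by (rule measurable_F_M[OF \<zeta>F])
  have BM: "B u \<in> borel_measurable M" if "0 \<le> u" for u using measurable_F_M[OF B_F[of u u]] that by simp
  have t: "0 \<le> t" using s by simp
  define P where "P u = (\<integral>\<^sup>+\<omega>. ennreal ((\<zeta> \<omega> * exp (B u \<omega>)) powr \<theta>) \<partial>M)" for u
  have split: "(\<integral>\<^sup>+\<omega>. ennreal (V (\<zeta> \<omega> * exp (B u \<omega>))) \<partial>M) = ennreal Dc * P u + (\<integral>\<^sup>+\<omega>. ennreal (Hc (\<zeta> \<omega> * exp (B u \<omega>))) \<partial>M)"
    if u: "0 \<le> u" for u
  proof -
    note [measurable] = BM[OF u]
    have [measurable]: "(\<lambda>\<omega>. Hc (\<zeta> \<omega> * exp (B u \<omega>))) \<in> borel_measurable M"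
      by (rule H_comp_measurable) (use \<zeta> in auto)
    have "(\<integral>\<^sup>+\<omega>. ennreal (V (\<zeta> \<omega> * exp (B u \<omega>))) \<partial>M)
      = (\<integral>\<^sup>+\<omega>. ennreal Dc * ennreal ((\<zeta> \<omega> * exp (B u \<omega>)) powr \<theta>) + ennreal (Hc (\<zeta> \<omega> * exp (B u \<omega>))) \<partial>M)"
      using Dc_nonneg H_nonneg \<zeta> by (intro nn_integral_cong) (simp add: V_def ennreal_mult)
    then show ?thesis unfolding P_def by (simp add: nn_integral_add nn_integral_cmult)
  qed
  have powr_eq: "(\<zeta> \<omega> * exp (B t \<omega>)) powr \<theta> = (\<zeta> \<omega> * exp (B s \<omega>)) powr \<theta> * exp (\<theta> * (B t \<omega> - B s \<omega>))" for \<omega>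
    using \<zeta>[of \<omega>] by (simp add: powr_mult powr_def[of "exp _"] right_diff_distrib exp_diff)
  have "P t = (\<integral>\<^sup>+\<omega>. ennreal ((\<zeta> \<omega> * exp (B s \<omega>)) powr \<theta>) * ennreal (exp (\<theta> * (B t \<omega> - B s \<omega>))) \<partial>M)"
    unfolding P_def powr_eq by (intro nn_integral_cong ennreal_mult) auto
  also have "\<dots> = ennreal (exp (growth \<theta> * (t - s))) * P s"
    unfolding P_def by (rule nn_integral_expB[OF s]) (use \<zeta>F B_F[of s s] s in measurable)
  finally have Pt: "P t = ennreal (exp (lam * (t - s))) * P s" by (simp add: growth_\<theta>)
  have "ennreal (exp (- lam * t)) * P t = ennreal (exp (- lam * t) * exp (lam * (t - s))) * P s"
    unfolding Pt by (simp add: ennreal_mult mult.assoc)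
  also have "exp (- lam * t) * exp (lam * (t - s)) = exp (- lam * s)"
    by (simp add: algebra_simps flip: exp_add)
  finally have PP: "ennreal (exp (- lam * t)) * P t = ennreal (exp (- lam * s)) * P s" .
  have "(\<integral>\<^sup>+u\<in>{s<..}. payoff \<zeta> u \<partial>lborel) = (\<integral>\<^sup>+u. payoff \<zeta> (max 0 u) * indicator {s<..t} u + payoff \<zeta> (max 0 u) * indicator {t<..} u \<partial>lborel)"
    using s by (intro nn_integral_cong) (auto split: split_indicator)
  also have "\<dots> = (\<integral>\<^sup>+u\<in>{s<..t}. payoff \<zeta> (max 0 u) \<partial>lborel) + (\<integral>\<^sup>+u\<in>{t<..}. payoff \<zeta> (max 0 u) \<partial>lborel)"
    using payoff_measurable[OF \<zeta>M] by (intro nn_integral_add) auto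
  also have "(\<integral>\<^sup>+u\<in>{s<..t}. payoff \<zeta> (max 0 u) \<partial>lborel) = (\<integral>\<^sup>+u\<in>{s<..t}. payoff \<zeta> u \<partial>lborel)"
    using s by (intro nn_integral_cong) (auto split: split_indicator)
  also have "(\<integral>\<^sup>+u\<in>{t<..}. payoff \<zeta> (max 0 u) \<partial>lborel) = (\<integral>\<^sup>+u\<in>{t<..}. payoff \<zeta> u \<partial>lborel)"
    using t by (intro nn_integral_cong) (auto split: split_indicator)
  finally have HH: "ennreal (exp (- lam * s)) * (\<integral>\<^sup>+\<omega>. ennreal (Hc (\<zeta> \<omega> * exp (B s \<omega>))) \<partial>M)
    = (\<integral>\<^sup>+u\<in>{s<..t}. payoff \<zeta> u \<partial>lborel) + ennreal (exp (- lam * t)) * (\<integral>\<^sup>+\<omega>. ennreal (Hc (\<zeta> \<omega> * exp (B t \<omega>))) \<partial>M)"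
    unfolding discounted_H[OF s(1) \<zeta>F \<zeta>] discounted_H[OF t measurable_F_mono[OF \<zeta>F s(2)] \<zeta>] .
  show ?thesis
    unfolding split[OF s(1)] split[OF t] distrib_left HH mult.left_commute[of _ "ennreal Dc"] PP
    by (simp add: ac_simps)
qed

end

section \<open>Error made by moving the reflection once per grid step\<close>

context valued
begin

lemma V_lipschitz:
  assumes w: "0 < w" "w \<le> x" and e: "\<bar>V' w\<bar> \<le> e" "\<bar>V' x\<bar> \<le> e"
  shows "\<bar>V x - V w\<bar> \<le> e * (x - w)"
proof -
  have "(x - w) * (- e) \<le> (x - w) * V' w" using w e by (intro mult_left_mono) auto
  moreover have "(x - w) * V' x \<le> (x - w) * e" using w e by (intro mult_left_mono) auto
  ultimately show ?thesis using V_slope[OF w] by (simp add: abs_le_iff ac_simps)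
qed

text \<open>Each grid step is done in two moves: \<open>B\<close> advances with \<open>Z0\<close>
  frozen, which \<open>V_step\<close> treats exactly, and then \<open>Z0\<close> is updated. The sum
  collects the changes of \<open>V\<close> in the second moves.\<close>

definition err :: "real \<Rightarrow> nat \<Rightarrow> 'a \<Rightarrow> real" where
  "err T n \<omega> = (\<Sum>k<n. \<bar>V (X0 (real (Suc k) * (T / real n)) \<omega>)
      - V (Z0 (real k * (T / real n)) \<omega> * exp (B (real (Suc k) * (T / real n)) \<omega>))\<bar>)"

text \<open>The factor \<open>Z0\<close> moves only while the state is within the oscillation of \<open>B\<close> from the
  barrier \<open>a\<close>, where \<open>V'\<close> is small.\<close>

lemma err_le:
  assumes T: "0 \<le> T" and n: "0 < n" and w: "0 \<le> w"
    and osc: "\<And>s u. s \<in> {0..T} \<Longrightarrow> u \<in> {0..T} \<Longrightarrow> \<bar>s - u\<bar> \<le> T / real n \<Longrightarrow> \<bar>B s \<omega> - B u \<omega>\<bar> \<le> w"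
    and e: "0 \<le> e" "\<And>z. a * exp (- w) \<le> z \<Longrightarrow> z \<le> a * exp w \<Longrightarrow> \<bar>V' z\<bar> \<le> e"
  shows "err T n \<omega> \<le> e * (y * exp (2 * K T \<omega>))"
proof -
  define h where "h = T / real n"
  have step: "\<bar>V (X0 (real (Suc k) * h) \<omega>) - V (Z0 (real k * h) \<omega> * exp (B (real (Suc k) * h) \<omega>))\<bar>
      \<le> e * exp (K T \<omega>) * (Z0 (real (Suc k) * h) \<omega> - Z0 (real k * h) \<omega>)" if "k < n" for k
  proof -
    define s t where "s = real k * h" and "t = real (Suc k) * h"
    have st: "0 \<le> s" "s \<le> t" "t \<le> T" "t - s = T / real n"
      using uniform_grid[OF T that] unfolding s_def t_def h_def by auto
    have Zst: "Z0 s \<omega> \<le> Z0 t \<omega>" using st by (intro Z0_mono) auto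
    show ?thesis
    proof (cases "Z0 t \<omega> = Z0 s \<omega>")
      case True
      then show ?thesis unfolding s_def[symmetric] t_def[symmetric] by (simp add: X0_def mult.commute)
    next
      case False
      obtain v where v: "s < v" "v \<le> t" "Z0 t \<omega> = a * exp (- B v \<omega>)" by (rule Z0_step[OF st(1,2) False])
      define p where "p = Z0 s \<omega> * exp (B t \<omega>)"
      have p: "0 < p" by (simp add: p_def Z0_pos)
      have pX: "p \<le> X0 t \<omega>" using Zst by (simp add: p_def X0_def mult.commute)
      have X: "X0 t \<omega> = a * exp (B t \<omega> - B v \<omega>)" by (simp add: X0_def v(3) exp_diff exp_minus field_simps)
      have "\<bar>B t \<omega> - B v \<omega>\<bar> \<le> w" "\<bar>B t \<omega> - B s \<omega>\<bar> \<le> w"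
        using st v by (auto intro!: osc)
      then have Xw: "X0 t \<omega> \<le> a * exp w" and sw: "a * exp (- w) \<le> a * exp (B t \<omega> - B s \<omega>)"
        unfolding X using a_pos by auto
      \<comment> \<open>At the start of the step the state was above \<open>a\<close>, so even with
        the old factor it cannot have fallen below \<open>a\<close> by more than the oscillation of
        \<open>B\<close>.\<close>
      have "a * exp (- B s \<omega>) * exp (B t \<omega>) \<le> p"
        unfolding p_def using barrier_le_Z0[OF st(1) order_refl, of \<omega>] by (intro mult_right_mono) auto
      moreover have "a * exp (- B s \<omega>) * exp (B t \<omega>) = a * exp (B t \<omega> - B s \<omega>)" by (simp flip: exp_add)
      ultimately have pw: "a * exp (- w) \<le> p" using sw by simp
      have "\<bar>V (X0 t \<omega>) - V p\<bar> \<le> e * (X0 t \<omega> - p)"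
        by (rule V_lipschitz[OF p pX]) (use e(2) pw pX Xw in auto)
      also have "X0 t \<omega> - p = exp (B t \<omega>) * (Z0 t \<omega> - Z0 s \<omega>)" by (simp add: X0_def p_def algebra_simps)
      also have "e * (exp (B t \<omega>) * (Z0 t \<omega> - Z0 s \<omega>)) \<le> e * (exp (K T \<omega>) * (Z0 t \<omega> - Z0 s \<omega>))"
        using e(1) Zst st by (intro mult_left_mono mult_right_mono expB_le) auto
      finally show ?thesis unfolding s_def[symmetric] t_def[symmetric] p_def by (simp add: mult.assoc)
    qed
  qed
  have "err T n \<omega> \<le> (\<Sum>k<n. e * exp (K T \<omega>) * (Z0 (real (Suc k) * h) \<omega> - Z0 (real k * h) \<omega>))"
    unfolding err_def h_def[symmetric] by (intro sum_mono step) auto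
  also have "\<dots> = e * exp (K T \<omega>) * (Z0 (real n * h) \<omega> - Z0 0 \<omega>)"
    unfolding sum_distrib_left[symmetric] sum_lessThan_telescope[of "\<lambda>k. Z0 (real k * h) \<omega>"] by simp
  also have "real n * h = T" using n by (simp add: h_def)
  also have "e * exp (K T \<omega>) * (Z0 T \<omega> - Z0 0 \<omega>) \<le> e * exp (K T \<omega>) * (y * exp (K T \<omega>))"
    using e(1) Z0_le[OF T order_refl, of \<omega>] Z0_pos[of 0 \<omega>] by (intro mult_left_mono) auto
  also have "\<dots> = e * (y * (exp (K T \<omega>) * exp (K T \<omega>)))" by (simp add: ac_simps)
  also have "exp (K T \<omega>) * exp (K T \<omega>) = exp (2 * K T \<omega>)" by (simp flip: exp_add)
  finally show ?thesis .
qed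

definition CV :: real where "CV = - \<theta> * Dc * a powr (\<theta> - 1) + \<alpha> / disc"

lemma CV_nonneg: "0 \<le> CV"
  unfolding CV_def using \<theta>_neg Dc_nonneg pos disc_pos by (intro add_nonneg_nonneg mult_nonneg_nonneg) auto

text \<open>The power term is largest at the smallest argument \<open>a * exp (- w)\<close>, where
  it exceeds its size at \<open>a\<close> by the exponential factor; \<open>G\<close> is bounded by
  \<alpha> \<open>/ disc\<close>. The two summands of \<open>CV\<close> are these two
  bounds.\<close>

lemma V'_bound:
  assumes w: "0 \<le> w" and z: "a * exp (- w) \<le> z"
  shows "\<bar>V' z\<bar> \<le> CV * exp ((1 - \<theta>) * w)"
proof -
  have "0 < a * exp (- w)" using a_pos by simp
  then have "z powr (\<theta> - 1) \<le> (a * exp (- w)) powr (\<theta> - 1)"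
    using z \<theta>_neg by (intro powr_mono2') auto
  also have "\<dots> = a powr (\<theta> - 1) * exp ((1 - \<theta>) * w)"
    using a_pos by (simp add: powr_mult powr_def[of "exp _"] algebra_simps)
  finally have z1: "- \<theta> * Dc * z powr (\<theta> - 1) \<le> - \<theta> * Dc * (a powr (\<theta> - 1) * exp ((1 - \<theta>) * w))"
    using mult_nonneg_nonneg[of "- \<theta>" Dc] \<theta>_neg Dc_nonneg by (intro mult_left_mono) auto
  have "1 \<le> exp ((1 - \<theta>) * w)" using w \<theta>_neg by simp
  then have "\<alpha> / disc * 1 \<le> \<alpha> / disc * exp ((1 - \<theta>) * w)"
    using pos disc_pos by (intro mult_left_mono) auto
  then have G: "G z \<le> \<alpha> / disc * exp ((1 - \<theta>) * w)" using G_le[of z] by simp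
  have "\<theta> * Dc * z powr (\<theta> - 1) \<le> 0" using \<theta>_neg Dc_nonneg by (intro mult_nonpos_nonneg) auto
  then have "\<bar>V' z\<bar> \<le> - \<theta> * Dc * z powr (\<theta> - 1) + G z"
    unfolding V'_def using G_nonneg[of z] abs_triangle_ineq[of "\<theta> * Dc * z powr (\<theta> - 1)" "G z"] by simp
  also have "\<dots> \<le> CV * exp ((1 - \<theta>) * w)" using z1 G by (simp add: CV_def algebra_simps)
  finally show ?thesis .
qed

lemma err_dominated:
  assumes T: "0 < T" and n: "0 < n"
  shows "err T n \<omega> \<le> CV * y * exp ((4 - 2 * \<theta>) * K T \<omega>)"
proof -
  have K: "0 \<le> K T \<omega>" using T by (intro K_nonneg) simp
  \<comment> \<open>The crude oscillation bound \<open>2 * K\<close> holds on every grid; it gives a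
    majorant for dominated convergence.\<close>
  have "err T n \<omega> \<le> CV * exp ((1 - \<theta>) * (2 * K T \<omega>)) * (y * exp (2 * K T \<omega>))"
  proof (rule err_le[OF _ n])
    fix s u assume "s \<in> {0..T}" "u \<in> {0..T}"
    then show "\<bar>B s \<omega> - B u \<omega>\<bar> \<le> 2 * K T \<omega>" using abs_B_le[of s T \<omega>] abs_B_le[of u T \<omega>] by auto
  next
    fix z assume "a * exp (- (2 * K T \<omega>)) \<le> z"
    then show "\<bar>V' z\<bar> \<le> CV * exp ((1 - \<theta>) * (2 * K T \<omega>))" using K by (intro V'_bound) auto
  qed (use T K CV_nonneg in auto)
  also have "\<dots> = CV * y * (exp ((1 - \<theta>) * (2 * K T \<omega>)) * exp (2 * K T \<omega>))" by (simp add: ac_simps)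
  also have "exp ((1 - \<theta>) * (2 * K T \<omega>)) * exp (2 * K T \<omega>) = exp ((4 - 2 * \<theta>) * K T \<omega>)"
    by (simp add: algebra_simps flip: exp_add)
  finally show ?thesis .
qed

lemma err_nonneg: "0 \<le> err T n \<omega>" unfolding err_def by (intro sum_nonneg) simp

lemma err_tendsto:
  assumes T: "0 < T"
  shows "(\<lambda>n. err T (Suc n) \<omega>) \<longlonglongrightarrow> 0"
proof (rule LIMSEQ_I)
  fix e0 :: real assume e0: "0 < e0"
  define Y where "Y = y * exp (2 * K T \<omega>)"
  have Y: "0 < Y" using y_pos by (simp add: Y_def)
  define e where "e = e0 / (2 * Y)"
  have e: "0 < e" "e * Y < e0" using e0 Y by (auto simp: e_def)
  obtain d where d: "0 < d" "\<And>z. dist z a < d \<Longrightarrow> dist (V' z) (V' a) < e"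
    using V'_isCont e(1) unfolding continuous_at_eps_delta by (auto simp: dist_real_def)
  \<comment> \<open>Chosen with \<open>w = ln (1 + b)\<close> so that all states between
    \<open>a * exp (- w)\<close> and \<open>a * exp w\<close> are within \<open>a * b\<close>, half
    of \<open>d\<close>, of the barrier.\<close>
  define b where "b = d / (2 * a)"
  have b: "0 < b" "a * b < d" using d a_pos by (auto simp: b_def)
  define w where "w = ln (1 + b)"
  have ew: "exp w = 1 + b" and w: "0 < w" using b by (auto simp: w_def)
  have emw: "1 - b \<le> exp (- w)"
  proof -
    have "(1 - b) * (1 + b) \<le> 1" using b by (simp add: algebra_simps)
    then show ?thesis using b by (simp add: exp_minus ew field_simps)
  qed
  have V'e: "\<bar>V' z\<bar> \<le> e" if z: "a * exp (- w) \<le> z" "z \<le> a * exp w" for z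
  proof -
    have "a * (1 - b) \<le> a * exp (- w)" using emw a_pos by (intro mult_left_mono) auto
    then have "a - a * b \<le> z" "z \<le> a + a * b" using z unfolding ew by (auto simp: algebra_simps)
    then have "dist z a < d" using b by (auto simp: dist_real_def)
    from d(2)[OF this] show ?thesis by (simp add: V'_a dist_real_def)
  qed
  have "uniformly_continuous_on {0..T} (\<lambda>t. B t \<omega>)"
    by (intro compact_uniformly_continuous continuous_on_subset[OF B_cont]) auto
  then obtain d2 where d2: "0 < d2" "\<And>s u. s \<in> {0..T} \<Longrightarrow> u \<in> {0..T} \<Longrightarrow> dist s u < d2 \<Longrightarrow> dist (B s \<omega>) (B u \<omega>) < w"
    unfolding uniformly_continuous_on_def using w by metis
  obtain N :: nat where N: "T / d2 < real N" using reals_Archimedean2 by blast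
  show "\<exists>no. \<forall>n\<ge>no. norm (err T (Suc n) \<omega> - 0) < e0"
  proof (intro exI[of _ N] allI impI)
    fix n assume "n \<ge> N"
    then have "T / d2 < real (Suc n)" using N by simp
    then have h: "T / real (Suc n) < d2" using d2 by (simp add: field_simps)
    have "err T (Suc n) \<omega> \<le> e * (y * exp (2 * K T \<omega>))"
    proof (rule err_le)
      fix s u assume "s \<in> {0..T}" "u \<in> {0..T}" "\<bar>s - u\<bar> \<le> T / real (Suc n)"
      then show "\<bar>B s \<omega> - B u \<omega>\<bar> \<le> w" using d2(2)[of s u] h by (simp add: dist_real_def)
    qed (use T w e V'e in auto)
    then show "norm (err T (Suc n) \<omega> - 0) < e0" using e err_nonneg[of T "Suc n" \<omega>] by (simp add: Y_def)
  qed
qed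

lemma B_M: "0 \<le> u \<Longrightarrow> B u \<in> borel_measurable M" using measurable_F_M[OF B_F[of u u]] by simp

lemma Z0_M: "0 \<le> u \<Longrightarrow> Z0 u \<in> borel_measurable M" using measurable_F_M[OF Z0_F[of u]] by simp

lemma V_grid_measurable:
  assumes "0 \<le> s" "0 \<le> t"
  shows "(\<lambda>\<omega>. V (Z0 s \<omega> * exp (B t \<omega>))) \<in> borel_measurable M" "(\<lambda>\<omega>. V (X0 t \<omega>)) \<in> borel_measurable M"
  using Z0_M[OF assms(1)] B_M[OF assms(2)] X0_M[OF assms(2)] Z0_pos X0_pos by (auto intro!: V_comp_measurable)

lemma err_M: "0 \<le> T \<Longrightarrow> err T n \<in> borel_measurable M"
  unfolding err_def[abs_def] by (intro borel_measurable_sum borel_measurable_abs borel_measurable_diff V_grid_measurable) auto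

lemma err_mean_tendsto:
  assumes T: "0 < T"
  shows "(\<lambda>n. \<integral>\<^sup>+\<omega>. ennreal (err T (Suc n) \<omega>) \<partial>M) \<longlonglongrightarrow> 0"
proof -
  have [measurable]: "K T \<in> borel_measurable M" "\<And>n. err T n \<in> borel_measurable M"
    using T by (auto intro: K_M err_M)
  have "(\<lambda>n. \<integral>\<^sup>+\<omega>. ennreal (err T (Suc n) \<omega>) \<partial>M) \<longlonglongrightarrow> (\<integral>\<^sup>+\<omega>. 0 \<partial>M)"
  proof (rule nn_integral_dominated_convergence[where w = "\<lambda>\<omega>. ennreal (CV * y) * ennreal (exp ((4 - 2 * \<theta>) * K T \<omega>))"])
    show "AE \<omega> in M. ennreal (err T (Suc n) \<omega>) \<le> ennreal (CV * y) * ennreal (exp ((4 - 2 * \<theta>) * K T \<omega>))" for n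
      using err_dominated[OF T, of "Suc n"] CV_nonneg y_pos by (auto simp: ennreal_mult[symmetric] intro!: ennreal_leI)
    show "(\<integral>\<^sup>+\<omega>. ennreal (CV * y) * ennreal (exp ((4 - 2 * \<theta>) * K T \<omega>)) \<partial>M) < \<infinity>"
      using exp_K_finite[of T "4 - 2 * \<theta>"] T \<theta>_neg by (simp add: nn_integral_cmult ennreal_mult_less_top)
    show "AE \<omega> in M. (\<lambda>n. ennreal (err T (Suc n) \<omega>)) \<longlonglongrightarrow> 0"
      using tendsto_ennrealI[OF err_tendsto[OF T]] by simp
  qed auto
  then show ?thesis by simp
qed

section \<open>Dynamic programming for the reflected process\<close>

definition running :: "real \<Rightarrow> ennreal" where
  "running u = payoff (Z0 u) u"

definition terminal :: "real \<Rightarrow> ennreal" where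
  "terminal s = ennreal (exp (- lam * s)) * (\<integral>\<^sup>+\<omega>. ennreal (V (X0 s \<omega>)) \<partial>M)"

definition accrued :: "real \<Rightarrow> ennreal" where
  "accrued s = (\<integral>\<^sup>+u\<in>{0<..s}. running u \<partial>lborel)"

lemma running_alt: "running u = (\<integral>\<^sup>+\<omega>. ennreal (exp (- lam * u) * (\<alpha> * max 0 (X0 u \<omega> - m))) \<partial>M)"
  unfolding running_def payoff_def X0_def by (simp add: ac_simps)

lemma running_measurable: "(\<lambda>u. running (max 0 u)) \<in> borel_measurable borel"
  unfolding running_alt by (rule borel_measurable_nn_integral) (simp add: case_prod_beta)

lemma accrued_add: assumes "0 \<le> s" "s \<le> t" shows "accrued t = accrued s + (\<integral>\<^sup>+u\<in>{s<..t}. running u \<partial>lborel)"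
proof -
  note [measurable] = running_measurable
  have eq: "running u * indicator {v<..t} u = running (max 0 u) * indicator {v<..t} u" if "0 \<le> v" for u v t
    using that by (auto split: split_indicator simp: max_def)
  have "accrued t = (\<integral>\<^sup>+u. running (max 0 u) * indicator {0<..s} u + running (max 0 u) * indicator {s<..t} u \<partial>lborel)"
    unfolding accrued_def using assms by (intro nn_integral_cong) (auto split: split_indicator)
  also have "\<dots> = (\<integral>\<^sup>+u\<in>{0<..s}. running (max 0 u) \<partial>lborel) + (\<integral>\<^sup>+u\<in>{s<..t}. running (max 0 u) \<partial>lborel)"
    by (rule nn_integral_add) measurable
  finally show ?thesis unfolding accrued_def eq[OF order_refl] eq[OF assms(1)] .
qed

lemma payoff_step:
  assumes st: "0 \<le> s" "s \<le> t" "t \<le> T"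
  shows "(\<integral>\<^sup>+u\<in>{s<..t}. payoff (Z0 s) u \<partial>lborel) \<le> (\<integral>\<^sup>+u\<in>{s<..t}. running u \<partial>lborel)"
    and "(\<integral>\<^sup>+u\<in>{s<..t}. running u \<partial>lborel) \<le> (\<integral>\<^sup>+u\<in>{s<..t}. payoff (Z0 s) u \<partial>lborel)
      + ennreal (\<alpha> * (t - s)) * (\<integral>\<^sup>+\<omega>. ennreal (exp (K T \<omega>) * (Z0 t \<omega> - Z0 s \<omega>)) \<partial>M)"
proof -
  define c where "c = (\<integral>\<^sup>+\<omega>. ennreal (exp (K T \<omega>) * (Z0 t \<omega> - Z0 s \<omega>)) \<partial>M)"
  have t: "0 \<le> t" "0 \<le> T" using st by auto
  note [measurable] = Z0_M[OF st(1)] Z0_M[OF t(1)] K_M[OF t(2)] payoff_measurable[OF Z0_M[OF st(1)]]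
  have a0: "0 \<le> \<alpha> * exp (- lam * u)" for u using pos by simp
  have lo: "payoff (Z0 s) u \<le> running u" if u: "s < u" "u \<le> t" for u
    unfolding running_def payoff_def
  proof (intro nn_integral_mono ennreal_leI mult_left_mono a0)
    fix \<omega>
    have "Z0 s \<omega> * exp (B u \<omega>) \<le> Z0 u \<omega> * exp (B u \<omega>)" using u st by (intro mult_right_mono Z0_mono) auto
    then show "max 0 (Z0 s \<omega> * exp (B u \<omega>) - m) \<le> max 0 (Z0 u \<omega> * exp (B u \<omega>) - m)"
      by (intro max.mono) auto
  qed
  then show "(\<integral>\<^sup>+u\<in>{s<..t}. payoff (Z0 s) u \<partial>lborel) \<le> (\<integral>\<^sup>+u\<in>{s<..t}. running u \<partial>lborel)"
    by (intro nn_integral_mono) (auto split: split_indicator)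
  have hi: "running u \<le> payoff (Z0 s) u + ennreal \<alpha> * c" if u: "s < u" "u \<le> t" for u
  proof -
    have [measurable]: "B u \<in> borel_measurable M" using u st by (intro B_M) simp
    have "running u \<le> (\<integral>\<^sup>+\<omega>. ennreal (\<alpha> * exp (- lam * u) * max 0 (Z0 s \<omega> * exp (B u \<omega>) - m)) + ennreal \<alpha> * ennreal (exp (K T \<omega>) * (Z0 t \<omega> - Z0 s \<omega>)) \<partial>M)"
      unfolding running_def payoff_def
    proof (intro nn_integral_mono)
      fix \<omega>
      have Z: "Z0 s \<omega> \<le> Z0 u \<omega>" "Z0 u \<omega> \<le> Z0 t \<omega>" using u st by (auto intro!: Z0_mono)
      define E where "E = exp (- lam * u)"
      have E: "0 \<le> E" "E \<le> 1" using pos u st by (auto simp: E_def)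
      have "exp (B u \<omega>) * (Z0 u \<omega> - Z0 s \<omega>) \<le> exp (K T \<omega>) * (Z0 t \<omega> - Z0 s \<omega>)"
        using Z u st by (intro mult_mono expB_le) auto
      then have "Z0 u \<omega> * exp (B u \<omega>) - m \<le> Z0 s \<omega> * exp (B u \<omega>) - m + exp (K T \<omega>) * (Z0 t \<omega> - Z0 s \<omega>)"
        by (simp add: algebra_simps)
      moreover have p: "0 \<le> exp (K T \<omega>) * (Z0 t \<omega> - Z0 s \<omega>)" using Z by simp
      ultimately have "max 0 (Z0 u \<omega> * exp (B u \<omega>) - m) \<le> max 0 (Z0 s \<omega> * exp (B u \<omega>) - m) + exp (K T \<omega>) * (Z0 t \<omega> - Z0 s \<omega>)"
        by simp
      then have "\<alpha> * E * max 0 (Z0 u \<omega> * exp (B u \<omega>) - m) \<le> \<alpha> * E * (max 0 (Z0 s \<omega> * exp (B u \<omega>) - m) + exp (K T \<omega>) * (Z0 t \<omega> - Z0 s \<omega>))"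
        using E pos by (intro mult_left_mono) auto
      also have "\<dots> = \<alpha> * E * max 0 (Z0 s \<omega> * exp (B u \<omega>) - m) + E * (\<alpha> * (exp (K T \<omega>) * (Z0 t \<omega> - Z0 s \<omega>)))"
        by (simp add: algebra_simps)
      also have "E * (\<alpha> * (exp (K T \<omega>) * (Z0 t \<omega> - Z0 s \<omega>))) \<le> 1 * (\<alpha> * (exp (K T \<omega>) * (Z0 t \<omega> - Z0 s \<omega>)))"
        using E pos p by (intro mult_right_mono) auto
      finally have "\<alpha> * E * max 0 (Z0 u \<omega> * exp (B u \<omega>) - m) \<le> \<alpha> * E * max 0 (Z0 s \<omega> * exp (B u \<omega>) - m) + \<alpha> * (exp (K T \<omega>) * (Z0 t \<omega> - Z0 s \<omega>))"
        by simp
      then have "ennreal (\<alpha> * E * max 0 (Z0 u \<omega> * exp (B u \<omega>) - m)) \<le> ennreal (\<alpha> * E * max 0 (Z0 s \<omega> * exp (B u \<omega>) - m)) + ennreal (\<alpha> * (exp (K T \<omega>) * (Z0 t \<omega> - Z0 s \<omega>)))"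
        by (rule order_trans[OF ennreal_leI ennreal_add_le])
      also have "ennreal (\<alpha> * (exp (K T \<omega>) * (Z0 t \<omega> - Z0 s \<omega>))) = ennreal \<alpha> * ennreal (exp (K T \<omega>) * (Z0 t \<omega> - Z0 s \<omega>))"
        using pos p by (intro ennreal_mult) auto
      finally show "ennreal (\<alpha> * exp (- lam * u) * max 0 (Z0 u \<omega> * exp (B u \<omega>) - m))
        \<le> ennreal (\<alpha> * exp (- lam * u) * max 0 (Z0 s \<omega> * exp (B u \<omega>) - m)) + ennreal \<alpha> * ennreal (exp (K T \<omega>) * (Z0 t \<omega> - Z0 s \<omega>))"
        by (simp add: E_def)
    qed
    also have "\<dots> = payoff (Z0 s) u + ennreal \<alpha> * c"
      unfolding payoff_def c_def by (simp add: nn_integral_add nn_integral_cmult)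
    finally show ?thesis .
  qed
  have "(\<integral>\<^sup>+u\<in>{s<..t}. running u \<partial>lborel) \<le> (\<integral>\<^sup>+u. payoff (Z0 s) (max 0 u) * indicator {s<..t} u + ennreal \<alpha> * c * indicator {s<..t} u \<partial>lborel)"
    using hi st by (intro nn_integral_mono) (auto split: split_indicator)
  also have "\<dots> = (\<integral>\<^sup>+u\<in>{s<..t}. payoff (Z0 s) (max 0 u) \<partial>lborel) + ennreal \<alpha> * c * ennreal (t - s)"
    using st by (subst nn_integral_add) (auto simp: nn_integral_cmult_indicator)
  also have "(\<integral>\<^sup>+u\<in>{s<..t}. payoff (Z0 s) (max 0 u) \<partial>lborel) = (\<integral>\<^sup>+u\<in>{s<..t}. payoff (Z0 s) u \<partial>lborel)"
    using st by (intro nn_integral_cong) (auto split: split_indicator)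
  also have "ennreal \<alpha> * c * ennreal (t - s) = ennreal (\<alpha> * (t - s)) * c"
    using pos st by (simp add: ennreal_mult ac_simps)
  finally show "(\<integral>\<^sup>+u\<in>{s<..t}. running u \<partial>lborel) \<le> (\<integral>\<^sup>+u\<in>{s<..t}. payoff (Z0 s) u \<partial>lborel)
      + ennreal (\<alpha> * (t - s)) * (\<integral>\<^sup>+\<omega>. ennreal (exp (K T \<omega>) * (Z0 t \<omega> - Z0 s \<omega>)) \<partial>M)"
    by (simp add: c_def)
qed

lemma terminal_step:
  assumes st: "0 \<le> s" "s \<le> t"
  defines "D \<equiv> \<integral>\<^sup>+\<omega>. ennreal \<bar>V (X0 t \<omega>) - V (Z0 s \<omega> * exp (B t \<omega>))\<bar> \<partial>M"
  shows "terminal s \<le> terminal t + (\<integral>\<^sup>+u\<in>{s<..t}. payoff (Z0 s) u \<partial>lborel) + D"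
    and "terminal t + (\<integral>\<^sup>+u\<in>{s<..t}. payoff (Z0 s) u \<partial>lborel) \<le> terminal s + D"
proof -
  define mid where "mid = ennreal (exp (- lam * t)) * (\<integral>\<^sup>+\<omega>. ennreal (V (Z0 s \<omega> * exp (B t \<omega>))) \<partial>M)"
  have t: "0 \<le> t" using st by simp
  have X: "X0 u \<omega> = Z0 u \<omega> * exp (B u \<omega>)" for u \<omega> by (simp add: X0_def mult.commute)
  have s: "terminal s = mid + (\<integral>\<^sup>+u\<in>{s<..t}. payoff (Z0 s) u \<partial>lborel)"
    unfolding terminal_def mid_def X by (rule V_step[OF st Z0_F[OF st(1)] Z0_pos])
  note [measurable] = V_grid_measurable[OF st(1) t]
  have le: "(\<integral>\<^sup>+\<omega>. ennreal (f \<omega>) \<partial>M) \<le> (\<integral>\<^sup>+\<omega>. ennreal (h \<omega>) \<partial>M) + (\<integral>\<^sup>+\<omega>. ennreal (d \<omega>) \<partial>M)"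
    if [measurable]: "h \<in> borel_measurable M" "d \<in> borel_measurable M" and "\<And>\<omega>. f \<omega> \<le> h \<omega> + d \<omega>" for f h d :: "'a \<Rightarrow> real"
  proof -
    have "(\<integral>\<^sup>+\<omega>. ennreal (f \<omega>) \<partial>M) \<le> (\<integral>\<^sup>+\<omega>. ennreal (h \<omega>) + ennreal (d \<omega>) \<partial>M)"
      by (intro nn_integral_mono order_trans[OF ennreal_leI[OF that(3)] ennreal_add_le])
    then show ?thesis by (simp add: nn_integral_add)
  qed
  have scale: "ennreal (exp (- lam * t)) * A \<le> ennreal (exp (- lam * t)) * C + D" if "A \<le> C + D" for A C
  proof -
    have "ennreal (exp (- lam * t)) \<le> ennreal 1" using pos t by (intro ennreal_leI) simp
    then have "ennreal (exp (- lam * t)) * D \<le> 1 * D" by (intro mult_right_mono) auto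
    moreover have "ennreal (exp (- lam * t)) * A \<le> ennreal (exp (- lam * t)) * (C + D)" using that by (intro mult_left_mono) auto
    ultimately show ?thesis unfolding distrib_left by (simp add: add_left_mono order_trans)
  qed
  have 1: "mid \<le> terminal t + D"
    unfolding mid_def terminal_def by (rule scale, unfold D_def, rule le; (linarith | measurable))
  have 2: "terminal t \<le> mid + D"
    unfolding mid_def terminal_def by (rule scale, unfold D_def, rule le; (linarith | measurable))
  show "terminal s \<le> terminal t + (\<integral>\<^sup>+u\<in>{s<..t}. payoff (Z0 s) u \<partial>lborel) + D"
    unfolding s using add_right_mono[OF 1, of "\<integral>\<^sup>+u\<in>{s<..t}. payoff (Z0 s) u \<partial>lborel"] by (simp add: ac_simps)
  show "terminal t + (\<integral>\<^sup>+u\<in>{s<..t}. payoff (Z0 s) u \<partial>lborel) \<le> terminal s + D"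
    unfolding s using add_right_mono[OF 2, of "\<integral>\<^sup>+u\<in>{s<..t}. payoff (Z0 s) u \<partial>lborel"] by (simp add: ac_simps)
qed

lemma dynamic_programming_approx:
  assumes T: "0 < T" and n: "0 < n"
  defines "E \<equiv> \<integral>\<^sup>+\<omega>. ennreal (err T n \<omega>) \<partial>M"
  shows "ennreal (V y) \<le> terminal T + accrued T + E"
    and "terminal T + accrued T \<le> ennreal (V y) + (E + ennreal (\<alpha> * (T / real n)) * (\<integral>\<^sup>+\<omega>. ennreal (y * exp (2 * K T \<omega>)) \<partial>M))"
proof -
  define h where "h = T / real n"
  define t where "t k = real k * h" for k
  have h: "0 < h" using T n by (simp add: h_def)
  have t0: "0 \<le> t k" "t k \<le> t (Suc k)" "t (Suc k) - t k = h" for k using h by (auto simp: t_def algebra_simps)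
  have tT: "t k \<le> T" if "k \<le> n" for k
  proof -
    have "t k \<le> real n * h" unfolding t_def using that h by (intro mult_right_mono) auto
    then show ?thesis using n by (simp add: h_def)
  qed
  have tn: "t n = T" "t 0 = 0" using n by (auto simp: t_def h_def)
  define d where "d k = (\<integral>\<^sup>+\<omega>. ennreal \<bar>V (X0 (t (Suc k)) \<omega>) - V (Z0 (t k) \<omega> * exp (B (t (Suc k)) \<omega>))\<bar> \<partial>M)" for k
  define s where "s k = (\<integral>\<^sup>+\<omega>. ennreal (exp (K T \<omega>) * (Z0 (t (Suc k)) \<omega> - Z0 (t k) \<omega>)) \<partial>M)" for k
  define I where "I k = (\<integral>\<^sup>+u\<in>{t k<..t (Suc k)}. payoff (Z0 (t k)) u \<partial>lborel)" for k
  define J where "J k = (\<integral>\<^sup>+u\<in>{t k<..t (Suc k)}. running u \<partial>lborel)" for k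
  have IJ: "I k \<le> J k" "J k \<le> I k + ennreal (\<alpha> * h) * s k" if "k < n" for k
    using payoff_step[OF t0(1,2), of k T] tT[of "Suc k"] that unfolding I_def J_def s_def t0(3) by auto
  have ts: "terminal (t k) \<le> terminal (t (Suc k)) + I k + d k" "terminal (t (Suc k)) + I k \<le> terminal (t k) + d k" for k
    unfolding I_def d_def by (rule terminal_step[OF t0(1,2)])+
  have acc: "accrued (t (Suc k)) = accrued (t k) + J k" for k
    unfolding J_def by (rule accrued_add[OF t0(1,2)])
  have acc0: "accrued 0 = 0" by (simp add: accrued_def)
  have up: "terminal 0 \<le> terminal (t j) + accrued (t j) + (\<Sum>k<j. d k)" if "j \<le> n" for j
    using that
  proof (induction j)
    case 0 then show ?case by (simp add: tn acc0)
  next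
    case (Suc j)
    have "terminal 0 \<le> terminal (t j) + accrued (t j) + (\<Sum>k<j. d k)" using Suc by simp
    also have "\<dots> \<le> (terminal (t (Suc j)) + J j + d j) + accrued (t j) + (\<Sum>k<j. d k)"
    proof (intro add_right_mono)
      show "terminal (t j) \<le> terminal (t (Suc j)) + J j + d j"
        by (rule order_trans[OF ts(1)]) (use IJ(1)[of j] Suc in \<open>auto intro!: add_left_mono add_right_mono\<close>)
    qed
    finally show ?case by (simp add: acc ac_simps)
  qed
  have low: "terminal (t j) + accrued (t j) \<le> terminal 0 + (\<Sum>k<j. d k + ennreal (\<alpha> * h) * s k)" if "j \<le> n" for j
    using that
  proof (induction j)
    case 0 then show ?case by (simp add: tn acc0)
  next
    case (Suc j)
    have "terminal (t (Suc j)) + accrued (t (Suc j)) \<le> terminal (t (Suc j)) + (accrued (t j) + (I j + ennreal (\<alpha> * h) * s j))"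
      unfolding acc using IJ(2)[of j] Suc by (intro add_left_mono) auto
    also have "\<dots> = (terminal (t (Suc j)) + I j) + (accrued (t j) + ennreal (\<alpha> * h) * s j)" by (simp add: ac_simps)
    also have "\<dots> \<le> (terminal (t j) + d j) + (accrued (t j) + ennreal (\<alpha> * h) * s j)"
      by (intro add_right_mono ts)
    also have "\<dots> = (terminal (t j) + accrued (t j)) + (d j + ennreal (\<alpha> * h) * s j)" by (simp add: ac_simps)
    also have "\<dots> \<le> (terminal 0 + (\<Sum>k<j. d k + ennreal (\<alpha> * h) * s k)) + (d j + ennreal (\<alpha> * h) * s j)"
      using Suc by (intro add_right_mono) auto
    finally show ?case by (simp add: ac_simps)
  qed
  have T0: "terminal 0 = ennreal (V y)" by (simp add: terminal_def X0_def Z0_def emeasure_space_1)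
  have dE: "(\<Sum>k<n. d k) = E"
  proof -
    have [measurable]: "(\<lambda>\<omega>. V (X0 (t (Suc k)) \<omega>)) \<in> borel_measurable M" "(\<lambda>\<omega>. V (Z0 (t k) \<omega> * exp (B (t (Suc k)) \<omega>))) \<in> borel_measurable M" for k
      using V_grid_measurable t0 by auto
    have "E = (\<integral>\<^sup>+\<omega>. (\<Sum>k<n. ennreal \<bar>V (X0 (t (Suc k)) \<omega>) - V (Z0 (t k) \<omega> * exp (B (t (Suc k)) \<omega>))\<bar>) \<partial>M)"
      unfolding E_def err_def t_def h_def by (intro nn_integral_cong sum_ennreal[symmetric]) simp
    also have "\<dots> = (\<Sum>k<n. d k)" unfolding d_def by (rule nn_integral_sum) measurable
    finally show ?thesis by simp
  qed
  have sS: "(\<Sum>k<n. s k) \<le> (\<integral>\<^sup>+\<omega>. ennreal (y * exp (2 * K T \<omega>)) \<partial>M)"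
  proof -
    have [measurable]: "K T \<in> borel_measurable M" "Z0 (t k) \<in> borel_measurable M" for k
      using T t0 by (auto intro: K_M Z0_M)
    have "(\<Sum>k<n. s k) = (\<integral>\<^sup>+\<omega>. (\<Sum>k<n. ennreal (exp (K T \<omega>) * (Z0 (t (Suc k)) \<omega> - Z0 (t k) \<omega>))) \<partial>M)"
      unfolding s_def by (rule nn_integral_sum[symmetric]) measurable
    also have "\<dots> \<le> (\<integral>\<^sup>+\<omega>. ennreal (y * exp (2 * K T \<omega>)) \<partial>M)"
    proof (intro nn_integral_mono)
      fix \<omega>
      have "(\<Sum>k<n. ennreal (exp (K T \<omega>) * (Z0 (t (Suc k)) \<omega> - Z0 (t k) \<omega>))) = ennreal (\<Sum>k<n. exp (K T \<omega>) * (Z0 (t (Suc k)) \<omega> - Z0 (t k) \<omega>))"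
        using Z0_mono[OF t0(1,2)] by (intro sum_ennreal) auto
      also have "(\<Sum>k<n. exp (K T \<omega>) * (Z0 (t (Suc k)) \<omega> - Z0 (t k) \<omega>)) = exp (K T \<omega>) * (Z0 T \<omega> - Z0 0 \<omega>)"
        unfolding sum_distrib_left[symmetric] sum_lessThan_telescope[of "\<lambda>k. Z0 (t k) \<omega>"] tn ..
      also have "ennreal \<dots> \<le> ennreal (exp (K T \<omega>) * (y * exp (K T \<omega>)))"
        using Z0_le[of T T \<omega>] Z0_pos[of 0 \<omega>] T by (intro ennreal_leI mult_left_mono) auto
      also have "exp (K T \<omega>) * (y * exp (K T \<omega>)) = y * exp (2 * K T \<omega>)"
        by (simp add: mult.left_commute[of _ y] flip: exp_add)
      finally show "(\<Sum>k<n. ennreal (exp (K T \<omega>) * (Z0 (t (Suc k)) \<omega> - Z0 (t k) \<omega>))) \<le> ennreal (y * exp (2 * K T \<omega>))" .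
    qed
    finally show ?thesis .
  qed
  show "ennreal (V y) \<le> terminal T + accrued T + E"
    using up[of n] by (simp add: T0 tn dE)
  have "terminal T + accrued T \<le> ennreal (V y) + (E + ennreal (\<alpha> * h) * (\<Sum>k<n. s k))"
    using low[of n] by (simp add: T0 tn sum.distrib dE sum_distrib_left)
  also have "\<dots> \<le> ennreal (V y) + (E + ennreal (\<alpha> * h) * (\<integral>\<^sup>+\<omega>. ennreal (y * exp (2 * K T \<omega>)) \<partial>M))"
    by (intro add_left_mono mult_left_mono sS) simp
  finally show "terminal T + accrued T \<le> ennreal (V y) + (E + ennreal (\<alpha> * (T / real n)) * (\<integral>\<^sup>+\<omega>. ennreal (y * exp (2 * K T \<omega>)) \<partial>M))"
    by (simp add: h_def)
qed

text \<open>The horizon is fixed and the mesh tends to 0. Both error terms vanish, the second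
  because the mean multiplying the mesh is finite.\<close>

lemma dynamic_programming:
  assumes T: "0 < T"
  shows "ennreal (V y) = terminal T + accrued T"
proof (rule antisym)
  define E where "E n = (\<integral>\<^sup>+\<omega>. ennreal (err T (Suc n) \<omega>) \<partial>M)" for n
  define S where "S = (\<integral>\<^sup>+\<omega>. ennreal (y * exp (2 * K T \<omega>)) \<partial>M)"
  have E: "E \<longlonglongrightarrow> 0" unfolding E_def by (rule err_mean_tendsto[OF T])
  have [measurable]: "K T \<in> borel_measurable M" using T by (intro K_M) simp
  have "S = ennreal y * (\<integral>\<^sup>+\<omega>. ennreal (exp (2 * K T \<omega>)) \<partial>M)"
    unfolding S_def using y_pos by (subst nn_integral_cmult[symmetric]) (auto simp: ennreal_mult)
  then have "S < \<infinity>" using exp_K_finite[of T 2] T by (simp add: ennreal_mult_less_top)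
  then obtain s where s: "0 \<le> s" "S = ennreal s" by (cases S) auto
  have "(\<lambda>n. terminal T + accrued T + E n) \<longlonglongrightarrow> terminal T + accrued T + 0"
    by (intro tendsto_add tendsto_const E)
  then have "(\<lambda>n. terminal T + accrued T + E n) \<longlonglongrightarrow> terminal T + accrued T" by simp
  then show "ennreal (V y) \<le> terminal T + accrued T"
    by (rule LIMSEQ_le_const) (use dynamic_programming_approx(1)[OF T] in \<open>auto simp: E_def\<close>)
  have "(\<lambda>n. \<alpha> * T * s * inverse (real (Suc n))) \<longlonglongrightarrow> \<alpha> * T * s * 0"
    by (intro tendsto_mult tendsto_const LIMSEQ_inverse_real_of_nat)
  then have "(\<lambda>n. ennreal (\<alpha> * T * s * inverse (real (Suc n)))) \<longlonglongrightarrow> ennreal 0"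
    by (intro tendsto_ennrealI) simp
  moreover have "ennreal (\<alpha> * T * s * inverse (real (Suc n))) = ennreal (\<alpha> * (T / real (Suc n))) * S" for n
    unfolding s(2) using s T pos by (subst ennreal_mult[symmetric]) (auto simp: divide_inverse ac_simps)
  ultimately have "(\<lambda>n. ennreal (\<alpha> * (T / real (Suc n))) * S) \<longlonglongrightarrow> 0" by simp
  then have "(\<lambda>n. ennreal (V y) + (E n + ennreal (\<alpha> * (T / real (Suc n))) * S)) \<longlonglongrightarrow> ennreal (V y) + (0 + 0)"
    by (intro tendsto_add tendsto_const E)
  then have "(\<lambda>n. ennreal (V y) + (E n + ennreal (\<alpha> * (T / real (Suc n))) * S)) \<longlonglongrightarrow> ennreal (V y)" by simp
  then show "terminal T + accrued T \<le> ennreal (V y)"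
  proof (rule LIMSEQ_le_const, intro exI allI impI)
    fix n show "terminal T + accrued T \<le> ennreal (V y) + (E n + ennreal (\<alpha> * (T / real (Suc n))) * S)"
      unfolding E_def S_def by (rule dynamic_programming_approx(2)[OF T]) simp
  qed
qed

lemma accrued_eq:
  "accrued T = (\<integral>\<^sup>+\<omega>. (\<integral>\<^sup>+t\<in>{0..}. ennreal (exp (- lam * t) * (\<alpha> * max 0 (X0 t \<omega> - m))) * indicator {..T} t \<partial>lborel) \<partial>M)"
proof -
  have "(\<integral>\<^sup>+\<omega>. (\<integral>\<^sup>+t\<in>{0..}. ennreal (exp (- lam * t) * (\<alpha> * max 0 (X0 t \<omega> - m))) * indicator {..T} t \<partial>lborel) \<partial>M)
    = (\<integral>\<^sup>+t\<in>{0..}. (\<integral>\<^sup>+\<omega>. ennreal (exp (- lam * t) * (\<alpha> * max 0 (X0 t \<omega> - m))) * indicator {..T} t \<partial>M) \<partial>lborel)"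
    by (rule nn_integral_swap(1)) measurable
  also have "\<dots> = accrued T"
    unfolding accrued_def running_alt
    by (rule nn_integral_cong_AE) (use AE_lborel_singleton[of 0] in \<open>auto elim!: eventually_mono split: split_indicator\<close>)
  finally show ?thesis by simp
qed

text \<open>Transversality. On states above \<open>a\<close> the power term is bounded and
  \<open>Hc\<close> grows at most linearly, while the first moment of \<open>X0\<close> grows, up to
  a linear factor, at rate \<open>max 0 (r - g)\<close>, which is below \<open>lam\<close>.\<close>

lemma terminal_tendsto: "(\<lambda>n. terminal (real (Suc n))) \<longlonglongrightarrow> 0"
proof -
  define b where "b = max 0 (r - g)"
  define d where "d = (lam - b) / 2"
  have d: "0 < d" using lam_gt pos by (simp add: d_def b_def)
  obtain C where C: "0 \<le> C" "\<And>t. 0 \<le> t \<Longrightarrow> (\<integral>\<^sup>+\<omega>. ennreal (X0 t \<omega> ^ 1) \<partial>M) \<le> ennreal (C * (t + 2) * exp (b * t))"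
    unfolding b_def using X0_moment[of 1] by (auto simp: growth_1)
  define k1 where "k1 = Dc * a powr \<theta>"
  define k3 where "k3 = \<alpha> / disc * C * (1 / d + 2)"
  have k1: "0 \<le> k1" using Dc_nonneg by (simp add: k1_def)
  have k3: "0 \<le> k3" using C d pos disc_pos by (auto simp: k3_def intro!: mult_nonneg_nonneg)
  have le: "terminal t \<le> ennreal ((k1 + k3) * exp (- d * t))" if t: "0 \<le> t" for t
  proof -
    have [measurable]: "X0 t \<in> borel_measurable M" by (rule X0_M[OF t])
    have "(\<integral>\<^sup>+\<omega>. ennreal (V (X0 t \<omega>)) \<partial>M) \<le> (\<integral>\<^sup>+\<omega>. ennreal k1 + ennreal (\<alpha> / disc) * ennreal (X0 t \<omega> ^ 1) \<partial>M)"
    proof (intro nn_integral_mono)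
      fix \<omega>
      have "X0 t \<omega> powr \<theta> \<le> a powr \<theta>" using X0_ge[OF t] a_pos \<theta>_neg by (intro powr_mono2') auto
      then have "V (X0 t \<omega>) \<le> k1 + \<alpha> / disc * X0 t \<omega>"
        unfolding V_def k1_def using Dc_nonneg H_le[OF X0_pos, of t \<omega>] by (intro add_mono mult_left_mono) auto
      then have "ennreal (V (X0 t \<omega>)) \<le> ennreal k1 + ennreal (\<alpha> / disc * X0 t \<omega>)"
        by (rule order_trans[OF ennreal_leI ennreal_add_le])
      also have "ennreal (\<alpha> / disc * X0 t \<omega>) = ennreal (\<alpha> / disc) * ennreal (X0 t \<omega> ^ 1)"
        unfolding power_one_right using pos disc_pos X0_pos[of t \<omega>] by (intro ennreal_mult) auto
      finally show "ennreal (V (X0 t \<omega>)) \<le> ennreal k1 + ennreal (\<alpha> / disc) * ennreal (X0 t \<omega> ^ 1)" .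
    qed
    also have "\<dots> = ennreal k1 + ennreal (\<alpha> / disc) * (\<integral>\<^sup>+\<omega>. ennreal (X0 t \<omega> ^ 1) \<partial>M)"
      by (simp add: nn_integral_add nn_integral_cmult emeasure_space_1)
    also have "\<dots> \<le> ennreal k1 + ennreal (\<alpha> / disc) * ennreal (C * (t + 2) * exp (b * t))"
      by (intro add_left_mono mult_left_mono C t) simp
    also have "\<dots> = ennreal (k1 + \<alpha> / disc * (C * (t + 2) * exp (b * t)))"
    proof -
      have "0 \<le> C * (t + 2) * exp (b * t)" "0 \<le> \<alpha> / disc" using C(1) t pos disc_pos by auto
      then show ?thesis using k1
        by (simp only: ennreal_mult[symmetric] ennreal_plus[symmetric] mult_nonneg_nonneg)
    qed
    finally have "terminal t \<le> ennreal (exp (- lam * t)) * ennreal (k1 + \<alpha> / disc * (C * (t + 2) * exp (b * t)))"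
      unfolding terminal_def by (intro mult_left_mono) auto
    also have "\<dots> = ennreal (exp (- lam * t) * (k1 + \<alpha> / disc * (C * (t + 2) * exp (b * t))))"
      using k1 pos disc_pos C t by (intro ennreal_mult[symmetric]) (auto intro!: add_nonneg_nonneg mult_nonneg_nonneg)
    also have "\<dots> \<le> ennreal ((k1 + k3) * exp (- d * t))"
    proof (rule ennreal_leI)
      have l2: "- lam * t + b * t = - d * t + - d * t" by (simp add: d_def algebra_simps)
      have "d \<le> lam" using pos by (simp add: d_def b_def max_def)
      then have "exp (- lam * t) \<le> exp (- d * t)" using t by (simp add: mult_right_mono)
      then have 1: "exp (- lam * t) * k1 \<le> exp (- d * t) * k1" using k1 by (intro mult_right_mono) auto
      have "exp (- lam * t) * (\<alpha> / disc * (C * (t + 2) * exp (b * t))) = \<alpha> / disc * C * (t + 2) * (exp (- lam * t) * exp (b * t))"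
        by (simp add: ac_simps)
      also have "\<dots> = \<alpha> / disc * C * (t + 2) * (exp (- d * t) * exp (- d * t))" unfolding exp_add[symmetric] l2 ..
      also have "\<dots> \<le> \<alpha> / disc * C * ((1 / d + 2) * exp (d * t)) * (exp (- d * t) * exp (- d * t))"
        using pos disc_pos C by (intro mult_right_mono mult_left_mono linear_le_exp d t) auto
      also have "\<dots> = k3 * exp (- d * t) * (exp (d * t) * exp (- d * t))" by (simp add: k3_def ac_simps)
      also have "exp (d * t) * exp (- d * t) = 1" by (simp flip: exp_add)
      finally show "exp (- lam * t) * (k1 + \<alpha> / disc * (C * (t + 2) * exp (b * t))) \<le> (k1 + k3) * exp (- d * t)"
        using 1 by (simp add: algebra_simps)
    qed
    finally show ?thesis .
  qed
  have "(\<lambda>n. (k1 + k3) * exp (- d * real (Suc n))) \<longlonglongrightarrow> (k1 + k3) * 0"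
  proof (intro tendsto_mult tendsto_const)
    have "filterlim (\<lambda>n. - d * real (Suc n)) at_bot sequentially"
      by (rule filterlim_tendsto_neg_mult_at_bot[OF tendsto_const])
         (use d filterlim_compose[OF filterlim_real_sequentially filterlim_Suc] in auto)
    then show "(\<lambda>n. exp (- d * real (Suc n))) \<longlonglongrightarrow> 0" by (rule filterlim_compose[OF exp_at_bot])
  qed
  then have "(\<lambda>n. ennreal ((k1 + k3) * exp (- d * real (Suc n)))) \<longlonglongrightarrow> 0"
    using tendsto_ennrealI by fastforce
  then show ?thesis
    by (rule tendsto_sandwich[OF _ _ tendsto_const, rotated 2]) (use le in auto)
qed

lemma reflection_cost_eq: "reflection_cost = ennreal (V y)"
proof (rule antisym)
  show "reflection_cost \<le> ennreal (V y)"
    by (rule reflection_cost_leI, unfold accrued_eq[symmetric]) (simp add: dynamic_programming)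
  have "accrued T \<le> reflection_cost" for T
    unfolding accrued_eq reflection_cost_def by (intro nn_integral_mono) (auto split: split_indicator)
  then have "ennreal (V y) \<le> terminal (real (Suc n)) + reflection_cost" for n
    using dynamic_programming[of "real (Suc n)"] by (simp add: add_left_mono)
  moreover have "(\<lambda>n. terminal (real (Suc n)) + reflection_cost) \<longlonglongrightarrow> 0 + reflection_cost"
    by (intro tendsto_add tendsto_const terminal_tendsto)
  ultimately show "ennreal (V y) \<le> reflection_cost"
    using LIMSEQ_le_const[of "\<lambda>n. terminal (real (Suc n)) + reflection_cost" "0 + reflection_cost"] by auto
qed

section \<open>Comparison with arbitrary responses and conclusion\<close>

lemma response_cost_ge:
  assumes x: "0 < x" and y: "y = max x a" and lam: "lam > r - g + \<alpha> / \<kappa>"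
    and resp: "\<eta> \<in> admissible_responses a x"
  shows "reflection_cost \<le> J2 x (reflection_policy a x \<eta>) \<eta>"
proof -
  define \<xi> where "\<xi> = (SOME \<xi>. unique_reflects a (max x a) \<eta> \<xi>)"
  have "\<exists>\<xi>. unique_reflects a (max x a) \<eta> \<xi>" using resp by (simp add: admissible_responses_def)
  then have "unique_reflects a (max x a) \<eta> \<xi>" unfolding \<xi>_def by (rule someI_ex)
  then have refl: "reflects a y \<eta> \<xi>" by (simp add: unique_reflects_def y)
  have pol: "reflection_policy a x \<eta> = (\<lambda>t \<omega>. max 0 (ln (a / x)) + \<xi> t \<omega>)"
    by (simp add: reflection_policy_def \<xi>_def fun_eq_iff)
  have adm: "\<eta> \<in> controls" "(reflection_policy a x \<eta>, \<eta>) \<in> admissible"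
    using resp by (auto simp: admissible_responses_def admissible_down_def)
  have \<xi>: "\<xi> \<in> controls" using refl by (simp add: reflects_def admissible_up_def)
  interpret response M W r g \<sigma> \<rho> lam c1 c2 \<alpha> \<kappa> m a y x \<eta> \<xi>
  proof
    show "AE \<omega> in M. \<forall>t>0. a \<le> X y \<xi> \<eta> \<omega> t" using refl by (simp add: reflects_def)
    assume xa: "x < a"
    \<comment> \<open>The policy jumps at time 0 by at least this amount, and admissibility forbids
      \<eta> to jump at the same time.\<close>
    then have c: "0 < ln (a / x)" using x by simp
    have "AE \<omega> in M. \<not> 0 < jump (path (reflection_policy a x \<eta>) \<omega>) 0 * jump (path \<eta> \<omega>) 0"
      using adm(2) unfolding admissible_def by blast
    then show "AE \<omega> in M. \<eta> 0 \<omega> = 0"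
      using AE_space
    proof eventually_elim
      case (elim \<omega>)
      have "0 \<le> \<xi> 0 \<omega>" "0 \<le> \<eta> 0 \<omega>" using \<xi> adm(1) elim(2) by (auto simp: controls_def)
      moreover have "\<not> 0 < (max 0 (ln (a / x)) + \<xi> 0 \<omega>) * \<eta> 0 \<omega>" using elim(1) by (simp add: jump_path_0 pol)
      ultimately show ?case using c by (metis add_pos_nonneg less_le max.strict_coboundedI2 mult_pos_pos)
    qed
  qed (use x y \<xi> adm in auto)
  have "\<alpha> / \<kappa> \<le> c" using lam by (simp add: c_def)
  then have "\<alpha> \<le> \<kappa> * c" using pos by (simp add: field_simps)
  from reflection_cost_le[OF this] show ?thesis
    by (simp add: pol policy_def[abs_def])
qed

lemma value_function:
  assumes x: "0 < x" and y: "y = max x a" and lam: "lam > r - g + \<alpha> / \<kappa>"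
  shows "V2 x a = ereal (V y)" and "optimal_response a x (\<lambda>t \<omega>. 0)"
proof -
  have e: "enn2ereal reflection_cost = ereal (V y)"
    using V_nonneg[OF y_pos] by (simp add: reflection_cost_eq enn2ereal_ennreal)
  show V2: "V2 x a = ereal (V y)"
    unfolding V2_def e[symmetric]
  proof (rule antisym)
    show "(INF \<eta>\<in>admissible_responses a x. enn2ereal (J2 x (reflection_policy a x \<eta>) \<eta>)) \<le> enn2ereal reflection_cost"
      by (rule INF_lower2[OF zero_response[OF x y]]) (simp add: J2_zero[OF x y])
    show "enn2ereal reflection_cost \<le> (INF \<eta>\<in>admissible_responses a x. enn2ereal (J2 x (reflection_policy a x \<eta>) \<eta>))"
      by (rule INF_greatest) (use response_cost_ge[OF x y lam] in \<open>simp add: less_eq_ennreal.rep_eq\<close>)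
  qed
  show "optimal_response a x (\<lambda>t \<omega>. 0)"
    unfolding optimal_response_def V2 using zero_response[OF x y] by (simp add: J2_zero[OF x y] e)
qed

end

theorem theorem4p1:
  fixes M :: "'w measure" and W :: "real \<Rightarrow> 'w \<Rightarrow> real"
    and r g \<sigma> \<rho> lam c1 c2 \<alpha> \<kappa> m a \<theta>2 :: real
  assumes "debt_model M W r g \<sigma> \<rho> lam c1 c2 \<alpha> \<kappa> m"
    and "lam > r - g + \<alpha> / \<kappa>"
    and "a > 0"
    and "\<theta>2 < 0" and "1 / 2 * \<sigma>\<^sup>2 * \<theta>2 * (\<theta>2 - 1) + (r - g) * \<theta>2 - lam = 0"
  defines "V2 \<equiv> debt_model.V2 M W r g \<sigma> \<rho> lam c1 c2 \<alpha> \<kappa> m"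
  shows "(\<forall>x. 0 < x \<and> x \<le> a \<longrightarrow> V2 x a = V2 a a)
    \<and> (\<forall>x\<ge>a. V2 x a = ereal (D2 r g \<sigma> lam \<alpha> m \<theta>2 a * x powr \<theta>2 + H r g \<sigma> lam \<alpha> m x))
    \<and> (\<forall>x>0. debt_model.optimal_response M W r g \<sigma> \<rho> lam c1 c2 \<alpha> \<kappa> m a x (\<lambda>t \<omega>. 0))"
proof -
  interpret debt_model M W r g \<sigma> \<rho> lam c1 c2 \<alpha> \<kappa> m by (rule assms(1))
  define f where "f x = D2 r g \<sigma> lam \<alpha> m \<theta>2 a * x powr \<theta>2 + H r g \<sigma> lam \<alpha> m x" for x
  have key: "V2 x a = ereal (f (max x a))" "optimal_response a x (\<lambda>t \<omega>. 0)" if x: "0 < x" for x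
  proof -
    \<comment> \<open>A separate interpretation for each \<open>x\<close>, because the start after
      the initial jump is a parameter. The value depends on \<open>x\<close> through
      \<open>max x a\<close> alone, which gives the constant branch below \<open>a\<close>.\<close>
    interpret v: valued M W r g \<sigma> \<rho> lam c1 c2 \<alpha> \<kappa> m a "max x a" \<theta>2
      by unfold_locales (use assms in auto)
    show "V2 x a = ereal (f (max x a))" "optimal_response a x (\<lambda>t \<omega>. 0)"
      using v.value_function[OF x refl assms(2)] by (simp_all add: assms(6) f_def v.V_def)
  qed
  show ?thesis
  proof (intro conjI allI impI)
    fix x assume "0 < x \<and> x \<le> a"
    then show "V2 x a = V2 a a" using key(1)[of x] key(1)[of a] assms(3) by (simp add: max_def)
  next
    fix x assume "a \<le> x"
    then show "V2 x a = ereal (D2 r g \<sigma> lam \<alpha> m \<theta>2 a * x powr \<theta>2 + H r g \<sigma> lam \<alpha> m x)"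
      using key(1)[of x] assms(3) by (simp add: f_def max_def)
  next
    fix x :: real assume "0 < x"
    then show "optimal_response a x (\<lambda>t \<omega>. 0)" by (rule key(2))
  qed
qed

end
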